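(* Let $\mathcal{M}$ be a $\sigma$-finite, semifinite infinite factor, let $A,B\in\mathcal{M}^+$ with $B\ne0$ and $\|A\|_e=\|A\|$. Then $A=\sum_{j=1}^\infty C_j$ for some $C_j\in\mathcal{M}^+$ with $C_j\sim B$ for all $j$ if and only if one of the following mutually exclusive conditions holds: (1) $\|A\|>\|B\|$; (2) $\|A\|=\|B\|$ and $\chi_{\{\|B\|\}}(B)=0$; (3) $\|A\|=\|B\|$, $\chi_{\{\|B\|\}}(B)\ne0$, $B\ne\|B\|\chi_{\{\|B\|\}}(B)$, and $\chi_{\{\|A\|\}}(A)$ is infinite; (4) $\|A\|=\|B\|$, $B=\|B\|\chi_{\{\|B\|\}}(B)$, $A=\|A\|\chi_{\{\|A\|\}}(A)$, and $\chi_{\{\|A\|\}}(A)$ is infinite. Furthermore, if one of these conditions is satisfied, the decomposition can be chosen so that $N_{C_j}$ is infinite for all $j$.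
   Context: $\mathcal{M}$ acts on a Hilbert space; $\mathcal{M}^+$ is its set of positive elements. A semifinite infinite factor is of type I$_\infty$ or II$_\infty$. $\mathcal{J}$ is the norm-closed two-sided ideal generated by the finite projections of $\mathcal{M}$, $\pi:\mathcal{M}\to\mathcal{M}/\mathcal{J}$ is the quotient map and $\|A\|_e=\|\pi(A)\|$. For $B,C\in\mathcal{M}^+$, $B\sim C$ means $B=XX^*$ and $C=X^*X$ for some $X\in\mathcal{M}$. $N_C$ is the projection on the null space of $C$. $\chi_S(B)$ is the spectral projection of $B$ for the Borel set $S$. "Infinite" for a projection is meant relative to $\mathcal{M}$ (Murray-von Neumann). Infinite sums of operators converge in the strong operator topology. *)

theory Defs
  imports "HOL-Analysis.Analysis"
begin

(* A complex Hilbert space, as a real Hilbert space carrying a compatible complex structure.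
   The norm is the one of the complex inner product, because
   cinner x x = complex_of_real (inner x x); cinner is linear in its first argument. *)
class complex_hilbert_space = real_inner + complete_space +
  fixes scaleC :: "complex \<Rightarrow> 'a \<Rightarrow> 'a" (infixr "*\<^sub>C" 75)
    and cinner :: "'a \<Rightarrow> 'a \<Rightarrow> complex"
  assumes scaleC_add_right: "c *\<^sub>C (x + y) = c *\<^sub>C x + c *\<^sub>C y"
    and scaleC_add_left: "(c + d) *\<^sub>C x = c *\<^sub>C x + d *\<^sub>C x"
    and scaleC_scaleC: "c *\<^sub>C d *\<^sub>C x = (c * d) *\<^sub>C x"
    and scaleC_of_real: "complex_of_real r *\<^sub>C x = r *\<^sub>R x"
    and cinner_commute: "cinner x y = cnj (cinner y x)"
    and cinner_add_left: "cinner (x + y) z = cinner x z + cinner y z"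
    and cinner_scaleC_left: "cinner (c *\<^sub>C x) y = c * cinner x y"
    and Re_cinner: "Re (cinner x y) = inner x y"

(* Operators are real-linear bounded maps, singled out below by complex linearity, so that the
   operator norm and the strong operator topology are those of the library. *)
type_synonym 'a bop = "'a \<Rightarrow>\<^sub>L 'a"

definition bounded_ops :: "'a::complex_hilbert_space bop set" where
  "bounded_ops = {T. \<forall>c x. blinfun_apply T (c *\<^sub>C x) = c *\<^sub>C blinfun_apply T x}"

definition adj :: "'a::complex_hilbert_space bop \<Rightarrow> 'a bop" where
  "adj T = (THE S. \<forall>x y. cinner (blinfun_apply T x) y = cinner x (blinfun_apply S y))"

definition pos_op :: "'a::complex_hilbert_space bop \<Rightarrow> bool" where
  "pos_op T \<longleftrightarrow> T \<in> bounded_ops \<and> (\<forall>x. cinner (blinfun_apply T x) x \<in> \<real>\<^sub>\<ge>\<^sub>0)"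

definition op_le :: "'a::complex_hilbert_space bop \<Rightarrow> 'a bop \<Rightarrow> bool" where
  "op_le S T \<longleftrightarrow> pos_op (T - S)"

definition is_projection :: "'a::complex_hilbert_space bop \<Rightarrow> bool" where
  "is_projection P \<longleftrightarrow> P \<in> bounded_ops \<and> P o\<^sub>L P = P \<and> adj P = P"

definition commutant :: "'a::complex_hilbert_space bop set \<Rightarrow> 'a bop set" where
  "commutant S = {T \<in> bounded_ops. \<forall>X\<in>S. T o\<^sub>L X = X o\<^sub>L T}"

definition von_neumann_algebra :: "'a::complex_hilbert_space bop set \<Rightarrow> bool" where
  "von_neumann_algebra M \<longleftrightarrow> (\<forall>X\<in>M. adj X \<in> M) \<and> commutant (commutant M) = M"

definition factor :: "'a::complex_hilbert_space bop set \<Rightarrow> bool" where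
  "factor M \<longleftrightarrow> von_neumann_algebra M \<and>
     (\<forall>T \<in> M \<inter> commutant M. \<exists>c. \<forall>x. blinfun_apply T x = c *\<^sub>C x)"

definition positive_part :: "'a::complex_hilbert_space bop set \<Rightarrow> 'a bop set" where
  "positive_part M = {T \<in> M. pos_op T}"

definition projections :: "'a::complex_hilbert_space bop set \<Rightarrow> 'a bop set" where
  "projections M = {P \<in> M. is_projection P}"

(* On projections this is Murray-von Neumann equivalence. *)
definition mv_equiv :: "'a::complex_hilbert_space bop set \<Rightarrow> 'a bop \<Rightarrow> 'a bop \<Rightarrow> bool" where
  "mv_equiv M B C \<longleftrightarrow> (\<exists>X\<in>M. B = X o\<^sub>L adj X \<and> C = adj X o\<^sub>L X)"

definition finite_proj :: "'a::complex_hilbert_space bop set \<Rightarrow> 'a bop \<Rightarrow> bool" where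
  "finite_proj M P \<longleftrightarrow> P \<in> projections M \<and>
     (\<forall>Q \<in> projections M. op_le Q P \<and> mv_equiv M Q P \<longrightarrow> Q = P)"

definition infinite_proj :: "'a::complex_hilbert_space bop set \<Rightarrow> 'a bop \<Rightarrow> bool" where
  "infinite_proj M P \<longleftrightarrow> P \<in> projections M \<and> \<not> finite_proj M P"

definition infinite_vna :: "'a::complex_hilbert_space bop set \<Rightarrow> bool" where
  "infinite_vna M \<longleftrightarrow> infinite_proj M id_blinfun"

(* For a factor the only nonzero central projection is the identity, so together with
   infinite_vna this says that the type is I_infinity or II_infinity. *)
definition semifinite_vna :: "'a::complex_hilbert_space bop set \<Rightarrow> bool" where
  "semifinite_vna M \<longleftrightarrow>
     (\<forall>Z \<in> projections (M \<inter> commutant M). Z \<noteq> 0 \<longrightarrow>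
        (\<exists>P. finite_proj M P \<and> P \<noteq> 0 \<and> op_le P Z))"

definition sigma_finite_vna :: "'a::complex_hilbert_space bop set \<Rightarrow> bool" where
  "sigma_finite_vna M \<longleftrightarrow>
     (\<forall>F. F \<subseteq> projections M - {0} \<and> pairwise (\<lambda>P Q. P o\<^sub>L Q = 0) F \<longrightarrow> countable F)"

(* Closure under scalars is included, since the scalar operators belong to M. *)
definition closed_ideal :: "'a::complex_hilbert_space bop set \<Rightarrow> 'a bop set \<Rightarrow> bool" where
  "closed_ideal M I \<longleftrightarrow> I \<subseteq> M \<and> 0 \<in> I \<and> (\<forall>S\<in>I. \<forall>T\<in>I. S + T \<in> I) \<and>
     (\<forall>X\<in>M. \<forall>T\<in>I. X o\<^sub>L T \<in> I \<and> T o\<^sub>L X \<in> I) \<and> closed I"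

definition finite_ideal :: "'a::complex_hilbert_space bop set \<Rightarrow> 'a bop set" where
  "finite_ideal M = closed_ideal M hull {P. finite_proj M P}"

definition quot_map :: "'a::real_normed_vector set \<Rightarrow> 'a \<Rightarrow> 'a set" where
  "quot_map J A = {A + K | K. K \<in> J}"

definition quot_norm :: "'a::real_normed_vector set \<Rightarrow> real" where
  "quot_norm c = (INF T\<in>c. norm T)"

definition ess_norm :: "'a::complex_hilbert_space bop set \<Rightarrow> 'a bop \<Rightarrow> real" where
  "ess_norm M A = quot_norm (quot_map (finite_ideal M) A)"

definition orth_proj :: "'a::complex_hilbert_space set \<Rightarrow> 'a bop" where
  "orth_proj V = (THE P. is_projection P \<and> range (blinfun_apply P) = V)"

definition null_proj :: "'a::complex_hilbert_space bop \<Rightarrow> 'a bop" where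
  "null_proj C = orth_proj {x. blinfun_apply C x = 0}"

definition sot_sums :: "(nat \<Rightarrow> 'a::complex_hilbert_space bop) \<Rightarrow> 'a bop \<Rightarrow> bool" where
  "sot_sums C A \<longleftrightarrow> limitin strong_operator_topology (\<lambda>n. \<Sum>j<n. C j) A sequentially"

definition projection_valued_measure :: "(real set \<Rightarrow> 'a::complex_hilbert_space bop) \<Rightarrow> bool" where
  "projection_valued_measure E \<longleftrightarrow>
     (\<forall>S \<in> sets borel. is_projection (E S)) \<and> E {} = 0 \<and> E UNIV = id_blinfun \<and>
     (\<forall>F :: nat \<Rightarrow> real set. range F \<subseteq> sets borel \<and> disjoint_family F \<longrightarrow>
        sot_sums (\<lambda>n. E (F n)) (E (\<Union>n. F n)))"

(* The measure S \<mapsto> cinner (E S x) x. *)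
definition scalar_measure ::
    "(real set \<Rightarrow> 'a::complex_hilbert_space bop) \<Rightarrow> 'a \<Rightarrow> real measure" where
  "scalar_measure E x =
     measure_of UNIV (sets borel) (\<lambda>S. ennreal (Re (cinner (blinfun_apply (E S) x) x)))"

(* E is the spectral measure of the self-adjoint operator B, i.e. B is the integral of t with
   respect to E. By polarization it is enough to test this on the quadratic forms; the
   integrability for every x forces E to have bounded support. *)
definition spectral_measure ::
    "'a::complex_hilbert_space bop \<Rightarrow> (real set \<Rightarrow> 'a bop) \<Rightarrow> bool" where
  "spectral_measure B E \<longleftrightarrow> projection_valued_measure E \<and>
     (\<forall>x. has_bochner_integral (scalar_measure E x) complex_of_real (cinner (blinfun_apply B x) x))"

(* The spectral measure is unique only on Borel sets, so the value on S is selected rather than E. *)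
definition spectral_proj :: "'a::complex_hilbert_space bop \<Rightarrow> real set \<Rightarrow> 'a bop" where
  "spectral_proj B S = (THE P. \<exists>E. spectral_measure B E \<and> P = E S)"

end

(*
  Idea. Every C ~ B is X X^* with X^* X = B, so a decomposition of A is a family X_j in M with X_j^* X_j = B and
  sum_j |X_j^* x|^2 = <A x, x>.

  Necessity: X_j X_j^* <= A gives |B| <= |A|. If |A| = |B| = a and p = chi_{a}(B) is nonzero, then X_j maps p
  isometrically (up to sqrt a) into the eigenspace of A for a, with ranges orthogonal for distinct j, so this eigenspace
  is infinite; if B = a p, the ranges fill the support of A.

  Sufficiency: |A|_e = |A| = a says that no spectral projection of A for (a - eps, a] lies in J. A sequential choice
  then yields isometries v_i in M, orthogonal and with orthogonal images under A, such that A dominates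
  sum_i (a - eps_i) v_i v_i^* for any prescribed errors eps_i > 0. If <B x, x> < a |x|^2 for all nonzero x, cut B into
  spectral blocks bounded by l_m < a; each v_i with a small enough error carries a copy of one block. The low block,
  bounded by b < d, is used to exhaust the remainder T of A: from T + d v v^* one can subtract a copy of it that takes
  a fixed proportion of T, and iterating makes the remainders tend to 0. If B has the eigenvalue a, the copies of that
  part are placed in the infinite eigenspace of A first. Replacing B by an infinite multiple of B throughout makes
  the null projection of each copy of B infinite.
*)
theory Submission
  imports Defs
begin

subsection \<open>Orthogonal projections and adjoints\<close>

text \<open>Identities between sums of \<open>X X\<^sup>\<star>\<close> are tested on quadratic
  forms. There they become series of nonnegative reals
  \<open>(norm (X\<^sup>\<star> x))\<^sup>2\<close>, which may be split and reordered freely; strong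
  convergence is recovered at the very end, because the remainders are positive and uniformly
  bounded. Comparison of projections is replaced by gluing: in the factor the identity is a
  countable sum of projections each equivalent to a piece of a given nonzero projection, so
  infinitely many orthogonal copies of that projection carry an isometric copy of the whole space.
  The obstacle when B lies strictly below a is that one copy of B needs a low and a high part with
  orthogonal ranges, although the low copies must also use up what A has left on the ranges of the
  high copies. Splitting the family into two halves, and pairing the low copies of one half with the
  high copies of the other, resolves this.\<close>

lemma closed_subspace_nearest_orthogonal:
  fixes V :: "'a::{real_inner,banach} set"
  assumes V: "subspace V" "closed V"
  shows "\<exists>y\<in>V. \<forall>z\<in>V. inner (x - y) z = 0"
proof -
  define D where "D = Inf ((\<lambda>y. (norm (x - y))\<^sup>2) ` V)"
  have V0: "0 \<in> V" using V(1) by (rule subspace_0)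
  have bdd: "bdd_below ((\<lambda>y. (norm (x - y))\<^sup>2) ` V)"
    by (rule bdd_belowI2[where m=0]) simp
  have D_le: "D \<le> (norm (x - y))\<^sup>2" if "y \<in> V" for y
    unfolding D_def using bdd that by (rule cINF_lower)
  have "\<exists>y\<in>V. (norm (x - y))\<^sup>2 < D + 1 / real (Suc n)" for n
  proof -
    have "Inf ((\<lambda>y. (norm (x - y))\<^sup>2) ` V) < D + 1 / real (Suc n)"
      by (simp add: D_def)
    then show ?thesis
      using cInf_lessD[of "(\<lambda>y. (norm (x - y))\<^sup>2) ` V"] V0 by blast
  qed
  then obtain y where yV: "\<And>n. y n \<in> V" and yD: "\<And>n. (norm (x - y n))\<^sup>2 < D + 1 / real (Suc n)"
    by metis
  \<comment> \<open>The midpoint of two members lies in V, so its squared distance from x is at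
    least D. The parallelogram law then makes a minimizing sequence Cauchy.\<close>
  have par: "(norm (y m - y n))\<^sup>2 \<le> 2 / real (Suc m) + 2 / real (Suc n)" for m n
  proof -
    have "(1/2) *\<^sub>R (y m + y n) \<in> V"
      by (intro subspace_scale subspace_add V yV)
    then have "D \<le> (norm (x - (1/2) *\<^sub>R (y m + y n)))\<^sup>2" by (rule D_le)
    moreover have "(norm (y m - y n))\<^sup>2 + 4 * (norm (x - (1/2) *\<^sub>R (y m + y n)))\<^sup>2
        = 2 * (norm (x - y m))\<^sup>2 + 2 * (norm (x - y n))\<^sup>2"
      unfolding power2_norm_eq_inner by (simp add: inner_simps inner_commute field_simps)
    ultimately show ?thesis using yD[of m] yD[of n] by simp
  qed
  have "Cauchy y"
  proof (rule metric_CauchyI)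
    fix e :: real assume "0 < e"
    then obtain N where N: "4 / e\<^sup>2 < real N"
      using reals_Archimedean2 by blast
    have "dist (y m) (y n) < e" if "m \<ge> N" "n \<ge> N" for m n
    proof -
      have "4 / e\<^sup>2 < real (Suc k)" if "k \<ge> N" for k using N that by simp
      then have *: "2 / real (Suc k) < e\<^sup>2 / 2" if "k \<ge> N" for k
        using that \<open>0 < e\<close> by (simp add: field_simps)
      have "(norm (y m - y n))\<^sup>2 < e\<^sup>2"
        using par[of m n] *[OF \<open>m \<ge> N\<close>] *[OF \<open>n \<ge> N\<close>] by simp
      then show ?thesis
        using \<open>0 < e\<close> by (simp add: dist_norm power2_less_imp_less)
    qed
    then show "\<exists>M. \<forall>m\<ge>M. \<forall>n\<ge>M. dist (y m) (y n) < e" by blast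
  qed
  then obtain l where l: "y \<longlonglongrightarrow> l"
    using Cauchy_convergent_iff convergent_def by blast
  have lV: "l \<in> V"
    using closed_sequentially[OF V(2)] yV l by blast
  have "(\<lambda>n. (norm (x - y n))\<^sup>2) \<longlonglongrightarrow> (norm (x - l))\<^sup>2"
    by (intro tendsto_intros l)
  moreover have "(\<lambda>n. D + 1 / real (Suc n)) \<longlonglongrightarrow> D + 0"
    by (intro tendsto_intros LIMSEQ_Suc[OF lim_const_over_n])
  ultimately have lD: "(norm (x - l))\<^sup>2 \<le> D"
    using LIMSEQ_le[of "\<lambda>n. (norm (x - y n))\<^sup>2" _ "\<lambda>n. D + 1 / real (Suc n)"] yD
    by (metis (no_types, lifting) add.right_neutral less_imp_le)
  have "inner (x - l) z = 0" if "z \<in> V" for z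
  proof (rule ccontr)
    assume ne: "inner (x - l) z \<noteq> 0"
    then have z0: "inner z z > 0" by auto
    \<comment> \<open>The minimizer of the distance from x along the line through l in direction z;
      it would lower the squared distance by a positive amount.\<close>
    define t where "t = inner (x - l) z / inner z z"
    have "l + t *\<^sub>R z \<in> V"
      by (intro subspace_add subspace_scale V lV that)
    then have "(norm (x - l))\<^sup>2 \<le> (norm (x - (l + t *\<^sub>R z)))\<^sup>2"
      using lD D_le by (meson order_trans)
    also have "\<dots> = (norm (x - l))\<^sup>2 - 2 * t * inner (x - l) z + t\<^sup>2 * inner z z"
      unfolding power2_norm_eq_inner
      by (simp add: inner_simps inner_commute power2_eq_square algebra_simps)
    also have "\<dots> = (norm (x - l))\<^sup>2 - (inner (x - l) z)\<^sup>2 / inner z z"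
      using z0 unfolding t_def by (simp add: field_simps power2_eq_square)
    finally show False using ne z0 by (simp add: divide_le_0_iff)
  qed
  with lV show ?thesis by blast
qed

definition hproj :: "'a::{real_inner,banach} set \<Rightarrow> 'a \<Rightarrow>\<^sub>L 'a" where
  "hproj V = Blinfun (\<lambda>x. SOME y. y \<in> V \<and> (\<forall>z\<in>V. inner (x - y) z = 0))"

context
  fixes V :: "'a::{real_inner,banach} set"
  assumes V: "subspace V" "closed V"
begin

lemma hproj_aux:
  "\<exists>f. bounded_linear f \<and> (\<forall>x. f x \<in> V \<and> (\<forall>z\<in>V. inner (x - f x) z = 0)) \<and> f = (\<lambda>x. SOME y. y \<in> V \<and> (\<forall>z\<in>V. inner (x - y) z = 0))"
proof -
  define f where "f = (\<lambda>x. SOME y. y \<in> V \<and> (\<forall>z\<in>V. inner (x - y) z = 0))"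
  have f: "f x \<in> V \<and> (\<forall>z\<in>V. inner (x - f x) z = 0)" for x
    unfolding f_def
    by (rule someI_ex) (use closed_subspace_nearest_orthogonal[OF V, of x] in blast)
  have uniq: "y = f x" if "y \<in> V" "\<And>z. z \<in> V \<Longrightarrow> inner (x - y) z = 0" for x y
  proof -
    have "f x - y \<in> V" using f that V(1) by (blast intro: subspace_diff)
    then have "inner (x - y) (f x - y) = 0" "inner (x - f x) (f x - y) = 0"
      using f that by auto
    then have "inner (f x - y) (f x - y) = 0" by (simp add: inner_diff_left)
    then show ?thesis by simp
  qed
  have "bounded_linear f"
  proof (rule bounded_linear_intro[where K=1])
    show "f (x + y) = f x + f y" for x y
    proof (rule uniq[symmetric])
      show "f x + f y \<in> V" using f V(1) by (blast intro: subspace_add)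
      fix z assume z: "z \<in> V"
      have "inner (x + y - (f x + f y)) z = inner (x - f x) z + inner (y - f y) z"
        by (simp add: inner_simps)
      then show "inner (x + y - (f x + f y)) z = 0" using f z by simp
    qed
    show "f (r *\<^sub>R x) = r *\<^sub>R f x" for r x
    proof (rule uniq[symmetric])
      show "r *\<^sub>R f x \<in> V" using f V(1) by (blast intro: subspace_scale)
      fix z assume z: "z \<in> V"
      have "inner (r *\<^sub>R x - r *\<^sub>R f x) z = r * inner (x - f x) z"
        by (simp add: inner_simps algebra_simps)
      then show "inner (r *\<^sub>R x - r *\<^sub>R f x) z = 0" using f z by simp
    qed
    show "norm (f x) \<le> norm x * 1" for x
    proof -
      have "inner (x - f x) (f x) = 0" using f by blast
      then have "(norm (f x))\<^sup>2 = inner x (f x)"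
        by (simp add: inner_diff_left power2_norm_eq_inner)
      also have "\<dots> \<le> norm x * norm (f x)" by (rule norm_cauchy_schwarz)
      finally show ?thesis
        by (cases "norm (f x) = 0") (auto simp: power2_eq_square)
    qed
  qed
  then show ?thesis using f f_def by blast
qed

lemma hproj_mem: "hproj V x \<in> V"
  and hproj_orth: "z \<in> V \<Longrightarrow> inner (x - hproj V x) z = 0"
  using hproj_aux unfolding hproj_def by (auto simp: bounded_linear_Blinfun_apply)

lemma hproj_orth': "z \<in> V \<Longrightarrow> inner z (x - hproj V x) = 0"
  using hproj_orth by (simp add: inner_commute)

lemma hproj_unique:
  assumes "y \<in> V" "\<And>z. z \<in> V \<Longrightarrow> inner (x - y) z = 0"
  shows "hproj V x = y"
proof -
  have d: "hproj V x - y \<in> V" using hproj_mem assms V(1) by (blast intro: subspace_diff)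
  then have "inner (x - y) (hproj V x - y) = 0" "inner (x - hproj V x) (hproj V x - y) = 0"
    using assms(2)[OF d] hproj_orth[OF d, of x] by simp_all
  then have "inner (hproj V x - y) (hproj V x - y) = 0" by (simp add: inner_diff_left)
  then show ?thesis by simp
qed

lemma hproj_eq_self: "x \<in> V \<Longrightarrow> hproj V x = x"
  by (rule hproj_unique) auto

lemma hproj_eq_self_iff: "hproj V x = x \<longleftrightarrow> x \<in> V"
  using hproj_mem[of x] hproj_eq_self by auto

lemma hproj_idem: "hproj V o\<^sub>L hproj V = hproj V"
  by (rule blinfun_eqI) (simp add: hproj_eq_self hproj_mem)

lemma hproj_selfadj: "inner (hproj V x) y = inner x (hproj V y)"
proof -
  have "inner (x - hproj V x) (hproj V y) = 0" "inner (y - hproj V y) (hproj V x) = 0"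
    by (simp_all add: hproj_orth hproj_mem)
  then show ?thesis
    using inner_commute[of "hproj V x" y] inner_commute[of "hproj V x" "hproj V y"]
    by (simp add: inner_diff_left)
qed

lemma range_hproj: "range (hproj V) = V"
  using hproj_mem hproj_eq_self by (metis rangeI image_subsetI subsetI subset_antisym)

lemma hproj_eq_0_iff: "hproj V x = 0 \<longleftrightarrow> (\<forall>z\<in>V. inner x z = 0)"
proof
  assume "hproj V x = 0"
  then show "\<forall>z\<in>V. inner x z = 0" using hproj_orth[of _ x] by simp
next
  assume "\<forall>z\<in>V. inner x z = 0"
  then show "hproj V x = 0" by (intro hproj_unique) (use V subspace_0 in auto)
qed

end

section \<open>Riesz representation and adjoints\<close>

lemma riesz_representation:
  fixes f :: "'a::{real_inner,banach} \<Rightarrow> real"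
  assumes "bounded_linear f"
  shows "\<exists>y. \<forall>x. f x = inner x y"
proof (cases "\<forall>x. f x = 0")
  case True
  then show ?thesis by (intro exI[of _ 0]) simp
next
  case False
  interpret bounded_linear f by fact
  define V where "V = {x. f x = 0}"
  have sV: "subspace V" unfolding V_def by (auto simp: subspace_def add scaleR zero)
  have cV: "closed V" unfolding V_def
    by (intro closed_Collect_eq continuous_intros linear_continuous_on assms)
  from False obtain x0 where x0: "f x0 \<noteq> 0" by blast
  \<comment> \<open>The kernel of f has codimension one, so a multiple of the component of x0
    orthogonal to it represents f.\<close>
  define z where "z = x0 - hproj V x0"
  have "f (hproj V x0) = 0" using hproj_mem[OF sV cV] unfolding V_def by blast
  then have fz: "f z \<noteq> 0" using x0 by (simp add: z_def diff)
  then have z0: "inner z z \<noteq> 0" using zero by (metis inner_eq_zero_iff)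
  have orth: "inner z v = 0" if "f v = 0" for v
    using hproj_orth[OF sV cV, of v x0] that by (simp add: z_def V_def)
  have "f x = inner x ((f z / inner z z) *\<^sub>R z)" for x
  proof -
    have "f (x - (f x / f z) *\<^sub>R z) = 0" using fz by (simp add: diff scaleR)
    then have "inner z (x - (f x / f z) *\<^sub>R z) = 0" by (rule orth)
    then have "inner x z = (f x / f z) * inner z z"
      by (simp add: inner_diff_right inner_commute)
    then show ?thesis using fz z0 by simp
  qed
  then show ?thesis by blast
qed

lemma adjoint_exists:
  fixes T :: "'a::{real_inner,banach} \<Rightarrow>\<^sub>L 'b::real_inner"
  shows "\<exists>S :: 'b \<Rightarrow>\<^sub>L 'a. \<forall>x y. inner (T x) y = inner x (S y)"
proof -
  have "\<exists>z. \<forall>x. inner (T x) y = inner x z" for y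
    by (rule riesz_representation) (intro bounded_linear_intros blinfun.bounded_linear_right)
  then obtain S where S: "\<And>x y. inner (T x) y = inner x (S y)" by metis
  have eqI: "a = b" if "\<And>x. inner x a = inner x b" for a b :: 'a
    using that[of "a - b"] by (metis inner_diff_right inner_eq_zero_iff right_minus_eq)
  have "bounded_linear S"
  proof (rule bounded_linear_intro[where K="norm T"])
    show "S (x + y) = S x + S y" for x y
      by (rule eqI) (simp add: inner_add_right flip: S)
    show "S (r *\<^sub>R x) = r *\<^sub>R S x" for r x
      by (rule eqI) (simp flip: S)
    show "norm (S y) \<le> norm y * norm T" for y
    proof -
      have "(norm (S y))\<^sup>2 = inner (T (S y)) y"
        by (simp add: S power2_norm_eq_inner)
      also have "\<dots> \<le> norm (T (S y)) * norm y" by (rule norm_cauchy_schwarz)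
      also have "\<dots> \<le> norm T * norm (S y) * norm y"
        by (intro mult_right_mono norm_blinfun norm_ge_zero)
      finally show ?thesis
        by (cases "norm (S y) = 0") (auto simp: power2_eq_square ac_simps)
    qed
  qed
  then show ?thesis
    using S by (intro exI[of _ "Blinfun S"]) (simp add: bounded_linear_Blinfun_apply)
qed

text \<open>The adjoint for the real inner product. On complex-linear operators it coincides with
  the complex adjoint (\<open>adj_eq_hadj\<close>), so the real theory applies to the algebra
  unchanged.\<close>

definition hadj :: "('a::{real_inner,banach} \<Rightarrow>\<^sub>L 'a) \<Rightarrow> 'a \<Rightarrow>\<^sub>L 'a" ("_\<^sup>\<star>" [1000] 1000) where
  "T\<^sup>\<star> = (SOME S :: 'a \<Rightarrow>\<^sub>L 'a. \<forall>x y. inner (T x) y = inner x (S y))"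

lemma inner_hadj_right: "inner x (T\<^sup>\<star> y) = inner (T x) y"
  using someI_ex[OF adjoint_exists[of T]] unfolding hadj_def by metis

lemma inner_hadj_left: "inner (T\<^sup>\<star> x) y = inner x (T y)"
  by (metis inner_hadj_right inner_commute)

lemma blinfun_inner_eqI:
  fixes S T :: "'a::real_normed_vector \<Rightarrow>\<^sub>L 'b::real_inner"
  assumes "\<And>x y. inner (S x) y = inner (T x) y" shows "S = T"
proof (rule blinfun_eqI)
  fix x
  have "inner (S x - T x) (S x - T x) = 0" using assms by (simp add: inner_diff_left)
  then show "S x = T x" by simp
qed

lemma hadj_eqI:
  fixes S T :: "'a::{real_inner,banach} \<Rightarrow>\<^sub>L 'a"
  assumes "\<And>x y. inner (T x) y = inner x (S y)"
  shows "T\<^sup>\<star> = S"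
proof (rule blinfun_inner_eqI)
  fix x y
  have "inner (T\<^sup>\<star> x) y = inner (T y) x" by (subst inner_hadj_left) (rule inner_commute)
  also have "\<dots> = inner (S x) y" by (subst assms) (rule inner_commute)
  finally show "inner (T\<^sup>\<star> x) y = inner (S x) y" .
qed

lemma hadj_hadj [simp]: "(T\<^sup>\<star>)\<^sup>\<star> = T"
  by (rule hadj_eqI) (simp add: inner_hadj_left)

lemma hadj_compose [simp]: "(S o\<^sub>L T)\<^sup>\<star> = T\<^sup>\<star> o\<^sub>L S\<^sup>\<star>"
  by (rule hadj_eqI) (simp add: inner_hadj_right)

lemma hadj_add [simp]: "(S + T)\<^sup>\<star> = S\<^sup>\<star> + T\<^sup>\<star>"
  by (rule hadj_eqI) (simp add: inner_hadj_right blinfun.bilinear_simps inner_simps)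

lemma hadj_diff [simp]: "(S - T)\<^sup>\<star> = S\<^sup>\<star> - T\<^sup>\<star>"
  by (rule hadj_eqI) (simp add: inner_hadj_right blinfun.bilinear_simps inner_simps)

lemma hadj_scaleR [simp]: "(r *\<^sub>R T)\<^sup>\<star> = r *\<^sub>R T\<^sup>\<star>"
  by (rule hadj_eqI) (simp add: inner_hadj_right blinfun.bilinear_simps inner_simps)

lemma hadj_0 [simp]: "0\<^sup>\<star> = 0" and hadj_id [simp]: "id_blinfun\<^sup>\<star> = id_blinfun"
  by (rule hadj_eqI; simp)+

lemma norm_hadj [simp]: "norm (T\<^sup>\<star>) = norm T"
proof -
  have "norm (T\<^sup>\<star>) \<le> norm T" for T :: "'a \<Rightarrow>\<^sub>L 'a"
  proof (rule norm_blinfun_bound)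
    fix x
    have "(norm (T\<^sup>\<star> x))\<^sup>2 = inner (T (T\<^sup>\<star> x)) x"
      by (simp add: inner_hadj_right[symmetric] power2_norm_eq_inner)
    also have "\<dots> \<le> norm (T (T\<^sup>\<star> x)) * norm x" by (rule norm_cauchy_schwarz)
    also have "\<dots> \<le> norm T * norm (T\<^sup>\<star> x) * norm x"
      by (intro mult_right_mono norm_blinfun norm_ge_zero)
    finally show "norm (T\<^sup>\<star> x) \<le> norm T * norm x"
      by (cases "norm (T\<^sup>\<star> x) = 0") (auto simp: power2_eq_square ac_simps)
  qed simp
  from this[of T] this[of "T\<^sup>\<star>"] show ?thesis by simp
qed

text \<open>Over the reals a nonnegative form does not force symmetry (rotations by a right angle
  have form 0), so self-adjointness is demanded explicitly.\<close>

definition pos :: "('a::{real_inner,banach} \<Rightarrow>\<^sub>L 'a) \<Rightarrow> bool" where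
  "pos T \<longleftrightarrow> T\<^sup>\<star> = T \<and> (\<forall>x. 0 \<le> inner (T x) x)"

lemma posI:
  fixes T :: "'a::{real_inner,banach} \<Rightarrow>\<^sub>L 'a"
  shows "T\<^sup>\<star> = T \<Longrightarrow> (\<And>x. 0 \<le> inner (T x) x) \<Longrightarrow> pos T"
  by (simp add: pos_def)

lemma pos_hadj: "pos T \<Longrightarrow> T\<^sup>\<star> = T"
  by (simp add: pos_def)

lemma pos_ge0:
  fixes T :: "'a::{real_inner,banach} \<Rightarrow>\<^sub>L 'a"
  shows "pos T \<Longrightarrow> 0 \<le> inner (T x) x"
  by (simp add: pos_def)

lemma selfadj_inner:
  fixes T :: "'a::{real_inner,banach} \<Rightarrow>\<^sub>L 'a"
  shows "T\<^sup>\<star> = T \<Longrightarrow> inner (T x) y = inner x (T y)"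
  by (metis inner_hadj_right)

lemma norm_sq_hadj:
  fixes X :: "'a::{real_inner,banach} \<Rightarrow>\<^sub>L 'a"
  shows "(norm (X x))\<^sup>2 = inner ((X\<^sup>\<star> o\<^sub>L X) x) x"
  by (simp add: inner_hadj_left power2_norm_eq_inner)

lemma pos_hadj_compose: "pos (X\<^sup>\<star> o\<^sub>L X)"
  by (rule posI) (auto simp: inner_hadj_left)

lemma pos_compose_hadj: "pos (X o\<^sub>L X\<^sup>\<star>)"
  using pos_hadj_compose[of "X\<^sup>\<star>"] by simp

lemma pos_cauchy_schwarz:
  fixes T :: "'a::{real_inner,banach} \<Rightarrow>\<^sub>L 'a"
  assumes "pos T"
  shows "(inner (T x) y)\<^sup>2 \<le> inner (T x) x * inner (T y) y"
proof -
  note sa = selfadj_inner[OF pos_hadj[OF assms]]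
  have q: "0 \<le> inner (T x) x * t\<^sup>2 + 2 * t * inner (T x) y + inner (T y) y" for t
  proof -
    have "0 \<le> inner (T (t *\<^sub>R x + y)) (t *\<^sub>R x + y)" using assms by (rule pos_ge0)
    also have "\<dots> = inner (T x) x * t\<^sup>2 + 2 * t * inner (T x) y + inner (T y) y"
      using sa[of y x] by (simp add: blinfun.bilinear_simps inner_simps inner_commute power2_eq_square algebra_simps)
    finally show ?thesis .
  qed
  show ?thesis
  proof (cases "inner (T x) x = 0")
    case True
    have "inner (T x) y = 0"
    proof (rule ccontr)
      assume ne: "inner (T x) y \<noteq> 0"
      \<comment> \<open>When the leading coefficient vanishes, \<open>q\<close> bounds an affine
        function of t from below by 0. This t gives it the value -1 unless the slope is 0.\<close>
      have "0 \<le> 2 * (- (inner (T y) y + 1) / (2 * inner (T x) y)) * inner (T x) y + inner (T y) y"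
        using q[of "- (inner (T y) y + 1) / (2 * inner (T x) y)"] True by simp
      also have "\<dots> = -1" using ne by (simp add: field_simps)
      finally show False by simp
    qed
    then show ?thesis using True by simp
  next
    case False
    then have p: "inner (T x) x > 0" using pos_ge0[OF assms, of x] by simp
    have "0 \<le> inner (T y) y - (inner (T x) y)\<^sup>2 / inner (T x) x"
      using q[of "- inner (T x) y / inner (T x) x"] p by (simp add: field_simps power2_eq_square)
    then show ?thesis using p by (simp add: field_simps)
  qed
qed

text \<open>Cauchy-Schwarz for the form of T at the pair x, T x. It controls T x by the form alone,
  so that convergence of the quadratic forms of bounded positive operators becomes strong
  convergence.\<close>

lemma pos_norm_sq_le:
  fixes T :: "'a::{real_inner,banach} \<Rightarrow>\<^sub>L 'a"
  assumes "pos T" and bd: "\<And>x. inner (T x) x \<le> c * (norm x)\<^sup>2"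
  shows "(norm (T x))\<^sup>2 \<le> c * inner (T x) x"
proof -
  have "(norm (T x))\<^sup>2 * (norm (T x))\<^sup>2 \<le> inner (T x) x * inner (T (T x)) (T x)"
    using pos_cauchy_schwarz[OF assms(1), of x "T x"]
    by (simp add: power2_norm_eq_inner) (simp add: power2_eq_square)
  also have "\<dots> \<le> inner (T x) x * (c * (norm (T x))\<^sup>2)"
    by (intro mult_left_mono bd pos_ge0 assms)
  finally have *: "(norm (T x))\<^sup>2 * (norm (T x))\<^sup>2 \<le> (c * inner (T x) x) * (norm (T x))\<^sup>2"
    by (simp only: ac_simps)
  show ?thesis
  proof (cases "T x = 0")
    case False
    then show ?thesis using mult_right_le_imp_le[OF *] by simp
  qed simp
qed

lemma inner_le_norm:
  fixes T :: "'a::real_inner \<Rightarrow>\<^sub>L 'a"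
  shows "inner (T x) x \<le> norm T * (norm x)\<^sup>2"
proof -
  have "inner (T x) x \<le> norm (T x) * norm x" by (rule norm_cauchy_schwarz)
  also have "\<dots> \<le> norm T * norm x * norm x" by (intro mult_right_mono norm_blinfun norm_ge_zero)
  finally show ?thesis by (simp add: power2_eq_square)
qed

lemma pos_norm_le:
  fixes T :: "'a::{real_inner,banach} \<Rightarrow>\<^sub>L 'a"
  assumes "pos T" "\<And>x. inner (T x) x \<le> c * (norm x)\<^sup>2" "0 \<le> c"
  shows "norm T \<le> c"
proof (rule norm_blinfun_bound)
  fix x
  have "(norm (T x))\<^sup>2 \<le> c * inner (T x) x" by (rule pos_norm_sq_le[OF assms(1,2)])
  also have "\<dots> \<le> c * (c * (norm x)\<^sup>2)" by (intro mult_left_mono assms)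
  also have "\<dots> = (c * norm x)\<^sup>2" by (simp add: power2_eq_square)
  finally show "norm (T x) \<le> c * norm x"
    by (rule power2_le_imp_le) (simp add: assms(3))
qed fact

lemma pos_inner_0:
  fixes T :: "'a::{real_inner,banach} \<Rightarrow>\<^sub>L 'a"
  shows "pos T \<Longrightarrow> inner (T x) x = 0 \<Longrightarrow> T x = 0"
  using pos_norm_sq_le[of T "norm T" x] inner_le_norm[of T] by simp

lemma norm_hadj_compose_self: "norm (X\<^sup>\<star> o\<^sub>L X) = (norm X)\<^sup>2"
proof (rule antisym)
  show "norm (X\<^sup>\<star> o\<^sub>L X) \<le> (norm X)\<^sup>2"
    using norm_blinfun_compose[of "X\<^sup>\<star>" X] by (simp add: power2_eq_square)
  have "norm X \<le> sqrt (norm (X\<^sup>\<star> o\<^sub>L X))"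
  proof (rule norm_blinfun_bound)
    fix x
    have "(norm (X x))\<^sup>2 \<le> norm (X\<^sup>\<star> o\<^sub>L X) * (norm x)\<^sup>2"
      unfolding norm_sq_hadj by (rule inner_le_norm)
    then show "norm (X x) \<le> sqrt (norm (X\<^sup>\<star> o\<^sub>L X)) * norm x"
      by (metis norm_ge_zero real_le_rsqrt real_sqrt_abs real_sqrt_mult abs_norm_cancel)
  qed simp
  then show "(norm X)\<^sup>2 \<le> norm (X\<^sup>\<star> o\<^sub>L X)"
    by (metis norm_ge_zero power_mono real_sqrt_pow2)
qed

lemma hadj_hproj:
  assumes "subspace V" "closed V" shows "(hproj V)\<^sup>\<star> = hproj V"
  by (rule hadj_eqI) (rule hproj_selfadj[OF assms])

subsection \<open>Orthogonal series of operators\<close>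

lemma blinfun_quad_eqI:
  fixes S T :: "'a::{real_inner,banach} \<Rightarrow>\<^sub>L 'a"
  assumes S: "S\<^sup>\<star> = S" and T: "T\<^sup>\<star> = T" and eq: "\<And>x. inner (S x) x = inner (T x) x"
  shows "S = T"
proof (rule blinfun_inner_eqI)
  fix x y
  have "2 * inner (R x) y = inner (R (x + y)) (x + y) - inner (R x) x - inner (R y) y"
    if "R\<^sup>\<star> = R" for R :: "'a \<Rightarrow>\<^sub>L 'a"
    using selfadj_inner[OF that, of y x] inner_commute[of y "R x"]
    by (simp add: blinfun.bilinear_simps inner_simps)
  from this[OF S] this[OF T] show "inner (S x) y = inner (T x) y" by (simp add: eq)
qed

lemma isometry_iff:
  fixes v :: "'a::{real_inner,banach} \<Rightarrow>\<^sub>L 'a"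
  shows "v\<^sup>\<star> o\<^sub>L v = id_blinfun \<longleftrightarrow> (\<forall>x. norm (v x) = norm x)"
proof
  assume *: "v\<^sup>\<star> o\<^sub>L v = id_blinfun"
  have "(norm (v x))\<^sup>2 = (norm x)\<^sup>2" for x
    using norm_sq_hadj[of v x] by (simp only: * blinfun_apply_id_blinfun id_apply power2_norm_eq_inner)
  then show "\<forall>x. norm (v x) = norm x" by simp
next
  assume "\<forall>x. norm (v x) = norm x"
  then show "v\<^sup>\<star> o\<^sub>L v = id_blinfun"
    by - (rule blinfun_quad_eqI; simp add: inner_hadj_left flip: power2_norm_eq_inner)
qed

text \<open>By polarization a self-adjoint operator is determined by its form. Candidates for copies
  of B are checked through this norm identity.\<close>

lemma hadj_compose_eq_iff:
  fixes X B :: "'a::{real_inner,banach} \<Rightarrow>\<^sub>L 'a"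
  assumes "B\<^sup>\<star> = B"
  shows "X\<^sup>\<star> o\<^sub>L X = B \<longleftrightarrow> (\<forall>x. (norm (X x))\<^sup>2 = inner (B x) x)"
proof
  assume "X\<^sup>\<star> o\<^sub>L X = B"
  then show "\<forall>x. (norm (X x))\<^sup>2 = inner (B x) x" by (simp add: norm_sq_hadj)
next
  assume "\<forall>x. (norm (X x))\<^sup>2 = inner (B x) x"
  then show "X\<^sup>\<star> o\<^sub>L X = B"
    by - (rule blinfun_quad_eqI; simp add: assms inner_hadj_left flip: power2_norm_eq_inner)
qed

lemma blinfun_strong_limit:
  fixes F :: "nat \<Rightarrow> 'a::real_normed_vector \<Rightarrow>\<^sub>L 'b::banach"
  assumes conv: "\<And>x. (\<lambda>n. F n x) \<longlonglongrightarrow> f x" and bd: "\<And>n x. norm (F n x) \<le> K * norm x"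
  shows "bounded_linear f"
proof (rule bounded_linear_intro[where K=K])
  fix x y and r :: real
  have "(\<lambda>n. F n (x + y)) \<longlonglongrightarrow> f x + f y"
    unfolding blinfun.add_right by (intro tendsto_intros conv)
  then show "f (x + y) = f x + f y" using conv LIMSEQ_unique by blast
  have "(\<lambda>n. F n (r *\<^sub>R x)) \<longlonglongrightarrow> r *\<^sub>R f x"
    unfolding blinfun.scaleR_right by (intro tendsto_intros conv)
  then show "f (r *\<^sub>R x) = r *\<^sub>R f x" using conv LIMSEQ_unique by blast
  have "norm (f x) \<le> K * norm x"
    by (rule LIMSEQ_le_const2[OF tendsto_norm[OF conv]]) (use bd in blast)
  then show "norm (f x) \<le> norm x * K" by (simp add: mult.commute)
qed

lemma norm_sq_orthogonal_sum:
  fixes a :: "'i \<Rightarrow> 'a::real_inner"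
  assumes "finite I" "\<And>m n. m \<in> I \<Longrightarrow> n \<in> I \<Longrightarrow> m \<noteq> n \<Longrightarrow> inner (a m) (a n) = 0"
  shows "(norm (\<Sum>n\<in>I. a n))\<^sup>2 = (\<Sum>n\<in>I. (norm (a n))\<^sup>2)"
proof -
  have "(norm (\<Sum>n\<in>I. a n))\<^sup>2 = (\<Sum>m\<in>I. \<Sum>n\<in>I. inner (a m) (a n))"
    by (simp add: power2_norm_eq_inner inner_sum_left inner_sum_right) (rule sum.swap)
  also have "\<dots> = (\<Sum>m\<in>I. \<Sum>n\<in>I. if n = m then inner (a m) (a m) else 0)"
    by (intro sum.cong refl) (auto simp: assms(2))
  also have "\<dots> = (\<Sum>n\<in>I. (norm (a n))\<^sup>2)"
    by (simp add: assms(1) power2_norm_eq_inner)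
  finally show ?thesis .
qed

lemma orthogonal_summable:
  fixes a :: "nat \<Rightarrow> 'a::{real_inner,banach}"
  assumes orth: "\<And>m n. m \<noteq> n \<Longrightarrow> inner (a m) (a n) = 0"
    and sm: "summable (\<lambda>n. (norm (a n))\<^sup>2)"
  shows "summable a"
  unfolding summable_Cauchy
proof (intro allI impI)
  fix e :: real assume e: "0 < e"
  then obtain N where N: "\<And>m n. m \<ge> N \<Longrightarrow> norm (\<Sum>k=m..<n. (norm (a k))\<^sup>2) < e\<^sup>2"
    using sm[unfolded summable_Cauchy] zero_less_power[OF e, of 2] by meson
  have "norm (sum a {m..<n}) < e" if "m \<ge> N" for m n
  proof -
    have "(norm (sum a {m..<n}))\<^sup>2 < e\<^sup>2"
      using N[OF that, of n] by (subst norm_sq_orthogonal_sum) (auto simp: orth)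
    then show ?thesis using e by (simp add: power2_less_imp_less)
  qed
  then show "\<exists>N. \<forall>m\<ge>N. \<forall>n. norm (sum a {m..<n}) < e" by blast
qed

lemma orthogonal_sums_norm_sq:
  fixes a :: "nat \<Rightarrow> 'a::real_inner"
  assumes orth: "\<And>m n. m \<noteq> n \<Longrightarrow> inner (a m) (a n) = 0" and "a sums s"
  shows "(\<lambda>n. (norm (a n))\<^sup>2) sums (norm s)\<^sup>2"
proof -
  have "(\<lambda>N. (norm (\<Sum>n<N. a n))\<^sup>2) \<longlonglongrightarrow> (norm s)\<^sup>2"
    using assms(2) unfolding sums_def by (intro tendsto_intros)
  then show ?thesis
    unfolding sums_def by (subst (asm) norm_sq_orthogonal_sum) (auto simp: orth)
qed

text \<open>Orthogonality is required of the ranges only. The uniform bound on the sums of squares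
  replaces a condition on the initial spaces and makes the pointwise sum a bounded operator.\<close>

definition orth_family :: "(nat \<Rightarrow> 'a::{real_inner,banach} \<Rightarrow>\<^sub>L 'a) \<Rightarrow> bool" where
  "orth_family X \<longleftrightarrow> (\<forall>m n x y. m \<noteq> n \<longrightarrow> inner (X m x) (X n y) = 0) \<and>
     (\<exists>c. \<forall>N x. (\<Sum>n<N. (norm (X n x))\<^sup>2) \<le> c * (norm x)\<^sup>2)"

definition osum :: "(nat \<Rightarrow> 'a::{real_inner,banach} \<Rightarrow>\<^sub>L 'a) \<Rightarrow> 'a \<Rightarrow>\<^sub>L 'a" where
  "osum X = Blinfun (\<lambda>x. \<Sum>n. X n x)"

context
  fixes X :: "nat \<Rightarrow> 'a::{real_inner,banach} \<Rightarrow>\<^sub>L 'a"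
  assumes X: "orth_family X"
begin

lemma osum_sums: "(\<lambda>n. X n x) sums osum X x"
proof -
  from X obtain c where orth: "\<And>m n x y. m \<noteq> n \<Longrightarrow> inner (X m x) (X n y) = 0"
    and c: "\<And>N x. (\<Sum>n<N. (norm (X n x))\<^sup>2) \<le> c * (norm x)\<^sup>2"
    unfolding orth_family_def by blast
  have sm: "summable (\<lambda>n. X n x)" for x
    by (rule orthogonal_summable[OF orth summableI_nonneg_bounded[OF _ c]]) simp_all
  have "bounded_linear (\<lambda>x. \<Sum>n. X n x)"
  proof (rule blinfun_strong_limit[where F="\<lambda>N. \<Sum>n<N. X n" and K="sqrt (max c 0)"])
    show "(\<lambda>N. (\<Sum>n<N. X n) x) \<longlonglongrightarrow> (\<Sum>n. X n x)" for x
      using summable_LIMSEQ[OF sm] by (simp add: blinfun.sum_left)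
    fix N x
    have "(norm (\<Sum>n<N. X n x))\<^sup>2 \<le> c * (norm x)\<^sup>2"
      using c by (subst norm_sq_orthogonal_sum) (auto simp: orth)
    also have "\<dots> \<le> max c 0 * (norm x)\<^sup>2" by (intro mult_right_mono) auto
    also have "\<dots> = (sqrt (max c 0) * norm x)\<^sup>2" by (simp add: power_mult_distrib)
    finally have "norm (\<Sum>n<N. X n x) \<le> sqrt (max c 0) * norm x"
      by (rule power2_le_imp_le) simp
    then show "norm ((\<Sum>n<N. X n) x) \<le> sqrt (max c 0) * norm x" by (simp add: blinfun.sum_left)
  qed
  then have "osum X x = (\<Sum>n. X n x)"
    unfolding osum_def by (simp add: bounded_linear_Blinfun_apply)
  then show ?thesis using sm summable_sums by metis
qed

lemma osum_norm_sq: "(\<lambda>n. (norm (X n x))\<^sup>2) sums (norm (osum X x))\<^sup>2"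
  by (rule orthogonal_sums_norm_sq[OF _ osum_sums]) (use X orth_family_def in blast)

lemma osum_inner_sums: "(\<lambda>n. inner z (X n x)) sums inner z (osum X x)"
  by (rule bounded_linear.sums[OF bounded_linear_inner_right osum_sums])

lemma osum_inner_component: "inner (X n z) (osum X x) = inner (X n z) (X n x)"
proof -
  have "(\<lambda>k. inner (X n z) (X k x)) = (\<lambda>k. if k = n then inner (X n z) (X n x) else 0)"
    using X unfolding orth_family_def by auto
  then have "(\<lambda>k. inner (X n z) (X k x)) sums inner (X n z) (X n x)"
    using sums_single[of n "\<lambda>_. inner (X n z) (X n x)"] by simp
  then show ?thesis using osum_inner_sums sums_unique2 by blast
qed

end

lemma inner_diff_quad:
  fixes S T :: "'a::real_inner \<Rightarrow>\<^sub>L 'a"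
  shows "inner ((S - T) x) x = inner (S x) x - inner (T x) x"
  by (simp add: blinfun.diff_left inner_diff_left)

subsection \<open>Square roots\<close>

text \<open>A fixed point Y of this recursion satisfies 2 Y = X + Y^2, that is (1 - Y)^2 = 1 - X, so
  1 - Y is a square root of 1 - X.\<close>

fun sqrt_iter :: "('a::real_normed_vector \<Rightarrow>\<^sub>L 'a) \<Rightarrow> nat \<Rightarrow> 'a \<Rightarrow>\<^sub>L 'a" where
  "sqrt_iter X 0 = 0"
| "sqrt_iter X (Suc n) = (1/2) *\<^sub>R (X + (sqrt_iter X n o\<^sub>L sqrt_iter X n))"

text \<open>The scalar recursion for X = 1. Every norm estimate for the operator recursion is read
  off from this increasing bounded sequence.\<close>

fun sqrt_iter_bound :: "nat \<Rightarrow> real" where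
  "sqrt_iter_bound 0 = 0"
| "sqrt_iter_bound (Suc n) = (1 + (sqrt_iter_bound n)\<^sup>2) / 2"

lemma sqrt_iter_bound_range: "0 \<le> sqrt_iter_bound n \<and> sqrt_iter_bound n \<le> 1"
proof (induction n)
  case (Suc n)
  then have "(sqrt_iter_bound n)\<^sup>2 \<le> 1" by (simp add: power_le_one)
  then show ?case by simp
qed simp

lemma sqrt_iter_bound_mono: "incseq sqrt_iter_bound"
proof (rule incseq_SucI)
  fix n
  have "0 \<le> (1 - sqrt_iter_bound n)\<^sup>2" by simp
  then show "sqrt_iter_bound n \<le> sqrt_iter_bound (Suc n)"
    by (simp add: power2_eq_square algebra_simps)
qed

context
  fixes X :: "'a::{real_inner,banach} \<Rightarrow>\<^sub>L 'a"
  assumes X1: "norm X \<le> 1"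
begin

lemma sqrt_iter_norm: "norm (sqrt_iter X n) \<le> sqrt_iter_bound n"
proof (induction n)
  case (Suc n)
  have "norm (X + (sqrt_iter X n o\<^sub>L sqrt_iter X n)) \<le> norm X + norm (sqrt_iter X n o\<^sub>L sqrt_iter X n)"
    by (rule norm_triangle_ineq)
  also have "\<dots> \<le> 1 + norm (sqrt_iter X n) * norm (sqrt_iter X n)"
    using X1 norm_blinfun_compose[of "sqrt_iter X n" "sqrt_iter X n"] by simp
  also have "\<dots> \<le> 1 + sqrt_iter_bound n * sqrt_iter_bound n"
    by (intro add_left_mono mult_mono Suc) (use sqrt_iter_bound_range in auto)
  finally show ?case by (simp add: power2_eq_square)
qed simp

text \<open>With P and Q for two iterates, P^2 - Q^2 = P (P - Q) + (P - Q) Q holds without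
  commutation. The scalar recursion satisfies the same identity, so its increments dominate those of
  the operators by induction, and its convergence makes the iterates Cauchy.\<close>

lemma sqrt_iter_diff: "norm (sqrt_iter X (n + k) - sqrt_iter X n) \<le> sqrt_iter_bound (n + k) - sqrt_iter_bound n"
proof (induction n)
  case 0
  then show ?case using sqrt_iter_norm by simp
next
  case (Suc n)
  let ?Y = "sqrt_iter X" and ?y = sqrt_iter_bound
  have eq: "?Y (Suc n + k) - ?Y (Suc n)
      = (1/2) *\<^sub>R ((?Y (n + k) o\<^sub>L (?Y (n + k) - ?Y n)) + ((?Y (n + k) - ?Y n) o\<^sub>L ?Y n))"
    by (rule blinfun_eqI) (simp add: blinfun.bilinear_simps algebra_simps)
  have "norm ((?Y (n + k) o\<^sub>L (?Y (n + k) - ?Y n)) + ((?Y (n + k) - ?Y n) o\<^sub>L ?Y n))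
      \<le> norm (?Y (n + k)) * norm (?Y (n + k) - ?Y n) + norm (?Y (n + k) - ?Y n) * norm (?Y n)"
    by (intro order_trans[OF norm_triangle_ineq] add_mono norm_blinfun_compose)
  also have "\<dots> \<le> ?y (n + k) * (?y (n + k) - ?y n) + (?y (n + k) - ?y n) * ?y n"
    by (intro add_mono mult_mono Suc sqrt_iter_norm) (use sqrt_iter_bound_range sqrt_iter_bound_mono in \<open>auto simp: incseq_def\<close>)
  also have "\<dots> = 2 * (?y (Suc n + k) - ?y (Suc n))"
    by (simp add: power2_eq_square algebra_simps)
  finally show ?case unfolding eq norm_scaleR by (simp del: sqrt_iter_bound.simps)
qed

lemma sqrt_one_minus_exists:
  assumes X: "X\<^sup>\<star> = X"
  shows "\<exists>Y. Y\<^sup>\<star> = Y \<and> norm Y \<le> 1 \<and> (id_blinfun - Y) o\<^sub>L (id_blinfun - Y) = id_blinfun - X \<and>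
    (\<forall>C. C o\<^sub>L X = X o\<^sub>L C \<longrightarrow> C o\<^sub>L Y = Y o\<^sub>L C)"
proof -
  let ?Y = "sqrt_iter X" and ?y = sqrt_iter_bound
  have "Cauchy ?y"
    by (rule convergent_Cauchy, rule Bseq_mono_convergent)
      (use sqrt_iter_bound_range sqrt_iter_bound_mono in \<open>auto simp: incseq_def intro!: BseqI'[where K=1]\<close>)
  have "Cauchy ?Y"
  proof (rule metric_CauchyI)
    fix e :: real assume "0 < e"
    then obtain N where N: "\<And>m n. m \<ge> N \<Longrightarrow> n \<ge> N \<Longrightarrow> dist (?y m) (?y n) < e"
      using metric_CauchyD[OF \<open>Cauchy ?y\<close>] by blast
    have le: "dist (?Y m) (?Y n) < e" if "m \<ge> n" "n \<ge> N" for m n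
      using sqrt_iter_diff[of n "m - n"] N[of m n] that by (simp add: dist_norm)
    have "dist (?Y m) (?Y n) < e" if "m \<ge> N" "n \<ge> N" for m n
      using le[of m n] le[of n m] that by (cases "m \<ge> n") (auto simp: dist_commute)
    then show "\<exists>N. \<forall>m\<ge>N. \<forall>n\<ge>N. dist (?Y m) (?Y n) < e" by blast
  qed
  then obtain Y where Y: "?Y \<longlonglongrightarrow> Y" using Cauchy_convergent_iff convergent_def by blast
  have sa: "(?Y n)\<^sup>\<star> = ?Y n" for n by (induction n) (simp_all add: X)
  have "Y\<^sup>\<star> = Y"
  proof (rule hadj_eqI)
    fix x y
    have "(\<lambda>n. inner (?Y n x) y) \<longlonglongrightarrow> inner (Y x) y" by (intro tendsto_intros Y)
    moreover have "(\<lambda>n. inner x (?Y n y)) \<longlonglongrightarrow> inner x (Y y)" by (intro tendsto_intros Y)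
    ultimately show "inner (Y x) y = inner x (Y y)"
      using LIMSEQ_unique by (simp add: selfadj_inner[OF sa])
  qed
  moreover have "norm Y \<le> 1"
    by (rule LIMSEQ_le_const2[OF tendsto_norm[OF Y]])
      (meson order_trans sqrt_iter_bound_range sqrt_iter_norm)
  moreover have "(id_blinfun - Y) o\<^sub>L (id_blinfun - Y) = id_blinfun - X"
  proof -
    have "(\<lambda>n. (1/2) *\<^sub>R (X + (?Y n o\<^sub>L ?Y n))) \<longlonglongrightarrow> (1/2) *\<^sub>R (X + (Y o\<^sub>L Y))"
      by (intro tendsto_intros bounded_bilinear.tendsto[OF bounded_bilinear_blinfun_compose] Y)
    moreover have "(\<lambda>n. (1/2) *\<^sub>R (X + (?Y n o\<^sub>L ?Y n))) \<longlonglongrightarrow> Y"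
      using LIMSEQ_Suc[OF Y] by simp
    ultimately have "Y = (1/2) *\<^sub>R (X + (Y o\<^sub>L Y))" using LIMSEQ_unique by blast
    then have "2 *\<^sub>R Y = 2 *\<^sub>R ((1/2) *\<^sub>R (X + (Y o\<^sub>L Y)))" by (rule arg_cong)
    then have eq: "Y o\<^sub>L Y = 2 *\<^sub>R Y - X" by simp
    have "(id_blinfun - Y) o\<^sub>L (id_blinfun - Y) = id_blinfun - 2 *\<^sub>R Y + (Y o\<^sub>L Y)"
      by (rule blinfun_eqI) (simp add: blinfun.bilinear_simps algebra_simps scaleR_2)
    then show ?thesis by (simp add: eq)
  qed
  moreover have "C o\<^sub>L Y = Y o\<^sub>L C" if C: "C o\<^sub>L X = X o\<^sub>L C" for C
  proof -
    have Cx: "C (X x) = X (C x)" for x using C by (metis blinfun_apply_blinfun_compose)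
    have comm: "C (?Y n x) = ?Y n (C x)" for n x
      by (induction n arbitrary: x) (simp_all add: blinfun.bilinear_simps Cx)
    show ?thesis
    proof (rule blinfun_eqI)
      fix x
      have "(\<lambda>n. C (?Y n x)) \<longlonglongrightarrow> C (Y x)" by (intro tendsto_intros Y)
      moreover have "(\<lambda>n. ?Y n (C x)) \<longlonglongrightarrow> Y (C x)" by (intro tendsto_intros Y)
      ultimately show "(C o\<^sub>L Y) x = (Y o\<^sub>L C) x" using LIMSEQ_unique comm by simp
    qed
  qed
  ultimately show ?thesis by blast
qed

end

text \<open>After scaling, T is 1 - X with X between 0 and 1, to which the iteration applies. The
  commutation clause is recorded together with existence since it is what keeps square roots inside
  an algebra described by commutation relations.\<close>

lemma pos_sqrt_exists:
  fixes T :: "'a::{real_inner,banach} \<Rightarrow>\<^sub>L 'a"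
  assumes T: "pos T"
  shows "\<exists>R. pos R \<and> R o\<^sub>L R = T \<and> (\<forall>C. C o\<^sub>L T = T o\<^sub>L C \<longrightarrow> C o\<^sub>L R = R o\<^sub>L C)"
proof (cases "T = 0")
  case True
  then show ?thesis by (intro exI[of _ 0]) (simp add: posI)
next
  case False
  define c where "c = norm T"
  have c: "c > 0" using False by (simp add: c_def)
  \<comment> \<open>Dividing by the norm puts X between 0 and the identity, hence
    \<open>norm X \<le> 1\<close>.\<close>
  define X where "X = id_blinfun - (1/c) *\<^sub>R T"
  have qX: "inner (X x) x = (norm x)\<^sup>2 - inner (T x) x / c" for x
    by (simp add: X_def blinfun.bilinear_simps inner_simps power2_norm_eq_inner)
  have "pos X"
  proof (rule posI)
    show "X\<^sup>\<star> = X" using T by (simp add: X_def pos_hadj)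
    show "0 \<le> inner (X x) x" for x
      unfolding qX using inner_le_norm[of T x] c by (simp add: c_def field_simps)
  qed
  then have "norm X \<le> 1"
    by (rule pos_norm_le) (use qX pos_ge0[OF T] c in auto)
  from sqrt_one_minus_exists[OF this pos_hadj[OF \<open>pos X\<close>]]
  obtain Y where Y: "Y\<^sup>\<star> = Y" "norm Y \<le> 1" "(id_blinfun - Y) o\<^sub>L (id_blinfun - Y) = id_blinfun - X"
    "\<And>C. C o\<^sub>L X = X o\<^sub>L C \<Longrightarrow> C o\<^sub>L Y = Y o\<^sub>L C" by blast
  define R where "R = sqrt c *\<^sub>R (id_blinfun - Y)"
  have "pos R"
  proof (rule posI)
    show "R\<^sup>\<star> = R" using Y by (simp add: R_def)
    fix x
    have "inner (Y x) x \<le> norm Y * (norm x)\<^sup>2" by (rule inner_le_norm)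
    also have "\<dots> \<le> 1 * (norm x)\<^sup>2" by (intro mult_right_mono Y) simp
    finally show "0 \<le> inner (R x) x"
      using c by (simp add: R_def blinfun.bilinear_simps inner_simps power2_norm_eq_inner)
  qed
  moreover have "R o\<^sub>L R = T"
  proof -
    have "R o\<^sub>L R = (sqrt c * sqrt c) *\<^sub>R ((id_blinfun - Y) o\<^sub>L (id_blinfun - Y))"
      unfolding R_def using c
      by (intro blinfun_eqI) (simp add: blinfun.bilinear_simps scaleR_diff_right)
    also have "\<dots> = T" using c by (simp add: Y X_def)
    finally show ?thesis .
  qed
  moreover have "C o\<^sub>L R = R o\<^sub>L C" if C: "C o\<^sub>L T = T o\<^sub>L C" for C
  proof -
    have "C (T x) = T (C x)" for x using C by (metis blinfun_apply_blinfun_compose)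
    then have "C o\<^sub>L X = X o\<^sub>L C" 
      unfolding X_def by (intro blinfun_eqI) (simp add: blinfun.bilinear_simps)
    from Y(4)[OF this] have "C (Y x) = Y (C x)" for x by (metis blinfun_apply_blinfun_compose)
    then show ?thesis
      unfolding R_def by (intro blinfun_eqI) (simp add: blinfun.bilinear_simps)
  qed
  ultimately show ?thesis by blast
qed

definition psqrt :: "('a::{real_inner,banach} \<Rightarrow>\<^sub>L 'a) \<Rightarrow> 'a \<Rightarrow>\<^sub>L 'a" where
  "psqrt T = (SOME R. pos R \<and> R o\<^sub>L R = T \<and> (\<forall>C. C o\<^sub>L T = T o\<^sub>L C \<longrightarrow> C o\<^sub>L R = R o\<^sub>L C))"

context
  fixes T :: "'a::{real_inner,banach} \<Rightarrow>\<^sub>L 'a"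
  assumes T: "pos T"
begin

lemma psqrt: "pos (psqrt T)" "psqrt T o\<^sub>L psqrt T = T"
  "C o\<^sub>L T = T o\<^sub>L C \<Longrightarrow> C o\<^sub>L psqrt T = psqrt T o\<^sub>L C"
  using someI_ex[OF pos_sqrt_exists[OF T]] unfolding psqrt_def by blast+

lemma psqrt_apply: "psqrt T (psqrt T x) = T x"
  using psqrt(2) by (metis blinfun_apply_blinfun_compose)

lemma psqrt_commute:
  fixes C :: "'a \<Rightarrow>\<^sub>L 'a"
  shows "(\<And>x. C (T x) = T (C x)) \<Longrightarrow> C (psqrt T x) = psqrt T (C x)"
  using psqrt(3)[of C] by (metis blinfun_apply_blinfun_compose blinfun_eqI)

lemma psqrt_inner: "inner (psqrt T x) y = inner x (psqrt T y)"
  by (rule selfadj_inner[OF pos_hadj[OF psqrt(1)]])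

lemma psqrt_norm_sq: "(norm (psqrt T x))\<^sup>2 = inner (T x) x"
  using psqrt_inner[of "psqrt T x" x] by (simp add: psqrt_apply power2_norm_eq_inner)

end

subsection \<open>Polar decomposition\<close>

text \<open>V reduces C: invariance under the adjoint is invariance of the orthogonal complement
  under C.\<close>

lemma hproj_commute:
  fixes C :: "'a::{real_inner,banach} \<Rightarrow>\<^sub>L 'a"
  assumes V: "subspace V" "closed V"
    and C: "\<And>x. x \<in> V \<Longrightarrow> C x \<in> V" and C': "\<And>x. x \<in> V \<Longrightarrow> C\<^sup>\<star> x \<in> V"
  shows "C o\<^sub>L hproj V = hproj V o\<^sub>L C"
proof (rule blinfun_eqI)
  fix x
  have "hproj V (C x) = C (hproj V x)"
  proof (rule hproj_unique[OF V])
    show "C (hproj V x) \<in> V" by (intro C hproj_mem V)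
    fix z assume "z \<in> V"
    then have "inner (x - hproj V x) (C\<^sup>\<star> z) = 0" by (intro hproj_orth V C')
    then show "inner (C x - C (hproj V x)) z = 0" by (simp add: inner_hadj_right blinfun.diff_right)
  qed
  then show "(C o\<^sub>L hproj V) x = (hproj V o\<^sub>L C) x" by simp
qed

lemma subspace_range_blinfun:
  fixes Y :: "'a::real_normed_vector \<Rightarrow>\<^sub>L 'b::real_normed_vector"
  shows "subspace (range Y)"
proof -
  have "linear (blinfun_apply Y)"
    by (intro bounded_linear.linear blinfun.bounded_linear_right)
  from linear_subspace_image[OF this subspace_UNIV] show ?thesis by simp
qed

lemma subspace_closure:
  fixes V :: "'a::real_normed_vector set"
  assumes "subspace V" shows "subspace (closure V)"
proof (rule subspaceI)
  show "0 \<in> closure V" using assms closure_subset subspace_0 by blast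
  fix x y and c :: real
  assume x: "x \<in> closure V"
  then obtain f where f: "\<And>n. f n \<in> V" "f \<longlonglongrightarrow> x" by (auto simp: closure_sequential)
  show "c *\<^sub>R x \<in> closure V"
    unfolding closure_sequential
    by (rule exI[of _ "\<lambda>n. c *\<^sub>R f n"]) (auto intro!: tendsto_intros f subspace_scale[OF assms])
  assume "y \<in> closure V"
  then obtain g where g: "\<And>n. g n \<in> V" "g \<longlonglongrightarrow> y" by (auto simp: closure_sequential)
  show "x + y \<in> closure V"
    unfolding closure_sequential
    by (rule exI[of _ "\<lambda>n. f n + g n"]) (auto intro!: tendsto_intros f g subspace_add[OF assms])
qed

lemma closure_range_sequence:
  assumes "z \<in> closure (range (f :: 'b \<Rightarrow> 'a::metric_space))"
  shows "\<exists>s. (\<lambda>n. f (s n)) \<longlonglongrightarrow> z"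
proof -
  from assms obtain g where g: "\<And>n. g n \<in> range f" "g \<longlonglongrightarrow> z" by (auto simp: closure_sequential)
  from g(1) have "\<forall>n. \<exists>x. g n = f x" by blast
  then obtain s where "\<And>n. g n = f (s n)" by metis
  then have "g = (\<lambda>n. f (s n))" by blast
  with g(2) show ?thesis by auto
qed

text \<open>The map $Yx \mapsto Xx$ is isometric on the range of $Y$ and is extended by continuity to the
  closure, then by zero to the orthogonal complement.\<close>

lemma partial_isometry_factor:
  fixes X Y :: "'a::{real_inner,banach} \<Rightarrow>\<^sub>L 'a"
  assumes eq: "\<And>x. norm (X x) = norm (Y x)"
  obtains W :: "'a \<Rightarrow>\<^sub>L 'a" where "\<And>x. W (Y x) = X x"
    and "\<And>z. (\<And>x. inner z (Y x) = 0) \<Longrightarrow> W z = 0"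
    and "W\<^sup>\<star> o\<^sub>L W = hproj (closure (range Y))"
    and "\<And>z. W z \<in> closure (range X)"
    and "\<And>C :: 'a \<Rightarrow>\<^sub>L 'a. C o\<^sub>L Y = Y o\<^sub>L C \<Longrightarrow> C\<^sup>\<star> o\<^sub>L Y = Y o\<^sub>L C\<^sup>\<star> \<Longrightarrow>
      C o\<^sub>L X = X o\<^sub>L C \<Longrightarrow> C o\<^sub>L W = W o\<^sub>L C"
proof -
  define V where "V = closure (range Y)"
  have V: "subspace V" "closed V"
    unfolding V_def by (intro subspace_closure subspace_range_blinfun closed_closure)+
  \<comment> \<open>The graph of the extended isometry as a relation: z and l are limits of Y and X
    along one common sequence. Norm preservation makes it single-valued, and every z in V is
    attained because Cauchy sequences correspond.\<close>
  define R where "R z l \<longleftrightarrow> (\<exists>s. (\<lambda>n. Y (s n)) \<longlonglongrightarrow> z \<and> (\<lambda>n. X (s n)) \<longlonglongrightarrow> l)" for z l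
  have dist_eq: "dist (X a) (X b) = dist (Y a) (Y b)" for a b
    using eq[of "a - b"] by (simp add: dist_norm blinfun.diff_right)
  have R_ex: "\<exists>l. R z l" if "z \<in> V" for z
  proof -
    obtain s where s: "(\<lambda>n. Y (s n)) \<longlonglongrightarrow> z" using closure_range_sequence \<open>z \<in> V\<close> V_def by metis
    then have "Cauchy (\<lambda>n. Y (s n))" by (rule LIMSEQ_imp_Cauchy)
    then have "Cauchy (\<lambda>n. X (s n))" by (simp add: Cauchy_def dist_eq)
    then obtain l where "(\<lambda>n. X (s n)) \<longlonglongrightarrow> l" using Cauchy_convergent_iff convergent_def by blast
    with s show ?thesis unfolding R_def by blast
  qed
  have R_norm: "norm l = norm z" if "R z l" for z l
  proof -
    from that obtain s where "(\<lambda>n. Y (s n)) \<longlonglongrightarrow> z" "(\<lambda>n. X (s n)) \<longlonglongrightarrow> l" unfolding R_def by blast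
    from this[THEN tendsto_norm] show ?thesis unfolding eq using LIMSEQ_unique by blast
  qed
  have R_add: "R (z + z') (l + l')" if "R z l" "R z' l'" for z z' l l'
  proof -
    from that obtain s s' where "(\<lambda>n. Y (s n)) \<longlonglongrightarrow> z" "(\<lambda>n. X (s n)) \<longlonglongrightarrow> l"
      "(\<lambda>n. Y (s' n)) \<longlonglongrightarrow> z'" "(\<lambda>n. X (s' n)) \<longlonglongrightarrow> l'" unfolding R_def by blast
    then show ?thesis
      unfolding R_def by (intro exI[of _ "\<lambda>n. s n + s' n"]) (auto simp: blinfun.add_right intro!: tendsto_intros)
  qed
  have R_scale: "R (c *\<^sub>R z) (c *\<^sub>R l)" if "R z l" for c z l
  proof -
    from that obtain s where "(\<lambda>n. Y (s n)) \<longlonglongrightarrow> z" "(\<lambda>n. X (s n)) \<longlonglongrightarrow> l" unfolding R_def by blast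
    then show ?thesis
      unfolding R_def by (intro exI[of _ "\<lambda>n. c *\<^sub>R s n"]) (auto simp: blinfun.scaleR_right intro!: tendsto_intros)
  qed
  have R_unique: "l = l'" if "R z l" "R z l'" for z l l'
  proof -
    have "R (z + (-1) *\<^sub>R z) (l + (-1) *\<^sub>R l')" by (intro R_add R_scale that)
    then show ?thesis using R_norm by fastforce
  qed
  have R_Y: "R (Y x) (X x)" for x unfolding R_def by (intro exI[of _ "\<lambda>_. x"]) auto
  define w where "w z = (SOME l. R z l)" for z
  have w: "R z (w z)" if "z \<in> V" for z unfolding w_def using R_ex[OF that] by (rule someI_ex)
  have wI: "w z = l" if "z \<in> V" "R z l" for z l using w that R_unique by blast
  note P = hproj_mem[OF V]
  have "bounded_linear (\<lambda>x. w (hproj V x))"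
  proof (rule bounded_linear_intro[where K=1])
    fix x y and r :: real
    show "w (hproj V (x + y)) = w (hproj V x) + w (hproj V y)"
      by (intro wI P) (simp only: blinfun.add_right R_add w P)
    show "w (hproj V (r *\<^sub>R x)) = r *\<^sub>R w (hproj V x)"
      by (intro wI P) (simp only: blinfun.scaleR_right R_scale w P)
    have "(norm (hproj V x))\<^sup>2 + (norm (x - hproj V x))\<^sup>2 = (norm x)\<^sup>2"
      using hproj_orth[OF V P, of x x]
      by (simp add: power2_norm_eq_inner inner_diff_left inner_diff_right inner_commute)
    then have "(norm (hproj V x))\<^sup>2 \<le> (norm x)\<^sup>2" by (smt (verit) zero_le_power2)
    then show "norm (w (hproj V x)) \<le> norm x * 1"
      using R_norm[OF w[OF P]] by simp
  qed
  then obtain W :: "'a \<Rightarrow>\<^sub>L 'a" where W: "\<And>x. W x = w (hproj V x)"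
    using bounded_linear_Blinfun_apply by metis
  have YV: "Y x \<in> V" for x unfolding V_def using closure_subset[of "range Y"] by auto
  show thesis
  proof (rule that[of W])
    show "W (Y x) = X x" for x by (simp add: W hproj_eq_self[OF V YV] wI[OF YV R_Y])
    show "W z = 0" if "\<And>x. inner z (Y x) = 0" for z
    proof -
      have "inner z v = 0" if "v \<in> V" for v
      proof -
        obtain s where s: "(\<lambda>n. Y (s n)) \<longlonglongrightarrow> v" using closure_range_sequence \<open>v \<in> V\<close> V_def by metis
        then have "(\<lambda>n. inner z (Y (s n))) \<longlonglongrightarrow> inner z v" by (intro tendsto_intros)
        then show ?thesis using \<open>\<And>x. inner z (Y x) = 0\<close> by (simp add: LIMSEQ_const_iff)
      qed
      then have "hproj V z = 0" by (simp add: hproj_eq_0_iff[OF V])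
      moreover have "R 0 0" using R_Y[of 0] by simp
      ultimately show "W z = 0" using wI[of 0 0] V subspace_0 by (auto simp: W)
    qed
    show "W\<^sup>\<star> o\<^sub>L W = hproj (closure (range Y))"
      unfolding V_def[symmetric]
    proof (subst hadj_compose_eq_iff[OF hadj_hproj[OF V]], rule allI)
      fix x
      have "(norm (W x))\<^sup>2 = inner (hproj V x) (hproj V x)"
        by (simp add: W R_norm[OF w[OF P]] power2_norm_eq_inner)
      also have "\<dots> = inner (hproj V x) x"
        using hproj_orth'[OF V P, of x x] by (simp add: inner_diff_right)
      finally show "(norm (W x))\<^sup>2 = inner (hproj V x) x" .
    qed
    show "W z \<in> closure (range X)" for z
    proof -
      from w[OF P] obtain s where "(\<lambda>n. X (s n)) \<longlonglongrightarrow> W z" unfolding R_def W by blast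
      then show ?thesis
        unfolding closure_sequential by (intro exI[of _ "\<lambda>n. X (s n)"]) auto
    qed
    fix C :: "'a \<Rightarrow>\<^sub>L 'a"
    assume "C o\<^sub>L Y = Y o\<^sub>L C" "C\<^sup>\<star> o\<^sub>L Y = Y o\<^sub>L C\<^sup>\<star>" "C o\<^sub>L X = X o\<^sub>L C"
    then have C: "C (Y x) = Y (C x)" "C\<^sup>\<star> (Y x) = Y (C\<^sup>\<star> x)" "C (X x) = X (C x)" for x
      by (metis blinfun_apply_blinfun_compose)+
    \<comment> \<open>Needed for both C and its adjoint, so that V reduces C and
      \<open>hproj_commute\<close> applies.\<close>
    have inv: "D z \<in> V" if "\<And>x. D (Y x) = Y (D x)" "z \<in> V" for D :: "'a \<Rightarrow>\<^sub>L 'a" and z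
    proof -
      obtain s where s: "(\<lambda>n. Y (s n)) \<longlonglongrightarrow> z" using closure_range_sequence \<open>z \<in> V\<close> V_def by metis
      then have "(\<lambda>n. D (Y (s n))) \<longlonglongrightarrow> D z" by (intro tendsto_intros)
      then show ?thesis using that(1) unfolding V_def closure_sequential
        by (intro exI[of _ "\<lambda>n. D (Y (s n))"]) auto
    qed
    have CP: "C (hproj V x) = hproj V (C x)" for x
      using hproj_commute[OF V, of C] inv C by (metis blinfun_apply_blinfun_compose)
    have Cw: "C (w z) = w (C z)" if z: "z \<in> V" for z
    proof (rule wI[symmetric])
      show "C z \<in> V" using inv C(1) z by blast
      from w[OF z] obtain s where "(\<lambda>n. Y (s n)) \<longlonglongrightarrow> z" "(\<lambda>n. X (s n)) \<longlonglongrightarrow> w z" unfolding R_def by blast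
      then have "(\<lambda>n. C (Y (s n))) \<longlonglongrightarrow> C z" "(\<lambda>n. C (X (s n))) \<longlonglongrightarrow> C (w z)"
        by - (rule blinfun.tendsto[OF tendsto_const], assumption)+
      then show "R (C z) (C (w z))" unfolding R_def using C by auto
    qed
    show "C o\<^sub>L W = W o\<^sub>L C" by (rule blinfun_eqI) (simp add: W Cw P CP)
  qed
qed

subsection \<open>Projections and isometries in a von Neumann algebra\<close>

definition proj :: "('a::{real_inner,banach} \<Rightarrow>\<^sub>L 'a) \<Rightarrow> bool" where
  "proj P \<longleftrightarrow> P\<^sup>\<star> = P \<and> P o\<^sub>L P = P"

lemma proj_inner: "proj P \<Longrightarrow> inner (P x) y = inner x (P y)"
  by (simp add: proj_def selfadj_inner)

lemma proj_idem: "proj P \<Longrightarrow> P (P x) = P x"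
  unfolding proj_def by (metis blinfun_apply_blinfun_compose)

lemma projI: 
  fixes P :: "'a::{real_inner,banach} \<Rightarrow>\<^sub>L 'a"
  shows "(\<And>x y. inner (P x) y = inner x (P y)) \<Longrightarrow> (\<And>x. P (P x) = P x) \<Longrightarrow> proj P"
  unfolding proj_def by (intro conjI; (rule hadj_eqI)?; (rule blinfun_eqI)?; simp)

lemma proj_norm_sq: "proj P \<Longrightarrow> (norm (P x))\<^sup>2 = inner (P x) x"
  by (simp add: power2_norm_eq_inner proj_inner proj_idem)

lemma proj_pos: "proj P \<Longrightarrow> pos P"
  by (rule posI) (auto simp: proj_def simp flip: proj_norm_sq)

lemma proj_norm_le:
  assumes "proj P" shows "norm (P x) \<le> norm x"
proof -
  have "(norm (P x))\<^sup>2 \<le> norm (P x) * norm x"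
    using proj_norm_sq[OF assms] norm_cauchy_schwarz by metis
  then show ?thesis by (cases "norm (P x) = 0") (auto simp: power2_eq_square)
qed

lemma proj_hproj: "subspace V \<Longrightarrow> closed V \<Longrightarrow> proj (hproj V)"
  by (simp add: proj_def hadj_hproj hproj_idem)

lemma proj_id: "proj id_blinfun" and proj_0: "proj 0"
  by (rule projI; simp)+

lemma proj_compl: "proj P \<Longrightarrow> proj (id_blinfun - P)"
  by (rule projI) (simp_all add: blinfun.bilinear_simps inner_simps proj_inner proj_idem)

lemma proj_pythagoras:
  assumes "proj P" shows "(norm x)\<^sup>2 = (norm (P x))\<^sup>2 + (norm (x - P x))\<^sup>2"
  using proj_norm_sq[OF assms, of x] 
    inner_commute[of x "P x"]
  by (simp add: power2_norm_eq_inner inner_diff_left inner_diff_right)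

lemma inner_eq_imp_eq:
  fixes a b :: "'a::real_inner"
  assumes "\<And>z. inner a z = inner b z" shows "a = b"
proof -
  have "inner (a - b) (a - b) = 0" using assms by (simp add: inner_diff_left)
  then show ?thesis by simp
qed

lemma proj_bessel:
  fixes P :: "'i \<Rightarrow> 'a::{real_inner,banach} \<Rightarrow>\<^sub>L 'a"
  assumes "finite I" and P: "\<And>n. proj (P n)" and orth: "\<And>m n x. m \<noteq> n \<Longrightarrow> P m (P n x) = 0"
  shows "(\<Sum>n\<in>I. (norm (P n x))\<^sup>2) \<le> (norm x)\<^sup>2"
proof -
  have o: "inner (P m x) (P n y) = 0" if "m \<noteq> n" for m n x y
    using orth[OF that] by (simp add: proj_inner[OF P])
  define s where "s = (\<Sum>n\<in>I. P n x)"
  have s2: "(norm s)\<^sup>2 = (\<Sum>n\<in>I. (norm (P n x))\<^sup>2)"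
    unfolding s_def by (rule norm_sq_orthogonal_sum) (auto simp: o assms)
  also have "\<dots> = inner s x" by (simp add: s_def proj_norm_sq[OF P] inner_sum_left)
  also have "\<dots> \<le> norm s * norm x" by (rule norm_cauchy_schwarz)
  finally have "norm s \<le> norm x" by (cases "norm s = 0") (auto simp: power2_eq_square)
  then show ?thesis unfolding s2[symmetric] by simp
qed

lemma orth_family_proj:
  fixes P :: "nat \<Rightarrow> 'a::{real_inner,banach} \<Rightarrow>\<^sub>L 'a"
  assumes P: "\<And>n. proj (P n)" and orth: "\<And>m n x. m \<noteq> n \<Longrightarrow> P m (P n x) = 0"
  shows "orth_family P"
  unfolding orth_family_def
proof (intro conjI allI impI exI[of _ 1])
  show "inner (P m x) (P n y) = 0" if "m \<noteq> n" for m n x y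
    using orth[OF that] by (simp add: proj_inner[OF P])
  show "(\<Sum>n<N. (norm (P n x))\<^sup>2) \<le> 1 * (norm x)\<^sup>2" for N x
    using proj_bessel[of "{..<N}" P x, OF finite_lessThan P] orth by simp
qed

lemma osum_proj_apply:
  fixes P :: "nat \<Rightarrow> 'a::{real_inner,banach} \<Rightarrow>\<^sub>L 'a"
  assumes P: "\<And>n. proj (P n)" and orth: "\<And>m n x. m \<noteq> n \<Longrightarrow> P m (P n x) = 0"
  shows "P n (osum P x) = P n x" and "proj (osum P)"
proof -
  have fam: "orth_family P" by (rule orth_family_proj[OF P]) (rule orth)
  show c: "P n (osum P x) = P n x" for n x
  proof -
    show ?thesis
    proof (rule inner_eq_imp_eq)
      fix z
      have "inner (P n (osum P x)) z = inner (P n z) (osum P x)"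
        by (simp add: proj_inner[OF P, of n z] inner_commute[of z])
      also have "\<dots> = inner (P n z) (P n x)" by (rule osum_inner_component[OF fam])
      also have "\<dots> = inner (P n x) z"
        by (simp add: proj_inner[OF P, of n z] proj_idem[OF P] inner_commute[of z])
      finally show "inner (P n (osum P x)) z = inner (P n x) z" .
    qed
  qed
  show "proj (osum P)"
  proof (rule projI)
    fix x y
    have "(\<lambda>n. inner y (P n x)) sums inner y (osum P x)" by (rule osum_inner_sums[OF fam])
    moreover have "(\<lambda>n. inner x (P n y)) sums inner x (osum P y)" by (rule osum_inner_sums[OF fam])
    moreover have "inner y (P n x) = inner x (P n y)" for n
      using proj_inner[OF P, of n x y] inner_commute[of y "P n x"] by simp
    ultimately have "inner y (osum P x) = inner x (osum P y)" using sums_unique2 by simp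
    then show "inner (osum P x) y = inner x (osum P y)" using inner_commute[of y "osum P x"] by simp
    have "(\<lambda>n. P n (osum P x)) sums osum P (osum P x)" by (rule osum_sums[OF fam])
    moreover have "(\<lambda>n. P n (osum P x)) sums osum P x" unfolding c by (rule osum_sums[OF fam])
    ultimately show "osum P (osum P x) = osum P x" by (rule sums_unique2)
  qed
qed

section \<open>Isometries and their range projections\<close>

definition iso :: "('a::{real_inner,banach} \<Rightarrow>\<^sub>L 'a) \<Rightarrow> bool" where
  "iso v \<longleftrightarrow> v\<^sup>\<star> o\<^sub>L v = id_blinfun"

lemma iso_norm: "iso v \<longleftrightarrow> (\<forall>x. norm (v x) = norm x)"
  unfolding iso_def by (rule isometry_iff)

lemma iso_hadj_apply: "iso v \<Longrightarrow> v\<^sup>\<star> (v x) = x"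
  unfolding iso_def by (metis blinfun_apply_blinfun_compose blinfun_apply_id_blinfun id_apply)

lemma iso_inner: "iso v \<Longrightarrow> inner (v x) (v y) = inner x y"
  by (metis inner_hadj_right iso_hadj_apply)

lemma iso_range_proj: "iso v \<Longrightarrow> proj (v o\<^sub>L v\<^sup>\<star>)"
  by (rule projI) (simp_all add: iso_hadj_apply inner_hadj_right[symmetric] inner_hadj_left)

lemma iso_hadj_norm_le: "iso v \<Longrightarrow> norm (v\<^sup>\<star> x) \<le> norm x"
  using proj_norm_le[OF iso_range_proj, of v x] by (simp add: iso_norm)

lemma iso_bessel:
  fixes v :: "'i \<Rightarrow> 'a::{real_inner,banach} \<Rightarrow>\<^sub>L 'a"
  assumes "finite I" and v: "\<And>n. iso (v n)" and orth: "\<And>m n x y. m \<noteq> n \<Longrightarrow> inner (v m x) (v n y) = 0"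
  shows "(\<Sum>n\<in>I. (norm ((v n)\<^sup>\<star> x))\<^sup>2) \<le> (norm x)\<^sup>2"
proof -
  have z: "(v m)\<^sup>\<star> (v n x) = 0" if "m \<noteq> n" for m n x
    by (rule inner_eq_imp_eq) (simp add: inner_hadj_left orth that[symmetric])
  have "(\<Sum>n\<in>I. (norm ((v n o\<^sub>L (v n)\<^sup>\<star>) x))\<^sup>2) \<le> (norm x)\<^sup>2"
    by (rule proj_bessel[OF assms(1) iso_range_proj[OF v]]) (simp add: z)
  then show ?thesis using v by (simp add: iso_norm)
qed

text \<open>The construction never uses complex scalars: an algebra enters as the set of all bounded
  real-linear operators commuting with a set \<open>S\<close>. For a complex algebra, \<open>S\<close> is its commutant, which contains
  the scalar multiplications and so enforces complex linearity.\<close>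

locale vn =
  fixes S M :: "('a::{real_inner,banach} \<Rightarrow>\<^sub>L 'a) set"
  assumes hadj_S: "C \<in> S \<Longrightarrow> C\<^sup>\<star> \<in> S"
    and M_eq: "M = {T. \<forall>C\<in>S. C o\<^sub>L T = T o\<^sub>L C}"
begin

lemma M_apply: "T \<in> M \<Longrightarrow> C \<in> S \<Longrightarrow> blinfun_apply C (blinfun_apply T x) = T (C x)"
  unfolding M_eq by (metis (mono_tags, lifting) blinfun_apply_blinfun_compose mem_Collect_eq)

lemma M_I: "(\<And>C x. C \<in> S \<Longrightarrow> blinfun_apply C (blinfun_apply T x) = T (C x)) \<Longrightarrow> T \<in> M"
  unfolding M_eq by (auto intro!: blinfun_eqI)

lemma M_id [simp, intro]: "id_blinfun \<in> M" and M_0 [simp, intro]: "0 \<in> M"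
  by (rule M_I; simp)+

lemma M_add [intro]: "T \<in> M \<Longrightarrow> R \<in> M \<Longrightarrow> T + R \<in> M"
  and M_diff [intro]: "T \<in> M \<Longrightarrow> R \<in> M \<Longrightarrow> T - R \<in> M"
  and M_scaleR [intro]: "T \<in> M \<Longrightarrow> r *\<^sub>R T \<in> M"
  and M_compose [intro]: "T \<in> M \<Longrightarrow> R \<in> M \<Longrightarrow> T o\<^sub>L R \<in> M"
  by (rule M_I, simp add: blinfun.bilinear_simps M_apply[of T] M_apply[of R])+

lemma M_hadj [intro]:
  assumes "T \<in> M" shows "T\<^sup>\<star> \<in> M"
  unfolding M_eq
proof (rule CollectI, rule ballI)
  fix C assume "C \<in> S"
  then have "C\<^sup>\<star> o\<^sub>L T = T o\<^sub>L C\<^sup>\<star>" using assms hadj_S unfolding M_eq by blast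
  then have "(C\<^sup>\<star> o\<^sub>L T)\<^sup>\<star> = (T o\<^sub>L C\<^sup>\<star>)\<^sup>\<star>" by simp
  then show "C o\<^sub>L T\<^sup>\<star> = T\<^sup>\<star> o\<^sub>L C" by simp
qed

lemma M_sum [intro]: "(\<And>i. i \<in> I \<Longrightarrow> T i \<in> M) \<Longrightarrow> (\<Sum>i\<in>I. T i) \<in> M"
  by (induction I rule: infinite_finite_induct) auto

lemma M_limit:
  assumes "\<And>n. F n \<in> M" "\<And>x. (\<lambda>n. blinfun_apply (F n) x) \<longlonglongrightarrow> blinfun_apply T x"
  shows "T \<in> M"
proof (rule M_I)
  fix C x assume C: "C \<in> S"
  have "(\<lambda>n. C (F n x)) \<longlonglongrightarrow> C (T x)" by (intro tendsto_intros assms)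
  moreover have "(\<lambda>n. F n (C x)) \<longlonglongrightarrow> T (C x)" by (rule assms)
  ultimately show "C (T x) = T (C x)"
    using LIMSEQ_unique by (simp add: M_apply[OF assms(1) C])
qed

lemma M_osum: "orth_family X \<Longrightarrow> (\<And>n. X n \<in> M) \<Longrightarrow> osum X \<in> M"
  by (rule M_limit[where F="\<lambda>N. \<Sum>n<N. X n"])
    (auto simp: blinfun.sum_left osum_sums simp flip: sums_def)

lemma M_psqrt [intro]: "pos T \<Longrightarrow> T \<in> M \<Longrightarrow> psqrt T \<in> M"
  unfolding M_eq using psqrt(3) by blast

lemma M_hproj:
  assumes "subspace V" "closed V" "\<And>C x. C \<in> S \<Longrightarrow> x \<in> V \<Longrightarrow> blinfun_apply C x \<in> V"
  shows "hproj V \<in> M"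
  unfolding M_eq using hproj_commute[OF assms(1,2)] assms(3) hadj_S by blast

lemma subspace_ker: "subspace {x. blinfun_apply T x = 0}" and closed_ker: "closed {x. blinfun_apply T x = 0}"
  by (auto simp: subspace_def blinfun.bilinear_simps intro!: closed_Collect_eq continuous_intros)

lemma M_hproj_ker: "T \<in> M \<Longrightarrow> hproj {x. blinfun_apply T x = 0} \<in> M"
  by (intro M_hproj subspace_ker closed_ker) (auto simp: M_apply[of T, symmetric])

lemma M_hproj_range:
  assumes "T \<in> M" shows "hproj (closure (range T)) \<in> M"
proof (rule M_hproj)
  show "subspace (closure (range T))" by (intro subspace_closure subspace_range_blinfun)
  fix C x assume C: "C \<in> S" and "x \<in> closure (range T)"
  then obtain s where s: "(\<lambda>n. T (s n)) \<longlonglongrightarrow> x" using closure_range_sequence by blast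
  have "(\<lambda>n. C (T (s n))) \<longlonglongrightarrow> C x" by (intro tendsto_intros s)
  then show "C x \<in> closure (range T)"
    unfolding closure_sequential M_apply[OF assms C]
    by (intro exI[of _ "\<lambda>n. T (C (s n))"]) auto
qed simp

text \<open>Polar decomposition inside M. The partial isometry commutes with S because X and its
  absolute value do and S is closed under adjoints; Q is the support projection of X.\<close>

lemma M_polar:
  assumes X: "X \<in> M"
  obtains W Q :: "'a \<Rightarrow>\<^sub>L 'a" where "W \<in> M" "Q \<in> M" "proj Q" "W\<^sup>\<star> o\<^sub>L W = Q"
    "\<And>x. Q x = 0 \<longleftrightarrow> X x = 0" "\<And>x. W (psqrt (X\<^sup>\<star> o\<^sub>L X) x) = X x" "\<And>z. W z \<in> closure (range X)"
    "\<And>x. Q (psqrt (X\<^sup>\<star> o\<^sub>L X) x) = psqrt (X\<^sup>\<star> o\<^sub>L X) x"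
proof -
  define Y where "Y = psqrt (X\<^sup>\<star> o\<^sub>L X)"
  note p = pos_hadj_compose[of X]
  have YM: "Y \<in> M" unfolding Y_def by (intro M_psqrt p M_compose M_hadj X)
  have eq: "norm (X x) = norm (Y x)" for x
    using psqrt_norm_sq[OF p, of x] unfolding Y_def norm_sq_hadj[symmetric] by simp
  obtain W :: "'a \<Rightarrow>\<^sub>L 'a" where W: "\<And>x. W (Y x) = X x" "W\<^sup>\<star> o\<^sub>L W = hproj (closure (range Y))"
    "\<And>z. W z \<in> closure (range X)"
    "\<And>C :: 'a \<Rightarrow>\<^sub>L 'a. C o\<^sub>L Y = Y o\<^sub>L C \<Longrightarrow> C\<^sup>\<star> o\<^sub>L Y = Y o\<^sub>L C\<^sup>\<star> \<Longrightarrow>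
      C o\<^sub>L X = X o\<^sub>L C \<Longrightarrow> C o\<^sub>L W = W o\<^sub>L C"
    using partial_isometry_factor[of X Y, OF eq] by metis
  have "W \<in> M" using X YM unfolding M_eq by (auto intro!: W(4) dest: hadj_S)
  have V: "subspace (closure (range Y))" by (intro subspace_closure subspace_range_blinfun)
  have "hproj (closure (range Y)) x = 0 \<longleftrightarrow> X x = 0" for x
  proof -
    have "hproj (closure (range Y)) x = 0 \<longleftrightarrow> (\<forall>z\<in>closure (range Y). inner x z = 0)"
      by (rule hproj_eq_0_iff[OF V closed_closure])
    also have "\<dots> \<longleftrightarrow> (\<forall>y. inner x (Y y) = 0)"
    proof
      assume "\<forall>z\<in>closure (range Y). inner x z = 0"
      then show "\<forall>y. inner x (Y y) = 0" using closure_subset[of "range Y"] by auto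
    next
      assume *: "\<forall>y. inner x (Y y) = 0"
      show "\<forall>z\<in>closure (range Y). inner x z = 0"
      proof
        fix z assume "z \<in> closure (range Y)"
        then obtain s where "(\<lambda>n. Y (s n)) \<longlonglongrightarrow> z" using closure_range_sequence by blast
        then have "(\<lambda>n. inner x (Y (s n))) \<longlonglongrightarrow> inner x z" by (intro tendsto_intros)
        then show "inner x z = 0" using * by (simp add: LIMSEQ_const_iff)
      qed
    qed
    also have "\<dots> \<longleftrightarrow> Y x = 0"
      using psqrt_inner[OF p, of x] unfolding Y_def[symmetric] by (metis inner_eq_zero_iff inner_zero_left)
    also have "\<dots> \<longleftrightarrow> X x = 0" using eq[of x] by (metis norm_eq_zero)
    finally show ?thesis .
  qed
  moreover have "hproj (closure (range Y)) (Y x) = Y x" for x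
    using closure_subset[of "range Y"] by (intro hproj_eq_self V) auto
  ultimately show thesis
    using \<open>W \<in> M\<close> M_hproj_range[OF YM] proj_hproj[OF V] W(1,3) W(2) unfolding Y_def
    by (intro that[of W "hproj (closure (range (psqrt (X\<^sup>\<star> o\<^sub>L X))))"]) auto
qed

end

lemma orth_seq_inner:
  assumes "a sums s" "\<And>n. inner z (a n) = 0" shows "inner z s = 0"
  using bounded_linear.sums[OF bounded_linear_inner_right assms(1), of z] assms(2) sums_unique2 sums_zero
  by (metis (no_types, lifting) sums_cong)

text \<open>What the construction needs from a \<open>\<sigma>\<close>-finite semifinite infinite factor: any two nonzero projections
  are linked by an element of \<open>M\<close> (which replaces comparison theory), and a projection outside the ideal \<open>J\<close>
  generated by the finite projections is infinite.\<close>

locale sf_factor = vn S M for S M :: "('a::{real_inner,banach} \<Rightarrow>\<^sub>L 'a) set" +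
  fixes J :: "('a \<Rightarrow>\<^sub>L 'a) set"
  assumes transitive: "e \<in> M \<Longrightarrow> proj e \<Longrightarrow> e \<noteq> 0 \<Longrightarrow> r \<in> M \<Longrightarrow> proj r \<Longrightarrow> r \<noteq> 0 \<Longrightarrow> \<exists>X\<in>M. r o\<^sub>L X o\<^sub>L e \<noteq> 0"
    and sigma_finite: "F \<subseteq> {P \<in> M. proj P \<and> P \<noteq> 0} \<Longrightarrow> (\<And>P Q. P \<in> F \<Longrightarrow> Q \<in> F \<Longrightarrow> P \<noteq> Q \<Longrightarrow> P o\<^sub>L Q = 0) \<Longrightarrow> countable F"
    and proper_isometry: "\<exists>w\<in>M. iso w \<and> w o\<^sub>L w\<^sup>\<star> \<noteq> id_blinfun"
    and J_subset: "J \<subseteq> M"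
    and J_add: "T \<in> J \<Longrightarrow> R \<in> J \<Longrightarrow> T + R \<in> J"
    and J_left: "X \<in> M \<Longrightarrow> T \<in> J \<Longrightarrow> X o\<^sub>L T \<in> J"
    and J_right: "X \<in> M \<Longrightarrow> T \<in> J \<Longrightarrow> T o\<^sub>L X \<in> J"
    and J_nonzero_proj: "\<exists>e\<in>J. proj e \<and> e \<noteq> 0"
    and not_J_infinite: "P \<in> M \<Longrightarrow> proj P \<Longrightarrow> P \<notin> J \<Longrightarrow> \<exists>w\<in>M. w\<^sup>\<star> o\<^sub>L w = P \<and> P o\<^sub>L w = w \<and> w o\<^sub>L w\<^sup>\<star> \<noteq> P"
begin

text \<open>Polar decomposition of a nonzero q X r: it kills the complement of r, so its support
  projection is a nonzero projection under r, and the partial isometry maps that support into the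
  range of q.\<close>

lemma subprojection_exists:
  assumes q: "q \<in> M" "proj q" "q \<noteq> 0" and r: "r \<in> M" "proj r" "r \<noteq> 0"
  shows "\<exists>f\<in>M. \<exists>t\<in>M. proj f \<and> f \<noteq> 0 \<and> r o\<^sub>L f = f \<and> t\<^sup>\<star> o\<^sub>L t = f \<and> q o\<^sub>L t = t"
proof -
  obtain X where X: "X \<in> M" "q o\<^sub>L X o\<^sub>L r \<noteq> 0" using transitive[OF r q] by blast
  define Y where "Y = q o\<^sub>L X o\<^sub>L r"
  have "Y \<in> M" unfolding Y_def by (intro M_compose X q r)
  obtain W Q :: "'a \<Rightarrow>\<^sub>L 'a" where W: "W \<in> M" "Q \<in> M" "proj Q" "W\<^sup>\<star> o\<^sub>L W = Q" "\<And>x. Q x = 0 \<longleftrightarrow> Y x = 0"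
    "\<And>z. W z \<in> closure (range Y)"
    using M_polar[OF \<open>Y \<in> M\<close>] by metis
  have "Q \<noteq> 0"
  proof
    assume "Q = 0"
    then have "Y = 0" using W(5) by (intro blinfun_eqI) simp
    then show False using X Y_def by simp
  qed
  have "Q (x - r x) = 0" for x
    unfolding W(5) Y_def by (simp add: blinfun.diff_right proj_idem[OF r(2)])
  then have "Q (r x) = Q x" for x by (simp add: blinfun.diff_right)
  then have "inner (r (Q x)) y = inner (Q x) y" for x y
    by (simp add: proj_inner[OF r(2)] proj_inner[OF W(3)])
  then have "r o\<^sub>L Q = Q" by (intro blinfun_inner_eqI) simp
  moreover have "q (W z) = W z" for z
  proof -
    obtain s where s: "(\<lambda>n. Y (s n)) \<longlonglongrightarrow> W z" using closure_range_sequence W(6) by blast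
    then have "(\<lambda>n. q (Y (s n))) \<longlonglongrightarrow> q (W z)" by (rule blinfun.tendsto[OF tendsto_const])
    then show ?thesis using LIMSEQ_unique s by (simp add: Y_def proj_idem[OF q(2)])
  qed
  then have "q o\<^sub>L W = W" by (intro blinfun_eqI) simp
  ultimately show ?thesis using W \<open>Q \<noteq> 0\<close> by blast
qed

text \<open>Zorn's lemma gives a maximal orthogonal family of projections equivalent to
  subprojections of q. By \<open>subprojection_exists\<close> its common kernel is 0, since
  otherwise the family could be enlarged there; \<sigma>-finiteness makes it countable. Only the
  partial isometries are kept, and the last conclusion says that their initial projections add up to
  the identity.\<close>

lemma partition_below:
  assumes q: "q \<in> M" "proj q" "q \<noteq> 0"
  obtains t :: "nat \<Rightarrow> 'a \<Rightarrow>\<^sub>L 'a" where "\<And>n. t n \<in> M" "\<And>n x. q (t n x) = t n x"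
    "\<And>x. (\<lambda>n. (norm (t n x))\<^sup>2) sums (norm x)\<^sup>2"
proof -
  define A where "A = {f\<in>M. proj f \<and> f \<noteq> 0 \<and> (\<exists>t\<in>M. t\<^sup>\<star> o\<^sub>L t = f \<and> q o\<^sub>L t = t)}"
  define FF where "FF = {F. F \<subseteq> A \<and> (\<forall>P\<in>F. \<forall>Q\<in>F. P \<noteq> Q \<longrightarrow> P o\<^sub>L Q = 0)}"
  have "\<exists>F\<in>FF. \<forall>X\<in>FF. F \<subseteq> X \<longrightarrow> X = F"
  proof (rule subset_Zorn')
    fix C assume C: "subset.chain FF C"
    have "P o\<^sub>L Q = 0" if PQ: "P \<in> \<Union>C" "Q \<in> \<Union>C" "P \<noteq> Q" for P Q
    proof -
      from PQ obtain F G where "F \<in> C" "G \<in> C" "P \<in> F" "Q \<in> G" by blast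
      moreover have "F \<subseteq> G \<or> G \<subseteq> F" using C calculation unfolding subset.chain_def by blast
      ultimately obtain H where "H \<in> C" "P \<in> H" "Q \<in> H" by blast
      moreover have "H \<in> FF" using C calculation unfolding subset.chain_def by blast
      ultimately show ?thesis using PQ unfolding FF_def by blast
    qed
    moreover have "\<Union>C \<subseteq> A" using C unfolding subset.chain_def FF_def by blast
    ultimately show "\<Union>C \<in> FF" unfolding FF_def by blast
  qed
  then obtain F where F: "F \<in> FF" and max: "\<And>X. X \<in> FF \<Longrightarrow> F \<subseteq> X \<Longrightarrow> X = F" by blast
  have FA: "F \<subseteq> A" and orth: "\<And>P Q. P \<in> F \<Longrightarrow> Q \<in> F \<Longrightarrow> P \<noteq> Q \<Longrightarrow> P o\<^sub>L Q = 0"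
    using F unfolding FF_def by blast+
  have "countable F" using FA by (intro sigma_finite orth) (auto simp: A_def)
  define V where "V = {x. \<forall>f\<in>F. blinfun_apply f x = 0}"
  have V_Int: "V = (\<Inter>f\<in>F. {x. blinfun_apply f x = 0})" unfolding V_def by blast
  have V: "subspace V" "closed V"
    unfolding V_Int by (auto intro!: subspace_Inter subspace_ker closed_ker closed_INT)
  have "hproj V \<in> M"
  proof (rule M_hproj[OF V])
    fix C x assume C: "C \<in> S" and x: "x \<in> V"
    have "f (C x) = 0" if "f \<in> F" for f
    proof -
      have "f \<in> M" using that FA unfolding A_def by blast
      then have "f (C x) = C (f x)" using M_apply[OF _ C] by simp
      then show ?thesis using x that unfolding V_def by simp
    qed
    then show "C x \<in> V" unfolding V_def by simp
  qed
  have V0: "hproj V = 0"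
  proof (rule ccontr)
    assume "hproj V \<noteq> 0"
    from subprojection_exists[OF q \<open>hproj V \<in> M\<close> proj_hproj[OF V] this]
    obtain f t where f: "f \<in> M" "t \<in> M" "proj f" "f \<noteq> 0" "hproj V o\<^sub>L f = f" "t\<^sup>\<star> o\<^sub>L t = f" "q o\<^sub>L t = t"
      by blast
    have "f x \<in> V" for x using f(5) hproj_mem[OF V] by (metis blinfun_apply_blinfun_compose)
    then have gf: "g o\<^sub>L f = 0" if "g \<in> F" for g using that by (intro blinfun_eqI) (auto simp: V_def)
    have fg: "f o\<^sub>L g = 0" if "g \<in> F" for g
    proof -
      have "(g o\<^sub>L f)\<^sup>\<star> = 0" using gf[OF that] by simp
      then show ?thesis using that FA f(3) by (auto simp: A_def proj_def)
    qed
    have "insert f F \<in> FF" using f FA gf fg orth unfolding FF_def A_def by auto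
    then have "f \<in> F" using max by blast
    then show False using gf[of f] f by (simp add: proj_def)
  qed
  \<comment> \<open>The family may be finite; indices that enumerate nothing get the zero
    projection, which is harmless in the sum.\<close>
  define f where "f n = (if n \<in> to_nat_on F ` F then from_nat_into F n else 0)" for n
  have fF: "f n \<in> F \<or> f n = 0" for n
    unfolding f_def using \<open>countable F\<close> by auto
  have f_orth: "f m (f n x) = 0" if "m \<noteq> n" for m n x
  proof (cases "m \<in> to_nat_on F ` F \<and> n \<in> to_nat_on F ` F")
    case True
    then have "f m \<noteq> f n" "f m \<in> F" "f n \<in> F"
      using \<open>m \<noteq> n\<close> \<open>countable F\<close> by (auto simp: f_def)
    then show ?thesis using orth[of "f m" "f n"] by (metis blinfun_apply_blinfun_compose zero_blinfun.rep_eq)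
  qed (auto simp: f_def)
  have f_proj: "proj (f n)" for n using fF[of n] FA by (auto simp: A_def proj_0)
  have "\<exists>t. t \<in> M \<and> t\<^sup>\<star> o\<^sub>L t = f n \<and> q o\<^sub>L t = t" for n
  proof (cases "f n = 0")
    case False
    then have "f n \<in> A" using fF[of n] FA by blast
    then show ?thesis unfolding A_def by blast
  qed (auto intro!: exI[of _ 0])
  then obtain t where t: "\<And>n. t n \<in> M" "\<And>n. (t n)\<^sup>\<star> o\<^sub>L t n = f n" "\<And>n. q o\<^sub>L t n = t n" by metis
  have fam: "orth_family f" by (rule orth_family_proj[OF f_proj]) (rule f_orth)
  have comp: "f n (osum f x) = f n x" for n x
    by (rule osum_proj_apply[OF f_proj]) (rule f_orth)
  have "osum f x = x" for x
  proof -
    have *: "f n (x - osum f x) = 0" for n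
      by (simp add: blinfun.diff_right comp)
    have "g (x - osum f x) = 0" if "g \<in> F" for g
    proof -
      have "g = f (to_nat_on F g)" using that \<open>countable F\<close> by (simp add: f_def)
      then show ?thesis using *[of "to_nat_on F g"] by simp
    qed
    then have "x - osum f x \<in> V" unfolding V_def by simp
    then have "hproj V (x - osum f x) = x - osum f x" by (rule hproj_eq_self[OF V])
    then show ?thesis using V0 by simp
  qed
  moreover have "(norm (t n x))\<^sup>2 = (norm (f n x))\<^sup>2" for n x
    using norm_sq_hadj[of "t n" x] unfolding t(2) proj_norm_sq[OF f_proj] .
  ultimately have "(\<lambda>n. (norm (t n x))\<^sup>2) sums (norm x)\<^sup>2" for x
    using osum_norm_sq[OF fam, of x] by simp
  moreover have "q (t n x) = t n x" for n x using t(3) by (metis blinfun_apply_blinfun_compose)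
  ultimately show thesis using t(1) that by blast
qed

text \<open>Infinitely many orthogonal copies of a nonzero projection are combined, via a partition of the
  identity below that projection, into a sequence of isometries with orthogonal ranges.\<close>

lemma isometries_from_copies:
  assumes q: "q \<in> M" "proj q" "q \<noteq> 0" and wM: "\<And>n :: nat. w n \<in> M"
    and w: "\<And>m n x y. inner (blinfun_apply (w m) x) (w n y) = (if m = n then inner (q x) y else 0)"
  obtains v t :: "nat \<Rightarrow> 'a \<Rightarrow>\<^sub>L 'a" where "\<And>k. v k \<in> M" "\<And>k. iso (v k)"
    "\<And>k x. (\<lambda>m. w (prod_encode (k, m)) (t m x)) sums v k x"
    "\<And>k l x y. k \<noteq> l \<Longrightarrow> inner (v k x) (v l y) = 0"
proof -
  obtain t :: "nat \<Rightarrow> 'a \<Rightarrow>\<^sub>L 'a" where t: "\<And>n. t n \<in> M" "\<And>n x. q (t n x) = t n x"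
    "\<And>x. (\<lambda>n. (norm (t n x))\<^sup>2) sums (norm x)\<^sup>2"
    using partition_below[OF q] by blast
  \<comment> \<open>The pairing function arranges the copies in infinitely many infinite rows. Row k
    yields one isometry, whose m-th piece sends the m-th member of the partition into the m-th copy
    of the row.\<close>
  define X where "X k m = w (prod_encode (k, m)) o\<^sub>L t m" for k m
  have Xn: "norm (X k m x) = norm (t m x)" for k m x
    by (simp add: norm_eq_sqrt_inner X_def w t(2))
  have fam: "orth_family (X k)" for k
    unfolding orth_family_def
  proof (intro conjI allI impI exI[of _ 1])
    show "inner (X k m x) (X k n y) = 0" if "m \<noteq> n" for m n x y
      using that by (simp add: X_def w)
    show "(\<Sum>n<N. (norm (X k n x))\<^sup>2) \<le> 1 * (norm x)\<^sup>2" for N x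
      using sum_le_suminf[OF sums_summable[OF t(3)], of "{..<N}" x] sums_unique[OF t(3), of x] by (simp add: Xn)
  qed
  show thesis
  proof (rule that[of "\<lambda>k. osum (X k)" t])
    show "osum (X k) \<in> M" for k by (intro M_osum fam) (auto simp: X_def wM t)
    show "iso (osum (X k))" for k
      unfolding iso_norm
    proof
      fix x
      have "(\<lambda>m. (norm (t m x))\<^sup>2) sums (norm (osum (X k) x))\<^sup>2"
        using osum_norm_sq[OF fam, of k x] by (simp add: Xn)
      then have "(norm (osum (X k) x))\<^sup>2 = (norm x)\<^sup>2" using t(3) sums_unique2 by blast
      then show "norm (osum (X k) x) = norm x" by simp
    qed
    show s: "(\<lambda>m. w (prod_encode (k, m)) (t m x)) sums osum (X k) x" for k x
      using osum_sums[OF fam, of k x] by (simp add: X_def)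
    show "inner (osum (X k) x) (osum (X l) y) = 0" if "k \<noteq> l" for k l x y
    proof (rule orth_seq_inner[OF s])
      fix m
      have "inner (w (prod_encode (l, m)) (t m y)) (osum (X k) x) = 0"
        by (rule orth_seq_inner[OF s]) (use that in \<open>simp add: w\<close>)
      then show "inner (osum (X k) x) (w (prod_encode (l, m)) (t m y)) = 0"
        by (simp add: inner_commute)
    qed
  qed
qed

lemma proj_preserved_sums:
  assumes "a sums s" "\<And>n. blinfun_apply P (a n) = a n" shows "P s = s"
  using bounded_linear.sums[OF blinfun.bounded_linear_right[of P] assms(1)] assms sums_unique2
  by (metis (no_types, lifting) sums_cong)

text \<open>Wold decomposition: e = \<open>P - (w o\<^sub>L w\<^sup>\<star>)\<close> is a nonzero
  projection orthogonal to the range of w, so e, w e, w w e, ... are copies of e with orthogonal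
  ranges under P, ready for \<open>isometries_from_copies\<close>.\<close>

lemma infinite_proj_isometries:
  assumes P: "P \<in> M" "proj P" and w: "w \<in> M" "w\<^sup>\<star> o\<^sub>L w = P" "P o\<^sub>L w = w" "w o\<^sub>L w\<^sup>\<star> \<noteq> P"
  obtains v :: "nat \<Rightarrow> 'a \<Rightarrow>\<^sub>L 'a" where "\<And>k. v k \<in> M" "\<And>k. iso (v k)" "\<And>k x. P (v k x) = v k x"
    "\<And>k l x y. k \<noteq> l \<Longrightarrow> inner (v k x) (v l y) = 0"
proof -
  have wP: "w\<^sup>\<star> (w x) = P x" "P (w x) = w x" for x
    using w by (metis blinfun_apply_blinfun_compose)+
  have wi: "inner (w x) (w y) = inner (P x) y" for x y
    by (metis inner_hadj_left wP(1) inner_commute)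
  have "inner (w (x - P x)) (w (x - P x)) = 0" for x
    unfolding wi by (simp add: blinfun.diff_right proj_idem[OF P(2)])
  then have wP': "w (P x) = w x" for x by (simp add: blinfun.diff_right)
  have Pw': "w\<^sup>\<star> (P x) = w\<^sup>\<star> x" for x
  proof -
    have "(P o\<^sub>L w)\<^sup>\<star> = w\<^sup>\<star>" using w(3) by simp
    then show ?thesis using P(2) by (metis blinfun_apply_blinfun_compose hadj_compose proj_def)
  qed
  have Pw'': "P (w\<^sup>\<star> x) = w\<^sup>\<star> x" for x
  proof -
    have "w o\<^sub>L P = w" using wP' by (intro blinfun_eqI) simp
    then have "(w o\<^sub>L P)\<^sup>\<star> = w\<^sup>\<star>" by simp
    then show ?thesis using P(2) by (metis blinfun_apply_blinfun_compose hadj_compose proj_def)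
  qed
  define e where "e = P - (w o\<^sub>L w\<^sup>\<star>)"
  have e: "e \<in> M" "e \<noteq> 0" unfolding e_def using P w by auto
  have ea: "e x = P x - w (w\<^sup>\<star> x)" for x by (simp add: e_def blinfun.diff_left)
  have we: "w\<^sup>\<star> (e x) = 0" for x by (simp add: ea blinfun.diff_right wP Pw' Pw'')
  have Pe: "P (e x) = e x" for x by (simp add: ea blinfun.diff_right wP proj_idem[OF P(2)])
  have "proj e"
  proof (rule projI)
    show "inner (e x) y = inner x (e y)" for x y
      by (simp add: ea inner_diff_left inner_diff_right proj_inner[OF P(2)] inner_hadj_left[symmetric] inner_hadj_right)
    show "e (e x) = e x" for x by (simp add: ea[of "e x"] we Pe)
  qed
  define W where "W n = ((o\<^sub>L) w ^^ n) e" for n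
  have W0: "W 0 = e" and WS: "\<And>n. W (Suc n) = w o\<^sub>L W n" by (auto simp: W_def)
  have WM: "W n \<in> M" for n by (induction n) (auto simp: W0 WS e w)
  have PW: "P (W n x) = W n x" for n x by (induction n) (auto simp: W0 WS Pe wP)
  have W: "inner (W m x) (W n y) = (if m = n then inner (e x) y else 0)" for m n x y
  proof (induction m arbitrary: n)
    case 0
    show ?case
    proof (cases n)
      case 0 then show ?thesis by (simp add: W0 proj_inner[OF \<open>proj e\<close>] proj_idem[OF \<open>proj e\<close>])
    next
      case (Suc k)
      have "inner (e x) (w (W k y)) = 0" by (simp add: inner_hadj_left[symmetric] we)
      then show ?thesis using Suc by (simp add: W0 WS)
    qed
  next
    case (Suc m)
    show ?case
    proof (cases n)
      case 0
      have "inner (w (W m x)) (e y) = 0" by (simp add: inner_hadj_right[symmetric] we)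
      then show ?thesis using 0 by (simp add: W0 WS)
    next
      case n: (Suc k)
      then show ?thesis using Suc[of k] by (simp add: WS wi PW)
    qed
  qed
  obtain v t :: "nat \<Rightarrow> 'a \<Rightarrow>\<^sub>L 'a" where v: "\<And>k. v k \<in> M" "\<And>k. iso (v k)"
    "\<And>k x. (\<lambda>m. W (prod_encode (k, m)) (blinfun_apply (t m) x)) sums v k x"
    "\<And>k l x y. k \<noteq> l \<Longrightarrow> inner (v k x) (v l y) = 0"
    by (rule isometries_from_copies[OF e(1) \<open>proj e\<close> e(2) WM W]) (rule that; assumption)
  then show thesis using proj_preserved_sums[OF v(3) PW] that by blast
qed

end

subsection \<open>Spectral projections of half-lines\<close>

lemma blinfun_tendsto:
  fixes T :: "'a::real_normed_vector \<Rightarrow>\<^sub>L 'b::real_normed_vector"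
  shows "(f \<longlongrightarrow> l) F \<Longrightarrow> ((\<lambda>n. T (f n)) \<longlongrightarrow> T l) F"
  by (rule blinfun.tendsto[OF tendsto_const])

text \<open>The squared norms decrease and their differences are the squared distances, so the
  sequence is Cauchy. The last two conclusions identify y as the projection of x onto the
  intersection of the ranges.\<close>

lemma decreasing_proj_limit:
  fixes P :: "nat \<Rightarrow> 'a::{real_inner,banach} \<Rightarrow>\<^sub>L 'a"
  assumes P: "\<And>n. proj (P n)" and dec: "\<And>m n x. m \<le> n \<Longrightarrow> P m (P n x) = P n x"
  obtains y where "(\<lambda>n. P n x) \<longlonglongrightarrow> y" "\<And>n. P n y = y"
    "\<And>z. (\<And>n. P n z = z) \<Longrightarrow> inner (x - y) z = 0"
proof -
  have inner_eq: "inner (P m x) (P n x) = (norm (P n x))\<^sup>2" if "m \<le> n" for m n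
    using dec[OF that, of x] proj_norm_sq[OF P, of n x] proj_inner[OF P, of m x "P n x"] inner_commute[of x "P n x"] by simp
  have diff: "(norm (P m x - P n x))\<^sup>2 = (norm (P m x))\<^sup>2 - (norm (P n x))\<^sup>2" if "m \<le> n" for m n
    using inner_eq[OF that] inner_commute[of "P n x" "P m x"]
    by (simp add: power2_norm_eq_inner inner_diff_left inner_diff_right)
  have dec: "decseq (\<lambda>n. (norm (P n x))\<^sup>2)"
    unfolding decseq_def using diff by (metis diff_ge_0_iff_ge zero_le_power2)
  obtain L where "(\<lambda>n. (norm (P n x))\<^sup>2) \<longlonglongrightarrow> L"
    by (rule decseq_convergent[OF dec, of 0]) auto
  then have C: "Cauchy (\<lambda>n. (norm (P n x))\<^sup>2)" by (rule LIMSEQ_imp_Cauchy)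
  have "Cauchy (\<lambda>n. P n x)"
  proof (rule metric_CauchyI)
    fix e :: real assume e: "0 < e"
    then obtain N where N: "\<And>m n. m \<ge> N \<Longrightarrow> n \<ge> N \<Longrightarrow> dist ((norm (P m x))\<^sup>2) ((norm (P n x))\<^sup>2) < e\<^sup>2"
      using metric_CauchyD[OF C, of "e\<^sup>2"] by auto
    have le: "dist (P m x) (P n x) < e" if "m \<le> n" "N \<le> m" for m n
    proof -
      have "(norm (P m x - P n x))\<^sup>2 < e\<^sup>2"
        unfolding diff[OF that(1)] using N[of m n] that by (simp add: dist_real_def)
      then show ?thesis using e by (simp add: dist_norm power2_less_imp_less)
    qed
    have "dist (P m x) (P n x) < e" if "m \<ge> N" "n \<ge> N" for m n
      using le[of m n] le[of n m] that by (cases "m \<le> n") (auto simp: dist_commute)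
    then show "\<exists>M. \<forall>m\<ge>M. \<forall>n\<ge>M. dist (P m x) (P n x) < e" by blast
  qed
  then obtain y where y: "(\<lambda>n. P n x) \<longlonglongrightarrow> y" using Cauchy_convergent_iff convergent_def by blast
  have "P n y = y" for n
  proof -
    have "(\<lambda>k. P n (P k x)) \<longlonglongrightarrow> P n y" by (rule blinfun_tendsto[OF y])
    moreover have "\<forall>\<^sub>F k in sequentially. P n (P k x) = P k x"
      using eventually_ge_at_top[of n] by eventually_elim (rule assms(2))
    ultimately have "(\<lambda>k. P k x) \<longlonglongrightarrow> P n y" using tendsto_cong by force
    then show ?thesis using y LIMSEQ_unique by blast
  qed
  moreover have "inner (x - y) z = 0" if z: "\<And>n. P n z = z" for z
  proof -
    have "inner (P n x) z = inner x z" for n using proj_inner[OF P, of n x z] z by simp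
    moreover have "(\<lambda>n. inner (P n x) z) \<longlonglongrightarrow> inner y z" by (intro tendsto_intros y)
    ultimately have "inner x z = inner y z" by (simp add: LIMSEQ_const_iff)
    then show ?thesis by (simp add: inner_diff_left)
  qed
  ultimately show thesis using y that by blast
qed

text \<open>The spectral projection of B for the half-line up to and including l. With T = B - l the
  operator |T| + T is twice the positive part of T, and its kernel is where T is nonpositive; a
  square root is all that is needed.\<close>

definition specp :: "('a::{real_inner,banach} \<Rightarrow>\<^sub>L 'a) \<Rightarrow> real \<Rightarrow> 'a \<Rightarrow>\<^sub>L 'a" where
  "specp B l = hproj {x. (psqrt ((B - l *\<^sub>R id_blinfun) o\<^sub>L (B - l *\<^sub>R id_blinfun)) + (B - l *\<^sub>R id_blinfun)) x = 0}"

context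
  fixes B :: "'a::{real_inner,banach} \<Rightarrow>\<^sub>L 'a"
  assumes B: "B\<^sup>\<star> = B"
begin

lemma subspace_closed_ker:
  fixes T :: "'a::{real_inner,banach} \<Rightarrow>\<^sub>L 'a"
  shows "subspace {x. T x = 0}" "closed {x. T x = 0}"
  by (auto simp: subspace_def blinfun.bilinear_simps intro!: closed_Collect_eq continuous_intros)

lemma specp_proj: "proj (specp B l)"
  unfolding specp_def by (intro proj_hproj subspace_closed_ker)

lemma shift_pos: "pos ((B - l *\<^sub>R id_blinfun) o\<^sub>L (B - l *\<^sub>R id_blinfun))"
  using pos_hadj_compose[of "B - l *\<^sub>R id_blinfun"] by (simp add: B)

lemma specp_commute:
  fixes C :: "'a \<Rightarrow>\<^sub>L 'a"
  assumes "\<And>x. C (B x) = B (C x)" "\<And>x. C\<^sup>\<star> (B x) = B (C\<^sup>\<star> x)"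
  shows "C o\<^sub>L specp B l = specp B l o\<^sub>L C"
proof -
  let ?T = "B - l *\<^sub>R id_blinfun"
  have *: "(psqrt (?T o\<^sub>L ?T) + ?T) (D x) = 0"
    if "\<And>x. D (B x) = B (D x)" "(psqrt (?T o\<^sub>L ?T) + ?T) x = 0" for D :: "'a \<Rightarrow>\<^sub>L 'a" and x
  proof -
    have T: "D (?T x) = ?T (D x)" for x using that(1) by (simp add: blinfun.bilinear_simps)
    then have "D (psqrt (?T o\<^sub>L ?T) x) = psqrt (?T o\<^sub>L ?T) (D x)"
      by (intro psqrt_commute[OF shift_pos]) simp
    with T have "(psqrt (?T o\<^sub>L ?T) + ?T) (D x) = D ((psqrt (?T o\<^sub>L ?T) + ?T) x)"
      by (simp only: blinfun.add_left blinfun.add_right)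
    then show ?thesis using that(2) by simp
  qed
  show ?thesis
    unfolding specp_def by (intro hproj_commute subspace_closed_ker) (use * assms in blast)+
qed

lemma specp_commute_self: "B (specp B l x) = specp B l (B x)"
  using specp_commute[of B l] B by (metis blinfun_apply_blinfun_compose)

lemma specp_commute_specp: "specp B m (specp B l x) = specp B l (specp B m x)"
  using specp_commute[of "specp B m" l] specp_proj[of m] specp_commute_self[of m]
  by (metis blinfun_apply_blinfun_compose proj_def)

lemma specp_upper:
  assumes "specp B l x = x" shows "inner (B x) x \<le> l * (norm x)\<^sup>2"
proof -
  let ?T = "B - l *\<^sub>R id_blinfun"
  let ?A = "psqrt (?T o\<^sub>L ?T)"
  have "(?A + ?T) x = 0"
    using assms hproj_eq_self_iff[OF subspace_closed_ker] unfolding specp_def by blast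
  then have "?T x = - ?A x" unfolding blinfun.add_left by (rule eq_neg_iff_add_eq_0[THEN iffD2, OF trans[OF add.commute]])
  moreover have "0 \<le> inner (?A x) x" by (rule pos_ge0[OF psqrt(1)[OF shift_pos]])
  ultimately have "inner (?T x) x \<le> 0" by simp
  then show ?thesis by (simp add: blinfun.bilinear_simps inner_diff_left power2_norm_eq_inner)
qed

text \<open>T and |T| commute and have the same square, so |T| - T maps into the kernel of |T| + T.
  A vector x orthogonal to that kernel therefore satisfies |T| x = T x. The inequality is strict
  because |T| x = 0 would put x into the kernel.\<close>

lemma specp_lower:
  assumes "specp B l x = 0" "x \<noteq> 0" shows "l * (norm x)\<^sup>2 < inner (B x) x"
proof -
  let ?T = "B - l *\<^sub>R id_blinfun"
  let ?A = "psqrt (?T o\<^sub>L ?T)"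
  let ?K = "{x. (?A + ?T) x = 0}"
  note A = psqrt(1)[OF shift_pos, of l]
  have orth: "inner x z = 0" if "z \<in> ?K" for z
    using assms(1) that hproj_eq_0_iff[OF subspace_closed_ker] unfolding specp_def by blast
  have TA: "?T (?A y) = ?A (?T y)" for y
    by (rule psqrt_commute[OF shift_pos]) simp
  have AA: "?A (?A y) = ?T (?T y)" for y using psqrt_apply[OF shift_pos] by simp
  have T: "?T\<^sup>\<star> = ?T" by (simp add: B)
  have "?A x - ?T x = 0"
  proof (rule inner_eq_imp_eq)
    fix y
    have "?A y - ?T y \<in> ?K"
      unfolding mem_Collect_eq blinfun.add_left blinfun.diff_right TA AA by simp
    then have "inner x (?A y - ?T y) = 0" by (rule orth)
    then show "inner (?A x - ?T x) y = inner 0 y"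
      by (simp only: inner_diff_left inner_diff_right selfadj_inner[OF T] selfadj_inner[OF pos_hadj[OF A]] inner_zero_left)
  qed
  then have eq: "?T x = ?A x" by simp
  have "inner (?A x) x \<noteq> 0"
  proof
    assume "inner (?A x) x = 0"
    then have "?A x = 0" by (rule pos_inner_0[OF A])
    then have "x \<in> ?K" using eq by (simp add: blinfun.add_left)
    then show False using orth[of x] assms(2) by simp
  qed
  then have "0 < inner (?T x) x" using eq pos_ge0[OF A, of x] by simp
  then show ?thesis by (simp add: blinfun.bilinear_simps inner_diff_left power2_norm_eq_inner)
qed

text \<open>The defect z lies in the range for l and is killed by the projection for m, so unless z
  = 0 its form would be at most l and more than m times its squared norm.\<close>

lemma specp_mono:
  assumes "l \<le> m" shows "specp B m (specp B l x) = specp B l x"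
proof -
  define z where "z = specp B l x - specp B m (specp B l x)"
  have "specp B m z = 0" by (simp add: z_def blinfun.diff_right proj_idem[OF specp_proj])
  moreover have "specp B l z = z"
    unfolding z_def blinfun.diff_right specp_commute_specp[of l m] proj_idem[OF specp_proj] ..
  then have "inner (B z) z \<le> l * (norm z)\<^sup>2" by (rule specp_upper)
  moreover have "l * (norm z)\<^sup>2 \<le> m * (norm z)\<^sup>2" using assms by (simp add: mult_right_mono)
  ultimately have "z = 0" using specp_lower[of m z] by fastforce
  then show ?thesis by (simp add: z_def)
qed

lemma specp_mono': "l \<le> m \<Longrightarrow> specp B l (specp B m x) = specp B l x"
  using specp_mono[of l m x] specp_commute_specp[of l m x] by simp

lemma specp_eq_id:
  assumes "\<And>x. inner (B x) x \<le> l * (norm x)\<^sup>2" shows "specp B l x = x"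
proof -
  have "specp B l (x - specp B l x) = 0" by (simp add: blinfun.diff_right proj_idem[OF specp_proj])
  then have "x - specp B l x = 0" using specp_lower assms by (meson not_less)
  then show ?thesis by simp
qed

lemma specp_eq_0:
  assumes "\<And>x. m * (norm x)\<^sup>2 \<le> inner (B x) x" "l < m" shows "specp B l x = 0"
proof (rule ccontr)
  assume n: "specp B l x \<noteq> 0"
  have "inner (B (specp B l x)) (specp B l x) \<le> l * (norm (specp B l x))\<^sup>2"
    by (rule specp_upper) (rule proj_idem[OF specp_proj])
  also have "\<dots> < m * (norm (specp B l x))\<^sup>2" using n assms by simp
  finally show False using assms(1)[of "specp B l x"] by simp
qed

text \<open>A vector in all the ranges for l + 1/(n+1) has form at most l times its squared norm, so
  no nonzero such vector is killed by \<open>specp B l\<close>.\<close>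

lemma specp_right_continuous: "(\<lambda>n. specp B (l + 1 / real (Suc n)) x) \<longlonglongrightarrow> specp B l x"
proof -
  obtain y where y: "(\<lambda>n. specp B (l + 1 / real (Suc n)) x) \<longlonglongrightarrow> y"
    "\<And>n. specp B (l + 1 / real (Suc n)) y = y"
    "\<And>z. (\<And>n. specp B (l + 1 / real (Suc n)) z = z) \<Longrightarrow> inner (x - y) z = 0"
  proof (rule decreasing_proj_limit[of "\<lambda>n. specp B (l + 1 / real (Suc n))" x])
    show "proj (specp B (l + 1 / real (Suc n)))" for n by (rule specp_proj)
    show "specp B (l + 1 / real (Suc m)) (specp B (l + 1 / real (Suc n)) x) = specp B (l + 1 / real (Suc n)) x"
      if "m \<le> n" for m n x by (rule specp_mono) (use that in \<open>simp add: frac_le\<close>)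
  qed (rule that; blast)
  define z where "z = y - specp B l y"
  have lz: "specp B l z = 0" by (simp add: z_def blinfun.diff_right proj_idem[OF specp_proj])
  have "specp B (l + 1 / real (Suc n)) z = z" for n
    unfolding z_def blinfun.diff_right y(2) by (subst specp_mono) auto
  then have "inner (B z) z \<le> (l + 1 / real (Suc n)) * (norm z)\<^sup>2" for n by (rule specp_upper)
  moreover have "(\<lambda>n. (l + 1 / real (Suc n)) * (norm z)\<^sup>2) \<longlonglongrightarrow> (l + 0) * (norm z)\<^sup>2"
    by (intro tendsto_intros LIMSEQ_Suc[OF lim_const_over_n])
  ultimately have "inner (B z) z \<le> (l + 0) * (norm z)\<^sup>2"
    by (intro LIMSEQ_le_const) auto
  then have "z = 0" using specp_lower[OF lz] by fastforce
  then have "specp B l y = y" by (simp add: z_def)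
  moreover have "specp B l (x - y) = 0"
  proof (rule inner_eq_imp_eq)
    fix w
    have "inner (x - y) (specp B l w) = 0" by (rule y(3)) (rule specp_mono, simp)
    then show "inner (specp B l (x - y)) w = inner 0 w" by (simp add: proj_inner[OF specp_proj])
  qed
  ultimately have "specp B l x = y" by (simp add: blinfun.diff_right)
  then show ?thesis using y(1) by simp
qed

text \<open>A vector killed by all \<open>specp B (l n)\<close> has form at least a times its
  squared norm, which strictness allows only for 0. The complementary projections decrease, hence
  tend to 0.\<close>

lemma specp_left_limit:
  assumes strict: "\<And>x. x \<noteq> 0 \<Longrightarrow> inner (B x) x < a * (norm x)\<^sup>2" and l: "incseq l" "l \<longlonglongrightarrow> a"
  shows "(\<lambda>n. specp B (l n) x) \<longlonglongrightarrow> x"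
proof -
  obtain y where y: "(\<lambda>n. (id_blinfun - specp B (l n)) x) \<longlonglongrightarrow> y"
    "\<And>n. (id_blinfun - specp B (l n)) y = y"
  proof (rule decreasing_proj_limit[of "\<lambda>n. id_blinfun - specp B (l n)" x])
    show "proj (id_blinfun - specp B (l n))" for n by (rule proj_compl[OF specp_proj])
    show "(id_blinfun - specp B (l m)) ((id_blinfun - specp B (l n)) x) = (id_blinfun - specp B (l n)) x"
      if "m \<le> n" for m n x
      using incseqD[OF l(1) that] by (simp add: blinfun.bilinear_simps specp_mono')
  qed (rule that; blast)
  have "y = 0"
  proof (rule ccontr)
    assume "y \<noteq> 0"
    have "specp B (l n) y = 0" for n using y(2)[of n] by (simp add: blinfun.diff_left)
    then have "l n * (norm y)\<^sup>2 \<le> inner (B y) y" for n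
      using specp_lower \<open>y \<noteq> 0\<close> by (meson less_imp_le)
    moreover have "(\<lambda>n. l n * (norm y)\<^sup>2) \<longlonglongrightarrow> a * (norm y)\<^sup>2" by (intro tendsto_intros l)
    ultimately have "a * (norm y)\<^sup>2 \<le> inner (B y) y" by (intro LIMSEQ_le_const2) auto
    then show False using strict[OF \<open>y \<noteq> 0\<close>] by simp
  qed
  then have "(\<lambda>n. x - specp B (l n) x) \<longlonglongrightarrow> 0" using y(1) by (simp add: blinfun.diff_left)
  then have "(\<lambda>n. x - (x - specp B (l n) x)) \<longlonglongrightarrow> x - 0" by (intro tendsto_diff tendsto_const)
  then show ?thesis by simp
qed

end

lemma (in vn) M_specp:
  assumes "B \<in> M" "B\<^sup>\<star> = B" shows "specp B l \<in> M"
  unfolding M_eq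
proof (rule CollectI, rule ballI)
  fix C assume "C \<in> S"
  then show "C o\<^sub>L specp B l = specp B l o\<^sub>L C"
    by (intro specp_commute assms M_apply hadj_S)
qed

subsection \<open>Sums of copies of a positive operator\<close>

lemma nonneg_iterated_has_sum:
  fixes f :: "nat \<times> nat \<Rightarrow> real"
  assumes "\<And>j k. 0 \<le> f (j, k)" and f: "\<And>j. (\<lambda>k. f (j, k)) sums g j" and g: "g sums s"
  shows "(f has_sum s) UNIV"
proof -
  have f': "((\<lambda>k. f (j, k)) has_sum g j) UNIV" for j
    by (intro sums_nonneg_imp_has_sum f assms)
  have g0: "0 \<le> g j" for j using has_sum_nonneg[OF f'] assms by auto
  have g': "(g has_sum s) UNIV" by (intro sums_nonneg_imp_has_sum g g0)
  have "f summable_on Sigma UNIV (\<lambda>_. UNIV)"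
    by (rule summable_on_SigmaI[where g=g]) (use f' g' assms in \<open>auto intro: has_sum_imp_summable\<close>)
  then have "(f has_sum s) (Sigma UNIV (\<lambda>_. UNIV))"
    by (intro has_sum_SigmaI[where g=g] f' g')
  then show ?thesis by simp
qed

lemma sums_finite_nonneg_le:
  fixes f :: "nat \<Rightarrow> real"
  assumes "f sums s" "\<And>n. 0 \<le> f n" shows "(\<Sum>n<N. f n) \<le> s"
  using sum_le_suminf[OF sums_summable[OF assms(1)], of "{..<N}"] assms sums_unique[OF assms(1)] by auto

lemma iso_hadj_orth:
  fixes v w :: "'a::{real_inner,banach} \<Rightarrow>\<^sub>L 'a"
  assumes "\<And>x y. inner (v x) (w y) = 0" shows "v\<^sup>\<star> (w y) = 0"
  by (rule inner_eq_imp_eq) (simp add: inner_hadj_left inner_commute[of "w y"] assms)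

context sf_factor
begin

lemma unit_isometries:
  obtains U :: "nat \<Rightarrow> 'a \<Rightarrow>\<^sub>L 'a" where "\<And>k. U k \<in> M" "\<And>k. iso (U k)"
    "\<And>k l x y. k \<noteq> l \<Longrightarrow> inner (U k x) (U l y) = 0"
proof -
  obtain w where w: "w \<in> M" "iso w" "w o\<^sub>L w\<^sup>\<star> \<noteq> id_blinfun" using proper_isometry by blast
  have id_w: "id_blinfun o\<^sub>L w = w" by (rule blinfun_eqI) simp
  obtain v :: "nat \<Rightarrow> 'a \<Rightarrow>\<^sub>L 'a" where "\<And>k. v k \<in> M" "\<And>k. iso (v k)"
    "\<And>k l x y. k \<noteq> l \<Longrightarrow> inner (v k x) (v l y) = 0"
    by (rule infinite_proj_isometries[OF M_id proj_id w(1) w(2)[unfolded iso_def] id_w w(3)])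
      (rule that; assumption)
  then show thesis using that by blast
qed

text \<open>The operator $B' = \sum_k U_k B U_k^*$ is an infinite multiple of $B$.\<close>

lemma amplify:
  assumes B: "B \<in> M" "pos B" "B \<noteq> 0" and bd: "\<And>x. inner (B x) x \<le> b * (norm x)\<^sup>2"
  obtains B' u :: "'a \<Rightarrow>\<^sub>L 'a" and U :: "nat \<Rightarrow> 'a \<Rightarrow>\<^sub>L 'a" and \<beta>
  where "B' \<in> M" "pos B'" "\<And>x. inner (B' x) x \<le> b * (norm x)\<^sup>2"
    "\<And>k. U k \<in> M" "\<And>k. iso (U k)" "\<And>k l x y. k \<noteq> l \<Longrightarrow> inner (U k x) (U l y) = 0"
    "\<And>k x. B' (U k x) = U k (B x)" "\<And>x. (\<And>k. (U k)\<^sup>\<star> x = 0) \<Longrightarrow> B' x = 0"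
    "u \<in> M" "iso u" "0 < \<beta>" "\<And>x. \<beta> * (norm x)\<^sup>2 \<le> inner (B' (u x)) (u x)"
proof -
  note sB = pos_hadj[OF B(2)]
  obtain x0 where x0: "B x0 \<noteq> 0" using B(3) by (metis blinfun_eqI zero_blinfun.rep_eq)
  have "inner (B x0) x0 \<noteq> 0" using pos_inner_0[OF B(2)] x0 by blast
  then have p: "0 < inner (B x0) x0" using pos_ge0[OF B(2), of x0] by simp
  have b0: "0 \<le> b"
    using p bd[of x0] by (smt (verit) mult_nonneg_nonneg zero_le_power2 mult_neg_pos mult_nonpos_nonneg)
  \<comment> \<open>Half the Rayleigh quotient of B at x0, so that x0 is not fixed by
    \<open>specp B \<beta>\<close> and the complementary projection q is nonzero.\<close>
  define \<beta> where "\<beta> = inner (B x0) x0 / (2 * (norm x0)\<^sup>2)"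
  have n0: "0 < (norm x0)\<^sup>2" using x0 by (metis blinfun.zero_right zero_less_norm_iff zero_less_power)
  then have \<beta>: "0 < \<beta>" using p by (simp add: \<beta>_def)
  define q where "q = id_blinfun - specp B \<beta>"
  have q: "q \<in> M" "proj q" unfolding q_def by (intro M_diff M_id M_specp B sB proj_compl specp_proj[OF sB])+
  have "q \<noteq> 0"
  proof
    assume "q = 0"
    then have "specp B \<beta> x0 = x0" unfolding q_def by simp
    then have "inner (B x0) x0 \<le> \<beta> * (norm x0)\<^sup>2" by (rule specp_upper[OF sB])
    then show False using p n0 by (simp add: \<beta>_def)
  qed
  obtain t :: "nat \<Rightarrow> 'a \<Rightarrow>\<^sub>L 'a" where t: "\<And>n. t n \<in> M" "\<And>n x. q (t n x) = t n x"
    "\<And>x. (\<lambda>n. (norm (t n x))\<^sup>2) sums (norm x)\<^sup>2"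
    using partition_below[OF q \<open>q \<noteq> 0\<close>] by blast
  have lower: "\<beta> * (norm (t n x))\<^sup>2 \<le> inner (B (t n x)) (t n x)" for n x
  proof (cases "t n x = 0")
    case False
    have "specp B \<beta> (t n x) = 0" using t(2)[of n x] by (simp add: q_def blinfun.diff_left)
    from specp_lower[OF sB this False] show ?thesis by simp
  qed simp
  obtain U :: "nat \<Rightarrow> 'a \<Rightarrow>\<^sub>L 'a" where U: "\<And>k. U k \<in> M" "\<And>k. iso (U k)"
    "\<And>k l x y. k \<noteq> l \<Longrightarrow> inner (U k x) (U l y) = 0" using unit_isometries by blast
  have UU: "(U k)\<^sup>\<star> (U l x) = (if k = l then x else 0)" for k l x
    using iso_hadj_apply[OF U(2)] iso_hadj_orth[of "U k" "U l"] U(3)[of k l] by auto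
  have Ubessel: "(\<Sum>n<N. (norm ((U n)\<^sup>\<star> x))\<^sup>2) \<le> (norm x)\<^sup>2" for N x
    by (rule iso_bessel[OF _ U(2)]) (auto intro: U)
  define X where "X k = U k o\<^sub>L B o\<^sub>L (U k)\<^sup>\<star>" for k
  have famX: "orth_family X"
    unfolding orth_family_def
  proof (intro conjI allI impI exI[of _ "(norm B)\<^sup>2"])
    show "inner (X m x) (X n y) = 0" if "m \<noteq> n" for m n x y using U(3)[OF that] by (simp add: X_def)
    fix N x
    have "(\<Sum>n<N. (norm (X n x))\<^sup>2) \<le> (\<Sum>n<N. (norm B)\<^sup>2 * (norm ((U n)\<^sup>\<star> x))\<^sup>2)"
      using U(2) by (intro sum_mono) (simp add: X_def iso_norm norm_blinfun power_mono flip: power_mult_distrib)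
    also have "\<dots> \<le> (norm B)\<^sup>2 * (norm x)\<^sup>2"
      unfolding sum_distrib_left[symmetric] by (intro mult_left_mono Ubessel) simp
    finally show "(\<Sum>n<N. (norm (X n x))\<^sup>2) \<le> (norm B)\<^sup>2 * (norm x)\<^sup>2" .
  qed
  define B' where "B' = osum X"
  have "B' \<in> M" unfolding B'_def by (intro M_osum famX, unfold X_def, intro M_compose M_hadj U B)
  have B's: "(\<lambda>k. U k (B ((U k)\<^sup>\<star> x))) sums B' x" for x
    using osum_sums[OF famX, of x] by (simp add: X_def B'_def)
  have B'i: "(\<lambda>k. inner (B ((U k)\<^sup>\<star> x)) ((U k)\<^sup>\<star> y)) sums inner (B' x) y" for x y
    using osum_inner_sums[OF famX, of y x] by (simp add: X_def B'_def inner_hadj_right inner_commute[of y])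
  have "pos B'"
  proof (rule posI)
    show "B'\<^sup>\<star> = B'"
    proof (rule hadj_eqI)
      fix x y
      have "inner (B ((U k)\<^sup>\<star> x)) ((U k)\<^sup>\<star> y) = inner (B ((U k)\<^sup>\<star> y)) ((U k)\<^sup>\<star> x)" for k
        by (subst selfadj_inner[OF sB]) (rule inner_commute)
      then have "inner (B' x) y = inner (B' y) x" using B'i[of x y] B'i[of y x] sums_unique2 by simp
      then show "inner (B' x) y = inner x (B' y)" by (simp add: inner_commute)
    qed
    fix x
    show "0 \<le> inner (B' x) x" by (rule sums_le[OF _ sums_zero B'i]) (rule pos_ge0[OF B(2)])
  qed
  have Us: "summable (\<lambda>n. (norm ((U n)\<^sup>\<star> x))\<^sup>2)" and Us_le: "(\<Sum>n. (norm ((U n)\<^sup>\<star> x))\<^sup>2) \<le> (norm x)\<^sup>2" for x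
  proof -
    show "summable (\<lambda>n. (norm ((U n)\<^sup>\<star> x))\<^sup>2)"
      by (rule summableI_nonneg_bounded[OF _ Ubessel]) simp
    then show "(\<Sum>n. (norm ((U n)\<^sup>\<star> x))\<^sup>2) \<le> (norm x)\<^sup>2"
      by (rule suminf_le_const) (rule Ubessel)
  qed
  have B'b: "inner (B' x) x \<le> b * (norm x)\<^sup>2" for x
  proof -
    have "inner (B' x) x \<le> b * (\<Sum>n. (norm ((U n)\<^sup>\<star> x))\<^sup>2)"
      by (rule sums_le[OF _ B'i sums_mult[OF summable_sums[OF Us]]]) (rule bd)
    also have "\<dots> \<le> b * (norm x)\<^sup>2" by (intro mult_left_mono Us_le b0)
    finally show ?thesis .
  qed
  have B'U: "B' (U k x) = U k (B x)" for k x
  proof -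
    have "(\<lambda>l. U l (B ((U l)\<^sup>\<star> (U k x)))) = (\<lambda>l. if l = k then U k (B x) else 0)"
      by (auto simp: UU fun_eq_iff)
    then show ?thesis using B's[of "U k x"] sums_single[of k "\<lambda>_. U k (B x)"] sums_unique2 by metis
  qed
  have B'0: "B' x = 0" if "\<And>k. (U k)\<^sup>\<star> x = 0" for x
    using B's[of x] that sums_unique2[OF _ sums_zero] by simp
  \<comment> \<open>The part of B above \<beta> may be too small to contain an isometric copy of the
    space. Spreading the partition below q over the different copies of B gives an isometry u on
    whose range B' is at least \<beta>.\<close>
  define Y where "Y n = U n o\<^sub>L t n" for n
  have famY: "orth_family Y"
    unfolding orth_family_def
  proof (intro conjI allI impI exI[of _ 1])
    show "inner (Y m x) (Y n y) = 0" if "m \<noteq> n" for m n x y using U(3)[OF that] by (simp add: Y_def)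
    show "(\<Sum>n<N. (norm (Y n x))\<^sup>2) \<le> 1 * (norm x)\<^sup>2" for N x
      using U(2) sums_finite_nonneg_le[OF t(3), of x N] by (simp add: Y_def iso_norm)
  qed
  define u where "u = osum Y"
  have "u \<in> M" unfolding u_def by (intro M_osum famY) (auto simp: Y_def U t)
  have "iso u"
    unfolding iso_norm
  proof
    fix x
    have "(\<lambda>n. (norm (t n x))\<^sup>2) sums (norm (u x))\<^sup>2"
      using osum_norm_sq[OF famY, of x] U(2) by (simp add: Y_def u_def iso_norm)
    then have "(norm (u x))\<^sup>2 = (norm x)\<^sup>2" using t(3) sums_unique2 by blast
    then show "norm (u x) = norm x" by simp
  qed
  have Uu: "(U k)\<^sup>\<star> (u x) = t k x" for k x
  proof -
    have "(\<lambda>l. (U k)\<^sup>\<star> (Y l x)) sums (U k)\<^sup>\<star> (u x)"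
      unfolding u_def by (rule bounded_linear.sums[OF blinfun.bounded_linear_right osum_sums[OF famY]])
    moreover have "(\<lambda>l. (U k)\<^sup>\<star> (Y l x)) = (\<lambda>l. if l = k then t k x else 0)"
      by (auto simp: UU Y_def fun_eq_iff)
    ultimately show ?thesis using sums_single[of k "\<lambda>_. t k x"] sums_unique2 by metis
  qed
  have "\<beta> * (norm x)\<^sup>2 \<le> inner (B' (u x)) (u x)" for x
    by (rule sums_le[OF _ sums_mult[OF t(3)] B'i]) (simp add: Uu lower)
  then show thesis
    using that[of B' U u \<beta>] \<open>B' \<in> M\<close> \<open>pos B'\<close> B'b U B'U B'0 \<open>u \<in> M\<close> \<open>iso u\<close> \<beta> by blast
qed

end

text \<open>The copy is essentially v \<open>psqrt B\<close>, which fits under d times the range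
  projection of v because B is bounded by b < d. It is tilted by a small \<sigma> into the direction
  of the square root H of T, so that it also removes a proportion of T. The term D is the tilt; R',
  the square root of what D leaves of B, restores the exact Gram operator B.\<close>

lemma (in vn) peel_copy:
  assumes T: "T \<in> M" "pos T" "\<And>x. inner (T x) x \<le> a * (norm x)\<^sup>2" "0 \<le> a"
    and v: "v \<in> M" "iso v" and B: "B \<in> M" "pos B" "\<And>x. inner (B x) x \<le> b * (norm x)\<^sup>2" "0 \<le> b"
    and u: "u \<in> M" "iso u" "\<And>x. \<beta> * (norm x)\<^sup>2 \<le> inner (B (u x)) (u x)" "0 \<le> \<beta>"
    and s: "0 < \<sigma>" "\<sigma>\<^sup>2 * a \<le> 1" "0 < d" "\<sigma>\<^sup>2 * b + b * (1 + \<sigma> * sqrt a)\<^sup>2 / d \<le> 1"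
  shows "\<exists>Z\<in>M. Z\<^sup>\<star> o\<^sub>L Z = B \<and> (\<forall>x. (norm (Z\<^sup>\<star> x))\<^sup>2 \<le> inner (T x) x + d * (norm (v\<^sup>\<star> x))\<^sup>2) \<and>
    (\<forall>x. \<sigma> * sqrt \<beta> * sqrt (inner (T x) x) \<le> norm (Z\<^sup>\<star> x) + sqrt d * norm (v\<^sup>\<star> x))"
proof -
  define H where "H = psqrt T"
  define R where "R = psqrt B"
  have HM: "H \<in> M" and RM: "R \<in> M" unfolding H_def R_def by (intro M_psqrt T B)+
  have H2: "(norm (H x))\<^sup>2 = inner (T x) x" and R2: "(norm (R x))\<^sup>2 = inner (B x) x" for x
    unfolding H_def R_def by (rule psqrt_norm_sq[OF T(2)], rule psqrt_norm_sq[OF B(2)])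
  have Ha: "H\<^sup>\<star> = H" and Ra: "R\<^sup>\<star> = R"
    unfolding H_def R_def by (rule pos_hadj[OF psqrt(1)[OF T(2)]], rule pos_hadj[OF psqrt(1)[OF B(2)]])
  have Hn: "norm (H x) \<le> sqrt a * norm x" for x
    using T(3)[of x] H2[of x] by (metis norm_ge_zero real_le_rsqrt real_sqrt_abs real_sqrt_mult abs_norm_cancel)
  have Rn: "norm (R x) \<le> sqrt b * norm x" for x
    using B(3)[of x] R2[of x] by (metis norm_ge_zero real_le_rsqrt real_sqrt_abs real_sqrt_mult abs_norm_cancel)
  \<comment> \<open>Its adjoint is \<sigma> times R u, which is bounded below by \<sigma>
    \<open>sqrt \<beta>\<close>; the fixed proportion of T comes from here.\<close>
  define K where "K = \<sigma> *\<^sub>R (u\<^sup>\<star> o\<^sub>L R)"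
  have Ka: "K\<^sup>\<star> = \<sigma> *\<^sub>R (R o\<^sub>L u)" by (simp add: K_def Ra)
  have Kn: "norm (K x) \<le> \<sigma> * norm (R x)" for x
    using s(1) iso_hadj_norm_le[OF u(2), of "R x"] by (simp add: K_def blinfun.scaleR_left)
  have K'2: "(norm (K\<^sup>\<star> x))\<^sup>2 = \<sigma>\<^sup>2 * inner (B (u x)) (u x)" for x
    by (simp add: Ka blinfun.scaleR_left power_mult_distrib R2)
  have un: "norm (u x) = norm x" and vn: "norm (v x) = norm x" for x using u(2) v(2) by (auto simp: iso_norm)
  \<comment> \<open>Projecting the tilt off the range of v makes the ranges of D and v R'
    orthogonal, so that their squared norms add.\<close>
  define E where "E = id_blinfun - (v o\<^sub>L v\<^sup>\<star>)"
  have E: "proj E" "E \<in> M" unfolding E_def using v by (auto intro: proj_compl iso_range_proj)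
  have vE: "v\<^sup>\<star> (E x) = 0" for x by (simp add: E_def blinfun.bilinear_simps iso_hadj_apply[OF v(2)])
  define D where "D = E o\<^sub>L H o\<^sub>L K"
  have DM: "D \<in> M" unfolding D_def K_def using E HM RM u by auto
  have Dn: "(norm (D x))\<^sup>2 \<le> inner (B x) x" for x
  proof -
    have "norm (D x) \<le> norm (H (K x))" unfolding D_def by (simp add: proj_norm_le[OF E(1)])
    also have "\<dots> \<le> sqrt a * norm (K x)" by (rule Hn)
    also have "\<dots> \<le> sqrt a * (\<sigma> * norm (R x))" by (intro mult_left_mono Kn) (use T in auto)
    finally have "(norm (D x))\<^sup>2 \<le> (sqrt a * (\<sigma> * norm (R x)))\<^sup>2" by (rule power_mono) simp
    also have "\<dots> = (\<sigma>\<^sup>2 * a) * inner (B x) x" using T(4) by (simp add: power_mult_distrib R2)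
    also have "\<dots> \<le> 1 * inner (B x) x" by (intro mult_right_mono s pos_ge0 B)
    finally show ?thesis by simp
  qed
  define B' where "B' = B - (D\<^sup>\<star> o\<^sub>L D)"
  have B'q: "inner (B' x) x = inner (B x) x - (norm (D x))\<^sup>2" for x
    unfolding B'_def inner_diff_quad norm_sq_hadj ..
  have B': "pos B'"
  proof (rule posI)
    show "B'\<^sup>\<star> = B'" by (simp add: B'_def pos_hadj[OF B(2)])
    show "0 \<le> inner (B' x) x" for x unfolding B'q using Dn[of x] by simp
  qed
  define R' where "R' = psqrt B'"
  have R'2: "(norm (R' x))\<^sup>2 = inner (B x) x - (norm (D x))\<^sup>2" for x
    unfolding R'_def psqrt_norm_sq[OF B'] B'q ..
  have R'M: "R' \<in> M" unfolding R'_def B'_def by (intro M_psqrt B'[unfolded B'_def] M_diff B M_compose M_hadj DM)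
  have R'a: "R'\<^sup>\<star> = R'" unfolding R'_def by (rule pos_hadj[OF psqrt(1)[OF B']])
  have R'n: "norm (R' x) \<le> sqrt b * norm x" for x
  proof -
    have "(norm (R' x))\<^sup>2 \<le> b * (norm x)\<^sup>2" using R'2[of x] B(3)[of x] by (smt (verit) zero_le_power2)
    then show ?thesis by (metis norm_ge_zero real_le_rsqrt real_sqrt_abs real_sqrt_mult abs_norm_cancel)
  qed
  define Z where "Z = D + (v o\<^sub>L R')"
  have ZM: "Z \<in> M" unfolding Z_def using DM v R'M by auto
  have "Z\<^sup>\<star> o\<^sub>L Z = B"
  proof (subst hadj_compose_eq_iff[OF pos_hadj[OF B(2)]], rule allI)
    fix x
    have "inner (D x) (v (R' x)) = 0"
      by (simp add: D_def vE flip: inner_hadj_left)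
    then have "(norm (Z x))\<^sup>2 = (norm (D x))\<^sup>2 + (norm (v (R' x)))\<^sup>2"
      by (simp add: Z_def blinfun.add_left power2_norm_eq_inner inner_add_left inner_add_right inner_commute)
    then show "(norm (Z x))\<^sup>2 = inner (B x) x" by (simp add: vn R'2)
  qed
  \<comment> \<open>The adjoint of Z applied to x is the adjoint of K applied to H (E x), plus R'
    applied to \<open>v\<^sup>\<star> x\<close>. Replacing E x by x changes this only by a function
    of \<open>v\<^sup>\<star> x\<close>; g collects all such terms, and r bounds it.\<close>
  define g where "g y = R' y - K\<^sup>\<star> (H (v y))" for y
  have Z': "Z\<^sup>\<star> x = K\<^sup>\<star> (H x) + g (v\<^sup>\<star> x)" for x
  proof -
    have "E\<^sup>\<star> = E" using E(1) by (simp add: proj_def)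
    then have "Z\<^sup>\<star> x = K\<^sup>\<star> (H (E x)) + R' (v\<^sup>\<star> x)"
      by (simp add: Z_def D_def Ha R'a blinfun.add_left)
    then show ?thesis by (simp add: E_def g_def blinfun.bilinear_simps)
  qed
  define p where "p = \<sigma> * sqrt b"
  define r where "r = sqrt b * (1 + \<sigma> * sqrt a)"
  have K'n: "norm (K\<^sup>\<star> x) \<le> p * norm x" for x
  proof -
    have "norm (K\<^sup>\<star> x) = \<sigma> * norm (R (u x))" using s(1) by (simp add: Ka blinfun.scaleR_left)
    also have "\<dots> \<le> \<sigma> * (sqrt b * norm (u x))" by (intro mult_left_mono Rn) (use s in auto)
    finally show ?thesis by (simp add: p_def un)
  qed
  have gn: "norm (g y) \<le> r * norm y" for y
  proof -
    have "norm (g y) \<le> norm (R' y) + norm (K\<^sup>\<star> (H (v y)))" unfolding g_def by (rule norm_triangle_ineq4)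
    also have "\<dots> \<le> sqrt b * norm y + p * (sqrt a * norm (v y))"
      by (intro add_mono R'n order_trans[OF K'n] mult_left_mono Hn) (use s B in \<open>auto simp: p_def\<close>)
    also have "\<dots> = r * norm y" by (simp add: vn r_def p_def algebra_simps)
    finally show ?thesis .
  qed
  have pr: "p\<^sup>2 + r\<^sup>2 / d \<le> 1" using s(4) B(4) by (simp add: p_def r_def power_mult_distrib)
  have up: "(norm (Z\<^sup>\<star> x))\<^sup>2 \<le> inner (T x) x + d * (norm (v\<^sup>\<star> x))\<^sup>2" for x
  proof -
    define \<alpha> where "\<alpha> = norm (H x)"
    define \<gamma> where "\<gamma> = norm (v\<^sup>\<star> x)"
    have "norm (Z\<^sup>\<star> x) \<le> p * \<alpha> + r * \<gamma>"
      unfolding Z' \<alpha>_def \<gamma>_def by (intro order_trans[OF norm_triangle_ineq] add_mono K'n gn)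
    then have "(norm (Z\<^sup>\<star> x))\<^sup>2 \<le> (p * \<alpha> + r * \<gamma>)\<^sup>2" by (rule power_mono) simp
    also have "\<dots> \<le> (p\<^sup>2 + r\<^sup>2 / d) * (\<alpha>\<^sup>2 + d * \<gamma>\<^sup>2)"
    proof -
      \<comment> \<open>Cauchy-Schwarz with weights 1 and d; the defect is a perfect square divided
        by d.\<close>
      have "(p\<^sup>2 + r\<^sup>2 / d) * (\<alpha>\<^sup>2 + d * \<gamma>\<^sup>2) - (p * \<alpha> + r * \<gamma>)\<^sup>2 = (p * d * \<gamma> - r * \<alpha>)\<^sup>2 / d"
        using s(3) by (simp add: field_simps power2_eq_square)
      moreover have "0 \<le> (p * d * \<gamma> - r * \<alpha>)\<^sup>2 / d" using s(3) by simp
      ultimately show ?thesis by linarith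
    qed
    also have "\<dots> \<le> 1 * (\<alpha>\<^sup>2 + d * \<gamma>\<^sup>2)" by (intro mult_right_mono pr) (use s in auto)
    finally show ?thesis by (simp add: \<alpha>_def \<gamma>_def H2)
  qed
  have low: "\<sigma> * sqrt \<beta> * sqrt (inner (T x) x) \<le> norm (Z\<^sup>\<star> x) + sqrt d * norm (v\<^sup>\<star> x)" for x
  proof -
    have "r\<^sup>2 \<le> d" using pr s(3) by (simp add: field_simps) (smt (verit) mult_nonneg_nonneg zero_le_power2)
    then have rd: "r \<le> sqrt d" by (rule real_le_rsqrt)
    have "(\<sigma> * sqrt \<beta> * norm (H x))\<^sup>2 \<le> (norm (K\<^sup>\<star> (H x)))\<^sup>2"
      unfolding K'2 using u(3)[of "H x"] u(4) by (simp add: power_mult_distrib mult.assoc mult_left_mono)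
    then have "\<sigma> * sqrt \<beta> * norm (H x) \<le> norm (K\<^sup>\<star> (H x))" by (rule power2_le_imp_le) simp
    also have "K\<^sup>\<star> (H x) = Z\<^sup>\<star> x - g (v\<^sup>\<star> x)" by (simp add: Z')
    also have "norm \<dots> \<le> norm (Z\<^sup>\<star> x) + norm (g (v\<^sup>\<star> x))" by (rule norm_triangle_ineq4)
    also have "\<dots> \<le> norm (Z\<^sup>\<star> x) + sqrt d * norm (v\<^sup>\<star> x)"
      by (intro add_left_mono order_trans[OF gn] mult_right_mono rd) simp
    finally show ?thesis by (simp flip: H2)
  qed
  show ?thesis using ZM \<open>Z\<^sup>\<star> o\<^sub>L Z = B\<close> up low by blast
qed

text \<open>At \<sigma> = 0 the two expressions are 0 and b / d, both below 1, and they depend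
  continuously on \<sigma>.\<close>

lemma small_parameter:
  fixes a b d :: real
  assumes "0 \<le> a" "0 \<le> b" "b < d"
  obtains \<sigma> where "0 < \<sigma>" "\<sigma>\<^sup>2 * a \<le> 1" "\<sigma>\<^sup>2 * b + b * (1 + \<sigma> * sqrt a)\<^sup>2 / d \<le> 1"
proof -
  have d: "0 < d" using assms by simp
  have "((\<lambda>\<sigma>. \<sigma>\<^sup>2 * a) \<longlongrightarrow> 0\<^sup>2 * a) (at_right 0)" by (intro tendsto_intros)
  then have 1: "\<forall>\<^sub>F \<sigma> in at_right 0. \<sigma>\<^sup>2 * a < 1" by (rule order_tendstoD) simp
  have "((\<lambda>\<sigma>. \<sigma>\<^sup>2 * b + b * (1 + \<sigma> * sqrt a)\<^sup>2 / d) \<longlongrightarrow> 0\<^sup>2 * b + b * (1 + 0 * sqrt a)\<^sup>2 / d) (at_right 0)"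
    by (intro tendsto_intros) (use d in auto)
  then have 2: "\<forall>\<^sub>F \<sigma> in at_right 0. \<sigma>\<^sup>2 * b + b * (1 + \<sigma> * sqrt a)\<^sup>2 / d < 1"
    by (rule order_tendstoD) (use assms d in simp)
  have 3: "\<forall>\<^sub>F \<sigma> in at_right (0::real). 0 < \<sigma>" by (rule eventually_at_right_less)
  have "\<forall>\<^sub>F \<sigma> in at_right 0. 0 < \<sigma> \<and> \<sigma>\<^sup>2 * a \<le> 1 \<and> \<sigma>\<^sup>2 * b + b * (1 + \<sigma> * sqrt a)\<^sup>2 / d \<le> 1"
    using 1 2 3 by eventually_elim auto
  from eventually_happens'[OF _ this] show thesis using that by auto
qed

context sf_factor
begin

text \<open>Copies of $B$ are peeled off one after the other. The remainders $T_n$ decrease to zero because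
  each copy contains a fixed proportion of the current remainder, while the copies tend to zero.\<close>

lemma exhaust_by_copies:
  assumes A0: "A0 \<in> M" "pos A0" and v: "\<And>k. v k \<in> M" "\<And>k. iso (v k)"
    and bd: "\<And>N x. inner (A0 x) x + d * (\<Sum>j<N. (norm ((v j)\<^sup>\<star> x))\<^sup>2) \<le> a * (norm x)\<^sup>2"
    and B: "B \<in> M" "pos B" "\<And>x. inner (B x) x \<le> b * (norm x)\<^sup>2" "0 \<le> b" "b < d"
    and u: "u \<in> M" "iso u" "\<And>x. \<beta> * (norm x)\<^sup>2 \<le> inner (B (u x)) (u x)" "0 < \<beta>"
  obtains Z where "\<And>n :: nat. Z n \<in> M" "\<And>n. (Z n)\<^sup>\<star> o\<^sub>L Z n = B"
    "\<And>x s. (\<lambda>j. (norm ((v j)\<^sup>\<star> x))\<^sup>2) sums s \<Longrightarrow> (\<lambda>n. (norm ((Z n)\<^sup>\<star> x))\<^sup>2) sums (inner (A0 x) x + d * s)"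
proof -
  \<comment> \<open>\<open>peel_copy\<close> takes the square root of the bound, so a nonnegative
    one is supplied.\<close>
  define c where "c = max a 0"
  have bd': "inner (A0 x) x + d * (\<Sum>j<N. (norm ((v j)\<^sup>\<star> x))\<^sup>2) \<le> c * (norm x)\<^sup>2" for N x
    by (rule order_trans[OF bd]) (simp add: c_def mult_right_mono)
  have c: "0 \<le> c" and d: "0 < d" using B by (auto simp: c_def)
  obtain \<sigma> where \<sigma>: "0 < \<sigma>" "\<sigma>\<^sup>2 * c \<le> 1" "\<sigma>\<^sup>2 * b + b * (1 + \<sigma> * sqrt c)\<^sup>2 / d \<le> 1"
    using small_parameter[OF c B(4,5)] by blast
  \<comment> \<open>P is the invariant of the recursion and Q links consecutive remainders through a
    copy. Comparing the remainder with \<open>A0\<close> plus all the supplied pieces bounds it by c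
    at every step, so one \<sigma>, and hence one proportion, serves throughout.\<close>
  define P where "P n T \<longleftrightarrow> (n = 0 \<longrightarrow> T = A0) \<and> T \<in> M \<and> pos T \<and>
    (\<forall>x. inner (T x) x \<le> inner (A0 x) x + d * (\<Sum>j<n. (norm ((v j)\<^sup>\<star> x))\<^sup>2))" for n :: nat and T
  define Q where "Q n T T' \<longleftrightarrow> (\<exists>Z\<in>M. Z\<^sup>\<star> o\<^sub>L Z = B \<and>
    (\<forall>x. inner (T' x) x = inner (T x) x + d * (norm ((v n)\<^sup>\<star> x))\<^sup>2 - (norm (Z\<^sup>\<star> x))\<^sup>2) \<and>
    (\<forall>x. \<sigma> * sqrt \<beta> * sqrt (inner (T x) x) \<le> norm (Z\<^sup>\<star> x) + sqrt d * norm ((v n)\<^sup>\<star> x)))"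
    for n :: nat and T T' :: "'a \<Rightarrow>\<^sub>L 'a"
  have "\<exists>T. P 0 T" using A0 by (auto simp: P_def)
  moreover have "\<exists>T'. P (Suc n) T' \<and> Q n T T'" if "P n T" for T n
  proof -
    have T: "T \<in> M" "pos T" and Tle: "\<And>x. inner (T x) x \<le> inner (A0 x) x + d * (\<Sum>j<n. (norm ((v j)\<^sup>\<star> x))\<^sup>2)"
      using that unfolding P_def by blast+
    have Tc: "inner (T x) x \<le> c * (norm x)\<^sup>2" for x by (rule order_trans[OF Tle bd'])
    obtain Z where Z: "Z \<in> M" "Z\<^sup>\<star> o\<^sub>L Z = B"
      "\<And>x. (norm (Z\<^sup>\<star> x))\<^sup>2 \<le> inner (T x) x + d * (norm ((v n)\<^sup>\<star> x))\<^sup>2"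
      "\<And>x. \<sigma> * sqrt \<beta> * sqrt (inner (T x) x) \<le> norm (Z\<^sup>\<star> x) + sqrt d * norm ((v n)\<^sup>\<star> x)"
      using peel_copy[OF T Tc c v(1)[of n] v(2)[of n] B(1,2,3,4) u(1,2,3) less_imp_le[OF u(4)] \<sigma>(1,2) d \<sigma>(3)]
      by blast
    define T' where "T' = T + d *\<^sub>R (v n o\<^sub>L (v n)\<^sup>\<star>) - (Z o\<^sub>L Z\<^sup>\<star>)"
    have q: "inner (T' x) x = inner (T x) x + d * (norm ((v n)\<^sup>\<star> x))\<^sup>2 - (norm (Z\<^sup>\<star> x))\<^sup>2" for x
      by (simp add: T'_def blinfun.bilinear_simps inner_simps inner_hadj_right power2_norm_eq_inner inner_hadj_left)
    have "pos T'"
    proof (rule posI)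
      show "T'\<^sup>\<star> = T'" by (simp add: T'_def pos_hadj[OF T(2)])
      show "0 \<le> inner (T' x) x" for x unfolding q using Z(3)[of x] by simp
    qed
    moreover have "T' \<in> M" unfolding T'_def by (intro M_diff M_add M_scaleR M_compose M_hadj T v Z)
    moreover have "inner (T' x) x \<le> inner (A0 x) x + d * (\<Sum>j<Suc n. (norm ((v j)\<^sup>\<star> x))\<^sup>2)" for x
      unfolding q sum.lessThan_Suc distrib_left
      using Tle[of x] zero_le_power2[of "norm (Z\<^sup>\<star> x)"] by linarith
    ultimately have "P (Suc n) T'" unfolding P_def by blast
    moreover have "Q n T T'" unfolding Q_def using Z q by blast
    ultimately show ?thesis by blast
  qed
  ultimately obtain T where T: "\<And>n. P n (T n)" "\<And>n. Q n (T n) (T (Suc n))"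
    using dependent_nat_choice[of P Q] by metis
  from T(2) have "\<forall>n. \<exists>Z. Z\<in>M \<and> Z\<^sup>\<star> o\<^sub>L Z = B \<and>
    (\<forall>x. inner (T (Suc n) x) x = inner (T n x) x + d * (norm ((v n)\<^sup>\<star> x))\<^sup>2 - (norm (Z\<^sup>\<star> x))\<^sup>2) \<and>
    (\<forall>x. \<sigma> * sqrt \<beta> * sqrt (inner (T n x) x) \<le> norm (Z\<^sup>\<star> x) + sqrt d * norm ((v n)\<^sup>\<star> x))"
    unfolding Q_def by blast
  then obtain Z where Z: "\<And>n. Z n \<in> M" "\<And>n. (Z n)\<^sup>\<star> o\<^sub>L Z n = B"
    "\<And>n x. inner (T (Suc n) x) x = inner (T n x) x + d * (norm ((v n)\<^sup>\<star> x))\<^sup>2 - (norm ((Z n)\<^sup>\<star> x))\<^sup>2"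
    "\<And>n x. \<sigma> * sqrt \<beta> * sqrt (inner (T n x) x) \<le> norm ((Z n)\<^sup>\<star> x) + sqrt d * norm ((v n)\<^sup>\<star> x)"
    by metis
  have T0: "T 0 = A0" using T(1)[of 0] by (simp add: P_def)
  have Tpos: "0 \<le> inner (T n x) x" for n x using T(1)[of n] pos_ge0 unfolding P_def by blast
  have tele: "(\<Sum>k<n. (norm ((Z k)\<^sup>\<star> x))\<^sup>2)
      = inner (A0 x) x + d * (\<Sum>k<n. (norm ((v k)\<^sup>\<star> x))\<^sup>2) - inner (T n x) x" for n x
    by (induction n) (simp_all add: T0 Z(3) algebra_simps)
  show thesis
  proof (rule that[OF Z(1,2)])
    fix x s assume s: "(\<lambda>j. (norm ((v j)\<^sup>\<star> x))\<^sup>2) sums s"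
    have "summable (\<lambda>k. (norm ((Z k)\<^sup>\<star> x))\<^sup>2)"
    proof (rule summableI_nonneg_bounded)
      show "(\<Sum>k<n. (norm ((Z k)\<^sup>\<star> x))\<^sup>2) \<le> c * (norm x)\<^sup>2" for n
        unfolding tele using bd'[where N=n and x=x] Tpos[of n x] by simp
    qed simp
    then have "(\<lambda>k. sqrt ((norm ((Z k)\<^sup>\<star> x))\<^sup>2)) \<longlonglongrightarrow> sqrt 0"
      by (intro tendsto_real_sqrt summable_LIMSEQ_zero)
    then have z1: "(\<lambda>k. norm ((Z k)\<^sup>\<star> x)) \<longlonglongrightarrow> 0" by simp
    have "(\<lambda>k. sqrt ((norm ((v k)\<^sup>\<star> x))\<^sup>2)) \<longlonglongrightarrow> sqrt 0"
      by (intro tendsto_real_sqrt summable_LIMSEQ_zero sums_summable[OF s])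
    then have z2: "(\<lambda>k. norm ((v k)\<^sup>\<star> x)) \<longlonglongrightarrow> 0" by simp
    have "(\<lambda>k. (norm ((Z k)\<^sup>\<star> x) + sqrt d * norm ((v k)\<^sup>\<star> x)) / (\<sigma> * sqrt \<beta>)) \<longlonglongrightarrow> (0 + sqrt d * 0) / (\<sigma> * sqrt \<beta>)"
      by (intro tendsto_intros z1 z2) (use \<sigma> u in auto)
    then have lim: "(\<lambda>k. (norm ((Z k)\<^sup>\<star> x) + sqrt d * norm ((v k)\<^sup>\<star> x)) / (\<sigma> * sqrt \<beta>)) \<longlonglongrightarrow> 0" by simp
    have "(\<lambda>k. sqrt (inner (T k x) x)) \<longlonglongrightarrow> 0"
    proof (rule tendsto_sandwich[OF _ _ tendsto_const lim])
      show "\<forall>\<^sub>F k in sequentially. 0 \<le> sqrt (inner (T k x) x)" using Tpos by simp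
      show "\<forall>\<^sub>F k in sequentially. sqrt (inner (T k x) x) \<le> (norm ((Z k)\<^sup>\<star> x) + sqrt d * norm ((v k)\<^sup>\<star> x)) / (\<sigma> * sqrt \<beta>)"
        using Z(4) \<sigma>(1) u(4) by (simp add: pos_le_divide_eq mult.commute)
    qed
    then have "(\<lambda>k. (sqrt (inner (T k x) x))\<^sup>2) \<longlonglongrightarrow> 0\<^sup>2" by (rule tendsto_power)
    then have "(\<lambda>k. inner (T k x) x) \<longlonglongrightarrow> 0" using Tpos by simp
    moreover have "(\<lambda>n. \<Sum>k<n. (norm ((v k)\<^sup>\<star> x))\<^sup>2) \<longlonglongrightarrow> s" using s unfolding sums_def .
    ultimately have "(\<lambda>n. inner (A0 x) x + d * (\<Sum>k<n. (norm ((v k)\<^sup>\<star> x))\<^sup>2) - inner (T n x) x)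
        \<longlonglongrightarrow> inner (A0 x) x + d * s - 0" by (intro tendsto_intros)
    then show "(\<lambda>n. (norm ((Z n)\<^sup>\<star> x))\<^sup>2) sums (inner (A0 x) x + d * s)"
      unfolding sums_def tele by simp
  qed
qed

text \<open>Copies of the infinite multiple B' of B are exhausted, and each is cut along the
  isometries U k into a row of copies of B with orthogonal ranges. Cutting loses nothing: B'
  vanishes off the span V of the ranges of the U k, so the adjoint of each Z n maps into V.\<close>

lemma exhaust_by_multiple_copies:
  assumes A0: "A0 \<in> M" "pos A0" and v: "\<And>k. v k \<in> M" "\<And>k. iso (v k)"
    and bd: "\<And>N x. inner (A0 x) x + d * (\<Sum>j<N. (norm ((v j)\<^sup>\<star> x))\<^sup>2) \<le> a * (norm x)\<^sup>2"
    and B: "B \<in> M" "pos B" "B \<noteq> 0" "\<And>x. inner (B x) x \<le> b * (norm x)\<^sup>2" "0 \<le> b" "b < d"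
  obtains Z :: "nat \<Rightarrow> nat \<Rightarrow> 'a \<Rightarrow>\<^sub>L 'a" where "\<And>j k. Z j k \<in> M"
    "\<And>j k l x y. inner (Z j k x) (Z j l y) = (if k = l then inner (B x) y else 0)"
    "\<And>x s. (\<lambda>j. (norm ((v j)\<^sup>\<star> x))\<^sup>2) sums s \<Longrightarrow>
      ((\<lambda>(j, k). (norm ((Z j k)\<^sup>\<star> x))\<^sup>2) has_sum (inner (A0 x) x + d * s)) UNIV"
proof -
  obtain B' u :: "'a \<Rightarrow>\<^sub>L 'a" and U :: "nat \<Rightarrow> 'a \<Rightarrow>\<^sub>L 'a" and \<beta>
    where B': "B' \<in> M" "pos B'" "\<And>x. inner (B' x) x \<le> b * (norm x)\<^sup>2"
      and U: "\<And>k. U k \<in> M" "\<And>k. iso (U k)" "\<And>k l x y. k \<noteq> l \<Longrightarrow> inner (U k x) (U l y) = 0"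
      and B'U: "\<And>k x. B' (U k x) = U k (B x)" and B'0: "\<And>x. (\<And>k. (U k)\<^sup>\<star> x = 0) \<Longrightarrow> B' x = 0"
      and u: "u \<in> M" "iso u" "0 < \<beta>" "\<And>x. \<beta> * (norm x)\<^sup>2 \<le> inner (B' (u x)) (u x)"
    using amplify[OF B(1-4)] by metis
  obtain Z where Z: "\<And>n :: nat. Z n \<in> M" "\<And>n. (Z n)\<^sup>\<star> o\<^sub>L Z n = B'"
    "\<And>x s. (\<lambda>j. (norm ((v j)\<^sup>\<star> x))\<^sup>2) sums s \<Longrightarrow> (\<lambda>n. (norm ((Z n)\<^sup>\<star> x))\<^sup>2) sums (inner (A0 x) x + d * s)"
    using exhaust_by_copies[OF A0 v bd B' B(5,6) u(1,2,4,3)] by metis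
  have Zi: "inner (Z n x) (Z n y) = inner (B' x) y" for n x y
    using Z(2)[of n] by (metis blinfun_apply_blinfun_compose inner_hadj_left)
  have UU: "(U k)\<^sup>\<star> (U l x) = (if k = l then x else 0)" for k l x
    using iso_hadj_apply[OF U(2)] iso_hadj_orth[of "U k" "U l"] U(3)[of k l] by auto
  have P: "proj (U k o\<^sub>L (U k)\<^sup>\<star>)" for k by (rule iso_range_proj[OF U(2)])
  have Po: "(U m o\<^sub>L (U m)\<^sup>\<star>) ((U n o\<^sub>L (U n)\<^sup>\<star>) x) = 0" if "m \<noteq> n" for m n x
    using that by (simp add: UU)
  define V where "V = osum (\<lambda>k. U k o\<^sub>L (U k)\<^sup>\<star>)"
  have V1: "(U k o\<^sub>L (U k)\<^sup>\<star>) (V x) = (U k o\<^sub>L (U k)\<^sup>\<star>) x" for k x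
    unfolding V_def by (rule osum_proj_apply(1)[OF P]) (rule Po)
  have V2: "proj V" unfolding V_def by (rule osum_proj_apply(2)[OF P]) (rule Po)
  have fam: "orth_family (\<lambda>k. U k o\<^sub>L (U k)\<^sup>\<star>)" by (rule orth_family_proj[OF P]) (rule Po)
  have UV: "(U k)\<^sup>\<star> (V x) = (U k)\<^sup>\<star> x" for k x
    using arg_cong[OF V1[of k x], of "(U k)\<^sup>\<star>"] by (simp add: UU)
  have ZV: "V ((Z n)\<^sup>\<star> x) = (Z n)\<^sup>\<star> x" for n x
  proof -
    define y where "y = (Z n)\<^sup>\<star> x"
    have "B' (y - V y) = 0" by (rule B'0) (simp add: blinfun.diff_right UV)
    then have "inner (Z n (y - V y)) (Z n (y - V y)) = 0" by (simp add: Zi)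
    then have "inner (Z n (y - V y)) x = 0" by simp
    then have "inner (y - V y) y = 0" by (simp add: y_def inner_hadj_right)
    moreover have "inner (y - V y) (V y) = 0"
      by (simp add: inner_diff_left proj_inner[OF V2, of y "V y"] proj_idem[OF V2])
    ultimately have "inner (y - V y) (y - V y) = 0" by (simp add: inner_diff_right)
    then show ?thesis by (simp add: y_def)
  qed
  have sq: "(\<lambda>k. (norm ((U k)\<^sup>\<star> ((Z n)\<^sup>\<star> x)))\<^sup>2) sums (norm ((Z n)\<^sup>\<star> x))\<^sup>2" for n x
    using osum_norm_sq[OF fam, of "(Z n)\<^sup>\<star> x"] U(2) by (simp add: ZV[unfolded V_def] iso_norm)
  show thesis
  proof (rule that[of "\<lambda>j k. Z j o\<^sub>L U k"])
    show "Z j o\<^sub>L U k \<in> M" for j k by (intro M_compose Z U)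
    show "inner ((Z j o\<^sub>L U k) x) ((Z j o\<^sub>L U l) y) = (if k = l then inner (B x) y else 0)" for j k l x y
      using U(3)[of k l] by (auto simp: Zi B'U iso_inner[OF U(2)])
    fix x s assume "(\<lambda>j. (norm ((v j)\<^sup>\<star> x))\<^sup>2) sums s"
    from Z(3)[OF this] show "((\<lambda>(j, k). (norm ((Z j o\<^sub>L U k)\<^sup>\<star> x))\<^sup>2) has_sum (inner (A0 x) x + d * s)) UNIV"
      by (intro nonneg_iterated_has_sum[where g="\<lambda>j. (norm ((Z j)\<^sup>\<star> x))\<^sup>2"]) (simp_all add: sq)
  qed
qed

end

section \<open>Splitting of unconditional sums; spectral blocks of an operator strictly below
  a\<close>

lemma has_sum_bool_split:
  fixes f :: "bool \<times> 'b \<Rightarrow> real"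
  assumes "((\<lambda>y. f (True, y)) has_sum a) UNIV" "((\<lambda>y. f (False, y)) has_sum b) UNIV"
  shows "(f has_sum (a + b)) UNIV"
proof -
  have "(f has_sum a) (range (Pair True))" "(f has_sum b) (range (Pair False))"
    using assms by (subst has_sum_reindex; simp add: inj_on_def o_def)+
  then have "(f has_sum (a + b)) (range (Pair True) \<union> range (Pair False))"
    by (rule has_sum_Un_disjoint) auto
  moreover have "range (Pair True) \<union> range (Pair False) = (UNIV :: (bool \<times> 'b) set)"
    by (auto simp: image_iff)
  ultimately show ?thesis by simp
qed

lemma has_sum_nat_split:
  fixes f :: "nat \<times> nat \<Rightarrow> real"
  assumes "((\<lambda>j. f (j, 0)) has_sum a) UNIV" "((\<lambda>(j, k). f (j, Suc k)) has_sum b) UNIV"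
  shows "(f has_sum (a + b)) UNIV"
proof -
  have "(f has_sum a) (range (\<lambda>j. (j, 0)))"
    using assms(1) by (subst has_sum_reindex) (auto simp: inj_on_def o_def)
  moreover have "(f has_sum b) (range (\<lambda>(j, k). (j, Suc k)))"
    using assms(2) by (subst has_sum_reindex) (auto simp: inj_on_def o_def case_prod_unfold)
  ultimately have "(f has_sum (a + b)) (range (\<lambda>j. (j, 0)) \<union> range (\<lambda>(j, k). (j, Suc k)))"
    by (rule has_sum_Un_disjoint) auto
  moreover have "(j, k) \<in> range (\<lambda>j. (j, 0)) \<union> range (\<lambda>(j, k). (j, Suc k))" for j k :: nat
    by (cases k) auto
  then have "range (\<lambda>j. (j, 0)) \<union> range (\<lambda>(j, k). (j, Suc k)) = (UNIV :: (nat \<times> nat) set)"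
    by auto
  ultimately show ?thesis by simp
qed

lemma summable_reindex_inj:
  fixes f :: "'a \<Rightarrow> real"
  assumes "f summable_on UNIV" "inj h" shows "(\<lambda>x. f (h x)) summable_on UNIV"
  using summable_on_reindex[of h UNIV f] summable_on_subset_banach[OF assms(1), of "range h"] assms(2)
  by (simp add: o_def)

text \<open>The half-line projections for levels increasing to a tend strongly to the identity, so
  dropping finitely many levels makes the lowest part of B nonzero.\<close>

lemma spectral_cuts:
  fixes B :: "'a::{real_inner,banach} \<Rightarrow>\<^sub>L 'a"
  assumes B: "pos B" "B \<noteq> 0" and strict: "\<And>x. x \<noteq> 0 \<Longrightarrow> inner (B x) x < a * (norm x)\<^sup>2"
  obtains l :: "nat \<Rightarrow> real" where "strict_mono l" "l \<longlonglongrightarrow> a" "0 < l 0" "\<And>n. l n < a"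
    "B o\<^sub>L specp B (l 0) \<noteq> 0"
proof -
  note sB = pos_hadj[OF B(1)]
  obtain x0 where x0: "B x0 \<noteq> 0" using B(2) by (metis blinfun_eqI zero_blinfun.rep_eq)
  then have "x0 \<noteq> 0" by auto
  then have "0 < a * (norm x0)\<^sup>2" using strict[of x0] pos_ge0[OF B(1), of x0] by linarith
  then have a: "0 < a" by (simp add: zero_less_mult_iff)
  \<comment> \<open>The denominator starts at 2, so that already the first level a / 2 is
    positive.\<close>
  define l where "l n = a - a / real (Suc (Suc n))" for n
  have mono: "strict_mono l"
    unfolding strict_mono_Suc_iff l_def using a by (auto simp: field_simps)
  have lim: "l \<longlonglongrightarrow> a"
  proof -
    have "(\<lambda>n. a - a / real (Suc (Suc n))) \<longlonglongrightarrow> a - 0"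
      by (intro tendsto_intros LIMSEQ_Suc[OF LIMSEQ_Suc[OF lim_const_over_n]])
    then show ?thesis unfolding l_def by simp
  qed
  have "(\<lambda>n. B (specp B (l n) x0)) \<longlonglongrightarrow> B x0"
    by (intro blinfun_tendsto specp_left_limit[OF sB strict strict_mono_mono[OF mono] lim])
  then have "\<forall>\<^sub>F n in sequentially. B (specp B (l n) x0) \<noteq> 0"
    using x0 by (rule tendsto_imp_eventually_ne)
  then obtain n0 where n0: "B (specp B (l n0) x0) \<noteq> 0" by (auto simp: eventually_sequentially)
  show thesis
  proof (rule that[of "\<lambda>n. l (n + n0)"])
    show "strict_mono (\<lambda>n. l (n + n0))" using mono by (simp add: strict_mono_def)
    show "(\<lambda>n. l (n + n0)) \<longlonglongrightarrow> a" using LIMSEQ_ignore_initial_segment[OF lim] .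
    show "0 < l (0 + n0)" using a by (simp add: l_def field_simps add_pos_nonneg)
    show "l (n + n0) < a" for n using a by (simp add: l_def)
    show "B o\<^sub>L specp B (l (0 + n0)) \<noteq> 0" using n0 by (metis add_0 blinfun_apply_blinfun_compose zero_blinfun.rep_eq)
  qed
qed

context
  fixes B :: "'a::{real_inner,banach} \<Rightarrow>\<^sub>L 'a" and l :: "nat \<Rightarrow> real" and a :: real
  assumes B: "pos B" and strict: "\<And>x. x \<noteq> 0 \<Longrightarrow> inner (B x) x < a * (norm x)\<^sup>2"
    and l: "strict_mono l" "l \<longlonglongrightarrow> a" "0 < l 0"
begin

abbreviation (input) "blk m \<equiv> specp B (l (Suc m)) - specp B (l m)"

lemma l_mono: "m \<le> n \<Longrightarrow> l m \<le> l n" and l_pos: "0 < l n"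
proof -
  show *: "m \<le> n \<Longrightarrow> l m \<le> l n" for m n using strict_mono_mono[OF l(1)] by (auto dest: monoD)
  show "0 < l n" using *[of 0 n] l(3) by simp
qed

lemma sB: "B\<^sup>\<star> = B" by (rule pos_hadj[OF B])

lemma blk_proj: "proj (blk m)"
proof (rule projI)
  show "inner (blk m x) y = inner x (blk m y)" for x y
    by (simp add: blinfun.diff_left inner_diff_left inner_diff_right proj_inner[OF specp_proj[OF sB]])
  show "blk m (blk m x) = blk m x" for x
    by (simp add: blinfun.bilinear_simps proj_idem[OF specp_proj[OF sB]] specp_mono[OF sB l_mono] specp_mono'[OF sB l_mono])
qed

lemma blk_orth:
  assumes "m \<noteq> n" shows "blk m (blk n x) = 0"
proof -
  have "blk m (blk n x) = 0" if "m < n" for m n x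
    using that by (simp add: blinfun.bilinear_simps specp_mono'[OF sB l_mono])
  moreover have "blk m (blk n x) = 0" if "n < m" for m n x
    using that by (simp add: blinfun.bilinear_simps specp_mono[OF sB l_mono])
  ultimately show ?thesis using assms by (meson nat_neq_iff)
qed

lemma blk_bessel: "(\<Sum>m<N. (norm (blk m x))\<^sup>2) \<le> (norm x)\<^sup>2"
  by (rule proj_bessel[of "{..<N}" "\<lambda>m. blk m", OF finite_lessThan blk_proj]) (rule blk_orth)

lemma blk_commute: "B (blk m x) = blk m (B x)"
  by (simp add: blinfun.bilinear_simps specp_commute_self[OF sB])

lemma psqrt_blk_norm_sq: "(norm (psqrt B (blk m x)))\<^sup>2 = inner (B (specp B (l (Suc m)) x)) x - inner (B (specp B (l m) x)) x"
proof -
  have "(norm (psqrt B (blk m x)))\<^sup>2 = inner (B (blk m x)) (blk m x)" by (rule psqrt_norm_sq[OF B])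
  also have "\<dots> = inner (blk m (B (blk m x))) x" by (simp only: proj_inner[OF blk_proj])
  also have "blk m (B (blk m x)) = B (blk m x)" by (simp only: blk_commute[symmetric] proj_idem[OF blk_proj])
  finally show ?thesis by (simp add: blinfun.bilinear_simps inner_diff_left)
qed

lemma psqrt_blk_norm_le: "(norm (psqrt B (blk m x)))\<^sup>2 \<le> l (Suc m) * (norm (blk m x))\<^sup>2"
  unfolding psqrt_norm_sq[OF B]
  by (rule specp_upper[OF sB])
    (simp add: blinfun.bilinear_simps proj_idem[OF specp_proj[OF sB]] specp_mono[OF sB l_mono])

lemma psqrt_blk_sums: "(\<lambda>m. (norm (psqrt B (blk m x)))\<^sup>2) sums (inner (B x) x - inner (B (specp B (l 0) x)) x)"
  unfolding psqrt_blk_norm_sq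
  by (rule telescope_sums)
    (intro tendsto_intros blinfun_tendsto specp_left_limit[OF sB strict strict_mono_mono[OF l(1)] l(2)])

text \<open>h m receives the block of \<open>psqrt B\<close> with spectrum between l m and l (m+1).
  The last claim bounds the range side of the sum. It tests at y =
  \<open>(osum X)\<^sup>\<star> x\<close>: in each block the arithmetic-geometric inequality with
  weight l (m+1) splits the inner product, the y-terms add up to at most half of the squared norm of
  y, and this half is absorbed on the left.\<close>

lemma high_part:
  fixes h :: "nat \<Rightarrow> 'a \<Rightarrow>\<^sub>L 'a"
  assumes h: "\<And>m. iso (h m)" "\<And>m n x y. m \<noteq> n \<Longrightarrow> inner (h m x) (h n y) = 0"
  defines "X \<equiv> \<lambda>m. h m o\<^sub>L psqrt B o\<^sub>L blk m"
  shows "orth_family X"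
    and "(norm (osum X x))\<^sup>2 = inner (B x) x - inner (B (specp B (l 0) x)) x"
    and "(\<lambda>m. l (Suc m) * (norm ((h m)\<^sup>\<star> x))\<^sup>2) sums s \<Longrightarrow> (norm ((osum X)\<^sup>\<star> x))\<^sup>2 \<le> s"
proof -
  have Xn: "norm (X m x) = norm (psqrt B (blk m x))" for m x using h(1) by (simp add: X_def iso_norm)
  show fam: "orth_family X"
    unfolding orth_family_def
  proof (intro conjI allI impI exI[of _ "norm B"])
    show "inner (X m x) (X n y) = 0" if "m \<noteq> n" for m n x y using h(2)[OF that] by (simp add: X_def)
    fix N x
    have "(\<Sum>m<N. (norm (X m x))\<^sup>2) \<le> (\<Sum>m<N. norm B * (norm (blk m x))\<^sup>2)"
      unfolding Xn psqrt_norm_sq[OF B] by (intro sum_mono inner_le_norm)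
    also have "\<dots> \<le> norm B * (norm x)\<^sup>2"
      unfolding sum_distrib_left[symmetric] by (intro mult_left_mono blk_bessel norm_ge_zero)
    finally show "(\<Sum>m<N. (norm (X m x))\<^sup>2) \<le> norm B * (norm x)\<^sup>2" .
  qed
  show "(norm (osum X x))\<^sup>2 = inner (B x) x - inner (B (specp B (l 0) x)) x"
    using osum_norm_sq[OF fam, of x] psqrt_blk_sums[of x] sums_unique2 unfolding Xn by blast
  assume s: "(\<lambda>m. l (Suc m) * (norm ((h m)\<^sup>\<star> x))\<^sup>2) sums s"
  define y where "y = (osum X)\<^sup>\<star> x"
  have sm: "summable (\<lambda>m. (norm (blk m y))\<^sup>2)" by (rule summableI_nonneg_bounded[OF _ blk_bessel]) simp
  have s1: "(\<lambda>m. inner x (X m y)) sums inner x (osum X y)" by (rule osum_inner_sums[OF fam])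
  have s2: "(\<lambda>m. (l (Suc m) * (norm ((h m)\<^sup>\<star> x))\<^sup>2 + (norm (blk m y))\<^sup>2) / 2) sums ((s + (\<Sum>m. (norm (blk m y))\<^sup>2)) / 2)"
    by (intro sums_divide sums_add s summable_sums sm)
  have le: "inner x (X m y) \<le> (l (Suc m) * (norm ((h m)\<^sup>\<star> x))\<^sup>2 + (norm (blk m y))\<^sup>2) / 2" for m
  proof -
    let ?L = "l (Suc m)" and ?p = "norm ((h m)\<^sup>\<star> x)" and ?r = "norm (psqrt B (blk m y))"
    have L: "0 < ?L" by (rule l_pos)
    have "inner x (X m y) = inner ((h m)\<^sup>\<star> x) (psqrt B (blk m y))" by (simp add: X_def inner_hadj_left)
    also have "\<dots> \<le> ?p * ?r" by (rule norm_cauchy_schwarz)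
    also have "\<dots> \<le> (?L * ?p\<^sup>2 + ?r\<^sup>2 / ?L) / 2"
    proof -
      have "0 \<le> (?L * ?p - ?r)\<^sup>2 / ?L" using L by simp
      also have "\<dots> = ?L * ?p\<^sup>2 + ?r\<^sup>2 / ?L - 2 * (?p * ?r)" using L by (simp add: field_simps power2_eq_square)
      finally show ?thesis by simp
    qed
    also have "?r\<^sup>2 / ?L \<le> (norm (blk m y))\<^sup>2"
      using psqrt_blk_norm_le[of m y] L by (simp add: pos_divide_le_eq mult.commute)
    finally show ?thesis by simp
  qed
  have "inner x (osum X y) \<le> (s + (\<Sum>m. (norm (blk m y))\<^sup>2)) / 2" by (rule sums_le[OF le s1 s2])
  moreover have "inner x (osum X y) = (norm y)\<^sup>2" by (simp add: y_def power2_norm_eq_inner inner_hadj_left)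
  moreover have "(\<Sum>m. (norm (blk m y))\<^sup>2) \<le> (norm y)\<^sup>2" by (rule suminf_le_const[OF sm blk_bessel])
  ultimately show "(norm ((osum X)\<^sup>\<star> x))\<^sup>2 \<le> s" by (simp add: y_def)
qed

end

section \<open>Orthogonal isometries on which A nearly attains its bound, and the case of B strictly
  below it\<close>

context vn
begin

text \<open>The quantitative form in which the hypothesis on the essential norm enters the construction; the
  errors \<open>\<epsilon> i\<close> can be prescribed in advance and differ from index to index.\<close>

definition room :: "('a \<Rightarrow>\<^sub>L 'a) \<Rightarrow> real \<Rightarrow> bool" where
  "room A a \<longleftrightarrow> (\<forall>\<epsilon> :: nat \<Rightarrow> real. (\<forall>i. 0 < \<epsilon> i) \<longrightarrow> (\<exists>v :: nat \<Rightarrow> 'a \<Rightarrow>\<^sub>L 'a.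
     (\<forall>i. v i \<in> M \<and> iso (v i)) \<and>
     (\<forall>i j x y. i \<noteq> j \<longrightarrow> inner (v i x) (v j y) = 0 \<and> inner (A (v i x)) (v j y) = 0) \<and>
     (\<forall>N x. (\<Sum>i<N. (a - \<epsilon> i) * (norm ((v i)\<^sup>\<star> x))\<^sup>2) \<le> inner (A x) x)))"

text \<open>Transport to an arbitrary countably infinite index set. Errors of at most a make all
  coefficients nonnegative, so a sum over a finite set of indices is dominated by one over an
  initial segment.\<close>

lemma roomE:
  assumes "room A a" "\<And>i :: 'i. 0 < \<epsilon> i \<and> \<epsilon> i \<le> a" and "infinite (UNIV :: 'i set)" "countable (UNIV :: 'i set)"
  obtains v :: "'i \<Rightarrow> 'a \<Rightarrow>\<^sub>L 'a" where "\<And>i. v i \<in> M" "\<And>i. iso (v i)"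
    "\<And>i j x y. i \<noteq> j \<Longrightarrow> inner (v i x) (v j y) = 0" "\<And>i j x y. i \<noteq> j \<Longrightarrow> inner (A (v i x)) (v j y) = 0"
    "\<And>I x. finite I \<Longrightarrow> (\<Sum>i\<in>I. (a - \<epsilon> i) * (norm ((v i)\<^sup>\<star> x))\<^sup>2) \<le> inner (A x) x"
proof -
  obtain e :: "'i \<Rightarrow> nat" where e: "bij e" using countableE_infinite[OF assms(4,3)] by blast
  then have inj: "inj e" by (rule bij_is_inj)
  have "\<exists>v :: nat \<Rightarrow> 'a \<Rightarrow>\<^sub>L 'a. (\<forall>i. v i \<in> M \<and> iso (v i)) \<and>
     (\<forall>i j x y. i \<noteq> j \<longrightarrow> inner (v i x) (v j y) = 0 \<and> inner (A (v i x)) (v j y) = 0) \<and>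
     (\<forall>N x. (\<Sum>i<N. (a - \<epsilon> (inv e i)) * (norm ((v i)\<^sup>\<star> x))\<^sup>2) \<le> inner (A x) x)"
    using assms(1)[unfolded room_def, rule_format, of "\<lambda>n. \<epsilon> (inv e n)"] assms(2) by blast
  then obtain v :: "nat \<Rightarrow> 'a \<Rightarrow>\<^sub>L 'a" where vv: "\<forall>i. v i \<in> M \<and> iso (v i)"
     "\<forall>i j x y. i \<noteq> j \<longrightarrow> inner (v i x) (v j y) = 0 \<and> inner (A (v i x)) (v j y) = 0"
     "\<forall>N x. (\<Sum>i<N. (a - \<epsilon> (inv e i)) * (norm ((v i)\<^sup>\<star> x))\<^sup>2) \<le> inner (A x) x"
    by (elim exE conjE) (rule that; assumption)
  have v: "v i \<in> M" "iso (v i)" for i using vv(1) by simp_all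
  show thesis
  proof (rule that[of "\<lambda>i. v (e i)"])
    show "v (e i) \<in> M" "iso (v (e i))" for i by (rule v)+
    show "inner (v (e i) x) (v (e j) y) = 0" "inner (A (v (e i) x)) (v (e j) y) = 0" if "i \<noteq> j" for i j x y
      using vv(2) inj_eq[OF inj, of i j] that by simp_all
    fix I :: "'i set" and x assume I: "finite I"
    then obtain N where N: "e ` I \<subseteq> {..<N}" using finite_nat_bounded[of "e ` I"] by blast
    have "(\<Sum>i\<in>I. (a - \<epsilon> i) * (norm ((v (e i))\<^sup>\<star> x))\<^sup>2) = (\<Sum>n\<in>e ` I. (a - \<epsilon> (inv e n)) * (norm ((v n)\<^sup>\<star> x))\<^sup>2)"
      by (subst sum.reindex) (auto intro: inj_on_subset[OF inj] simp: inv_f_f[OF inj])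
    also have "\<dots> \<le> (\<Sum>n<N. (a - \<epsilon> (inv e n)) * (norm ((v n)\<^sup>\<star> x))\<^sup>2)"
      by (rule sum_mono2[OF finite_lessThan N]) (use assms(2) in auto)
    also have "\<dots> \<le> inner (A x) x" using vv(3) by simp
    finally show "(\<Sum>i\<in>I. (a - \<epsilon> i) * (norm ((v (e i))\<^sup>\<star> x))\<^sup>2) \<le> inner (A x) x" .
  qed
qed

end

context sf_factor
begin

text \<open>The copies of the high parts of \<open>B\<close> and the isometries reserved for its low part are split into two
  classes. The remainder of \<open>A\<close> is divided between the classes so that the share of a class is orthogonal to the
  high copies of the other one; the low copies exhausting that share can then be added to those high copies.\<close>

lemma sum_of_copies_strict:
  assumes A: "A \<in> M" "pos A" "\<And>x. inner (A x) x \<le> a * (norm x)\<^sup>2" and room: "room A a"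
    and B: "B \<in> M" "pos B" "B \<noteq> 0" and strict: "\<And>x. x \<noteq> 0 \<Longrightarrow> inner (B x) x < a * (norm x)\<^sup>2"
  obtains X :: "nat \<Rightarrow> nat \<Rightarrow> 'a \<Rightarrow>\<^sub>L 'a" where "\<And>j k. X j k \<in> M"
    "\<And>j k l x y. inner (X j k x) (X j l y) = (if k = l then inner (B x) y else 0)"
    "\<And>x. ((\<lambda>(j, k). (norm ((X j k)\<^sup>\<star> x))\<^sup>2) has_sum inner (A x) x) UNIV"
proof -
  obtain l :: "nat \<Rightarrow> real" where l: "strict_mono l" "l \<longlonglongrightarrow> a" "0 < l 0" "\<And>n. l n < a"
    "B o\<^sub>L specp B (l 0) \<noteq> 0"
    using spectral_cuts[OF B(2,3) strict] by blast
  note sB = pos_hadj[OF B(2)]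
  have lpos: "0 < l n" for n by (rule l_pos[OF B(2) strict l(1,2,3)])
  \<comment> \<open>The low part of B is bounded by l 0, while the isometries reserved for it carry
    the weight l 1; the gap is the condition b < d of the exhaustion.\<close>
  define d where "d = l 1"
  have d: "0 < d" "l 0 < d" using lpos l(1) by (auto simp: d_def strict_mono_def)
  define E where "E = specp B (l 0)"
  have E: "E \<in> M" "proj E" unfolding E_def by (intro M_specp B sB specp_proj[OF sB])+
  have EB: "B (E x) = E (B x)" for x unfolding E_def by (rule specp_commute_self[OF sB])
  define B0 where "B0 = B o\<^sub>L E"
  have B0q: "inner (B0 x) y = inner (B (E x)) (E y)" for x y
    unfolding B0_def blinfun_apply_blinfun_compose
    by (metis EB proj_inner[OF E(2)] proj_idem[OF E(2)])
  have B0: "B0 \<in> M" "B0 \<noteq> 0" unfolding B0_def using B E l(5) E_def by auto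
  have "pos B0"
  proof (rule posI)
    show "B0\<^sup>\<star> = B0"
      by (rule hadj_eqI) (metis B0q selfadj_inner[OF sB] inner_commute)
    show "0 \<le> inner (B0 x) x" for x unfolding B0q by (rule pos_ge0[OF B(2)])
  qed
  have B0b: "inner (B0 x) x \<le> l 0 * (norm x)\<^sup>2" for x
  proof -
    have "inner (B0 x) x \<le> l 0 * (norm (E x))\<^sup>2"
      unfolding B0q by (rule specp_upper[OF sB]) (simp add: E_def[symmetric] proj_idem[OF E(2)])
    also have "\<dots> \<le> l 0 * (norm x)\<^sup>2"
      using lpos[of 0] proj_norm_le[OF E(2), of x] by (intro mult_left_mono power_mono) auto
    finally show ?thesis .
  qed

  have inf4: "infinite (UNIV :: ((bool \<times> nat \<times> nat) \<times> nat) set)" and inf3: "infinite (UNIV :: (bool \<times> nat \<times> nat) set)"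
    by (simp_all add: finite_prod)
  \<comment> \<open>The first component of an index names a member of the family (class, row,
    position), the second a spectral block m. The error is chosen so that the weight left on the
    isometry is exactly l (m+1).\<close>
  have eps: "0 < a - l (Suc (snd i)) \<and> a - l (Suc (snd i)) \<le> a" for i :: "(bool \<times> nat \<times> nat) \<times> nat"
    using l(4) less_imp_le[OF lpos] by simp
  obtain v' :: "(bool \<times> nat \<times> nat) \<times> nat \<Rightarrow> 'a \<Rightarrow>\<^sub>L 'a" where v': "\<And>i. v' i \<in> M" "\<And>i. iso (v' i)"
    "\<And>i j x y. i \<noteq> j \<Longrightarrow> inner (v' i x) (v' j y) = 0" "\<And>i j x y. i \<noteq> j \<Longrightarrow> inner (A (v' i x)) (v' j y) = 0"
    "\<And>I x. finite I \<Longrightarrow> (\<Sum>i\<in>I. (a - (a - l (Suc (snd i)))) * (norm ((v' i)\<^sup>\<star> x))\<^sup>2) \<le> inner (A x) x"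
    by (rule roomE[OF room eps inf4 countableI_type]) (rule that; assumption)
  define v where "v i m = v' (i, m)" for i m
  have v: "v i m \<in> M" "iso (v i m)" for i m unfolding v_def by (rule v')+
  have vo: "inner (v i m x) (v j n y) = 0" "inner (A (v i m x)) (v j n y) = 0" if "(i, m) \<noteq> (j, n)" for i m j n x y
    unfolding v_def by (rule v'(3,4)[OF that])+
  have vsum: "(\<Sum>i\<in>I. \<Sum>m<N. l (Suc m) * (norm ((v i m)\<^sup>\<star> x))\<^sup>2) \<le> inner (A x) x" if "finite I" for I N x
    using v'(5)[of "I \<times> {..<N}" x] that by (simp add: sum.cartesian_product v_def case_prod_beta)

  define Z1 where "Z1 i = osum (\<lambda>m. v i m o\<^sub>L psqrt B o\<^sub>L (specp B (l (Suc m)) - specp B (l m)))" for i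
  have ho: "inner (v i m x) (v i n y) = 0" if "m \<noteq> n" for i m n x y
    using vo(1)[of i m i n] that by simp
  have Z1fam: "orth_family (\<lambda>m. v i m o\<^sub>L psqrt B o\<^sub>L (specp B (l (Suc m)) - specp B (l m)))" for i
    by (rule high_part(1)[OF B(2) _ l(1,2,3) v(2)]; (rule strict | rule ho); assumption)
  have Z1q': "(norm (Z1 i x))\<^sup>2 = inner (B x) x - inner (B (specp B (l 0) x)) x" for i x
    unfolding Z1_def
    by (rule high_part(2)[OF B(2) _ l(1,2,3) v(2)]; (rule strict | rule ho); assumption)
  have Z1q: "(norm (Z1 i x))\<^sup>2 = inner (B x) x - inner (B0 x) x" for i x
    unfolding Z1q' by (simp add: B0_def E_def)
  have Z1a: "(norm ((Z1 i)\<^sup>\<star> x))\<^sup>2 \<le> s" if "(\<lambda>m. l (Suc m) * (norm ((v i m)\<^sup>\<star> x))\<^sup>2) sums s" for i x s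
    unfolding Z1_def
    by (rule high_part(3)[OF B(2) _ l(1,2,3) v(2) _ that]; (rule strict | rule ho); assumption)
  have Z1M: "Z1 i \<in> M" for i
    unfolding Z1_def by (intro M_osum Z1fam M_compose v M_psqrt B M_diff M_specp sB)
  have Z1s: "(\<lambda>m. v i m (psqrt B ((specp B (l (Suc m)) - specp B (l m)) x))) sums Z1 i x" for i x
    using osum_sums[OF Z1fam, of i x] by (simp add: Z1_def)
  have Z1v: "inner (Z1 i x) (v j n y) = 0" "inner (A (Z1 i x)) (v j n y) = 0" if "i \<noteq> j" for i j n x y
  proof -
    have "inner (v j n y) (Z1 i x) = 0" by (rule orth_seq_inner[OF Z1s]) (rule vo, use that in auto)
    then show "inner (Z1 i x) (v j n y) = 0" by (simp add: inner_commute)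
    have "inner (A (v j n y)) (Z1 i x) = 0" by (rule orth_seq_inner[OF Z1s]) (rule vo, use that in auto)
    then show "inner (A (Z1 i x)) (v j n y) = 0"
      using selfadj_inner[OF pos_hadj[OF A(2)], of "Z1 i x" "v j n y"] inner_commute[of "Z1 i x" "A (v j n y)"] by simp
  qed
  have Z1o: "inner (Z1 i x) (Z1 j y) = 0" "inner (A (Z1 i x)) (Z1 j y) = 0" if "i \<noteq> j" for i j x y
    by (rule orth_seq_inner[OF Z1s], rule Z1v[OF that])+
  have Z1i: "inner (Z1 i x) (Z1 i y) = inner (B x) y - inner (B0 x) y" for i x y
  proof -
    have "(Z1 i)\<^sup>\<star> o\<^sub>L Z1 i = B - B0"
      by (subst hadj_compose_eq_iff) (simp_all add: sB pos_hadj[OF \<open>pos B0\<close>] Z1q blinfun.diff_left inner_diff_left)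
    then have "(Z1 i)\<^sup>\<star> (Z1 i x) = B x - B0 x" by (metis blinfun_apply_blinfun_compose blinfun.diff_left)
    then show ?thesis by (metis inner_hadj_left inner_diff_left)
  qed

  text \<open>For each class \<open>c\<close> the family consists of isometries \<open>(c, j, 0)\<close>, reserved for the low part
    of \<open>B\<close>, and of copies \<open>(c, j, Suc k)\<close> of the high part.\<close>
  define F where "F i = (if snd (snd i) = 0 then sqrt d *\<^sub>R v i 0 else Z1 i)" for i :: "bool \<times> nat \<times> nat"
  have FM: "F i \<in> M" for i unfolding F_def by (simp add: M_scaleR v Z1M)
  have Fo: "inner (F i x) (F j y) = 0" and FAo: "inner (A (F i x)) (F j y) = 0" if "i \<noteq> j" for i j x y
    unfolding F_def using that vo[of i 0 j 0] Z1v[OF that] Z1o[OF that] Z1v[OF that[symmetric]]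
    by (auto simp: blinfun.bilinear_simps inner_commute[of "v i 0 _"]
        selfadj_inner[OF pos_hadj[OF A(2)], of "v i 0 _"])
  have Fle: "(norm ((F i)\<^sup>\<star> x))\<^sup>2 \<le> s" if s: "(\<lambda>m. l (Suc m) * (norm ((v i m)\<^sup>\<star> x))\<^sup>2) sums s" for i x s
  proof (cases "snd (snd i) = 0")
    case True
    have "(\<Sum>m<1. l (Suc m) * (norm ((v i m)\<^sup>\<star> x))\<^sup>2) \<le> s"
      by (rule sums_finite_nonneg_le[OF s]) (simp add: less_imp_le[OF lpos])
    then show ?thesis using True d by (simp add: F_def d_def blinfun.scaleR_left power_mult_distrib)
  qed (use Z1a[OF s] in \<open>simp add: F_def\<close>)
  have Fsum: "(\<Sum>i\<in>I. (norm ((F i)\<^sup>\<star> x))\<^sup>2) \<le> inner (A x) x" if "finite I" for I x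
  proof -
    have sm: "(\<lambda>m. l (Suc m) * (norm ((v i m)\<^sup>\<star> x))\<^sup>2) sums (\<Sum>m. l (Suc m) * (norm ((v i m)\<^sup>\<star> x))\<^sup>2)" for i
    proof (rule summable_sums, rule summableI_nonneg_bounded)
      show "(\<Sum>m<N. l (Suc m) * (norm ((v i m)\<^sup>\<star> x))\<^sup>2) \<le> inner (A x) x" for N
        using vsum[where I="{i}" and N=N and x=x] by simp
    qed (simp add: less_imp_le[OF lpos])
    have "(\<Sum>i\<in>I. (norm ((F i)\<^sup>\<star> x))\<^sup>2) \<le> (\<Sum>i\<in>I. \<Sum>m. l (Suc m) * (norm ((v i m)\<^sup>\<star> x))\<^sup>2)"
      by (intro sum_mono Fle sm)
    also have "\<dots> \<le> inner (A x) x"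
    proof (rule LIMSEQ_le_const2)
      show "(\<lambda>N. \<Sum>i\<in>I. \<Sum>m<N. l (Suc m) * (norm ((v i m)\<^sup>\<star> x))\<^sup>2) \<longlonglongrightarrow>
          (\<Sum>i\<in>I. \<Sum>m. l (Suc m) * (norm ((v i m)\<^sup>\<star> x))\<^sup>2)"
        using sm unfolding sums_def by (intro tendsto_sum)
    qed (use vsum[OF that] in auto)
    finally show ?thesis .
  qed

  obtain e :: "bool \<times> nat \<times> nat \<Rightarrow> nat" where e: "bij e" using countableE_infinite[OF _ inf3] by auto
  define \<psi> where "\<psi> = inv e"
  have \<psi>: "bij \<psi>" unfolding \<psi>_def by (rule bij_imp_bij_inv[OF e])
  define G where "G n = F (\<psi> n) o\<^sub>L (F (\<psi> n))\<^sup>\<star>" for n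
  have Gq: "inner x (G n y) = inner ((F (\<psi> n))\<^sup>\<star> x) ((F (\<psi> n))\<^sup>\<star> y)" for n x y
    by (simp add: G_def inner_hadj_left)
  have Gfam: "orth_family G"
    unfolding orth_family_def
  proof (intro conjI allI impI exI[of _ "a * a"])
    show "inner (G m x) (G n y) = 0" if "m \<noteq> n" for m n x y
      using that bij_is_inj[OF \<psi>] by (simp add: G_def Fo inj_eq)
    fix N x
    have Fn: "(norm (F i y))\<^sup>2 \<le> a * (norm y)\<^sup>2" for i y
    proof (cases "snd (snd i) = 0")
      case True
      have "(norm (F i y))\<^sup>2 = d * (norm y)\<^sup>2"
        using True d v(2) by (simp add: F_def blinfun.scaleR_left power_mult_distrib iso_norm)
      also have "\<dots> \<le> a * (norm y)\<^sup>2" using l(4)[of 1] by (intro mult_right_mono) (auto simp: d_def)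
      finally show ?thesis .
    next
      case False
      have "(norm (F i y))\<^sup>2 \<le> inner (B y) y" using False Z1q pos_ge0[OF \<open>pos B0\<close>, of y] by (simp add: F_def)
      also have "\<dots> \<le> a * (norm y)\<^sup>2" using strict[of y] by (cases "y = 0") auto
      finally show ?thesis .
    qed
    have "(\<Sum>n<N. (norm (G n x))\<^sup>2) \<le> (\<Sum>n<N. a * (norm ((F (\<psi> n))\<^sup>\<star> x))\<^sup>2)"
      by (intro sum_mono) (simp add: G_def Fn)
    also have "\<dots> = a * (\<Sum>i\<in>\<psi> ` {..<N}. (norm ((F i)\<^sup>\<star> x))\<^sup>2)"
      by (subst sum.reindex) (auto intro: inj_on_subset[OF bij_is_inj[OF \<psi>]] simp: sum_distrib_left)
    also have "\<dots> \<le> a * (a * (norm x)\<^sup>2)"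
      using lpos[of 0] l(4)[of 0] by (intro mult_left_mono order_trans[OF Fsum A(3)]) auto
    finally show "(\<Sum>n<N. (norm (G n x))\<^sup>2) \<le> a * a * (norm x)\<^sup>2" by simp
  qed
  \<comment> \<open>The part of A that is already assigned: the high copies, and the weight d on the
    reserved isometries.\<close>
  define W where "W = osum G"
  have Wi: "(\<lambda>n. inner ((F (\<psi> n))\<^sup>\<star> x) ((F (\<psi> n))\<^sup>\<star> y)) sums inner x (W y)" for x y
    using osum_inner_sums[OF Gfam, of x y] by (simp add: W_def Gq)
  have WM: "W \<in> M" unfolding W_def by (intro M_osum Gfam, unfold G_def, intro M_compose M_hadj FM)
  have Wa: "W\<^sup>\<star> = W"
  proof (rule hadj_eqI)
    fix x y
    have "inner y (W x) = inner x (W y)"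
      using Wi[of y x] Wi[of x y] sums_unique2 by (simp add: inner_commute)
    then show "inner (W x) y = inner x (W y)" by (simp add: inner_commute)
  qed
  have Whs: "((\<lambda>i. (norm ((F i)\<^sup>\<star> x))\<^sup>2) has_sum inner (W x) x) UNIV" for x
  proof -
    have "(\<lambda>n. (norm ((F (\<psi> n))\<^sup>\<star> x))\<^sup>2) sums inner (W x) x"
      using Wi[of x x] by (simp add: power2_norm_eq_inner inner_commute)
    then have "((\<lambda>n. (norm ((F (\<psi> n))\<^sup>\<star> x))\<^sup>2) has_sum inner (W x) x) UNIV"
      by (rule sums_nonneg_imp_has_sum) simp
    then show ?thesis using has_sum_reindex_bij_betw[OF \<psi>, of "\<lambda>i. (norm ((F i)\<^sup>\<star> x))\<^sup>2"] by simp
  qed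
  have WFo: "inner (W (F i x)) (F j y) = 0" if "i \<noteq> j" for i j x y
  proof -
    have "inner ((F (\<psi> n))\<^sup>\<star> (F i x)) ((F (\<psi> n))\<^sup>\<star> (F j y)) = 0" for n
      using that iso_hadj_orth[of "F (\<psi> n)" "F i"] iso_hadj_orth[of "F (\<psi> n)" "F j"] Fo
      by (cases "\<psi> n = i") auto
    then have "inner (F i x) (W (F j y)) = 0" using Wi[of "F i x" "F j y"] sums_unique2[OF _ sums_zero] by simp
    then show ?thesis using selfadj_inner[OF Wa] by simp
  qed
  define Y where "Y = A - W"
  have YM: "Y \<in> M" unfolding Y_def by (intro M_diff A WM)
  have "pos Y"
  proof (rule posI)
    show "Y\<^sup>\<star> = Y" by (simp add: Y_def Wa pos_hadj[OF A(2)])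
    fix x
    have "inner (W x) x \<le> inner (A x) x"
      by (rule has_sum_le_finite_sums[OF Whs]) (use Fsum in auto)
    then show "0 \<le> inner (Y x) x" by (simp add: Y_def blinfun.diff_left inner_diff_left)
  qed
  \<comment> \<open>Here the orthogonality of the images under A enters. The form of the remainder Y
    couples no two members of the family, so its square root H sends their ranges to orthogonal
    sets, and Y can be divided between the classes by a projection.\<close>
  have YFo: "inner (Y (F i x)) (F j y) = 0" if "i \<noteq> j" for i j x y
    unfolding Y_def blinfun.diff_left inner_diff_left FAo[OF that] WFo[OF that] by simp

  define H where "H = psqrt Y"
  have HM: "H \<in> M" unfolding H_def by (intro M_psqrt \<open>pos Y\<close> YM)
  have Hi: "inner (H x) y = inner x (H y)" and HH: "H (H x) = Y x" for x y
    unfolding H_def by (rule psqrt_inner[OF \<open>pos Y\<close>], rule psqrt_apply[OF \<open>pos Y\<close>])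
  \<comment> \<open>The orthogonal complement of the images under H of the high copies of class
    \<open>True\<close>. The images of the high copies of class \<open>False\<close> lie in V, so
    \<open>Yc True\<close> vanishes on the latter copies and \<open>Yc False\<close> on the
    former.\<close>
  define V where "V = (\<Inter>jk. {x. ((F (True, fst jk, Suc (snd jk)))\<^sup>\<star> o\<^sub>L H) x = 0})"
  have V: "subspace V" "closed V"
    unfolding V_def by (auto simp del: blinfun_apply_blinfun_compose intro!: subspace_Inter subspace_ker closed_ker closed_INT)
  have Vmem: "x \<in> V \<longleftrightarrow> (\<forall>j k. (F (True, j, Suc k))\<^sup>\<star> (H x) = 0)" for x by (auto simp: V_def)
  have sM: "hproj V \<in> M"
  proof (rule M_hproj[OF V])
    fix C x assume C: "C \<in> S" "x \<in> V"
    have "(F (True, j, Suc k))\<^sup>\<star> (H (C x)) = C ((F (True, j, Suc k))\<^sup>\<star> (H x))" for j k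
      by (simp add: M_apply[OF HM C(1)] M_apply[OF M_hadj[OF FM] C(1)])
    then show "C x \<in> V" using C(2) by (simp add: Vmem)
  qed
  define s where "s c = (if c then id_blinfun - hproj V else hproj V)" for c
  have s: "s c \<in> M" "proj (s c)" for c
    unfolding s_def using sM proj_hproj[OF V] by (auto intro: proj_compl)
  define Yc where "Yc c = H o\<^sub>L s c o\<^sub>L H" for c
  have Ycq: "inner (Yc c x) x = (norm (s c (H x)))\<^sup>2" for c x
    unfolding Yc_def proj_norm_sq[OF s(2)] by (simp add: Hi)
  have YcM: "Yc c \<in> M" for c unfolding Yc_def by (intro M_compose HM s)
  have Ycpos: "pos (Yc c)" for c
  proof (rule posI)
    show "(Yc c)\<^sup>\<star> = Yc c"
      by (rule hadj_eqI) (simp add: Yc_def Hi proj_inner[OF s(2)])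
    show "0 \<le> inner (Yc c x) x" for x unfolding Ycq by simp
  qed
  have Ycadd: "inner (Yc True x) x + inner (Yc False x) x = inner (Y x) x" for x
    by (simp add: Yc_def s_def blinfun.bilinear_simps inner_diff_left HH)
  have Yckill: "inner (Yc c (Z1 (\<not> c, j, Suc k) y)) (Z1 (\<not> c, j, Suc k) y) = 0" for c j k y
  proof -
    have "s c (H (Z1 (\<not> c, j, Suc k) y)) = 0"
    proof (cases c)
      case False
      have "inner (H (Z1 (True, j, Suc k) y)) z = 0" if "z \<in> V" for z
      proof -
        have "(F (True, j, Suc k))\<^sup>\<star> (H z) = 0" using that Vmem by blast
        then have "inner y ((F (True, j, Suc k))\<^sup>\<star> (H z)) = 0" by simp
        then show ?thesis by (simp add: inner_hadj_right Hi F_def)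
      qed
      then show ?thesis using False by (simp add: s_def hproj_eq_0_iff[OF V])
    next
      case True
      have "H (Z1 (False, j, Suc k) y) \<in> V"
        unfolding Vmem
      proof (intro allI)
        fix j' k'
        have "(F (True, j', Suc k'))\<^sup>\<star> (Y (F (False, j, Suc k) y)) = 0"
          by (rule inner_eq_imp_eq) (simp add: inner_hadj_left YFo)
        then show "(F (True, j', Suc k'))\<^sup>\<star> (H (H (Z1 (False, j, Suc k) y))) = 0" by (simp add: HH F_def)
      qed
      then show ?thesis using True by (simp add: s_def blinfun.diff_left hproj_eq_self[OF V])
    qed
    then show ?thesis unfolding Ycq by simp
  qed

  have ex: "\<exists>Z0 :: nat \<Rightarrow> nat \<Rightarrow> 'a \<Rightarrow>\<^sub>L 'a. (\<forall>j k. Z0 j k \<in> M) \<and>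
    (\<forall>j k m x y. inner (Z0 j k x) (Z0 j m y) = (if k = m then inner (B0 x) y else 0)) \<and>
    (\<forall>x t. (\<lambda>j. (norm ((v (c, j, 0) 0)\<^sup>\<star> x))\<^sup>2) sums t \<longrightarrow>
      ((\<lambda>(j, k). (norm ((Z0 j k)\<^sup>\<star> x))\<^sup>2) has_sum (inner (Yc c x) x + d * t)) UNIV)" for c
  proof -
    have bdc: "inner (Yc c x) x + d * (\<Sum>j<N. (norm ((v (c, j, 0) 0)\<^sup>\<star> x))\<^sup>2) \<le> a * (norm x)\<^sup>2" for N x
    proof -
      have "d * (\<Sum>j<N. (norm ((v (c, j, 0) 0)\<^sup>\<star> x))\<^sup>2) = (\<Sum>i\<in>(\<lambda>j. (c, j, 0)) ` {..<N}. (norm ((F i)\<^sup>\<star> x))\<^sup>2)"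
        using d by (subst sum.reindex) (auto simp: inj_on_def F_def blinfun.scaleR_left power_mult_distrib sum_distrib_left)
      also have "\<dots> \<le> inner (W x) x"
        by (rule finite_sum_le_has_sum[OF Whs]) auto
      finally have "d * (\<Sum>j<N. (norm ((v (c, j, 0) 0)\<^sup>\<star> x))\<^sup>2) \<le> inner (W x) x" .
      moreover have "inner (Yc c x) x \<le> inner (Y x) x"
        using Ycadd[of x] pos_ge0[OF Ycpos, of "\<not> c" x] by (cases c) auto
      moreover have "inner (Y x) x + inner (W x) x = inner (A x) x" by (simp add: Y_def blinfun.diff_left inner_diff_left)
      ultimately show ?thesis using A(3)[of x] by linarith
    qed
    show ?thesis
      by (rule exhaust_by_multiple_copies[OF YcM Ycpos v(1) v(2) bdc B0(1) \<open>pos B0\<close> B0(2) B0b less_imp_le[OF lpos] d(2)]) blast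
  qed
  have "\<forall>c. \<exists>Z0 :: nat \<Rightarrow> nat \<Rightarrow> 'a \<Rightarrow>\<^sub>L 'a. (\<forall>j k. Z0 j k \<in> M) \<and>
    (\<forall>j k m x y. inner (Z0 j k x) (Z0 j m y) = (if k = m then inner (B0 x) y else 0)) \<and>
    (\<forall>x t. (\<lambda>j. (norm ((v (c, j, 0) 0)\<^sup>\<star> x))\<^sup>2) sums t \<longrightarrow>
      ((\<lambda>(j, k). (norm ((Z0 j k)\<^sup>\<star> x))\<^sup>2) has_sum (inner (Yc c x) x + d * t)) UNIV)"
    using ex by blast
  from choice[OF this] obtain Z0 :: "bool \<Rightarrow> nat \<Rightarrow> nat \<Rightarrow> 'a \<Rightarrow>\<^sub>L 'a"
    where ZZ: "\<forall>c. (\<forall>j k. Z0 c j k \<in> M) \<and>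
    (\<forall>j k m x y. inner (blinfun_apply (Z0 c j k) x) (blinfun_apply (Z0 c j m) y) = (if k = m then inner (B0 x) y else 0)) \<and>
    (\<forall>x t. (\<lambda>j. (norm ((v (c, j, 0) 0)\<^sup>\<star> x))\<^sup>2) sums t \<longrightarrow>
      ((\<lambda>(j, k). (norm (blinfun_apply ((Z0 c j k)\<^sup>\<star>) x))\<^sup>2) has_sum (inner (Yc c x) x + d * t)) UNIV)" ..
  have Z0M: "Z0 c j k \<in> M" for c j k using ZZ by blast
  have Z0i: "inner (Z0 c j k x) (Z0 c j m y) = (if k = m then inner (B0 x) y else 0)" for c j k m x y
    using ZZ by blast
  have Z0s: "((\<lambda>(j, k). (norm ((Z0 c j k)\<^sup>\<star> x))\<^sup>2) has_sum (inner (Yc c x) x + d * t)) UNIV"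
    if "(\<lambda>j. (norm ((v (c, j, 0) 0)\<^sup>\<star> x))\<^sup>2) sums t" for c x t
    using ZZ that by blast

  \<comment> \<open>The squares of the adjoints of all low copies of class c add up to the form of
    \<open>Yc c\<close> plus the weight on its reserved isometries. Both vanish on the high copies
    of the other class.\<close>
  have Z0kill: "(Z0 c j k)\<^sup>\<star> (Z1 (\<not> c, j', Suc k') y) = 0" for c j k j' k' y
  proof -
    let ?z = "Z1 (\<not> c, j', Suc k') y"
    have "(v (c, i, 0) 0)\<^sup>\<star> ?z = 0" for i
      by (rule inner_eq_imp_eq) (simp add: inner_hadj_left Z1v)
    then have "((\<lambda>(j, k). (norm ((Z0 c j k)\<^sup>\<star> ?z))\<^sup>2) has_sum (inner (Yc c ?z) ?z + d * 0)) UNIV"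
      by (intro Z0s) simp
    then have "((\<lambda>(j, k). (norm ((Z0 c j k)\<^sup>\<star> ?z))\<^sup>2) has_sum 0) UNIV" unfolding Yckill by simp
    from nonneg_has_sum_le_0D[OF this, of "(j, k)"] show ?thesis by auto
  qed
  define X where "X c j k = Z0 c j k + Z1 (\<not> c, j, Suc k)" for c j k
  have Z01: "inner (Z0 c j k x) (Z1 (\<not> c, j', Suc k') y) = 0" for c j k j' k' x y
    using Z0kill[of c j k j' k' y] by (simp flip: inner_hadj_right)
  have Xi: "inner (X c j k x) (X c j m y) = (if k = m then inner (B x) y else 0)" for c j k m x y
  proof -
    have "inner (Z1 (\<not> c, j, Suc k) x) (Z0 c j m y) = 0" using Z01[of c j m y j k x] by (simp add: inner_commute)
    then show ?thesis
      using Z01[of c j k x j m y] Z1o(1)[of "(\<not> c, j, Suc k)" "(\<not> c, j, Suc m)"]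
      by (auto simp: X_def blinfun.add_left inner_add_left inner_add_right Z0i Z1i)
  qed
  have XM: "X c j k \<in> M" for c j k unfolding X_def by (intro M_add Z0M Z1M)
  \<comment> \<open>The cross term disappears on the source side: the adjoint of a low copy maps
    into the range of E, that of a high copy into its kernel.\<close>
  have Xa: "(norm ((X c j k)\<^sup>\<star> x))\<^sup>2 = (norm ((Z0 c j k)\<^sup>\<star> x))\<^sup>2 + (norm ((F (\<not> c, j, Suc k))\<^sup>\<star> x))\<^sup>2" for c j k x
  proof -
    let ?p = "(Z0 c j k)\<^sup>\<star> x" and ?r = "(Z1 (\<not> c, j, Suc k))\<^sup>\<star> x"
    have E2: "E (E y) = E y" for y by (rule proj_idem[OF E(2)])
    have "inner (Z0 c j k (y - E y)) (Z0 c j k (y - E y)) = 0" for y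
      unfolding Z0i B0q by (simp add: blinfun.diff_right E2)
    then have "Z0 c j k (E y) = Z0 c j k y" for y by (simp add: blinfun.diff_right)
    then have "inner (E ?p) y = inner ?p y" for y
      by (simp add: proj_inner[OF E(2)] inner_hadj_left)
    then have p: "E ?p = ?p" by (rule inner_eq_imp_eq)
    have "inner (Z1 (\<not> c, j, Suc k) (E y)) (Z1 (\<not> c, j, Suc k) (E y)) = 0" for y
      by (simp add: Z1i B0q E2)
    then have "Z1 (\<not> c, j, Suc k) (E y) = 0" for y by simp
    then have "inner (E ?r) y = inner 0 y" for y
      by (simp add: proj_inner[OF E(2)] inner_hadj_left)
    then have r: "E ?r = 0" by (rule inner_eq_imp_eq)
    have "inner ?p ?r = inner (E ?p) ?r" by (simp only: p)
    also have "\<dots> = 0" by (simp add: proj_inner[OF E(2)] r)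
    finally have "inner ?p ?r = 0" .
    then show ?thesis
      using inner_commute[of ?r ?p]
      by (simp add: X_def F_def blinfun.add_left power2_norm_eq_inner inner_add_left inner_add_right)
  qed
  have total: "((\<lambda>(c, j, k). (norm ((X c j k)\<^sup>\<star> x))\<^sup>2) has_sum inner (A x) x) UNIV" for x
  proof -
    define f where "f = (\<lambda>i. (norm ((F i)\<^sup>\<star> x))\<^sup>2)"
    have fs: "(f has_sum inner (W x) x) UNIV" using Whs[of x] by (simp add: f_def)
    note fsm = has_sum_imp_summable[OF fs]
    \<comment> \<open>\<open>p c\<close> and \<open>r c\<close> are the shares of the reserved
      isometries and of the high copies of class c in the form of W. Class c of X uses
      \<open>p c\<close> but \<open>r (\<not> c)\<close>, so the exchange is invisible in the
      total.\<close>
    define p where "p c = infsum (\<lambda>j. f (c, j, 0)) UNIV" for c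
    define r where "r c = infsum (\<lambda>(j, k). f (c, j, Suc k)) UNIV" for c
    have p: "((\<lambda>j. f (c, j, 0)) has_sum p c) UNIV" for c
      unfolding p_def by (intro has_sum_infsum summable_reindex_inj[OF fsm]) (auto simp: inj_def)
    have r: "((\<lambda>(j, k). f (c, j, Suc k)) has_sum r c) UNIV" for c
    proof -
      have "(\<lambda>jk. f (c, fst jk, Suc (snd jk))) summable_on UNIV"
        by (rule summable_reindex_inj[OF fsm]) (auto simp: inj_def)
      then show ?thesis unfolding r_def by (intro has_sum_infsum) (simp add: case_prod_unfold)
    qed
    have "(f has_sum ((p True + r True) + (p False + r False))) UNIV"
      by (rule has_sum_bool_split; rule has_sum_nat_split; (rule p)?; (rule r)?)
    with fs have Weq: "inner (W x) x = (p True + r True) + (p False + r False)" by (rule has_sum_unique)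
    have Z0t: "((\<lambda>(j, k). (norm ((Z0 c j k)\<^sup>\<star> x))\<^sup>2) has_sum (inner (Yc c x) x + p c)) UNIV" for c
    proof -
      have "(\<lambda>j. f (c, j, 0) / d) sums (p c / d)" by (intro sums_divide has_sum_imp_sums p)
      moreover have "f (c, j, 0) / d = (norm ((v (c, j, 0) 0)\<^sup>\<star> x))\<^sup>2" for j
        using d by (simp add: f_def F_def blinfun.scaleR_left power_mult_distrib)
      ultimately have "(\<lambda>j. (norm ((v (c, j, 0) 0)\<^sup>\<star> x))\<^sup>2) sums (p c / d)" by simp
      from Z0s[OF this] show ?thesis using d by simp
    qed
    have Xt: "((\<lambda>(j, k). (norm ((X c j k)\<^sup>\<star> x))\<^sup>2) has_sum (inner (Yc c x) x + p c + r (\<not> c))) UNIV" for c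
      using has_sum_add[OF Z0t[of c] r[of "\<not> c"]] by (simp add: Xa f_def case_prod_unfold)
    have "((\<lambda>(c, j, k). (norm ((X c j k)\<^sup>\<star> x))\<^sup>2) has_sum
        ((inner (Yc True x) x + p True + r False) + (inner (Yc False x) x + p False + r True))) UNIV"
      by (rule has_sum_bool_split) (use Xt[of True] Xt[of False] in simp_all)
    also have "(inner (Yc True x) x + p True + r False) + (inner (Yc False x) x + p False + r True) = inner (A x) x"
      using Ycadd[of x] Weq by (simp add: Y_def blinfun.diff_left inner_diff_left)
    finally show ?thesis .
  qed
  have inf2: "infinite (UNIV :: (bool \<times> nat) set)" by (simp add: finite_prod)
  obtain e2 :: "bool \<times> nat \<Rightarrow> nat" where e2: "bij e2" using countableE_infinite[OF _ inf2] by auto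
  define \<phi> where "\<phi> = inv e2"
  have \<phi>: "bij \<phi>" unfolding \<phi>_def by (rule bij_imp_bij_inv[OF e2])
  show thesis
  proof (rule that[of "\<lambda>n k. X (fst (\<phi> n)) (snd (\<phi> n)) k"])
    fix x
    define \<theta> :: "nat \<times> nat \<Rightarrow> bool \<times> nat \<times> nat" where "\<theta> nk = (fst (\<phi> (fst nk)), snd (\<phi> (fst nk)), snd nk)" for nk
    have "bij \<theta>"
    proof (rule bijI)
      show "inj \<theta>"
        using bij_is_inj[OF \<phi>] by (auto simp: inj_def prod_eq_iff \<theta>_def)
      have "i \<in> range \<theta>" for i
      proof -
        obtain n where "\<phi> n = (fst i, fst (snd i))" using bij_is_surj[OF \<phi>] by (metis surjD)
        then show ?thesis by (intro image_eqI[of _ _ "(n, snd (snd i))"]) (auto simp: \<theta>_def)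
      qed
      then show "surj \<theta>" by auto
    qed
    from has_sum_reindex_bij_betw[OF this, of "\<lambda>(c, j, k). (norm ((X c j k)\<^sup>\<star> x))\<^sup>2"] total[of x]
    show "((\<lambda>(n, k). (norm ((X (fst (\<phi> n)) (snd (\<phi> n)) k)\<^sup>\<star> x))\<^sup>2) has_sum inner (A x) x) UNIV"
      by (simp add: case_prod_unfold \<theta>_def)
  qed (rule XM Xi)+
qed

end

section \<open>Projections that dominate an isometry, and room in an eigenspace\<close>

context vn
begin

text \<open>Cantor--Bernstein argument for a projection \<open>h\<close> that dominates a copy of the identity.\<close>

lemma isometry_onto:
  assumes h: "h \<in> M" "proj h" and u: "u \<in> M" "iso u" "\<And>x. h (u x) = u x"
  shows "\<exists>w\<in>M. iso w \<and> w o\<^sub>L w\<^sup>\<star> = h"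
proof -
  define c where "c = id_blinfun - h"
  have c: "c \<in> M" "proj c" unfolding c_def using h by (auto intro: proj_compl)
  have cu: "c (u x) = 0" for x by (simp add: c_def blinfun.diff_left u)
  define W where "W n = (((o\<^sub>L) u ^^ n) c)" for n
  have W0: "W 0 = c" and WS: "\<And>n. W (Suc n) = u o\<^sub>L W n" by (auto simp: W_def)
  have WM: "W n \<in> M" for n by (induction n) (auto simp: W0 WS c u)
  have Wi: "inner (W m x) (W n y) = (if m = n then inner (c x) y else 0)" for m n x y
  proof (induction m arbitrary: n)
    case 0
    show ?case
    proof (cases n)
      case 0 then show ?thesis by (simp add: W0 proj_inner[OF c(2)] proj_idem[OF c(2)])
    next
      case (Suc k)
      have "inner (c x) (u (W k y)) = 0" by (simp add: proj_inner[OF c(2)] cu)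
      then show ?thesis using Suc by (simp add: W0 WS)
    qed
  next
    case (Suc m)
    show ?case
    proof (cases n)
      case 0
      have "inner (u (W m x)) (c y) = 0" by (simp add: proj_inner[OF c(2), symmetric] cu)
      then show ?thesis using 0 by (simp add: W0 WS)
    next
      case n: (Suc k)
      then show ?thesis using Suc[of k] by (simp add: WS iso_inner[OF u(2)])
    qed
  qed
  have Wc: "W n (c x) = W n x" for n x by (induction n) (simp_all add: W0 WS proj_idem[OF c(2)])
  have WW: "(W m)\<^sup>\<star> (W n x) = (if m = n then c x else 0)" for m n x
    by (rule inner_eq_imp_eq) (simp add: inner_hadj_left Wi inner_commute[of x] proj_inner[OF c(2)])
  define k where "k n = W n o\<^sub>L (W n)\<^sup>\<star>" for n
  have kp: "proj (k n)" for n
    by (rule projI) (simp_all add: k_def inner_hadj_left inner_hadj_right[symmetric] WW Wc)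
  have ko: "k m (k n x) = 0" if "m \<noteq> n" for m n x using that by (simp add: k_def WW)
  have fam: "orth_family k" by (rule orth_family_proj[OF kp]) (rule ko)
  define K where "K = osum k"
  have Kp: "proj K" unfolding K_def by (rule osum_proj_apply(2)[OF kp]) (rule ko)
  have KM: "K \<in> M" unfolding K_def by (intro M_osum fam, unfold k_def, intro M_compose M_hadj WM)
  have Ks: "(\<lambda>n. k n x) sums K x" for x using osum_sums[OF fam] by (simp add: K_def)
  have k0: "k 0 = c" using c(2) by (intro blinfun_eqI) (simp add: k_def W0 proj_def proj_idem)
  have uKu: "u (K (u\<^sup>\<star> x)) = K x - c x" for x
  proof -
    have "(\<lambda>n. u (k n (u\<^sup>\<star> x))) sums u (K (u\<^sup>\<star> x))"
      by (rule bounded_linear.sums[OF blinfun.bounded_linear_right Ks])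
    moreover have "u (k n (u\<^sup>\<star> x)) = k (Suc n) x" for n by (simp add: k_def WS)
    moreover have "(\<lambda>n. k (Suc n) x) sums (K x - k 0 x)" using Ks[of x] sums_Suc_iff[of "\<lambda>n. k n x" "K x - k 0 x"] by simp
    ultimately show ?thesis using sums_unique2 k0 by simp
  qed
  have uK: "u (K x) = K (u x) - c (u x)" for x using uKu[of "u x"] by (simp add: iso_hadj_apply[OF u(2)])
  have uK': "K (u x) = u (K x)" for x using uK[of x] cu by simp
  \<comment> \<open>K is the projection onto the span of the ranges of c, u c, u u c, and so on.
    Shifting by u there removes exactly the range of c, and the identity elsewhere changes nothing,
    so the range of w is that of h.\<close>
  define w where "w = (u o\<^sub>L K) + (id_blinfun - K)"
  have wM: "w \<in> M" unfolding w_def by (intro M_add M_diff M_compose M_id u KM)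
  have wa: "w x = u (K x) + (x - K x)" for x by (simp add: w_def blinfun.bilinear_simps)
  have orth: "inner (u (K x)) (y - K y) = 0" for x y
  proof -
    have "K (u (K x)) = u (K x)" by (simp add: uK' proj_idem[OF Kp])
    then have "inner (u (K x)) (y - K y) = inner (u (K x)) (K (y - K y))"
      using proj_inner[OF Kp, of "u (K x)" "y - K y"] by simp
    then show ?thesis by (simp add: blinfun.diff_right proj_idem[OF Kp])
  qed
  have "iso w"
    unfolding iso_norm
  proof
    fix x
    have "(norm (w x))\<^sup>2 = (norm (u (K x)))\<^sup>2 + (norm (x - K x))\<^sup>2"
      unfolding wa using orth[of x x] inner_commute[of "x - K x" "u (K x)"]
      by (simp add: power2_norm_eq_inner inner_add_left inner_add_right)
    also have "\<dots> = (norm x)\<^sup>2" using u(2) proj_pythagoras[OF Kp, of x] by (simp add: iso_norm)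
    finally show "norm (w x) = norm x" by simp
  qed
  moreover have "w o\<^sub>L w\<^sup>\<star> = h"
  proof (rule blinfun_eqI)
    fix x
    have Ka: "K\<^sup>\<star> = K" using Kp by (simp add: proj_def)
    have w': "w\<^sup>\<star> x = K (u\<^sup>\<star> x) + (x - K x)" by (simp add: w_def Ka blinfun.bilinear_simps)
    have "K (x - K x) = 0" "K (K (u\<^sup>\<star> x)) = K (u\<^sup>\<star> x)" by (simp_all add: blinfun.diff_right proj_idem[OF Kp])
    then have "w (w\<^sup>\<star> x) = u (K (u\<^sup>\<star> x)) + (x - K x)"
      unfolding w' wa by (simp add: blinfun.add_right)
    also have "\<dots> = h x" by (simp add: uKu c_def blinfun.diff_left)
    finally show "(w o\<^sub>L w\<^sup>\<star>) x = h x" by simp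
  qed
  ultimately show ?thesis using wM by blast
qed

text \<open>Splitting x into its component y in the first N ranges and the rest z decouples the form
  of A, since y is an eigenvector and orthogonal to z. Already the errors 0 would be
  admissible.\<close>

lemma room_eigen:
  fixes v :: "nat \<Rightarrow> 'a \<Rightarrow>\<^sub>L 'a"
  assumes A: "pos A" "0 \<le> a" and v: "\<And>i. v i \<in> M" "\<And>i. iso (v i)"
    "\<And>i j x y. i \<noteq> j \<Longrightarrow> inner (v i x) (v j y) = 0" "\<And>i x. A (v i x) = a *\<^sub>R v i x"
  shows "room A a"
  unfolding room_def
proof (intro allI impI exI[of _ v] conjI)
  fix \<epsilon> :: "nat \<Rightarrow> real" and N x assume \<epsilon>: "\<forall>i. 0 < \<epsilon> i"
  define y where "y = (\<Sum>i<N. v i ((v i)\<^sup>\<star> x))"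
  define z where "z = x - y"
  have Ay: "A y = a *\<^sub>R y" by (simp add: y_def blinfun.sum_right v(4) scaleR_sum_right)
  have y2: "(norm y)\<^sup>2 = (\<Sum>i<N. (norm ((v i)\<^sup>\<star> x))\<^sup>2)"
    unfolding y_def using v(2,3) by (subst norm_sq_orthogonal_sum) (auto simp: iso_norm)
  have "inner y x = (\<Sum>i<N. (norm ((v i)\<^sup>\<star> x))\<^sup>2)"
    by (simp add: y_def inner_sum_left inner_hadj_right[symmetric] power2_norm_eq_inner)
  then have yz: "inner y z = 0" using y2 by (simp add: z_def inner_diff_right power2_norm_eq_inner)
  have "inner (A x) x = inner (A (y + z)) (y + z)" by (simp add: z_def)
  also have "\<dots> = a * (norm y)\<^sup>2 + inner (A z) z"
    using selfadj_inner[OF pos_hadj[OF A(1)], of z y] yz inner_commute[of z y]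
    by (simp add: blinfun.add_right inner_add_left inner_add_right Ay power2_norm_eq_inner)
  finally have "a * (norm y)\<^sup>2 \<le> inner (A x) x" using pos_ge0[OF A(1), of z] by simp
  moreover have "(\<Sum>i<N. (a - \<epsilon> i) * (norm ((v i)\<^sup>\<star> x))\<^sup>2) \<le> a * (norm y)\<^sup>2"
    unfolding y2 sum_distrib_left using \<epsilon> by (intro sum_mono mult_right_mono) (auto simp: less_imp_le)
  ultimately show "(\<Sum>i<N. (a - \<epsilon> i) * (norm ((v i)\<^sup>\<star> x))\<^sup>2) \<le> inner (A x) x" by linarith
qed (use v in simp_all)

end

section \<open>The ideal of the finite projections, and the room that the spectral projections
  outside it provide\<close>

context sf_factor
begin

lemma J_M: "T \<in> J \<Longrightarrow> T \<in> M"
  using J_subset by blast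

text \<open>The range projection of X f. It lies in the ideal because the polar part W satisfies W =
  W f. The last clause is minimality: a P that fixes the range of X f fixes the range of g.\<close>

lemma range_proj_in_J:
  assumes f: "f \<in> J" "proj f" and X: "X \<in> M"
  obtains g where "g \<in> J" "proj g" "\<And>x. g (X (f x)) = X (f x)"
    "\<And>(P :: 'a \<Rightarrow>\<^sub>L 'a) y. \<forall>x. P (X (f x)) = X (f x) \<Longrightarrow> P (g y) = g y"
proof -
  define T where "T = X o\<^sub>L f"
  have TM: "T \<in> M" unfolding T_def by (intro M_compose X J_M f)
  obtain W Q :: "'a \<Rightarrow>\<^sub>L 'a" where W: "W \<in> M" "Q \<in> M" "proj Q" "W\<^sup>\<star> o\<^sub>L W = Q"
    "\<And>x. Q x = 0 \<longleftrightarrow> T x = 0" "\<And>x. W (psqrt (T\<^sup>\<star> o\<^sub>L T) x) = T x" "\<And>z. W z \<in> closure (range T)"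
    "\<And>x. Q (psqrt (T\<^sup>\<star> o\<^sub>L T) x) = psqrt (T\<^sup>\<star> o\<^sub>L T) x"
    using M_polar[OF TM] by metis
  have W2: "(norm (W x))\<^sup>2 = inner (Q x) x" for x unfolding W(4)[symmetric] by (rule norm_sq_hadj)
  have WW: "W\<^sup>\<star> (W x) = Q x" for x using W(4) by (metis blinfun_apply_blinfun_compose)
  have Wf: "W (f x) = W x" for x
  proof -
    have "Q (x - f x) = 0" unfolding W(5) T_def by (simp add: blinfun.diff_right proj_idem[OF f(2)])
    then have "(norm (W (x - f x)))\<^sup>2 = 0" unfolding W2 by simp
    then show ?thesis by (simp add: blinfun.diff_right)
  qed
  have WQ: "W (Q x) = W x" for x
  proof -
    have "(norm (W (x - Q x)))\<^sup>2 = 0" unfolding W2 by (simp add: blinfun.diff_right proj_idem[OF W(3)])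
    then show ?thesis by (simp add: blinfun.diff_right)
  qed
  have "W = W o\<^sub>L f" using Wf by (intro blinfun_eqI) simp
  then have "W \<in> J" using J_left[OF W(1) f(1)] by simp
  show thesis
  proof (rule that[of "W o\<^sub>L W\<^sup>\<star>"])
    show "W o\<^sub>L W\<^sup>\<star> \<in> J" by (intro J_right \<open>W \<in> J\<close> M_hadj W)
    show "proj (W o\<^sub>L W\<^sup>\<star>)" by (rule projI) (simp_all add: inner_hadj_left inner_hadj_right[symmetric] WW WQ)
    show "(W o\<^sub>L W\<^sup>\<star>) (X (f x)) = X (f x)" for x
      using W(6)[of x] WW[of "psqrt (T\<^sup>\<star> o\<^sub>L T) x"] W(8)[of x] by (simp add: T_def)
    fix P :: "'a \<Rightarrow>\<^sub>L 'a" and x assume P: "\<forall>x. P (X (f x)) = X (f x)"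
    obtain s where s: "(\<lambda>n. T (s n)) \<longlonglongrightarrow> W (W\<^sup>\<star> x)" using closure_range_sequence W(7) by blast
    then have "(\<lambda>n. P (T (s n))) \<longlonglongrightarrow> P (W (W\<^sup>\<star> x))" by (rule blinfun_tendsto)
    then have "(\<lambda>n. T (s n)) \<longlonglongrightarrow> P (W (W\<^sup>\<star> x))" by (simp add: T_def P)
    then show "P ((W o\<^sub>L W\<^sup>\<star>) x) = (W o\<^sub>L W\<^sup>\<star>) x" using LIMSEQ_unique s by simp
  qed
qed

text \<open>The join of f and g is f plus the range projection of (1 - f) g, which is orthogonal to
  f by minimality.\<close>

lemma J_proj_join:
  assumes "f \<in> J" "proj f" "g \<in> J" "proj g"
  obtains h where "h \<in> J" "proj h" "\<And>x. h (f x) = f x" "\<And>x. h (g x) = g x"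
proof -
  obtain k :: "'a \<Rightarrow>\<^sub>L 'a" where k: "k \<in> J" "proj k" "\<And>x. k ((id_blinfun - f) (g x)) = (id_blinfun - f) (g x)"
    "\<And>(P :: 'a \<Rightarrow>\<^sub>L 'a) y. \<forall>x. P ((id_blinfun - f) (g x)) = (id_blinfun - f) (g x) \<Longrightarrow> P (k y) = k y"
    using range_proj_in_J[OF assms(3,4), of "id_blinfun - f"] M_diff[OF M_id J_M[OF assms(1)]] by metis
  have "(id_blinfun - f) (k x) = k x" for x
    by (rule k(4)) (simp add: blinfun.bilinear_simps proj_idem[OF assms(2)])
  then have fk: "f (k x) = 0" for x by (simp add: blinfun.diff_left)
  have kf: "k (f x) = 0" for x
    by (rule inner_eq_imp_eq) (simp add: proj_inner[OF k(2)] proj_inner[OF assms(2)] fk)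
  show thesis
  proof (rule that[of "f + k"])
    show "f + k \<in> J" by (intro J_add assms k)
    show "proj (f + k)"
      by (rule projI) (simp_all add: blinfun.bilinear_simps inner_simps proj_inner[OF k(2)] proj_inner[OF assms(2)]
        fk kf proj_idem[OF k(2)] proj_idem[OF assms(2)])
    show "(f + k) (f x) = f x" for x by (simp add: blinfun.add_left kf proj_idem[OF assms(2)])
    show "(f + k) (g x) = g x" for x
      using k(3)[of x] by (simp add: blinfun.bilinear_simps kf)
  qed
qed

text \<open>The range projection g of P f lies in J and under P. Hence P - g is still outside J, so
  it is infinite and contains an isometric copy of the whole space, and its range is annihilated by
  f.\<close>

lemma copy_avoiding:
  assumes P: "P \<in> M" "proj P" "P \<notin> J" and f: "f \<in> J" "proj f" and e: "e \<in> M"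
  obtains u where "u \<in> M" "\<And>x y. inner (u x) (u y) = inner (e x) (e y)" "\<And>x. P (u x) = u x" "\<And>x. f (u x) = 0"
    "\<And>x. e (e x) = e x \<Longrightarrow> u (e x) = u x"
proof -
  obtain g :: "'a \<Rightarrow>\<^sub>L 'a" where g: "g \<in> J" "proj g" "\<And>x. g (P (f x)) = P (f x)"
    "\<And>(Q :: 'a \<Rightarrow>\<^sub>L 'a) y. \<forall>x. Q (P (f x)) = P (f x) \<Longrightarrow> Q (g y) = g y"
    using range_proj_in_J[OF f P(1)] by metis
  have Pg: "P (g x) = g x" for x by (rule g(4)) (simp add: proj_idem[OF P(2)])
  have gP: "g (P x) = g x" for x
    by (rule inner_eq_imp_eq) (simp add: proj_inner[OF g(2)] proj_inner[OF P(2)] Pg)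
  define p where "p = P - g"
  have pM: "p \<in> M" unfolding p_def by (intro M_diff P J_M g)
  have pp: "proj p"
    unfolding p_def by (rule projI) (simp_all add: blinfun.bilinear_simps inner_simps proj_inner[OF P(2)] proj_inner[OF g(2)]
      Pg gP proj_idem[OF P(2)] proj_idem[OF g(2)])
  have "p \<notin> J"
  proof
    assume "p \<in> J"
    then have "p + g \<in> J" using g by (intro J_add)
    then show False using P by (simp add: p_def)
  qed
  obtain w where w: "w \<in> M" "w\<^sup>\<star> o\<^sub>L w = p" "p o\<^sub>L w = w" "w o\<^sub>L w\<^sup>\<star> \<noteq> p"
    using not_J_infinite[OF pM pp \<open>p \<notin> J\<close>] by blast
  obtain v :: "nat \<Rightarrow> 'a \<Rightarrow>\<^sub>L 'a" where v: "\<And>k. v k \<in> M" "\<And>k. iso (v k)" "\<And>k x. p (v k x) = v k x"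
    using infinite_proj_isometries[OF pM pp w] by metis
  have fp: "f (p x) = 0" for x
  proof (rule inner_eq_imp_eq)
    fix y
    have "p (f y) = 0" using g(3)[of y] by (simp add: p_def blinfun.diff_left gP)
    then show "inner (f (p x)) y = inner 0 y" by (simp add: proj_inner[OF f(2)] proj_inner[OF pp])
  qed
  have Pp: "P (p x) = p x" for x by (simp add: p_def blinfun.bilinear_simps proj_idem[OF P(2)] Pg)
  show thesis
  proof (rule that[of "v 0 o\<^sub>L e"])
    show "v 0 o\<^sub>L e \<in> M" by (intro M_compose v e)
    show "inner ((v 0 o\<^sub>L e) x) ((v 0 o\<^sub>L e) y) = inner (e x) (e y)" for x y by (simp add: iso_inner[OF v(2)])
    show "P ((v 0 o\<^sub>L e) x) = (v 0 o\<^sub>L e) x" for x using Pp[of "v 0 (e x)"] by (simp add: v(3))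
    show "f ((v 0 o\<^sub>L e) x) = 0" for x using fp[of "v 0 (e x)"] by (simp add: v(3))
  qed simp
qed

text \<open>Copies of one fixed nonzero projection e of J are chosen recursively inside the spectral
  projections P. A projection f in J carries all earlier copies and their images under A, and the
  next copy is placed in the kernel of f; taking e in J is what keeps every f in J. The copies are
  then glued to isometries.\<close>

lemma room_from_not_J:
  assumes A: "A \<in> M" "pos A" "\<And>x. inner (A x) x \<le> a * (norm x)\<^sup>2" "0 < a"
    and nJ: "\<And>\<epsilon>. 0 < \<epsilon> \<Longrightarrow> id_blinfun - specp A (a - \<epsilon>) \<notin> J"
  shows "room A a"
  unfolding room_def
proof (intro allI impI)
  fix \<epsilon> :: "nat \<Rightarrow> real" assume \<epsilon>: "\<forall>i. 0 < \<epsilon> i"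
  note sA = pos_hadj[OF A(2)]
  \<comment> \<open>Halving pays for the factor 2 lost when the deficit of y + z is split below; the
    minimum with a keeps all copies inside the spectral projection of A above a / 2.\<close>
  define \<delta> where "\<delta> k = min (\<epsilon> k) a / 2" for k
  have \<delta>: "0 < \<delta> k" "2 * \<delta> k \<le> \<epsilon> k" "2 * \<delta> k \<le> a" for k using \<epsilon> A(4) by (auto simp: \<delta>_def)
  define P where "P t = id_blinfun - specp A (a - t)" for t
  have PM: "P t \<in> M" and Pp: "proj (P t)" for t
    unfolding P_def by (intro M_diff M_id M_specp A sA, intro proj_compl specp_proj[OF sA])
  have Plow: "(a - t) * (norm x)\<^sup>2 \<le> inner (A x) x" if "P t x = x" for t x
  proof (cases "x = 0")
    case False
    have "specp A (a - t) x = 0" using that by (simp add: P_def blinfun.diff_left)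
    from specp_lower[OF sA this False] show ?thesis by simp
  qed simp
  have Pmono: "P t (P s x) = P s x" if "s \<le> t" for s t x
    using specp_mono'[OF sA, of "a - t" "a - s" x] that by (simp add: P_def blinfun.bilinear_simps)
  obtain e where e: "e \<in> J" "proj e" "e \<noteq> 0" using J_nonzero_proj by blast
  \<comment> \<open>The n-th copy will belong to the row given by the first component of
    \<open>prod_decode n\<close>, so it is chosen within the error of that row.\<close>
  define idx where "idx n = \<delta> (fst (prod_decode n))" for n
  define Good where "Good n uf \<longleftrightarrow> fst uf \<in> M \<and> snd uf \<in> J \<and> proj (snd uf) \<and>
    (\<forall>x y. inner (fst uf x) (fst uf y) = inner (e x) y) \<and> (\<forall>x. P (idx n) (fst uf x) = fst uf x) \<and>
    (\<forall>x. snd uf (fst uf x) = fst uf x) \<and> (\<forall>x. snd uf (A (fst uf x)) = A (fst uf x))"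
    for n and uf :: "('a \<Rightarrow>\<^sub>L 'a) \<times> ('a \<Rightarrow>\<^sub>L 'a)"
  define Step where "Step n uf uf' \<longleftrightarrow> (\<forall>x. snd uf (fst uf' x) = 0) \<and> (\<forall>x. snd uf' (snd uf x) = snd uf x)"
    for n :: nat and uf uf' :: "('a \<Rightarrow>\<^sub>L 'a) \<times> ('a \<Rightarrow>\<^sub>L 'a)"
  have ext: "\<exists>uf. Good n uf \<and> (\<forall>x. f (fst uf x) = 0) \<and> (\<forall>x. snd uf (f x) = f x)" if f: "f \<in> J" "proj f" for n f
  proof -
    have "P (idx n) \<notin> J" unfolding P_def by (rule nJ) (simp add: idx_def \<delta>)
    obtain u where u: "u \<in> M" "\<And>x y. inner (u x) (u y) = inner (e x) (e y)" "\<And>x. P (idx n) (u x) = u x"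
      "\<And>x. f (u x) = 0" "\<And>x. u (e x) = u x"
      using copy_avoiding[OF PM Pp \<open>P (idx n) \<notin> J\<close> f J_M[OF e(1)]] proj_idem[OF e(2)] by metis
    obtain g1 :: "'a \<Rightarrow>\<^sub>L 'a" where g1: "g1 \<in> J" "proj g1" "\<And>x. g1 (u (e x)) = u (e x)"
      using range_proj_in_J[OF e(1,2) u(1)] by metis
    obtain g2 :: "'a \<Rightarrow>\<^sub>L 'a" where g2: "g2 \<in> J" "proj g2" "\<And>x. g2 ((A o\<^sub>L u) (e x)) = (A o\<^sub>L u) (e x)"
      using range_proj_in_J[OF e(1,2) M_compose[OF A(1) u(1)]] by metis
    obtain h1 :: "'a \<Rightarrow>\<^sub>L 'a" where h1: "h1 \<in> J" "proj h1" "\<And>x. h1 (g1 x) = g1 x" "\<And>x. h1 (g2 x) = g2 x"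
      using J_proj_join[OF g1(1,2) g2(1,2)] by metis
    obtain h :: "'a \<Rightarrow>\<^sub>L 'a" where h: "h \<in> J" "proj h" "\<And>x. h (f x) = f x" "\<And>x. h (h1 x) = h1 x"
      using J_proj_join[OF f h1(1,2)] by metis
    have hu: "h (u x) = u x" for x
    proof -
      have "h (h1 (g1 (u x))) = h1 (g1 (u x))" by (rule h(4))
      then show ?thesis using g1(3)[of x] h1(3)[of "u x"] by (simp add: u(5))
    qed
    have hAu: "h (A (u x)) = A (u x)" for x
    proof -
      have "h (h1 (g2 (A (u x)))) = h1 (g2 (A (u x)))" by (rule h(4))
      then show ?thesis using g2(3)[of x] h1(4)[of "A (u x)"] by (simp add: u(5))
    qed
    have "inner (u x) (u y) = inner (e x) y" for x y
      by (simp add: u(2) proj_inner[OF e(2)] proj_idem[OF e(2)])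
    then have "Good n (u, h)" using u h hu hAu by (simp add: Good_def)
    then show ?thesis using u h by (intro exI[of _ "(u, h)"]) simp
  qed
  have "0 \<in> J" using J_left[OF M_0 e(1)] by (simp add: zero_blinfun_def[symmetric])
  then have "\<exists>uf. Good 0 uf" using ext[of 0 0] proj_0 by blast
  moreover have "\<exists>uf'. Good (Suc n) uf' \<and> Step n uf uf'" if "Good n uf" for n uf
    using ext[of "snd uf" "Suc n"] that unfolding Good_def Step_def by blast
  ultimately obtain uf where uf: "\<And>n. Good n (uf n)" "\<And>n. Step n (uf n) (uf (Suc n))"
    using dependent_nat_choice[of Good Step] by metis
  define u where "u n = fst (uf n)" for n
  define f where "f n = snd (uf n)" for n
  have u: "u n \<in> M" "inner (u n x) (u n y) = inner (e x) y" "P (idx n) (u n x) = u n x"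
    "f n (u n x) = u n x" "f n (A (u n x)) = A (u n x)" "proj (f n)" for n x y
    using uf(1)[of n] by (simp_all add: Good_def u_def f_def)
  have fs: "f n (u (Suc n) x) = 0" "f (Suc n) (f n x) = f n x" for n x
    using uf(2)[of n] by (simp_all add: Step_def u_def f_def)
  have ff: "f (m + k) (f m x) = f m x" for m k x
    by (induction k) (use u(6) in \<open>auto simp: proj_idem\<close>, metis fs(2))
  have fu: "f m (u n x) = 0" if "m < n" for m n x
  proof (rule inner_eq_imp_eq)
    fix z
    obtain k where k: "n = Suc (m + k)" using less_imp_Suc_add[OF \<open>m < n\<close>] by blast
    have "inner (f m (u n x)) z = inner (u n x) (f (m + k) (f m z))" by (simp add: proj_inner[OF u(6)] ff)
    also have "\<dots> = inner (f (m + k) (u n x)) (f m z)" by (simp add: proj_inner[OF u(6)])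
    also have "\<dots> = 0" by (simp add: k fs)
    finally show "inner (f m (u n x)) z = inner 0 z" by simp
  qed
  have uo1: "inner (u m x) (u n y) = 0 \<and> inner (A (u m x)) (u n y) = 0" if "m < n" for m n x y
    using proj_inner[OF u(6), of m "u m x" "u n y"] proj_inner[OF u(6), of m "A (u m x)" "u n y"]
    by (simp add: u(4,5) fu[OF that])
  have uo: "inner (u m x) (u n y) = 0" "inner (A (u m x)) (u n y) = 0" if "m \<noteq> n" for m n x y
  proof -
    have "inner (A (u m x)) (u n y) = inner (A (u n y)) (u m x)" by (subst selfadj_inner[OF sA]) (rule inner_commute)
    moreover have "inner (u m x) (u n y) = inner (u n y) (u m x)" by (rule inner_commute)
    moreover have "m < n \<or> n < m" using that by auto
    ultimately show "inner (u m x) (u n y) = 0" "inner (A (u m x)) (u n y) = 0" using uo1 by metis+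
  qed
  have ui: "inner (u m x) (u n y) = (if m = n then inner (e x) y else 0)" for m n x y
    using uo(1)[of m n] u(2) by simp
  obtain v t :: "nat \<Rightarrow> 'a \<Rightarrow>\<^sub>L 'a" where v: "\<And>k. v k \<in> M" "\<And>k. iso (v k)"
    "\<And>k x. (\<lambda>m. u (prod_encode (k, m)) (t m x)) sums v k x"
    "\<And>k l x y. k \<noteq> l \<Longrightarrow> inner (v k x) (v l y) = 0"
    by (rule isometries_from_copies[OF J_M[OF e(1)] e(2,3) u(1) ui]) (rule that; assumption)
  have vP: "P (\<delta> k) (v k x) = v k x" for k x
    by (rule proj_preserved_sums[OF v(3)]) (use u(3)[of "prod_encode (k, _)"] in \<open>simp add: idx_def\<close>)
  have vA: "inner (A (v k x)) (v l y) = 0" if "k \<noteq> l" for k l x y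
  proof (rule orth_seq_inner[OF v(3)])
    fix n
    have "inner (A (u (prod_encode (l, n)) (t n y))) (v k x) = 0"
      by (rule orth_seq_inner[OF v(3)]) (rule uo, use that in simp)
    then show "inner (A (v k x)) (u (prod_encode (l, n)) (t n y)) = 0"
      by (simp add: selfadj_inner[OF sA] inner_commute)
  qed
  define D where "D = a *\<^sub>R id_blinfun - A"
  have Dq: "inner (D x) x = a * (norm x)\<^sup>2 - inner (A x) x" for x
    by (simp add: D_def blinfun.bilinear_simps inner_diff_left power2_norm_eq_inner)
  have Dpos: "pos D"
    by (rule posI) (simp_all add: Dq A(3), simp add: D_def sA)
  have vD: "inner (D (v k x)) (v l y) = 0" if "k \<noteq> l" for k l x y
    by (simp add: D_def blinfun.bilinear_simps inner_diff_left v(4)[OF that] vA[OF that])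
  have main: "(\<Sum>i<N. (a - \<epsilon> i) * (norm ((v i)\<^sup>\<star> x))\<^sup>2) \<le> inner (A x) x" for N x
  proof -
    \<comment> \<open>All v i live under this projection, so x may be replaced by x' without
      changing the left side. The component z of x' off the chosen ranges then has deficit at most a
      / 2 times its squared norm; doubled, this is exactly the term that z contributes to a times
      the squared norm of x', and it cancels.\<close>
    let ?P = "P (a / 2)"
    define x' where "x' = ?P x"
    have "?P (v i y) = v i y" for i y using Pmono[of "\<delta> i" "a / 2" "v i y"] \<delta>(3)[of i] by (simp add: vP)
    then have vx: "(v i)\<^sup>\<star> x = (v i)\<^sup>\<star> x'" for i
      by - (rule inner_eq_imp_eq, simp add: inner_hadj_left x'_def proj_inner[OF Pp])
    have AP: "A (?P y) = ?P (A y)" for y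
      by (simp add: P_def blinfun.bilinear_simps specp_commute_self[OF sA])
    have Ax: "inner (A x') x' \<le> inner (A x) x"
    proof -
      have "inner (A x) x = inner (A x') x' + inner (A (x - x')) (x - x')"
      proof -
        have "inner (A x') (x - x') = inner (A x) (?P (x - x'))"
          unfolding x'_def AP by (simp add: proj_inner[OF Pp])
        also have "\<dots> = 0" by (simp add: x'_def blinfun.diff_right proj_idem[OF Pp])
        finally have 0: "inner (A x') (x - x') = 0" .
        have "inner (A x) x = inner (A (x' + (x - x'))) (x' + (x - x'))" by simp
        also have "\<dots> = inner (A x') x' + inner (A (x - x')) (x - x')"
          unfolding blinfun.add_right inner_add_left inner_add_right
          using 0 selfadj_inner[OF sA, of "x - x'" x'] inner_commute[of "x - x'" "A x'"] by simp
        finally show ?thesis .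
      qed
      then show ?thesis using pos_ge0[OF A(2), of "x - x'"] by simp
    qed
    define y where "y = (\<Sum>i<N. v i ((v i)\<^sup>\<star> x'))"
    define z where "z = x' - y"
    have y2: "(norm y)\<^sup>2 = (\<Sum>i<N. (norm ((v i)\<^sup>\<star> x'))\<^sup>2)"
      unfolding y_def using v(2,4) by (subst norm_sq_orthogonal_sum) (auto simp: iso_norm)
    have "inner y x' = (\<Sum>i<N. (norm ((v i)\<^sup>\<star> x'))\<^sup>2)"
      by (simp add: y_def inner_sum_left inner_hadj_right[symmetric] power2_norm_eq_inner)
    then have yz: "inner y z = 0" using y2 by (simp add: z_def inner_diff_right power2_norm_eq_inner)
    have x2: "(norm x')\<^sup>2 = (norm y)\<^sup>2 + (norm z)\<^sup>2"
    proof -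
      have "x' = y + z" by (simp add: z_def)
      then show ?thesis using yz inner_commute[of z y] by (simp add: power2_norm_eq_inner inner_add_left inner_add_right)
    qed
    have Pz: "?P z = z"
      using \<open>\<And>i y. ?P (v i y) = v i y\<close> by (simp add: z_def y_def x'_def blinfun.diff_right blinfun.sum_right proj_idem[OF Pp])
    have Dz: "inner (D z) z \<le> a / 2 * (norm z)\<^sup>2" using Plow[OF Pz] by (simp add: Dq algebra_simps)
    have Dy: "inner (D y) y \<le> (\<Sum>i<N. \<delta> i * (norm ((v i)\<^sup>\<star> x'))\<^sup>2)"
    proof -
      have "inner (D y) y = (\<Sum>i<N. \<Sum>j<N. inner (D (v i ((v i)\<^sup>\<star> x'))) (v j ((v j)\<^sup>\<star> x')))"
        by (simp add: y_def blinfun.sum_right inner_sum_left inner_sum_right) (rule sum.swap)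
      also have "\<dots> = (\<Sum>i<N. \<Sum>j<N. if j = i then inner (D (v i ((v i)\<^sup>\<star> x'))) (v i ((v i)\<^sup>\<star> x')) else 0)"
        by (intro sum.cong refl) (simp add: vD)
      also have "\<dots> = (\<Sum>i<N. inner (D (v i ((v i)\<^sup>\<star> x'))) (v i ((v i)\<^sup>\<star> x')))" by simp
      also have "\<dots> \<le> (\<Sum>i<N. \<delta> i * (norm ((v i)\<^sup>\<star> x'))\<^sup>2)"
      proof (rule sum_mono)
        fix i
        show "inner (D (v i ((v i)\<^sup>\<star> x'))) (v i ((v i)\<^sup>\<star> x')) \<le> \<delta> i * (norm ((v i)\<^sup>\<star> x'))\<^sup>2"
          using Plow[OF vP, of i "(v i)\<^sup>\<star> x'"] v(2)[of i] by (simp add: Dq iso_norm algebra_simps)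
      qed
      finally show ?thesis .
    qed
    have "0 \<le> inner (D (y - z)) (y - z)" by (rule pos_ge0[OF Dpos])
    then have "inner (D x') x' \<le> 2 * inner (D y) y + 2 * inner (D z) z"
      using selfadj_inner[OF pos_hadj[OF Dpos], of y z] inner_commute[of y "D z"]
      by (simp add: z_def[THEN eq_diff_eq[THEN iffD1], symmetric] blinfun.bilinear_simps inner_simps)
    then have "a * (norm x')\<^sup>2 - inner (A x') x' \<le> 2 * (\<Sum>i<N. \<delta> i * (norm ((v i)\<^sup>\<star> x'))\<^sup>2) + a * (norm z)\<^sup>2"
      using Dy Dz by (simp add: Dq)
    then have "a * (\<Sum>i<N. (norm ((v i)\<^sup>\<star> x'))\<^sup>2) - 2 * (\<Sum>i<N. \<delta> i * (norm ((v i)\<^sup>\<star> x'))\<^sup>2) \<le> inner (A x') x'"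
      unfolding x2 y2 by (simp add: algebra_simps)
    moreover have "(\<Sum>i<N. (a - \<epsilon> i) * (norm ((v i)\<^sup>\<star> x'))\<^sup>2) \<le> (\<Sum>i<N. (a - 2 * \<delta> i) * (norm ((v i)\<^sup>\<star> x'))\<^sup>2)"
      using \<delta>(2) by (intro sum_mono mult_right_mono) auto
    moreover have "(\<Sum>i<N. (a - 2 * \<delta> i) * (norm ((v i)\<^sup>\<star> x'))\<^sup>2)
        = a * (\<Sum>i<N. (norm ((v i)\<^sup>\<star> x'))\<^sup>2) - 2 * (\<Sum>i<N. \<delta> i * (norm ((v i)\<^sup>\<star> x'))\<^sup>2)"
      by (simp add: left_diff_distrib sum_subtractf sum_distrib_left mult.assoc)
    ultimately show ?thesis using Ax by (simp add: vx)
  qed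
  show "\<exists>v :: nat \<Rightarrow> 'a \<Rightarrow>\<^sub>L 'a. (\<forall>i. v i \<in> M \<and> iso (v i)) \<and>
     (\<forall>i j x y. i \<noteq> j \<longrightarrow> inner (v i x) (v j y) = 0 \<and> inner (A (v i x)) (v j y) = 0) \<and>
     (\<forall>N x. (\<Sum>i<N. (a - \<epsilon> i) * (norm ((v i)\<^sup>\<star> x))\<^sup>2) \<le> inner (A x) x)"
    by (intro exI[of _ v] conjI allI impI v vA main)
qed

end

section \<open>Decompositions into rows of copies, their consequences, and necessity\<close>

context sf_factor
begin

text \<open>A proper isometry y of M is moved into the range of u by conjugation and extended by the
  identity on the rest of N.\<close>

lemma infinite_if_dominates_isometry:
  assumes N: "N \<in> M" "proj N" and u: "u \<in> M" "iso u" "\<And>x. N (u x) = u x"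
  shows "\<exists>w\<in>M. w\<^sup>\<star> o\<^sub>L w = N \<and> N o\<^sub>L w = w \<and> w o\<^sub>L w\<^sup>\<star> \<noteq> N"
proof -
  obtain y where y: "y \<in> M" "iso y" "y o\<^sub>L y\<^sup>\<star> \<noteq> id_blinfun" using proper_isometry by blast
  define w where "w = (u o\<^sub>L y o\<^sub>L u\<^sup>\<star>) + (N - (u o\<^sub>L u\<^sup>\<star>))"
  have wM: "w \<in> M" unfolding w_def by (intro M_add M_diff M_compose M_hadj u y N)
  have Na: "N\<^sup>\<star> = N" using N(2) by (simp add: proj_def)
  have uN: "u\<^sup>\<star> (N x) = u\<^sup>\<star> x" for x
    by (rule inner_eq_imp_eq) (simp add: inner_hadj_left proj_inner[OF N(2)] u(3))
  note uu = iso_hadj_apply[OF u(2)] and yy = iso_hadj_apply[OF y(2)]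
  have wx: "w x = u (y (u\<^sup>\<star> x)) + (N x - u (u\<^sup>\<star> x))" for x by (simp add: w_def blinfun.bilinear_simps)
  have w'x: "w\<^sup>\<star> x = u (y\<^sup>\<star> (u\<^sup>\<star> x)) + (N x - u (u\<^sup>\<star> x))" for x
    by (simp add: w_def Na blinfun.bilinear_simps)
  have "w\<^sup>\<star> o\<^sub>L w = N"
    by (rule blinfun_eqI) (simp add: wx w'x blinfun.bilinear_simps uu yy u(3) uN proj_idem[OF N(2)])
  moreover have "N o\<^sub>L w = w"
    by (rule blinfun_eqI) (simp add: wx blinfun.bilinear_simps u(3) proj_idem[OF N(2)])
  moreover have "w o\<^sub>L w\<^sup>\<star> \<noteq> N"
  proof
    assume "w o\<^sub>L w\<^sup>\<star> = N"
    then have "w (w\<^sup>\<star> (u x)) = N (u x)" for x by (metis blinfun_apply_blinfun_compose)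
    then have "u (y (y\<^sup>\<star> x)) = u x" for x
      by (simp add: wx w'x blinfun.bilinear_simps uu u(3) uN)
    then have "u\<^sup>\<star> (u (y (y\<^sup>\<star> x))) = u\<^sup>\<star> (u x)" for x by simp
    then have "y (y\<^sup>\<star> x) = x" for x by (simp add: uu)
    then have "y o\<^sub>L y\<^sup>\<star> = id_blinfun" by (intro blinfun_eqI) simp
    then show False using y by blast
  qed
  ultimately show ?thesis using wM by blast
qed

text \<open>Row j holds infinitely many copies of B with mutually orthogonal ranges, while copies
  from different rows may overlap. The orthogonality within a row is what later makes the null
  projections infinite.\<close>

definition decomposes :: "('a \<Rightarrow>\<^sub>L 'a) \<Rightarrow> ('a \<Rightarrow>\<^sub>L 'a) \<Rightarrow> bool" where
  "decomposes A B \<longleftrightarrow> (\<exists>X :: nat \<Rightarrow> nat \<Rightarrow> 'a \<Rightarrow>\<^sub>L 'a. (\<forall>j k. X j k \<in> M) \<and>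
    (\<forall>j k l x y. inner (X j k x) (X j l y) = (if k = l then inner (B x) y else 0)) \<and>
    (\<forall>x. ((\<lambda>(j, k). (norm ((X j k)\<^sup>\<star> x))\<^sup>2) has_sum inner (A x) x) UNIV))"

lemma decomposesI:
  fixes X :: "nat \<Rightarrow> nat \<Rightarrow> 'a \<Rightarrow>\<^sub>L 'a" and A B :: "'a \<Rightarrow>\<^sub>L 'a"
  assumes "\<And>j k. X j k \<in> M"
    "\<And>j k l x y. inner (X j k x) (X j l y) = (if k = l then inner (B x) y else 0)"
    "\<And>x. ((\<lambda>(j, k). (norm ((X j k)\<^sup>\<star> x))\<^sup>2) has_sum inner (A x) x) UNIV"
  shows "decomposes A B"
  unfolding decomposes_def using assms by blast

lemma decomposes_strict:
  assumes "A \<in> M" "pos A" "\<And>x. inner (A x) x \<le> a * (norm x)\<^sup>2" "room A a"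
    and "B \<in> M" "pos B" "B \<noteq> 0" "\<And>x. x \<noteq> 0 \<Longrightarrow> inner (B x) x < a * (norm x)\<^sup>2"
  shows "decomposes A B"
  by (rule sum_of_copies_strict[OF assms(1-7)], erule assms(8)) (rule decomposesI; assumption)

text \<open>The copies of the top part \<open>a *\<^sub>R p\<close> of \<open>B\<close> are placed on the isometries with even index; the rest of \<open>B\<close> is strictly
  below \<open>a\<close> and is summed to what remains of \<open>A\<close>, which has room on the isometries with odd index.\<close>

lemma decomposes_mixed:
  assumes A: "A \<in> M" "pos A" "\<And>x. inner (A x) x \<le> a * (norm x)\<^sup>2" "0 < a"
    and v: "\<And>i :: nat. v i \<in> M" "\<And>i. iso (v i)" "\<And>i j x y. i \<noteq> j \<Longrightarrow> inner (v i x) (v j y) = 0"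
      "\<And>i x. A (v i x) = a *\<^sub>R v i x"
    and B: "B \<in> M" "pos B" "\<And>x. inner (B x) x \<le> a * (norm x)\<^sup>2"
    and p: "p \<in> M" "proj p" "\<And>x. p x = x \<longleftrightarrow> B x = a *\<^sub>R x" and Bp: "B \<noteq> a *\<^sub>R p"
  shows "decomposes A B"
proof -
  note sA = pos_hadj[OF A(2)] and sB = pos_hadj[OF B(2)]
  have Bpx: "B (p x) = a *\<^sub>R p x" for x using p(3)[of "p x"] proj_idem[OF p(2)] by simp
  have pBx: "p (B x) = a *\<^sub>R p x" for x
    by (rule inner_eq_imp_eq) (simp add: proj_inner[OF p(2)] selfadj_inner[OF sB] Bpx)
  define B' where "B' = B - a *\<^sub>R p"
  have B'x: "B' x = B (x - p x)" for x by (simp add: B'_def blinfun.bilinear_simps Bpx)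
  have B'q: "inner (B' x) x = inner (B (x - p x)) (x - p x)" for x
  proof -
    have "inner (B (x - p x)) (p x) = inner (p (B (x - p x))) x" by (simp only: proj_inner[OF p(2)])
    also have "\<dots> = 0" by (simp add: pBx blinfun.diff_right proj_idem[OF p(2)])
    finally show ?thesis by (simp add: B'x inner_diff_right)
  qed
  have B'M: "B' \<in> M" unfolding B'_def by (intro M_diff M_scaleR B p)
  have B'pos: "pos B'"
  proof (rule posI)
    show "B'\<^sup>\<star> = B'" using p(2) by (simp add: B'_def sB proj_def)
    show "0 \<le> inner (B' x) x" for x unfolding B'q by (rule pos_ge0[OF B(2)])
  qed
  have B'p: "B' (p x) = 0" for x by (simp add: B'_def blinfun.bilinear_simps Bpx proj_idem[OF p(2)])
  have B'0: "B' \<noteq> 0" using Bp by (simp add: B'_def)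
  have aB: "pos (a *\<^sub>R id_blinfun - B)"
    by (rule posI) (simp_all add: sB blinfun.bilinear_simps inner_diff_left B(3) flip: power2_norm_eq_inner)
  \<comment> \<open>On the kernel of p equality would make x an eigenvector for a, hence fixed by p.
    Off the kernel the component p x contributes nothing to the form of B' but does contribute to
    the norm.\<close>
  have strict: "inner (B' x) x < a * (norm x)\<^sup>2" if "x \<noteq> 0" for x
  proof (cases "p x = 0")
    case True
    have "inner (B x) x \<noteq> a * (norm x)\<^sup>2"
    proof
      assume "inner (B x) x = a * (norm x)\<^sup>2"
      then have "inner ((a *\<^sub>R id_blinfun - B) x) x = 0"
        by (simp add: blinfun.bilinear_simps inner_diff_left power2_norm_eq_inner)
      then have "(a *\<^sub>R id_blinfun - B) x = 0" by (rule pos_inner_0[OF aB])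
      then have "p x = x" unfolding p(3) by (simp add: blinfun.bilinear_simps)
      then show False using True that by simp
    qed
    then show ?thesis using B(3)[of x] unfolding B'q True by simp
  next
    case False
    have "inner (B' x) x \<le> a * (norm (x - p x))\<^sup>2" unfolding B'q by (rule B(3))
    also have "\<dots> < a * (norm x)\<^sup>2"
      using False A(4) proj_pythagoras[OF p(2), of x] by simp
    finally show ?thesis .
  qed

  define G where "G n = v (2 * n) o\<^sub>L (a *\<^sub>R p) o\<^sub>L (v (2 * n))\<^sup>\<star>" for n
  have vv: "(v i)\<^sup>\<star> (v j x) = (if i = j then x else 0)" for i j x
    using iso_hadj_apply[OF v(2)] iso_hadj_orth[of "v i" "v j"] v(3)[of i j] by auto
  have fam: "orth_family G"
    unfolding orth_family_def
  proof (intro conjI allI impI exI[of _ "a\<^sup>2"])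
    show "inner (G m x) (G n y) = 0" if "m \<noteq> n" for m n x y using that by (simp add: G_def v(3))
    fix N x
    have "(\<Sum>n<N. (norm (G n x))\<^sup>2) \<le> (\<Sum>n<N. a\<^sup>2 * (norm ((v (2 * n))\<^sup>\<star> x))\<^sup>2)"
    proof (rule sum_mono)
      fix n
      have "norm (G n x) = a * norm (p ((v (2 * n))\<^sup>\<star> x))"
        using A(4) v(2)[of "2 * n"] by (simp add: G_def iso_norm blinfun.scaleR_left)
      also have "\<dots> \<le> a * norm ((v (2 * n))\<^sup>\<star> x)"
        using A(4) proj_norm_le[OF p(2)] by (intro mult_left_mono) auto
      finally have "(norm (G n x))\<^sup>2 \<le> (a * norm ((v (2 * n))\<^sup>\<star> x))\<^sup>2" by (rule power_mono) simp
      then show "(norm (G n x))\<^sup>2 \<le> a\<^sup>2 * (norm ((v (2 * n))\<^sup>\<star> x))\<^sup>2" by (simp add: power_mult_distrib)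
    qed
    also have "\<dots> \<le> a\<^sup>2 * (norm x)\<^sup>2"
      unfolding sum_distrib_left[symmetric]
      using iso_bessel[of "{..<N}" "\<lambda>n. v (2 * n)" x] v(2,3) by (intro mult_left_mono) auto
    finally show "(\<Sum>n<N. (norm (G n x))\<^sup>2) \<le> a\<^sup>2 * (norm x)\<^sup>2" .
  qed
  define W where "W = osum G"
  have Wi: "(\<lambda>n. a * inner (p ((v (2 * n))\<^sup>\<star> y)) ((v (2 * n))\<^sup>\<star> x)) sums inner x (W y)" for x y
    using osum_inner_sums[OF fam, of x y]
    by (simp add: W_def G_def blinfun.bilinear_simps inner_commute[of x] inner_hadj_right)
  have Ws: "(\<lambda>n. G n x) sums W x" for x using osum_sums[OF fam] by (simp add: W_def)
  have WM: "W \<in> M" unfolding W_def by (intro M_osum fam, unfold G_def, intro M_compose M_hadj v M_scaleR p)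
  have Wa: "W\<^sup>\<star> = W"
  proof (rule hadj_eqI)
    fix x y
    have "inner (p ((v (2 * n))\<^sup>\<star> y)) ((v (2 * n))\<^sup>\<star> x) = inner (p ((v (2 * n))\<^sup>\<star> x)) ((v (2 * n))\<^sup>\<star> y)" for n
      by (subst proj_inner[OF p(2)]) (rule inner_commute)
    then have "inner x (W y) = inner y (W x)" using Wi[of x y] Wi[of y x] sums_unique2 by simp
    then show "inner (W x) y = inner x (W y)" by (simp add: inner_commute)
  qed
  have Wv: "W (v (2 * n) x) = a *\<^sub>R v (2 * n) (p x)" "W (v (Suc (2 * n)) x) = 0" for n x
  proof -
    have "G m (v (2 * n) x) = (if m = n then a *\<^sub>R v (2 * n) (p x) else 0)" for m
      by (simp add: G_def vv blinfun.bilinear_simps)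
    then show "W (v (2 * n) x) = a *\<^sub>R v (2 * n) (p x)"
      using Ws[of "v (2 * n) x"] sums_single[of n "\<lambda>_. a *\<^sub>R v (2 * n) (p x)"] sums_unique2 by simp
    have "G m (v (Suc (2 * n)) x) = 0" for m
    proof -
      have "2 * m \<noteq> Suc (2 * n)" by presburger
      then show ?thesis by (simp add: G_def vv)
    qed
    then show "W (v (Suc (2 * n)) x) = 0"
      using Ws[of "v (Suc (2 * n)) x"] sums_unique2[OF _ sums_zero] by simp
  qed
  have Wq: "(\<lambda>n. (norm (sqrt a *\<^sub>R p ((v (2 * n))\<^sup>\<star> x)))\<^sup>2) sums inner (W x) x" for x
    using Wi[of x x] A(4) by (simp add: power_mult_distrib proj_norm_sq[OF p(2)] inner_commute)
  define A' where "A' = A - W"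
  have A'M: "A' \<in> M" unfolding A'_def by (intro M_diff A WM)
  have A'q: "inner (A' x) x = inner (A x) x - inner (W x) x" for x by (simp add: A'_def inner_diff_quad)
  have W0: "0 \<le> inner (W x) x" for x by (rule sums_le[OF _ sums_zero Wq]) simp
  have A'pos: "pos A'"
  proof (rule posI)
    show "A'\<^sup>\<star> = A'" by (simp add: A'_def sA Wa)
    fix x
    have "(\<Sum>n<N. (norm (sqrt a *\<^sub>R p ((v (2 * n))\<^sup>\<star> x)))\<^sup>2) \<le> inner (A x) x" for N
    proof -
      have "(\<Sum>n<N. (norm (sqrt a *\<^sub>R p ((v (2 * n))\<^sup>\<star> x)))\<^sup>2) \<le> (\<Sum>n<N. a * (norm ((v (2 * n))\<^sup>\<star> x))\<^sup>2)"
        using A(4) proj_norm_le[OF p(2)] by (intro sum_mono) (simp add: power_mult_distrib mult_left_mono power_mono)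
      also have "\<dots> \<le> inner (A x) x"
      proof -
        define y where "y = (\<Sum>n<N. v (2 * n) ((v (2 * n))\<^sup>\<star> x))"
        have Ay: "A y = a *\<^sub>R y" by (simp add: y_def blinfun.sum_right v(4) scaleR_sum_right)
        have y2: "(norm y)\<^sup>2 = (\<Sum>n<N. (norm ((v (2 * n))\<^sup>\<star> x))\<^sup>2)"
          unfolding y_def using v(2,3) by (subst norm_sq_orthogonal_sum) (auto simp: iso_norm)
        have "inner y x = (\<Sum>n<N. (norm ((v (2 * n))\<^sup>\<star> x))\<^sup>2)"
          by (simp add: y_def inner_sum_left inner_hadj_right[symmetric] power2_norm_eq_inner)
        then have yx: "inner y (x - y) = 0" using y2 by (simp add: inner_diff_right power2_norm_eq_inner)
        have "inner (A x) x = inner (A (y + (x - y))) (y + (x - y))" by simp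
        also have "\<dots> = a * (norm y)\<^sup>2 + inner (A (x - y)) (x - y)"
          unfolding blinfun.add_right inner_add_left inner_add_right Ay
          using selfadj_inner[OF sA, of "x - y" y] yx inner_commute[of "x - y" y]
          by (simp add: Ay power2_norm_eq_inner)
        finally show ?thesis using pos_ge0[OF A(2), of "x - y"] by (simp add: y2 sum_distrib_left)
      qed
      finally show ?thesis .
    qed
    then have "inner (W x) x \<le> inner (A x) x"
      using sums_unique[OF Wq] suminf_le_const[OF sums_summable[OF Wq]] by metis
    then show "0 \<le> inner (A' x) x" by (simp add: A'q)
  qed
  have A'b: "inner (A' x) x \<le> a * (norm x)\<^sup>2" for x using A(3)[of x] W0[of x] by (simp add: A'q)
  have "room A' a"
  proof (rule room_eigen[OF A'pos less_imp_le[OF A(4)]])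
    show "v (Suc (2 * n)) \<in> M" "iso (v (Suc (2 * n)))" for n by (rule v)+
    show "inner (v (Suc (2 * i)) x) (v (Suc (2 * j)) y) = 0" if "i \<noteq> j" for i j x y
      by (rule v) (use that in simp)
    show "A' (v (Suc (2 * n)) x) = a *\<^sub>R v (Suc (2 * n)) x" for n x
      by (simp add: A'_def blinfun.diff_left Wv v(4))
  qed
  then obtain X' :: "nat \<Rightarrow> nat \<Rightarrow> 'a \<Rightarrow>\<^sub>L 'a" where X': "\<And>j k. X' j k \<in> M"
    "\<And>j k l x y. inner (X' j k x) (X' j l y) = (if k = l then inner (B' x) y else 0)"
    "\<And>x. ((\<lambda>(j, k). (norm ((X' j k)\<^sup>\<star> x))\<^sup>2) has_sum inner (A' x) x) UNIV"
    using decomposes_strict[OF A'M A'pos A'b _ B'M B'pos B'0 strict] unfolding decomposes_def by blast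
  define XP where "XP j k = v (2 * prod_encode (j, k)) o\<^sub>L (sqrt a *\<^sub>R p)" for j k
  have XPM: "XP j k \<in> M" for j k unfolding XP_def by (intro M_compose v M_scaleR p)
  have XPi: "inner (XP j k x) (XP j l y) = (if k = l then a * inner (p x) y else 0)" for j k l x y
    using A(4) by (simp add: XP_def v(3) iso_inner[OF v(2)] blinfun.bilinear_simps proj_inner[OF p(2)] proj_idem[OF p(2)])
  have pa: "p\<^sup>\<star> = p" using p(2) by (simp add: proj_def)
  have XPa: "(XP j k)\<^sup>\<star> x = sqrt a *\<^sub>R p ((v (2 * prod_encode (j, k)))\<^sup>\<star> x)" for j k x
    by (simp add: XP_def pa blinfun.scaleR_left)
  \<comment> \<open>A' vanishes on the ranges of the copies XP, and the squares of the adjoints of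
    the X' add up to the form of A'; so the two kinds of copies have orthogonal ranges.\<close>
  have X'XP: "(X' j k)\<^sup>\<star> (XP j' l y) = 0" for j k j' l y
  proof -
    have "A' (XP j' l y) = 0"
      by (simp add: A'_def XP_def blinfun.bilinear_simps v(4) Wv proj_idem[OF p(2)])
    then have "((\<lambda>(j, k). (norm ((X' j k)\<^sup>\<star> (XP j' l y)))\<^sup>2) has_sum 0) UNIV" using X'(3)[of "XP j' l y"] by simp
    from nonneg_has_sum_le_0D[OF this, of "(j, k)"] show ?thesis by auto
  qed
  have X'o: "inner (X' j k x) (XP j' l y) = 0" for j k x j' l y
    using X'XP[of j k j' l y] by (simp flip: inner_hadj_right)
  show ?thesis
  proof (rule decomposesI)
    show "XP j k + X' j k \<in> M" for j k by (intro M_add XPM X')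
    show "inner ((XP j k + X' j k) x) ((XP j l + X' j l) y) = (if k = l then inner (B x) y else 0)" for j k l x y
      using X'o[of j k x j l y] X'o[of j l y j k x] inner_commute[of "XP j k x" "X' j l y"]
      by (simp add: blinfun.add_left inner_add_left inner_add_right XPi X'(2))
        (simp add: B'_def blinfun.bilinear_simps inner_diff_left)
    fix x
    have "inner (X' j k (p y)) (X' j k (p y)) = 0" for j k y unfolding X'(2) by (simp add: B'p)
    then have X'p: "X' j k (p y) = 0" for j k y by simp
    have pX': "p ((X' j k)\<^sup>\<star> x) = 0" for j k
      by (rule inner_eq_imp_eq) (simp add: proj_inner[OF p(2)] inner_hadj_left X'p)
    \<comment> \<open>On the source side the parts are orthogonal too: the adjoint of XP maps into
      the range of p, that of X' into its kernel.\<close>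
    have sq: "(norm ((XP j k + X' j k)\<^sup>\<star> x))\<^sup>2 = (norm ((XP j k)\<^sup>\<star> x))\<^sup>2 + (norm ((X' j k)\<^sup>\<star> x))\<^sup>2" for j k
    proof -
      have "inner ((XP j k)\<^sup>\<star> x) ((X' j k)\<^sup>\<star> x) = 0" by (simp add: XPa proj_inner[OF p(2)] pX')
      then show ?thesis using inner_commute[of "(XP j k)\<^sup>\<star> x" "(X' j k)\<^sup>\<star> x"]
        by (simp add: blinfun.add_left power2_norm_eq_inner inner_add_left inner_add_right)
    qed
    have "((\<lambda>n. (norm (sqrt a *\<^sub>R p ((v (2 * n))\<^sup>\<star> x)))\<^sup>2) has_sum inner (W x) x) UNIV"
      by (rule sums_nonneg_imp_has_sum[OF Wq]) simp
    then have "((\<lambda>jk. (norm (sqrt a *\<^sub>R p ((v (2 * prod_encode jk))\<^sup>\<star> x)))\<^sup>2) has_sum inner (W x) x) UNIV"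
      by (subst has_sum_reindex_bij_betw[OF bij_prod_encode, of "\<lambda>n. (norm (sqrt a *\<^sub>R p ((v (2 * n))\<^sup>\<star> x)))\<^sup>2"])
    then have "((\<lambda>(j, k). (norm ((XP j k)\<^sup>\<star> x))\<^sup>2) has_sum inner (W x) x) UNIV"
      by (simp add: XPa case_prod_unfold)
    from has_sum_add[OF this X'(3)[of x]]
    show "((\<lambda>(j, k). (norm ((XP j k + X' j k)\<^sup>\<star> x))\<^sup>2) has_sum inner (A x) x) UNIV"
      by (simp add: sq case_prod_unfold A'q del: hadj_add)
  qed
qed

text \<open>An infinite multiple Q of p dominates an isometry, as E does by assumption. So both are
  ranges of isometries s and w in M, and w \<open>s\<^sup>\<star>\<close> carries Q, an orthogonal
  sum of copies of p, onto E.\<close>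

lemma decomposes_projection:
  assumes E: "E \<in> M" "proj E" and u0: "u0 \<in> M" "iso u0" "\<And>x. E (u0 x) = u0 x"
    and p: "p \<in> M" "proj p" "p \<noteq> 0" and a: "0 < a"
  shows "decomposes (a *\<^sub>R E) (a *\<^sub>R p)"
proof -
  obtain w where w: "w \<in> M" "iso w" "w o\<^sub>L w\<^sup>\<star> = E" using isometry_onto[OF E u0] by blast
  obtain U :: "nat \<Rightarrow> 'a \<Rightarrow>\<^sub>L 'a" where U: "\<And>k. U k \<in> M" "\<And>k. iso (U k)"
    "\<And>k l x y. k \<noteq> l \<Longrightarrow> inner (U k x) (U l y) = 0" using unit_isometries by blast
  have UU: "(U k)\<^sup>\<star> (U l x) = (if k = l then x else 0)" for k l x
    using iso_hadj_apply[OF U(2)] iso_hadj_orth[of "U k" "U l"] U(3)[of k l] by auto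
  define P where "P k = U k o\<^sub>L p o\<^sub>L (U k)\<^sup>\<star>" for k
  have pa: "p\<^sup>\<star> = p" using p(2) by (simp add: proj_def)
  have Pp: "proj (P k)" for k
    by (rule projI)
      (simp_all add: P_def UU pa proj_idem[OF p(2)] inner_hadj_left inner_hadj_right[symmetric] proj_inner[OF p(2)])
  have Po: "P m (P n x) = 0" if "m \<noteq> n" for m n x using that by (simp add: P_def UU)
  have fam: "orth_family P" by (rule orth_family_proj[OF Pp]) (rule Po)
  define Q where "Q = osum P"
  have Qp: "proj Q" unfolding Q_def by (rule osum_proj_apply(2)[OF Pp]) (rule Po)
  have PQ: "P n (Q x) = P n x" for n x unfolding Q_def by (rule osum_proj_apply(1)[OF Pp]) (rule Po)
  have QM: "Q \<in> M" unfolding Q_def by (intro M_osum fam, unfold P_def, intro M_compose M_hadj U p)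
  have QU: "Q (U k (p x)) = U k (p x)" for k x
  proof -
    have "Q (P k y) = P k y" for y
      by (rule inner_eq_imp_eq) (simp add: proj_inner[OF Qp] proj_inner[OF Pp] PQ)
    from this[of "U k x"] show ?thesis by (simp add: P_def UU)
  qed
  obtain v t :: "nat \<Rightarrow> 'a \<Rightarrow>\<^sub>L 'a" where v: "\<And>k. v k \<in> M" "\<And>k. iso (v k)"
    "\<And>k x. (\<lambda>m. (U (prod_encode (k, m)) o\<^sub>L p) (t m x)) sums v k x"
    "\<And>k l x y. k \<noteq> l \<Longrightarrow> inner (v k x) (v l y) = 0"
  proof (rule isometries_from_copies[OF p, of "\<lambda>n. U n o\<^sub>L p"])
    show "U n o\<^sub>L p \<in> M" for n by (intro M_compose U p)
    show "inner ((U m o\<^sub>L p) x) ((U n o\<^sub>L p) y) = (if m = n then inner (p x) y else 0)" for m n x y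
      by (simp add: U(3) iso_inner[OF U(2)] proj_inner[OF p(2)] proj_idem[OF p(2)])
  qed (rule that; assumption)
  have Qv: "Q (v 0 x) = v 0 x" for x
    by (rule proj_preserved_sums[OF v(3)]) (simp add: QU)
  obtain s where s: "s \<in> M" "iso s" "s o\<^sub>L s\<^sup>\<star> = Q" using isometry_onto[OF QM Qp v(1,2) Qv] by blast
  have ss: "s (s\<^sup>\<star> x) = Q x" "w (w\<^sup>\<star> x) = E x" for x using s(3) w(3) by (metis blinfun_apply_blinfun_compose)+
  define X where "X n = sqrt a *\<^sub>R (w o\<^sub>L s\<^sup>\<star> o\<^sub>L U n o\<^sub>L p)" for n
  have XM: "X n \<in> M" for n unfolding X_def by (intro M_scaleR M_compose M_hadj w s U p)
  have Xi: "inner (X m x) (X n y) = (if m = n then a * inner (p x) y else 0)" for m n x y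
  proof -
    have "inner (X m x) (X n y) = a * inner (s\<^sup>\<star> (U m (p x))) (s\<^sup>\<star> (U n (p y)))"
      using a by (simp add: X_def blinfun.scaleR_left iso_inner[OF w(2)])
    also have "inner (s\<^sup>\<star> (U m (p x))) (s\<^sup>\<star> (U n (p y))) = inner (U m (p x)) (U n (p y))"
      by (simp add: inner_hadj_left ss QU)
    also have "\<dots> = (if m = n then inner (p x) y else 0)"
      by (simp add: U(3) iso_inner[OF U(2)] proj_inner[OF p(2)] proj_idem[OF p(2)])
    finally show ?thesis by simp
  qed
  have Xs: "(\<lambda>n. (norm ((X n)\<^sup>\<star> x))\<^sup>2) sums (a * inner (E x) x)" for x
  proof -
    define y where "y = s (w\<^sup>\<star> x)"
    have "Q y = y" unfolding y_def ss(1)[symmetric] by (simp add: iso_hadj_apply[OF s(2)])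
    then have "(\<lambda>n. (norm (P n y))\<^sup>2) sums (norm y)\<^sup>2" using osum_norm_sq[OF fam, of y] by (simp add: Q_def)
    moreover have "norm (P n y) = norm (p ((U n)\<^sup>\<star> y))" for n using U(2)[of n] by (simp add: P_def iso_norm)
    moreover have "(norm y)\<^sup>2 = inner (E x) x"
    proof -
      have "(norm y)\<^sup>2 = (norm (w\<^sup>\<star> x))\<^sup>2" using s(2) by (simp add: y_def iso_norm)
      also have "\<dots> = inner (E x) x" by (simp add: power2_norm_eq_inner inner_hadj_right ss)
      finally show ?thesis .
    qed
    ultimately have "(\<lambda>n. a * (norm (p ((U n)\<^sup>\<star> y)))\<^sup>2) sums (a * inner (E x) x)" by (intro sums_mult) simp
    moreover have "(norm ((X n)\<^sup>\<star> x))\<^sup>2 = a * (norm (p ((U n)\<^sup>\<star> y)))\<^sup>2" for n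
      using a by (simp add: X_def pa blinfun.scaleR_left power_mult_distrib y_def)
    ultimately show ?thesis by simp
  qed
  show ?thesis
  proof (rule decomposesI[of "\<lambda>j k. X (prod_encode (j, k))"])
    fix x
    have "((\<lambda>n. (norm ((X n)\<^sup>\<star> x))\<^sup>2) has_sum (a * inner (E x) x)) UNIV"
      by (rule sums_nonneg_imp_has_sum[OF Xs]) simp
    then have "((\<lambda>jk. (norm ((X (prod_encode jk))\<^sup>\<star> x))\<^sup>2) has_sum (a * inner (E x) x)) UNIV"
      by (subst has_sum_reindex_bij_betw[OF bij_prod_encode, of "\<lambda>n. (norm ((X n)\<^sup>\<star> x))\<^sup>2"])
    then show "((\<lambda>(j, k). (norm ((X (prod_encode (j, k)))\<^sup>\<star> x))\<^sup>2) has_sum inner ((a *\<^sub>R E) x) x) UNIV"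
      by (simp add: case_prod_unfold blinfun.scaleR_left)
  qed (simp_all add: XM Xi blinfun.scaleR_left)
qed

text \<open>The double family is enumerated, and \<open>pos_norm_sq_le\<close> applied to the
  positive remainders R N turns convergence of forms into strong convergence. The null space of each
  \<open>X n X\<^sup>\<star> n\<close>-type term contains the ranges of all other members of its
  row, that is infinitely many orthogonal copies of the support of B.\<close>

lemma decomposes_imp_series:
  assumes A: "A \<in> M" "pos A" and B: "B \<in> M" "pos B" "B \<noteq> 0" and dec: "decomposes A B"
  obtains X :: "nat \<Rightarrow> 'a \<Rightarrow>\<^sub>L 'a" where "\<And>n. X n \<in> M" "\<And>n. (X n)\<^sup>\<star> o\<^sub>L X n = B"
    "\<And>x. (\<lambda>N. (\<Sum>n<N. X n o\<^sub>L (X n)\<^sup>\<star>) x) \<longlonglongrightarrow> A x"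
    "\<And>n. \<exists>w\<in>M. w\<^sup>\<star> o\<^sub>L w = hproj {x. (X n o\<^sub>L (X n)\<^sup>\<star>) x = 0} \<and>
      hproj {x. (X n o\<^sub>L (X n)\<^sup>\<star>) x = 0} o\<^sub>L w = w \<and> w o\<^sub>L w\<^sup>\<star> \<noteq> hproj {x. (X n o\<^sub>L (X n)\<^sup>\<star>) x = 0}"
proof -
  note sA = pos_hadj[OF A(2)] and sB = pos_hadj[OF B(2)]
  from dec obtain X :: "nat \<Rightarrow> nat \<Rightarrow> 'a \<Rightarrow>\<^sub>L 'a" where XM: "\<And>j k. X j k \<in> M"
    and Xi: "\<And>j k l x y. inner (X j k x) (X j l y) = (if k = l then inner (B x) y else 0)"
    and Xs: "\<And>x. ((\<lambda>(j, k). (norm ((X j k)\<^sup>\<star> x))\<^sup>2) has_sum inner (A x) x) UNIV"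
    unfolding decomposes_def by blast
  define Y where "Y n = X (fst (prod_decode n)) (snd (prod_decode n))" for n
  have YB: "(Y n)\<^sup>\<star> o\<^sub>L Y n = B" for n
    by (subst hadj_compose_eq_iff[OF sB]) (simp add: Y_def power2_norm_eq_inner Xi)
  have Ys: "(\<lambda>n. (norm ((Y n)\<^sup>\<star> x))\<^sup>2) sums inner (A x) x" for x
  proof -
    have "((\<lambda>n. case prod_decode n of (j, k) \<Rightarrow> (norm ((X j k)\<^sup>\<star> x))\<^sup>2) has_sum inner (A x) x) UNIV"
      by (subst has_sum_reindex_bij_betw[OF bij_prod_decode, of "\<lambda>(j, k). (norm ((X j k)\<^sup>\<star> x))\<^sup>2"]) (rule Xs)
    then show ?thesis by (intro has_sum_imp_sums) (simp add: Y_def case_prod_unfold)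
  qed
  show thesis
  proof (rule that[of Y])
    show "Y n \<in> M" for n unfolding Y_def by (rule XM)
    show "(Y n)\<^sup>\<star> o\<^sub>L Y n = B" for n by (rule YB)
    fix x
    define R where "R N = A - (\<Sum>n<N. Y n o\<^sub>L (Y n)\<^sup>\<star>)" for N
    have Rq: "inner (R N y) y = inner (A y) y - (\<Sum>n<N. (norm ((Y n)\<^sup>\<star> y))\<^sup>2)" for N y
      by (simp add: R_def blinfun.diff_left inner_diff_left blinfun.sum_left inner_sum_left
        inner_hadj_right[symmetric] power2_norm_eq_inner)
    have Rle: "inner (R N y) y \<le> norm A * (norm y)\<^sup>2" for N y
      using inner_le_norm[of A y] sum_nonneg[of "{..<N}" "\<lambda>n. (norm ((Y n)\<^sup>\<star> y))\<^sup>2"] by (simp add: Rq)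
    have Rpos: "pos (R N)" for N
    proof (rule posI)
      have "(\<Sum>n<N. Y n o\<^sub>L (Y n)\<^sup>\<star>)\<^sup>\<star> = (\<Sum>n<N. Y n o\<^sub>L (Y n)\<^sup>\<star>)" by (induction N) simp_all
      then show "(R N)\<^sup>\<star> = R N" by (simp add: R_def sA)
      show "0 \<le> inner (R N y) y" for y
        unfolding Rq using sums_finite_nonneg_le[OF Ys, of y N] by simp
    qed
    have "(\<lambda>N. inner (A x) x - (\<Sum>n<N. (norm ((Y n)\<^sup>\<star> x))\<^sup>2)) \<longlonglongrightarrow> inner (A x) x - inner (A x) x"
      using Ys[of x] unfolding sums_def by (intro tendsto_intros)
    then have "(\<lambda>N. norm A * inner (R N x) x) \<longlonglongrightarrow> norm A * 0" unfolding Rq by (intro tendsto_intros) simp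
    then have "(\<lambda>N. sqrt (norm A * inner (R N x) x)) \<longlonglongrightarrow> sqrt 0" by (intro tendsto_real_sqrt) simp
    then have lim: "(\<lambda>N. sqrt (norm A * inner (R N x) x)) \<longlonglongrightarrow> 0" by simp
    have "(\<lambda>N. norm (R N x)) \<longlonglongrightarrow> 0"
    proof (rule tendsto_sandwich[OF _ _ tendsto_const lim])
      show "\<forall>\<^sub>F N in sequentially. norm (R N x) \<le> sqrt (norm A * inner (R N x) x)"
        by (intro always_eventually allI real_le_rsqrt pos_norm_sq_le Rpos Rle)
    qed simp
    then have "(\<lambda>N. R N x) \<longlonglongrightarrow> 0" by (rule tendsto_norm_zero_cancel)
    then have "(\<lambda>N. A x - R N x) \<longlonglongrightarrow> A x - 0" by (intro tendsto_intros)
    then show "(\<lambda>N. (\<Sum>n<N. Y n o\<^sub>L (Y n)\<^sup>\<star>) x) \<longlonglongrightarrow> A x" by (simp add: R_def blinfun.diff_left)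
  next
    fix n
    define j where "j = fst (prod_decode n)"
    define k where "k = snd (prod_decode n)"
    define C where "C = Y n o\<^sub>L (Y n)\<^sup>\<star>"
    define N where "N = hproj {x. C x = 0}"
    have Yn: "Y n = X j k" by (simp add: Y_def j_def k_def)
    have CM: "C \<in> M" unfolding C_def by (intro M_compose M_hadj) (simp_all add: Y_def XM)
    have NM: "N \<in> M" unfolding N_def by (rule M_hproj_ker[OF CM])
    have Np: "proj N" unfolding N_def by (intro proj_hproj subspace_ker closed_ker)
    define good where "good l WQ \<longleftrightarrow> fst WQ \<in> M \<and> snd WQ \<in> M \<and> proj (snd WQ) \<and>
      (fst WQ)\<^sup>\<star> o\<^sub>L fst WQ = snd WQ \<and> (\<forall>x. snd WQ x = 0 \<longleftrightarrow> B x = 0) \<and>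
      (\<forall>z. fst WQ z \<in> closure (range (X j l)))" for l and WQ :: "('a \<Rightarrow>\<^sub>L 'a) \<times> ('a \<Rightarrow>\<^sub>L 'a)"
    have "\<exists>WQ. good l WQ" for l
    proof -
      obtain W Q :: "'a \<Rightarrow>\<^sub>L 'a" where W: "W \<in> M" "Q \<in> M" "proj Q" "W\<^sup>\<star> o\<^sub>L W = Q"
        "\<And>x. Q x = 0 \<longleftrightarrow> X j l x = 0" "\<And>z. W z \<in> closure (range (X j l))"
        using M_polar[OF XM, of j l] by metis
      have "X j l x = 0 \<longleftrightarrow> B x = 0" for x
        using Xi[of j l x l x] pos_inner_0[OF B(2), of x] by (metis inner_eq_zero_iff inner_zero_left)
      then have "good l (W, Q)" using W by (simp add: good_def)
      then show ?thesis ..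
    qed
    then have "\<forall>l. \<exists>WQ. good l WQ" ..
    from choice[OF this] obtain WQ where WQ: "\<And>l. good l (WQ l)" by blast
    define W where "W l = fst (WQ l)" for l
    define Q where "Q l = snd (WQ l)" for l
    have W: "W l \<in> M" "Q l \<in> M" "proj (Q l)" "(W l)\<^sup>\<star> o\<^sub>L W l = Q l"
      "Q l x = 0 \<longleftrightarrow> B x = 0" "W l z \<in> closure (range (X j l))" for l x z
      using WQ[of l] by (simp_all add: good_def W_def Q_def)
    have Qeq: "Q l = Q 0" for l
    proof -
      have 0: "Q i (x - Q i x) = 0" for i x by (simp add: blinfun.diff_right proj_idem[OF W(3)])
      have "Q l (x - Q 0 x) = 0" "Q 0 (x - Q l x) = 0" for x
        using 0[of 0 x] 0[of l x] W(5)[of 0] W(5)[of l] by blast+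
      then have a: "Q l x = Q l (Q 0 x)" "Q 0 x = Q 0 (Q l x)" for x by (simp_all add: blinfun.diff_right)
      show ?thesis
        by (rule blinfun_inner_eqI) (metis a proj_inner[OF W(3)])
    qed
    have Worth: "inner (W l x) (W m y) = 0" if "l \<noteq> m" for l m x y
    proof -
      obtain s where s: "(\<lambda>i. X j l (s i)) \<longlonglongrightarrow> W l x" using closure_range_sequence W(6) by blast
      obtain r where r: "(\<lambda>i. X j m (r i)) \<longlonglongrightarrow> W m y" using closure_range_sequence W(6) by blast
      have "(\<lambda>i. inner (X j l (s i)) (X j m (r i))) \<longlonglongrightarrow> inner (W l x) (W m y)" by (intro tendsto_intros s r)
      then show ?thesis using that by (simp add: Xi LIMSEQ_const_iff)
    qed
    \<comment> \<open>Only the members after position k of the row are used; the offset 1 skips the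
      member itself.\<close>
    define w where "w i = W (Suc (k + i))" for i
    have wi: "inner (w m x) (w i y) = (if m = i then inner (Q 0 x) y else 0)" for m i x y
    proof (cases "m = i")
      case True
      have "inner (W l x) (W l y) = inner (Q 0 x) y" for l
        using W(4)[of l] Qeq[of l] by (metis blinfun_apply_blinfun_compose inner_hadj_left)
      then show ?thesis using True by (simp add: w_def)
    qed (simp add: w_def Worth)
    have "Q 0 \<noteq> 0"
    proof
      assume "Q 0 = 0"
      then have "B x = 0" for x using W(5)[of 0 x] by simp
      then show False using B(3) by (metis blinfun_eqI zero_blinfun.rep_eq)
    qed
    obtain v t :: "nat \<Rightarrow> 'a \<Rightarrow>\<^sub>L 'a" where v: "\<And>i. v i \<in> M" "\<And>i. iso (v i)"
      "\<And>i x. (\<lambda>m. w (prod_encode (i, m)) (t m x)) sums v i x"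
    proof (rule isometries_from_copies[OF W(2,3) \<open>Q 0 \<noteq> 0\<close> _ wi])
      show "w i \<in> M" for i unfolding w_def by (rule W)
    qed (rule that; assumption)
    have Nw: "N (w i x) = w i x" for i x
    proof -
      obtain s where s: "(\<lambda>m. X j (Suc (k + i)) (s m)) \<longlonglongrightarrow> w i x" using closure_range_sequence W(6) unfolding w_def by blast
      have "(X j k)\<^sup>\<star> (X j (Suc (k + i)) y) = 0" for y
        by (rule inner_eq_imp_eq) (simp add: inner_hadj_left Xi)
      then have "C (X j (Suc (k + i)) y) = 0" for y by (simp add: C_def Yn)
      then have "(\<lambda>m. 0) \<longlonglongrightarrow> C (w i x)" using blinfun_tendsto[OF s, of C] by simp
      then have "C (w i x) = 0" by (simp add: LIMSEQ_const_iff)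
      then show ?thesis unfolding N_def by (intro hproj_eq_self subspace_ker closed_ker) simp
    qed
    have "N (v 0 x) = v 0 x" for x by (rule proj_preserved_sums[OF v(3) Nw])
    from infinite_if_dominates_isometry[OF NM Np v(1,2) this]
    show "\<exists>w\<in>M. w\<^sup>\<star> o\<^sub>L w = hproj {x. (Y n o\<^sub>L (Y n)\<^sup>\<star>) x = 0} \<and>
      hproj {x. (Y n o\<^sub>L (Y n)\<^sup>\<star>) x = 0} o\<^sub>L w = w \<and> w o\<^sub>L w\<^sup>\<star> \<noteq> hproj {x. (Y n o\<^sub>L (Y n)\<^sup>\<star>) x = 0}"
      unfolding N_def C_def .
  qed
qed

text \<open>For y = X n (p x) the bounds \<open>(norm ((X n)\<^sup>\<star> y))\<^sup>2\<close> \<le>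
  <A y, y> \<le> a |y|^2 are equalities. Equality in the second makes y an eigenvector of A, and
  equality in the first leaves nothing for the other X m, so the ranges of the X n p are orthogonal
  copies of p under E.\<close>

lemma necessity:
  assumes A: "A \<in> M" "pos A" "\<And>x. inner (A x) x \<le> a * (norm x)\<^sup>2" "0 < a"
    and X: "\<And>n :: nat. X n \<in> M" "\<And>n. (X n)\<^sup>\<star> o\<^sub>L X n = B"
      "\<And>x. (\<lambda>N. (\<Sum>n<N. X n o\<^sub>L (X n)\<^sup>\<star>) x) \<longlonglongrightarrow> A x"
    and p: "p \<in> M" "proj p" "p \<noteq> 0" "\<And>x. p x = x \<longleftrightarrow> B x = a *\<^sub>R x"
    and E: "E \<in> M" "proj E" "\<And>x. E x = x \<longleftrightarrow> A x = a *\<^sub>R x"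
  shows "\<exists>w\<in>M. w\<^sup>\<star> o\<^sub>L w = E \<and> E o\<^sub>L w = w \<and> w o\<^sub>L w\<^sup>\<star> \<noteq> E"
    and "B = a *\<^sub>R p \<Longrightarrow> A = a *\<^sub>R E"
proof -
  note sA = pos_hadj[OF A(2)]
  have Xi: "inner (X n x) (X n y) = inner (B x) y" for n x y
    using X(2)[of n] by (metis blinfun_apply_blinfun_compose inner_hadj_left)
  have XX: "(X n)\<^sup>\<star> (X n x) = B x" for n x using X(2) by (metis blinfun_apply_blinfun_compose)
  have Xs: "(\<lambda>n. (norm ((X n)\<^sup>\<star> x))\<^sup>2) sums inner (A x) x" for x
  proof -
    have "(\<lambda>N. inner ((\<Sum>n<N. X n o\<^sub>L (X n)\<^sup>\<star>) x) x) \<longlonglongrightarrow> inner (A x) x" by (intro tendsto_intros X)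
    then show ?thesis
      by (simp add: sums_def blinfun.sum_left inner_sum_left inner_hadj_right[symmetric] power2_norm_eq_inner)
  qed
  have Bp: "B (p x) = a *\<^sub>R p x" for x using p(4)[of "p x"] proj_idem[OF p(2)] by simp
  have aA: "pos (a *\<^sub>R id_blinfun - A)"
    by (rule posI) (simp_all add: sA blinfun.bilinear_simps inner_diff_left A(3) flip: power2_norm_eq_inner)
  have key: "A (X n (p x)) = a *\<^sub>R X n (p x) \<and> (\<forall>m. m \<noteq> n \<longrightarrow> (X m)\<^sup>\<star> (X n (p x)) = 0)" for n x
  proof -
    define y where "y = X n (p x)"
    have "(X n)\<^sup>\<star> y = a *\<^sub>R p x" by (simp add: y_def XX Bp)
    moreover have "(norm y)\<^sup>2 = a * (norm (p x))\<^sup>2" by (simp add: y_def power2_norm_eq_inner Xi Bp)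
    ultimately have n: "(norm ((X n)\<^sup>\<star> y))\<^sup>2 = a * (norm y)\<^sup>2" by (simp add: power_mult_distrib power2_eq_square)
    have le: "(norm ((X n)\<^sup>\<star> y))\<^sup>2 + (norm ((X m)\<^sup>\<star> y))\<^sup>2 \<le> inner (A y) y" if "m \<noteq> n" for m
    proof -
      have "((\<lambda>n. (norm ((X n)\<^sup>\<star> y))\<^sup>2) has_sum inner (A y) y) UNIV" by (rule sums_nonneg_imp_has_sum[OF Xs]) simp
      from finite_sum_le_has_sum[OF this, of "{n, m}"] that show ?thesis by simp
    qed
    \<comment> \<open>\<open>Suc n\<close> merely serves as some index different from n.\<close>
    have "inner (A y) y = a * (norm y)\<^sup>2"
      using le[of "Suc n"] n A(3)[of y] zero_le_power2[of "norm ((X (Suc n))\<^sup>\<star> y)"] by linarith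
    then have "inner ((a *\<^sub>R id_blinfun - A) y) y = 0"
      by (simp add: blinfun.bilinear_simps inner_diff_left power2_norm_eq_inner)
    then have "(a *\<^sub>R id_blinfun - A) y = 0" by (rule pos_inner_0[OF aA])
    then have "A y = a *\<^sub>R y" by (simp add: blinfun.bilinear_simps)
    moreover have "(X m)\<^sup>\<star> y = 0" if "m \<noteq> n" for m
      using le[OF that] n A(3)[of y] zero_le_power2[of "norm ((X m)\<^sup>\<star> y)"] by (smt (verit) norm_eq_zero zero_eq_power2)
    ultimately show ?thesis by (simp add: y_def)
  qed
  have EX: "E (X n (p x)) = X n (p x)" for n x unfolding E(3) using key by blast
  define w where "w n = (1 / sqrt a) *\<^sub>R (X n o\<^sub>L p)" for n
  have wi: "inner (w m x) (w n y) = (if m = n then inner (p x) y else 0)" for m n x y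
  proof (cases "m = n")
    case True
    then show ?thesis using A(4)
      by (simp add: w_def blinfun.scaleR_left Xi Bp proj_inner[OF p(2)] proj_idem[OF p(2)])
  next
    case False
    have "inner (X m (p x)) (X n (p y)) = inner (p x) ((X m)\<^sup>\<star> (X n (p y)))" by (simp add: inner_hadj_right)
    also have "\<dots> = 0" using key[of n y] False by simp
    finally show ?thesis using False by (simp add: w_def blinfun.scaleR_left)
  qed
  obtain v t :: "nat \<Rightarrow> 'a \<Rightarrow>\<^sub>L 'a" where v: "\<And>i. v i \<in> M" "\<And>i. iso (v i)"
    "\<And>i x. (\<lambda>m. w (prod_encode (i, m)) (t m x)) sums v i x"
  proof (rule isometries_from_copies[OF p(1,2,3) _ wi])
    show "w i \<in> M" for i unfolding w_def by (intro M_scaleR M_compose X p)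
  qed (rule that; assumption)
  have "E (v 0 x) = v 0 x" for x
    by (rule proj_preserved_sums[OF v(3)]) (simp add: w_def blinfun.scaleR_left blinfun.scaleR_right EX)
  from infinite_if_dominates_isometry[OF E(1,2) v(1,2) this]
  show "\<exists>w\<in>M. w\<^sup>\<star> o\<^sub>L w = E \<and> E o\<^sub>L w = w \<and> w o\<^sub>L w\<^sup>\<star> \<noteq> E" .
  assume Ba: "B = a *\<^sub>R p"
  have EXx: "E (X n x) = X n x" for n x
  proof -
    have "inner (X n (x - p x)) (X n (x - p x)) = 0"
      unfolding Xi by (simp add: Ba blinfun.bilinear_simps proj_idem[OF p(2)])
    then have "X n x = X n (p x)" by (simp add: blinfun.diff_right)
    then show ?thesis using EX by simp
  qed
  have EA: "E (A x) = A x" for x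
  proof -
    have "(\<lambda>N. E ((\<Sum>n<N. X n o\<^sub>L (X n)\<^sup>\<star>) x)) \<longlonglongrightarrow> E (A x)" by (rule blinfun_tendsto[OF X(3)])
    then have "(\<lambda>N. (\<Sum>n<N. X n o\<^sub>L (X n)\<^sup>\<star>) x) \<longlonglongrightarrow> E (A x)"
      by (simp add: blinfun.sum_left blinfun.sum_right EXx)
    then show ?thesis using X(3) LIMSEQ_unique by blast
  qed
  have AE: "A (E x) = a *\<^sub>R E x" for x using E(3)[of "E x"] proj_idem[OF E(2)] by simp
  show "A = a *\<^sub>R E"
  proof (rule blinfun_inner_eqI)
    fix x y
    have "inner (A x) y = inner (E (A x)) y" by (simp add: EA)
    also have "\<dots> = inner x (A (E y))" by (simp add: proj_inner[OF E(2)] selfadj_inner[OF sA])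
    also have "\<dots> = inner ((a *\<^sub>R E) x) y" by (simp add: AE blinfun.scaleR_left proj_inner[OF E(2)])
    finally show "inner (A x) y = inner ((a *\<^sub>R E) x) y" .
  qed
qed

end

subsection \<open>Operators on a complex Hilbert space as real operators\<close>

instance complex_hilbert_space \<subseteq> banach ..

lemma Im_cinner: "Im (cinner x y) = inner x (\<i> *\<^sub>C (y :: 'a::complex_hilbert_space))"
proof -
  have "cinner x (\<i> *\<^sub>C y) = cnj (\<i> * cinner y x)"
    by (subst cinner_commute) (simp add: cinner_scaleC_left)
  also have "\<dots> = - \<i> * cinner x y" by (subst (2) cinner_commute) simp
  finally have "Re (cinner x (\<i> *\<^sub>C y)) = Im (cinner x y)" by simp
  then show ?thesis by (simp add: Re_cinner)
qed

lemma inner_scaleC_left: "inner (c *\<^sub>C x) y = inner x (cnj c *\<^sub>C (y :: 'a::complex_hilbert_space))"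
proof -
  have "cinner x (cnj c *\<^sub>C y) = cnj (cnj c * cinner y x)"
    by (subst cinner_commute) (simp add: cinner_scaleC_left)
  also have "\<dots> = c * cinner x y" by (subst (2) cinner_commute) simp
  also have "\<dots> = cinner (c *\<^sub>C x) y" by (simp add: cinner_scaleC_left)
  finally show ?thesis by (metis Re_cinner)
qed

lemma bounded_ops_iff:
  fixes T :: "'a::complex_hilbert_space bop"
  shows "T \<in> bounded_ops \<longleftrightarrow> (\<forall>c x. T (c *\<^sub>C x) = c *\<^sub>C T x)"
  by (simp add: bounded_ops_def)

lemma hadj_bounded_ops:
  fixes T :: "'a::complex_hilbert_space bop"
  assumes "T \<in> bounded_ops" shows "T\<^sup>\<star> \<in> bounded_ops"
  unfolding bounded_ops_iff
proof (intro allI)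
  fix c x
  show "T\<^sup>\<star> (c *\<^sub>C x) = c *\<^sub>C T\<^sup>\<star> x"
  proof (rule inner_eq_imp_eq)
    fix z
    have "inner (T\<^sup>\<star> (c *\<^sub>C x)) z = inner x (cnj c *\<^sub>C T z)" by (simp add: inner_hadj_left inner_scaleC_left)
    also have "\<dots> = inner x (T (cnj c *\<^sub>C z))" using assms by (simp add: bounded_ops_iff)
    also have "\<dots> = inner (c *\<^sub>C T\<^sup>\<star> x) z" by (simp add: inner_hadj_left inner_scaleC_left)
    finally show "inner (T\<^sup>\<star> (c *\<^sub>C x)) z = inner (c *\<^sub>C T\<^sup>\<star> x) z" .
  qed
qed

lemma adj_eq_hadj:
  fixes T :: "'a::complex_hilbert_space bop"
  assumes "T \<in> bounded_ops" shows "adj T = T\<^sup>\<star>"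
  unfolding adj_def
proof (rule the_equality)
  have "T\<^sup>\<star> (\<i> *\<^sub>C y) = \<i> *\<^sub>C T\<^sup>\<star> y" for y using hadj_bounded_ops[OF assms] by (simp add: bounded_ops_iff)
  then show "\<forall>x y. cinner (T x) y = cinner x (T\<^sup>\<star> y)"
    by (simp add: complex_eq_iff Re_cinner Im_cinner inner_hadj_right[symmetric])
  fix R :: "'a bop" assume "\<forall>x y. cinner (T x) y = cinner x (R y)"
  then have "inner (T x) y = inner x (R y)" for x y by (metis Re_cinner)
  then show "R = T\<^sup>\<star>" by (rule hadj_eqI[symmetric])
qed

text \<open>A real complex form gives symmetry: polarize the vanishing imaginary part and replace y
  by i y. Conversely, for a symmetric complex-linear T the number <T x, i x> equals its own
  negative, so the complex form is real.\<close>

lemma pos_op_iff: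
  fixes T :: "'a::complex_hilbert_space bop"
  shows "pos_op T \<longleftrightarrow> T \<in> bounded_ops \<and> pos T"
proof
  assume T: "pos_op T"
  then have lin: "T (c *\<^sub>C x) = c *\<^sub>C T x" for c x by (simp add: pos_op_def bounded_ops_iff)
  have nn: "cinner (T x) x \<in> \<real>\<^sub>\<ge>\<^sub>0" for x using T by (simp add: pos_op_def)
  have Re0: "0 \<le> inner (T x) x" and Im0: "inner (T x) (\<i> *\<^sub>C x) = 0" for x
    using nn[of x] Im_cinner[of "T x" x] Re_cinner[of "T x" x] by (simp_all add: complex_nonneg_Reals_iff)
  have sym: "inner (T x) (\<i> *\<^sub>C y) + inner (T y) (\<i> *\<^sub>C x) = 0" for x y
    using Im0[of "x + y"] Im0[of x] Im0[of y]
    by (simp add: blinfun.add_right scaleC_add_right inner_add_left inner_add_right)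
  have ii: "\<i> *\<^sub>C \<i> *\<^sub>C z = - z" for z :: 'a
    using scaleC_of_real[of "-1" z] by (simp add: scaleC_scaleC)
  have i2: "inner (\<i> *\<^sub>C y) (\<i> *\<^sub>C z) = inner y z" for y z :: 'a
    using scaleC_of_real[of 1 z] by (simp add: inner_scaleC_left scaleC_scaleC)
  have "inner (T x) y = inner x (T y)" for x y
  proof -
    have "- inner (T x) y + inner (T y) x = 0" using sym[of x "\<i> *\<^sub>C y"] by (simp only: lin ii i2 inner_minus_right)
    then show ?thesis using inner_commute[of "T y" x] by simp
  qed
  then have "pos T" using Re0 by (intro posI hadj_eqI)
  then show "T \<in> bounded_ops \<and> pos T" using T by (simp add: pos_op_def)
next
  assume T: "T \<in> bounded_ops \<and> pos T"
  then have lin: "T (c *\<^sub>C x) = c *\<^sub>C T x" for c x by (simp add: bounded_ops_iff)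
  have "inner (T x) (\<i> *\<^sub>C x) = 0" for x
  proof -
    have "inner (T x) (\<i> *\<^sub>C x) = inner x (\<i> *\<^sub>C T x)" using T by (simp add: selfadj_inner[OF pos_hadj] lin)
    also have "\<dots> = inner (\<i> *\<^sub>C T x) x" by (rule inner_commute)
    also have "\<dots> = inner (T x) (cnj \<i> *\<^sub>C x)" by (rule inner_scaleC_left)
    also have "cnj \<i> *\<^sub>C x = - (\<i> *\<^sub>C x)"
      using scaleC_scaleC[of "-1" \<i> x] scaleC_of_real[of "-1" "\<i> *\<^sub>C x"] by simp
    finally show ?thesis by simp
  qed
  then have "cinner (T x) x = complex_of_real (inner (T x) x)" for x
    by (simp add: complex_eq_iff Re_cinner Im_cinner)
  then have "cinner (T x) x \<in> \<real>\<^sub>\<ge>\<^sub>0" for x using T by (simp add: pos_ge0)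
  then show "pos_op T" using T by (simp add: pos_op_def)
qed

lemma pos_cinner: "pos_op T \<Longrightarrow> cinner (T x) x = complex_of_real (inner (T x) x)"
  by (simp add: pos_op_def complex_nonneg_Reals_iff complex_eq_iff Re_cinner)

lemma is_projection_iff: "is_projection P \<longleftrightarrow> P \<in> bounded_ops \<and> proj P"
  unfolding is_projection_def proj_def using adj_eq_hadj by metis

lemma sot_limit_iff:
  fixes f :: "nat \<Rightarrow> 'a::real_normed_vector \<Rightarrow>\<^sub>L 'b::real_normed_vector"
  shows "limitin strong_operator_topology f l sequentially \<longleftrightarrow> (\<forall>x. (\<lambda>n. f n x) \<longlonglongrightarrow> l x)"
proof
  assume L: "limitin strong_operator_topology f l sequentially"
  show "\<forall>x. (\<lambda>n. f n x) \<longlonglongrightarrow> l x"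
    using continuous_map_limit[OF strong_operator_topology_continuous_evaluation L]
    by (simp add: o_def limitin_canonical_iff)
next
  assume R: "\<forall>x. (\<lambda>n. f n x) \<longlonglongrightarrow> l x"
  have "limitin (product_topology (\<lambda>_. euclidean) UNIV) (\<lambda>n. blinfun_apply (f n)) (blinfun_apply l) sequentially"
    unfolding limitin_componentwise using R by (auto simp: limitin_canonical_iff)
  then have L: "((\<lambda>n. blinfun_apply (f n)) \<longlongrightarrow> blinfun_apply l) sequentially"
    by (simp add: euclidean_product_topology limitin_canonical_iff)
  show "limitin strong_operator_topology f l sequentially"
    unfolding limitin_def strong_operator_topology_topspace
  proof (intro conjI allI impI UNIV_I)
    fix U assume "openin strong_operator_topology U \<and> l \<in> U"
    then obtain W where W: "open W" "U = blinfun_apply -` W" "l \<in> U"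
      unfolding strong_operator_topology_def openin_pullback_topology by auto
    then have "\<forall>\<^sub>F n in sequentially. blinfun_apply (f n) \<in> W" using topological_tendstoD[OF L] by auto
    then show "\<forall>\<^sub>F n in sequentially. f n \<in> U" by (simp add: W(2))
  qed
qed

lemma sot_sums_iff:
  "sot_sums C A \<longleftrightarrow> (\<forall>x. (\<lambda>n. (\<Sum>j<n. C j) x) \<longlonglongrightarrow> A x)"
  unfolding sot_sums_def by (rule sot_limit_iff)

subsection \<open>Spectral measures\<close>

text \<open>Over n + 1 equal pieces the increments of G telescope, so the total variation of f along
  the partition is of order 1 / n. This lets an integral be compared with an operator form without
  Riemann sums.\<close>

lemma flat_if_quadratically_close:
  fixes f G :: "real \<Rightarrow> real"
  assumes "c \<le> b" and close: "\<And>s t. c \<le> s \<Longrightarrow> s \<le> t \<Longrightarrow> t \<le> b \<Longrightarrow> \<bar>f t - f s\<bar> \<le> (t - s) * (G t - G s)"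
  shows "f b = f c"
proof -
  have bound: "\<bar>f b - f c\<bar> \<le> (b - c) * (G b - G c) / real (Suc n)" for n
  proof -
    define h where "h = (b - c) / real (Suc n)"
    define p where "p k = c + real k * h" for k
    have h: "0 \<le> h" using assms(1) by (simp add: h_def)
    have p0: "p 0 = c" and pn: "p (Suc n) = b" by (simp_all add: p_def h_def field_simps)
    have pS: "p (Suc k) - p k = h" for k by (simp add: p_def algebra_simps)
    have rng: "c \<le> p k" "p k \<le> p (Suc k)" for k using h by (simp_all add: p_def algebra_simps)
    have "p (Suc k) \<le> b" if "k \<le> n" for k
    proof -
      have "real (Suc k) * h \<le> real (Suc n) * h" using that h by (intro mult_right_mono) auto
      then show ?thesis using pn by (simp add: p_def)
    qed
    then have step: "\<bar>f (p (Suc k)) - f (p k)\<bar> \<le> h * (G (p (Suc k)) - G (p k))" if "k < Suc n" for k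
      using close[of "p k" "p (Suc k)"] rng that by (simp add: pS)
    have "f b - f c = (\<Sum>k<Suc n. f (p (Suc k)) - f (p k))"
      using sum_lessThan_telescope[of "\<lambda>k. f (p k)" "Suc n"] p0 pn by simp
    then have "\<bar>f b - f c\<bar> \<le> (\<Sum>k<Suc n. \<bar>f (p (Suc k)) - f (p k)\<bar>)" using sum_abs by metis
    also have "\<dots> \<le> (\<Sum>k<Suc n. h * (G (p (Suc k)) - G (p k)))" by (intro sum_mono step) simp
    also have "\<dots> = h * (G b - G c)"
      unfolding sum_distrib_left[symmetric] using sum_lessThan_telescope[of "\<lambda>k. G (p k)" "Suc n"] p0 pn by simp
    finally show ?thesis by (simp add: h_def)
  qed
  have "(\<lambda>n. (b - c) * (G b - G c) / real (Suc n)) \<longlonglongrightarrow> 0"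
    by (rule LIMSEQ_Suc[OF lim_const_over_n])
  then have "\<bar>f b - f c\<bar> \<le> 0" by (rule LIMSEQ_le_const) (use bound in auto)
  then show ?thesis by simp
qed

section \<open>The measures attached to the half-line spectral projections\<close>

context
  fixes B :: "'a::{real_inner,banach} \<Rightarrow>\<^sub>L 'a"
  assumes B: "pos B"
begin

lemma sBB: "B\<^sup>\<star> = B" by (rule pos_hadj[OF B])

definition distr_fun :: "'a \<Rightarrow> real \<Rightarrow> real" where
  "distr_fun x t = inner (specp B t x) x"

lemma distr_fun_norm: "distr_fun x t = (norm (specp B t x))\<^sup>2"
  by (simp add: distr_fun_def proj_norm_sq[OF specp_proj[OF sBB]])

lemma distr_fun_neg: "t < 0 \<Longrightarrow> distr_fun x t = 0"
  unfolding distr_fun_norm using specp_eq_0[OF sBB, of 0 t x] pos_ge0[OF B] by simp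

lemma distr_fun_top: "norm B \<le> t \<Longrightarrow> distr_fun x t = (norm x)\<^sup>2"
proof -
  assume t: "norm B \<le> t"
  have "inner (B y) y \<le> t * (norm y)\<^sup>2" for y
    using inner_le_norm[of B y] t by (meson mult_right_mono order_trans zero_le_power2)
  then show ?thesis unfolding distr_fun_norm by (subst specp_eq_id[OF sBB]) auto
qed

lemma specp_diff_proj: "s \<le> t \<Longrightarrow> proj (specp B t - specp B s)"
  by (rule projI)
    (simp_all add: blinfun.bilinear_simps inner_simps proj_inner[OF specp_proj[OF sBB]]
      proj_idem[OF specp_proj[OF sBB]] specp_mono[OF sBB] specp_mono'[OF sBB])

lemma distr_fun_diff: "s \<le> t \<Longrightarrow> distr_fun x t - distr_fun x s = (norm (specp B t x - specp B s x))\<^sup>2"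
  using proj_norm_sq[OF specp_diff_proj, of s t x]
  by (simp add: distr_fun_def blinfun.diff_left inner_diff_left)

lemma distr_fun_mono: "s \<le> t \<Longrightarrow> distr_fun x s \<le> distr_fun x t"
  using distr_fun_diff[of s t x] zero_le_power2[of "norm (specp B t x - specp B s x)"] by linarith

lemma distr_fun_right_continuous: "continuous (at_right t) (distr_fun x)"
proof -
  have lim: "(\<lambda>n. distr_fun x (t + 1 / real (Suc n))) \<longlonglongrightarrow> distr_fun x t"
    unfolding distr_fun_def by (intro tendsto_intros specp_right_continuous[OF sBB])
  have "(distr_fun x \<longlongrightarrow> distr_fun x t) (at_right t)"
  proof (rule order_tendstoI)
    fix a assume "a < distr_fun x t"
    then have "a < distr_fun x s" if "t < s" for s using distr_fun_mono[of t s x] that by simp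
    then show "\<forall>\<^sub>F s in at_right t. a < distr_fun x s" by (auto simp: eventually_at_filter)
  next
    fix a assume "distr_fun x t < a"
    then have "\<forall>\<^sub>F n in sequentially. distr_fun x (t + 1 / real (Suc n)) < a" using lim by (rule order_tendstoD(2)[rotated])
    then obtain n where n: "distr_fun x (t + 1 / real (Suc n)) < a" by (auto simp: eventually_sequentially)
    have "distr_fun x s < a" if "s \<in> {t<..<t + 1 / real (Suc n)}" for s
      using distr_fun_mono[of s "t + 1 / real (Suc n)" x] n that by simp
    then show "\<forall>\<^sub>F s in at_right t. distr_fun x s < a"
      unfolding eventually_at_right_field by (intro exI[of _ "t + 1 / real (Suc n)"]) auto
  qed
  then show ?thesis by (simp add: continuous_within)
qed

definition smeasure :: "'a \<Rightarrow> real measure" where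
  "smeasure x = interval_measure (distr_fun x)"

lemma sets_smeasure [simp, measurable_cong]: "sets (smeasure x) = sets borel"
  and space_smeasure [simp]: "space (smeasure x) = UNIV"
  by (simp_all add: smeasure_def)

lemma emeasure_smeasure_Ioc: "s \<le> t \<Longrightarrow> emeasure (smeasure x) {s<..t} = ennreal (distr_fun x t - distr_fun x s)"
  unfolding smeasure_def
  by (rule emeasure_interval_measure_Ioc) (auto intro: distr_fun_mono distr_fun_right_continuous)

lemma emeasure_smeasure_Iic: "emeasure (smeasure x) {..t} = ennreal (distr_fun x t)"
proof -
  \<comment> \<open>The left end is always negative, where the distribution function vanishes; so
    all these intervals have the same mass.\<close>
  define I where "I n = {min t 0 - real (Suc n)<..t}" for n
  have I: "emeasure (smeasure x) (I n) = ennreal (distr_fun x t)" for n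
    unfolding I_def by (subst emeasure_smeasure_Ioc) (auto simp: distr_fun_neg)
  have "(\<lambda>n. emeasure (smeasure x) (I n)) \<longlonglongrightarrow> emeasure (smeasure x) (\<Union>n. I n)"
    by (rule Lim_emeasure_incseq) (auto simp: I_def incseq_def)
  moreover have "(\<Union>n. I n) = {..t}"
  proof -
    have "\<exists>n. min t 0 - real (Suc n) < s" for s
      using reals_Archimedean2[of "min t 0 - s"] by (auto simp: algebra_simps intro: less_trans)
        (metis add.commute add_strict_increasing less_diff_eq less_eq_real_def of_nat_0_le_iff zero_less_one diff_less_eq)
    then show ?thesis by (auto simp: I_def)
  qed
  ultimately show ?thesis unfolding I using LIMSEQ_unique[OF tendsto_const] by metis
qed

lemma emeasure_smeasure_UNIV: "emeasure (smeasure x) UNIV = ennreal ((norm x)\<^sup>2)"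
proof -
  define I where "I n = {..norm B + real n}" for n
  have "(\<lambda>n. emeasure (smeasure x) (I n)) \<longlonglongrightarrow> emeasure (smeasure x) (\<Union>n. I n)"
    by (rule Lim_emeasure_incseq) (auto simp: I_def incseq_def)
  moreover have "emeasure (smeasure x) (I n) = ennreal ((norm x)\<^sup>2)" for n
    by (simp add: I_def emeasure_smeasure_Iic distr_fun_top)
  ultimately have "emeasure (smeasure x) (\<Union>n. I n) = ennreal ((norm x)\<^sup>2)"
    by (simp add: LIMSEQ_const_iff)
  moreover have "(\<Union>n. I n) = UNIV"
  proof -
    have "\<exists>n. s \<le> norm B + real n" for s
      using real_arch_simple[of "s - norm B"] by (auto simp: algebra_simps)
    then show ?thesis by (auto simp: I_def)
  qed
  ultimately show ?thesis by simp
qed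

lemma finite_smeasure: "finite_measure (smeasure x)"
  by (rule finite_measureI) (simp add: emeasure_smeasure_UNIV)

lemma measure_smeasure_Iic: "measure (smeasure x) {..t} = inner (specp B t x) x"
  using distr_fun_norm[of x t] by (simp add: measure_def emeasure_smeasure_Iic) (simp add: distr_fun_def)

lemma measure_smeasure_UNIV: "measure (smeasure x) UNIV = (norm x)\<^sup>2"
  by (simp add: measure_def emeasure_smeasure_UNIV)

text \<open>The half-open intervals omit their left end, so it is taken negative to retain a
  possible atom at 0.\<close>

lemma AE_smeasure: "AE t in smeasure x. -1 < t \<and> t \<le> norm B"
proof -
  have "emeasure (smeasure x) {-1<..norm B} = emeasure (smeasure x) UNIV"
    by (subst emeasure_smeasure_Ioc) (simp_all add: distr_fun_neg distr_fun_top emeasure_smeasure_UNIV order_trans[OF _ norm_ge_zero])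
  then have "emeasure (smeasure x) (UNIV - {-1<..norm B}) = 0"
    by (subst emeasure_Diff) (auto simp: emeasure_smeasure_UNIV)
  then show ?thesis by (intro AE_I[where N="UNIV - {-1<..norm B}"]) auto
qed

lemma integrable_smeasure: "integrable (smeasure x) (\<lambda>t. t)"
proof (rule finite_measure.integrable_const_bound[OF finite_smeasure])
  show "AE t in smeasure x. norm t \<le> max 1 (norm B)" using AE_smeasure[of x] by eventually_elim auto
qed simp

text \<open>H is the truncated integral. Over an interval from s to t of mass m the increment of H
  and that of the form of B cut by \<open>specp B\<close> both lie between s m and t m, so their
  difference f is quadratically close to constant, hence constant.\<close>

lemma integral_smeasure: "integral\<^sup>L (smeasure x) (\<lambda>t. t) = inner (B x) x"
proof -
  interpret finite_measure "smeasure x" by (rule finite_smeasure)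
  define H where "H t = (\<integral>s. indicator {-1<..t} s * s \<partial>smeasure x)" for t
  define f where "f t = H t - inner (B (specp B t x)) x" for t
  have int: "integrable (smeasure x) (\<lambda>s. indicator A s * s)" if "A \<in> sets borel" for A :: "real set"
    using integrable_mult_indicator[OF _ integrable_smeasure, of A x] that by simp
  have Hdiff: "H t - H s = (\<integral>r. indicator {s<..t} r * r \<partial>smeasure x)" if "-1 \<le> s" "s \<le> t" for s t
  proof -
    have "H t - H s = (\<integral>r. indicator {-1<..t} r * r - indicator {-1<..s} r * r \<partial>smeasure x)"
      unfolding H_def by (subst Bochner_Integration.integral_diff) (auto intro: int)
    also have "\<dots> = (\<integral>r. indicator {s<..t} r * r \<partial>smeasure x)"
      by (rule Bochner_Integration.integral_cong) (use that in \<open>auto split: split_indicator\<close>)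
    finally show ?thesis .
  qed
  have close: "\<bar>f t - f s\<bar> \<le> (t - s) * (distr_fun x t - distr_fun x s)" if st: "-1 \<le> s" "s \<le> t" for s t
  proof -
    define m where "m = distr_fun x t - distr_fun x s"
    have m: "measure (smeasure x) {s<..t} = m" "0 \<le> m"
      using distr_fun_mono[OF st(2)] by (simp_all add: measure_def emeasure_smeasure_Ioc[OF st(2)] m_def)
    have intc: "integrable (smeasure x) (\<lambda>r. indicator {s<..t} r * c)" for c :: real
      by (intro integrable_mult_left integrable_real_indicator) (simp_all add: less_top[symmetric])
    have c: "(\<integral>r. indicator {s<..t} r * c \<partial>smeasure x) = c * m" for c :: real
      by (simp add: m)
    have "(\<integral>r. indicator {s<..t} r * s \<partial>smeasure x) \<le> H t - H s"
      unfolding Hdiff[OF st] by (rule integral_mono[OF intc int]) (auto split: split_indicator)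
    moreover have "H t - H s \<le> (\<integral>r. indicator {s<..t} r * t \<partial>smeasure x)"
      unfolding Hdiff[OF st] by (rule integral_mono[OF int intc]) (auto split: split_indicator)
    ultimately have 1: "s * m \<le> H t - H s" "H t - H s \<le> t * m" by (simp_all only: c)
    define z where "z = specp B t x - specp B s x"
    have zq: "inner (B (specp B t x)) x - inner (B (specp B s x)) x = inner (B z) z"
    proof -
      have "z = (specp B t - specp B s) x" by (simp add: z_def blinfun.diff_left)
      moreover have "(specp B t - specp B s) (B y) = B ((specp B t - specp B s) y)" for y
        by (simp add: blinfun.bilinear_simps specp_commute_self[OF sBB])
      ultimately have "inner (B z) z = inner (B ((specp B t - specp B s) x)) x"
        using proj_inner[OF specp_diff_proj[OF st(2)], of "B z" x] proj_idem[OF specp_diff_proj[OF st(2)], of x] by simp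
      then show ?thesis by (simp add: blinfun.bilinear_simps inner_diff_left)
    qed
    have zm: "(norm z)\<^sup>2 = m" unfolding z_def m_def distr_fun_diff[OF st(2)] ..
    have "inner (B z) z \<le> t * m"
      unfolding zm[symmetric] by (rule specp_upper[OF sBB])
        (simp add: z_def blinfun.diff_right proj_idem[OF specp_proj[OF sBB]] specp_mono[OF sBB st(2)])
    moreover have "s * m \<le> inner (B z) z"
    proof (cases "z = 0")
      case False
      have "specp B s z = 0"
        by (simp add: z_def blinfun.diff_right proj_idem[OF specp_proj[OF sBB]] specp_mono'[OF sBB st(2)])
      then show ?thesis using specp_lower[OF sBB _ False] zm by (metis less_imp_le)
    qed (simp flip: zm)
    ultimately have "\<bar>(H t - H s) - inner (B z) z\<bar> \<le> (t - s) * m" using 1 by (simp add: abs_le_iff algebra_simps)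
    then show ?thesis unfolding f_def m_def using zq by (simp add: algebra_simps)
  qed
  have "f (norm B) = f (-1)"
    by (rule flat_if_quadratically_close[where G="distr_fun x"]) (auto intro: close order_trans[OF _ norm_ge_zero])
  also have "f (-1) = 0"
    using specp_eq_0[OF sBB, of 0 "-1" x] pos_ge0[OF B] by (simp add: f_def H_def)
  finally have "H (norm B) = inner (B (specp B (norm B) x)) x" by (simp add: f_def)
  also have "specp B (norm B) x = x" by (rule specp_eq_id[OF sBB]) (rule inner_le_norm)
  finally have H: "H (norm B) = inner (B x) x" .
  have "integral\<^sup>L (smeasure x) (\<lambda>t. t) = H (norm B)"
    unfolding H_def
  proof (rule integral_cong_AE)
    show "AE t in smeasure x. t = indicator {-1<..norm B} t * t"
      using AE_smeasure[of x] by eventually_elim simp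
  qed simp_all
  then show ?thesis using H by simp
qed

end

text \<open>Induction over the Borel sets generated by the intersection-stable half-lines. In the
  union step disjoint sets give orthogonal projections: for y in the range of P n the set A n
  already has the full mass of y, so A m has none.\<close>

lemma (in vn) spectral_projection_exists:
  fixes I :: "real set"
  assumes B: "B \<in> M" "pos B" and "I \<in> sets borel"
  shows "\<exists>P. P \<in> M \<and> proj P \<and> (\<forall>x. inner (P x) x = measure (smeasure B x) I)"
proof -
  let ?G = "range (\<lambda>a::real. {..a})"
  note fin = finite_smeasure[OF B(2)]
  have bor: "A \<in> sets borel" if "A \<in> sigma_sets UNIV ?G" for A
    using that unfolding borel_eq_atMost by (simp add: sets_measure_of)
  have "Int_stable ?G" by (auto simp: Int_stable_def min_def)
  moreover have "?G \<subseteq> Pow UNIV" by simp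
  moreover have "I \<in> sigma_sets UNIV ?G"
    using assms(3) unfolding borel_eq_atMost by (simp add: sets_measure_of)
  ultimately show ?thesis
  proof (induction rule: sigma_sets_induct_disjoint)
    case (basic A)
    then obtain t where A: "A = {..t}" by blast
    show ?case
      unfolding A
      by (intro exI[of _ "specp B t"] conjI M_specp B pos_hadj specp_proj allI)
        (simp add: measure_smeasure_Iic[OF B(2)])
  next
    case empty
    show ?case by (intro exI[of _ 0]) (simp add: proj_0)
  next
    case (compl A)
    then obtain P where P: "P \<in> M" "proj P" "\<And>x. inner (P x) x = measure (smeasure B x) A" by blast
    have "measure (smeasure B x) (UNIV - A) = (norm x)\<^sup>2 - measure (smeasure B x) A" for x
      using finite_measure.finite_measure_compl[OF fin, of A x] bor[OF compl(1)]
      by (simp add: measure_smeasure_UNIV[OF B(2)] space_smeasure[OF B(2)] sets_smeasure[OF B(2)])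
    then show ?case
      using P by (intro exI[of _ "id_blinfun - P"])
        (auto simp: proj_compl blinfun.bilinear_simps inner_diff_left power2_norm_eq_inner)
  next
    case (union A)
    then have "\<forall>i. \<exists>P. P \<in> M \<and> proj P \<and> (\<forall>x. inner (P x) x = measure (smeasure B x) (A i))" by blast
    from choice[OF this] obtain P where P: "\<And>i. P i \<in> M" "\<And>i. proj (P i)"
      "\<And>i x. inner (P i x) x = measure (smeasure B x) (A i)" by blast
    have Ab: "A i \<in> sets borel" for i using union bor by blast
    have orth: "P m (P n x) = 0" if "m \<noteq> n" for m n x
    proof -
      have dj: "A m \<inter> A n = {}" using union(1) that by (auto simp: disjoint_family_on_def)
      define y where "y = P n x"
      have "measure (smeasure B y) (A m) + measure (smeasure B y) (A n) = measure (smeasure B y) (A m \<union> A n)"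
        by (rule finite_measure.finite_measure_Union[OF fin, symmetric])
          (use Ab dj in \<open>auto simp: sets_smeasure[OF B(2)]\<close>)
      also have "\<dots> \<le> (norm y)\<^sup>2"
        using finite_measure.bounded_measure[OF fin, of y "A m \<union> A n"]
        by (simp add: measure_smeasure_UNIV[OF B(2)] space_smeasure[OF B(2)])
      finally have "inner (P m y) y + inner (P n y) y \<le> (norm y)\<^sup>2" by (simp add: P(3))
      moreover have "inner (P n y) y = (norm y)\<^sup>2" by (simp add: y_def proj_idem[OF P(2)] power2_norm_eq_inner)
      ultimately have "(norm (P m y))\<^sup>2 \<le> 0" by (simp add: proj_norm_sq[OF P(2)])
      then show ?thesis by (simp add: y_def)
    qed
    have fam: "orth_family P" by (rule orth_family_proj[OF P(2)]) (rule orth)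
    have "inner (osum P x) x = measure (smeasure B x) (\<Union>i. A i)" for x
    proof -
      have "(\<lambda>n. inner x (P n x)) sums inner x (osum P x)" by (rule osum_inner_sums[OF fam])
      moreover have "(\<lambda>n. measure (smeasure B x) (A n)) sums measure (smeasure B x) (\<Union>i. A i)"
        by (rule finite_measure.finite_measure_UNION[OF fin])
          (use Ab union(1) in \<open>auto simp: sets_smeasure[OF B(2)]\<close>)
      moreover have "inner x (P n x) = measure (smeasure B x) (A n)" for n
        using P(3)[of n x] by (simp add: inner_commute)
      ultimately show ?thesis using sums_unique2 by (simp add: inner_commute)
    qed
    moreover have "proj (osum P)" by (rule osum_proj_apply(2)[OF P(2)]) (rule orth)
    moreover have "osum P \<in> M" by (intro M_osum fam P)
    ultimately show ?case by blast
  qed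
qed

section \<open>Complex scalars, and the spectral measure of a positive operator\<close>

lemma norm_scaleC: "norm (c *\<^sub>C (x :: 'a::complex_hilbert_space)) = cmod c * norm x"
proof -
  have "inner (c *\<^sub>C x) (c *\<^sub>C x) = inner x ((cnj c * c) *\<^sub>C x)" by (simp add: inner_scaleC_left scaleC_scaleC)
  also have "cnj c * c = complex_of_real ((cmod c)\<^sup>2)" by (metis complex_norm_square mult.commute)
  finally have "(norm (c *\<^sub>C x))\<^sup>2 = (cmod c * norm x)\<^sup>2"
    by (simp add: scaleC_of_real power2_norm_eq_inner power_mult_distrib)
  then show ?thesis by simp
qed

definition scalar_op :: "complex \<Rightarrow> 'a::complex_hilbert_space bop" where
  "scalar_op c = Blinfun (\<lambda>x. c *\<^sub>C x)"

lemma scalar_op_apply [simp]: "scalar_op c x = c *\<^sub>C x"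
proof -
  have "bounded_linear (\<lambda>x :: 'a. c *\<^sub>C x)"
  proof (rule bounded_linear_intro[where K="cmod c"])
    show "c *\<^sub>C (r *\<^sub>R x) = r *\<^sub>R c *\<^sub>C x" for r and x :: 'a
      by (simp add: scaleC_scaleC mult.commute flip: scaleC_of_real)
  qed (simp_all add: scaleC_add_right norm_scaleC)
  then show ?thesis by (simp add: scalar_op_def bounded_linear_Blinfun_apply)
qed

lemma hadj_scalar_op: "(scalar_op c :: 'a::complex_hilbert_space bop)\<^sup>\<star> = scalar_op (cnj c)"
  by (rule hadj_eqI) (simp add: inner_scaleC_left)

lemma scalar_op_commute_iff:
  "scalar_op c o\<^sub>L T = T o\<^sub>L scalar_op c \<longleftrightarrow> (\<forall>x. blinfun_apply T (c *\<^sub>C x) = c *\<^sub>C T x)"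
proof
  assume eq: "scalar_op c o\<^sub>L T = T o\<^sub>L scalar_op c"
  have "blinfun_apply (T o\<^sub>L scalar_op c) x = blinfun_apply (scalar_op c o\<^sub>L T) x" for x by (simp only: eq)
  then show "\<forall>x. T (c *\<^sub>C x) = c *\<^sub>C T x" by simp
qed (auto intro: blinfun_eqI)

text \<open>With this instance the spectral projections obtained over the reals are
  complex-linear.\<close>

lemma vn_bounded_ops: "vn (range scalar_op) (bounded_ops :: 'a::complex_hilbert_space bop set)"
proof
  show "(C :: 'a bop) \<in> range scalar_op \<Longrightarrow> C\<^sup>\<star> \<in> range scalar_op" for C by (auto simp: hadj_scalar_op)
  show "(bounded_ops :: 'a bop set) = {T. \<forall>C\<in>range scalar_op. C o\<^sub>L T = T o\<^sub>L C}"
    by (auto simp: bounded_ops_iff scalar_op_commute_iff)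
qed

lemma pos_family_limit:
  fixes R :: "nat \<Rightarrow> 'a::{real_inner,banach} \<Rightarrow>\<^sub>L 'a"
  assumes pos: "\<And>n. pos (R n)" and bd: "\<And>n y. inner (R n y) y \<le> c * (norm y)\<^sup>2"
    and lim: "(\<lambda>n. inner (R n x) x) \<longlonglongrightarrow> 0"
  shows "(\<lambda>n. R n x) \<longlonglongrightarrow> 0"
proof -
  have "(\<lambda>n. c * inner (R n x) x) \<longlonglongrightarrow> c * 0" by (intro tendsto_intros lim)
  then have "(\<lambda>n. sqrt (c * inner (R n x) x)) \<longlonglongrightarrow> sqrt 0" by (intro tendsto_real_sqrt) simp
  then have lim': "(\<lambda>n. sqrt (c * inner (R n x) x)) \<longlonglongrightarrow> 0" by simp
  have "(\<lambda>n. norm (R n x)) \<longlonglongrightarrow> 0"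
  proof (rule tendsto_sandwich[OF _ _ tendsto_const lim'])
    show "\<forall>\<^sub>F n in sequentially. norm (R n x) \<le> sqrt (c * inner (R n x) x)"
      by (intro always_eventually allI real_le_rsqrt pos_norm_sq_le pos bd)
  qed simp
  then show ?thesis by (rule tendsto_norm_zero_cancel)
qed

lemma proj_eq_0I: "proj P \<Longrightarrow> (\<And>x. inner (P x) x = 0) \<Longrightarrow> P = 0"
  by (rule blinfun_eqI) (metis proj_norm_sq zero_eq_power2 norm_eq_zero zero_blinfun.rep_eq)

lemma proj_fixes_iff: "proj P \<Longrightarrow> P x = x \<longleftrightarrow> inner (P x) x = (norm x)\<^sup>2"
  using proj_pythagoras[of P x] proj_norm_sq[of P x] by (auto simp: power2_norm_eq_inner)

text \<open>E is chosen set by set, which is harmless because a projection is determined by its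
  form. Countable additivity of the measures passes to strong convergence since the remainders are
  positive and bounded by 1.\<close>

lemma spectral_measure_exists:
  fixes B :: "'a::complex_hilbert_space bop"
  assumes "pos_op B"
  shows "\<exists>E. spectral_measure B E"
proof -
  interpret vn "range scalar_op" "bounded_ops :: 'a bop set" by (rule vn_bounded_ops)
  have B: "B \<in> bounded_ops" "pos B" using assms by (simp_all add: pos_op_iff)
  note fin = finite_smeasure[OF B(2)]
  define E where "E I = (SOME P. P \<in> bounded_ops \<and> proj P \<and> (\<forall>x. inner (blinfun_apply P x) x = measure (smeasure B x) I))" for I
  have E: "E I \<in> bounded_ops" "proj (E I)" "inner (E I x) x = measure (smeasure B x) I" if "I \<in> sets borel" for I x
    using someI_ex[OF spectral_projection_exists[OF B that]] unfolding E_def by blast+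
  have "projection_valued_measure E"
    unfolding projection_valued_measure_def
  proof (intro conjI ballI allI impI)
    show "is_projection (E I)" if "I \<in> sets borel" for I using E[OF that] by (simp add: is_projection_iff)
    show "E {} = 0" by (rule proj_eq_0I) (simp_all add: E)
    show "E UNIV = id_blinfun"
    proof (rule blinfun_eqI)
      fix x
      have "E UNIV x = x" by (subst proj_fixes_iff) (simp_all add: E measure_smeasure_UNIV[OF B(2)])
      then show "E UNIV x = id_blinfun x" by simp
    qed
    fix F :: "nat \<Rightarrow> real set" assume F: "range F \<subseteq> sets borel \<and> disjoint_family F"
    then have Fb: "F n \<in> sets borel" and Ub: "(\<Union>n. F n) \<in> sets borel" for n by auto
    define R where "R n = E (\<Union>n. F n) - (\<Sum>j<n. E (F j))" for n
    have sums: "(\<lambda>n. measure (smeasure B x) (F n)) sums measure (smeasure B x) (\<Union>n. F n)" for x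
      by (rule finite_measure.finite_measure_UNION[OF fin]) (use F in \<open>auto simp: sets_smeasure[OF B(2)]\<close>)
    have Rq: "inner (R n x) x = measure (smeasure B x) (\<Union>n. F n) - (\<Sum>j<n. measure (smeasure B x) (F j))" for n x
      by (simp add: R_def blinfun.diff_left blinfun.sum_left inner_diff_left inner_sum_left E Fb Ub)
    have Rpos: "pos (R n)" for n
    proof (rule posI)
      have "(\<Sum>j<n. E (F j))\<^sup>\<star> = (\<Sum>j<n. E (F j))"
        using E(2)[OF Fb] by (induction n) (simp_all add: proj_def)
      then show "(R n)\<^sup>\<star> = R n" using E(2)[OF Ub] by (simp add: R_def proj_def)
      show "0 \<le> inner (R n x) x" for x
        unfolding Rq using sums_finite_nonneg_le[OF sums, of x n] by simp
    qed
    have Rle: "inner (R n x) x \<le> 1 * (norm x)\<^sup>2" for n x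
      unfolding Rq
      using finite_measure.bounded_measure[OF fin, of x "\<Union>n. F n"] sum_nonneg[of "{..<n}" "\<lambda>j. measure (smeasure B x) (F j)"]
      by (simp add: measure_smeasure_UNIV[OF B(2)] space_smeasure[OF B(2)])
    show "sot_sums (\<lambda>n. E (F n)) (E (\<Union>n. F n))"
      unfolding sot_sums_iff
    proof
      fix x
      have "(\<lambda>n. measure (smeasure B x) (\<Union>n. F n) - (\<Sum>j<n. measure (smeasure B x) (F j)))
          \<longlonglongrightarrow> measure (smeasure B x) (\<Union>n. F n) - measure (smeasure B x) (\<Union>n. F n)"
        using sums[of x] unfolding sums_def by (intro tendsto_intros)
      then have "(\<lambda>n. inner (R n x) x) \<longlonglongrightarrow> 0" unfolding Rq by simp
      from pos_family_limit[OF Rpos Rle this] have "(\<lambda>n. E (\<Union>n. F n) x - R n x) \<longlonglongrightarrow> E (\<Union>n. F n) x - 0"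
        by (intro tendsto_intros)
      then show "(\<lambda>n. (\<Sum>j<n. E (F j)) x) \<longlonglongrightarrow> E (\<Union>n. F n) x" by (simp add: R_def blinfun.diff_left)
    qed
  qed
  moreover have "has_bochner_integral (scalar_measure E x) complex_of_real (cinner (B x) x)" for x
  proof -
    have "scalar_measure E x = measure_of UNIV (sets borel) (emeasure (smeasure B x))"
      unfolding scalar_measure_def
    proof (rule measure_of_eq)
      fix I :: "real set" assume "I \<in> sigma_sets UNIV (sets borel)"
      then have "I \<in> sets borel" using sets.sigma_sets_eq[of "borel :: real measure"] by simp
      then show "ennreal (Re (cinner (E I x) x)) = emeasure (smeasure B x) I"
        by (simp add: Re_cinner E finite_measure.emeasure_eq_measure[OF fin])
    qed simp
    also have "\<dots> = smeasure B x"
      using measure_of_of_measure[of "smeasure B x"] by (simp add: space_smeasure[OF B(2)] sets_smeasure[OF B(2)])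
    finally have eq: "scalar_measure E x = smeasure B x" .
    have "has_bochner_integral (smeasure B x) (\<lambda>t. t) (inner (B x) x)"
      unfolding has_bochner_integral_iff using integrable_smeasure[OF B(2)] integral_smeasure[OF B(2)] by simp
    then have "has_bochner_integral (smeasure B x) (\<lambda>t. complex_of_real t) (complex_of_real (inner (B x) x))"
      by (rule has_bochner_integral_of_real)
    then show ?thesis unfolding eq pos_cinner[OF assms] .
  qed
  ultimately show ?thesis unfolding spectral_measure_def by blast
qed

text \<open>Since the norm is the largest spectral value, the spectral projection at it is read off from the
  quadratic form alone.\<close>

lemma spectral_measure_top:
  fixes B :: "'a::complex_hilbert_space bop"
  assumes "pos_op B" and E: "spectral_measure B E"
  shows "E {norm B} = hproj {x. B x = norm B *\<^sub>R x}"
proof -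
  have B: "pos B" using assms by (simp add: pos_op_iff)
  define b where "b = norm B"
  have pvm: "projection_valued_measure E" using E by (simp add: spectral_measure_def)
  have proj: "proj (E I)" if "I \<in> sets borel" for I
    using pvm that by (simp add: projection_valued_measure_def is_projection_iff)
  have E0: "E {} = 0" and E1: "E UNIV = id_blinfun" using pvm by (simp_all add: projection_valued_measure_def)
  define \<nu> where "\<nu> = scalar_measure E"
  have nu_sets [simp, measurable_cong]: "sets (\<nu> x) = sets borel" and nu_space [simp]: "space (\<nu> x) = UNIV" for x
    unfolding \<nu>_def scalar_measure_def
    using sets.sigma_sets_eq[of "borel :: real measure"] by (simp_all add: sets_measure_of)
  have nu: "emeasure (\<nu> x) I = ennreal (inner (E I x) x)" if "I \<in> sets borel" for I x
    unfolding \<nu>_def scalar_measure_def Re_cinner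
  proof (rule emeasure_measure_of_sigma)
    show "sigma_algebra UNIV (sets (borel :: real measure))"
      using sets.sigma_algebra_axioms[of "borel :: real measure"] by simp
    show "positive (sets borel) (\<lambda>I. ennreal (inner (E I x) x))" by (simp add: positive_def E0)
    show "countably_additive (sets borel) (\<lambda>I. ennreal (inner (E I x) x))"
      unfolding countably_additive_def
    proof (intro allI impI)
      fix F :: "nat \<Rightarrow> real set"
      assume F: "range F \<subseteq> sets borel" "disjoint_family F" "(\<Union>i. F i) \<in> sets borel"
      then have "sot_sums (\<lambda>n. E (F n)) (E (\<Union>n. F n))" using pvm by (simp add: projection_valued_measure_def)
      then have "(\<lambda>n. (\<Sum>j<n. E (F j)) x) \<longlonglongrightarrow> E (\<Union>n. F n) x" by (simp add: sot_sums_iff)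
      then have "(\<lambda>n. inner ((\<Sum>j<n. E (F j)) x) x) \<longlonglongrightarrow> inner (E (\<Union>n. F n) x) x" by (rule tendsto_inner[OF _ tendsto_const])
      then have "(\<lambda>j. inner (E (F j) x) x) sums inner (E (\<Union>n. F n) x) x"
        by (simp add: sums_def blinfun.sum_left inner_sum_left)
      then show "(\<Sum>i. ennreal (inner (E (F i) x) x)) = ennreal (inner (E (\<Union>i. F i) x) x)"
        using F(1) by (intro suminf_ennreal_eq) (auto intro!: pos_ge0 proj_pos proj)
    qed
  qed fact
  have nu1: "emeasure (\<nu> x) UNIV = ennreal ((norm x)\<^sup>2)" for x by (simp add: nu E1 power2_norm_eq_inner)
  have fin: "finite_measure (\<nu> x)" for x by (rule finite_measureI) (simp add: nu1)
  have null: "AE t in \<nu> x. t \<in> I" if "I \<in> sets borel" "inner (E I x) x = (norm x)\<^sup>2" for I x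
  proof -
    have "emeasure (\<nu> x) (UNIV - I) = emeasure (\<nu> x) UNIV - emeasure (\<nu> x) I"
      using that by (intro emeasure_Diff) (auto simp: nu)
    also have "\<dots> = 0" using that by (simp add: nu E1 power2_norm_eq_inner)
    finally show ?thesis using that by (intro AE_I[where N="UNIV - I"]) auto
  qed
  have full: "inner (E I x) x = (norm x)\<^sup>2" if "I \<in> sets borel" "AE t in \<nu> x. t \<in> I" for I x
  proof -
    have "emeasure (\<nu> x) I = emeasure (\<nu> x) UNIV"
      using that by (intro emeasure_eq_AE) auto
    then show ?thesis using that pos_ge0[OF proj_pos[OF proj]] by (simp add: nu E1 power2_norm_eq_inner)
  qed
  have int: "integrable (\<nu> x) (\<lambda>t. t)" "integral\<^sup>L (\<nu> x) (\<lambda>t. t) = inner (B x) x" for x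
  proof -
    have "has_bochner_integral (\<nu> x) complex_of_real (cinner (B x) x)"
      using E by (simp add: spectral_measure_def \<nu>_def)
    from has_bochner_integral_bounded_linear[OF bounded_linear_Re this]
    have "has_bochner_integral (\<nu> x) (\<lambda>t. t) (inner (B x) x)" by (simp add: Re_cinner)
    then show "integrable (\<nu> x) (\<lambda>t. t)" "integral\<^sup>L (\<nu> x) (\<lambda>t. t) = inner (B x) x"
      by (simp_all add: has_bochner_integral_iff)
  qed
  have int_diff: "integrable (\<nu> x) (\<lambda>t. b - t)" "integral\<^sup>L (\<nu> x) (\<lambda>t. b - t) = b * (norm x)\<^sup>2 - inner (B x) x" for x
  proof -
    interpret finite_measure "\<nu> x" by (rule fin)
    show "integrable (\<nu> x) (\<lambda>t. b - t)" by (intro Bochner_Integration.integrable_diff int) simp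
    show "integral\<^sup>L (\<nu> x) (\<lambda>t. b - t) = b * (norm x)\<^sup>2 - inner (B x) x"
      by (subst Bochner_Integration.integral_diff) (simp_all add: int measure_def nu1 mult.commute)
  qed
  have Bb: "inner (B x) x \<le> b * (norm x)\<^sup>2" for x unfolding b_def by (rule inner_le_norm)
  \<comment> \<open>For x in the range of this projection the measure sits on t > b, where b - t is
    negative, while the integral of b - t is nonnegative by the norm bound. So the measure, and with
    it x, is zero.\<close>
  have "E {b<..} y = 0" for y
  proof -
    define x where "x = E {b<..} y"
    have Ex: "inner (E {b<..} x) x = (norm x)\<^sup>2"
      by (simp add: x_def proj_idem[OF proj] power2_norm_eq_inner)
    from null[OF _ this] have ae: "AE t in \<nu> x. b < t" by simp
    have "0 \<le> integral\<^sup>L (\<nu> x) (\<lambda>t. b - t)" unfolding int_diff using Bb[of x] by simp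
    moreover have eq: "integral\<^sup>L (\<nu> x) (\<lambda>t. - (b - t)) = - integral\<^sup>L (\<nu> x) (\<lambda>t. b - t)"
      by (rule Bochner_Integration.integral_minus)
    moreover have "0 \<le> integral\<^sup>L (\<nu> x) (\<lambda>t. - (b - t))"
      by (rule integral_nonneg_AE) (use ae in \<open>auto elim: eventually_mono\<close>)
    ultimately have "integral\<^sup>L (\<nu> x) (\<lambda>t. - (b - t)) = 0" by linarith
    moreover have "AE t in \<nu> x. 0 \<le> - (b - t)" using ae by eventually_elim simp
    ultimately have "AE t in \<nu> x. - (b - t) = 0"
      using integral_nonneg_eq_0_iff_AE[OF integrable_minus[OF int_diff(1)]] by simp
    with ae have "AE t in \<nu> x. t \<in> {}" by eventually_elim simp
    from full[OF _ this] show ?thesis by (simp add: E0 x_def)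
  qed
  then have "E {b<..} = 0" by (intro blinfun_eqI) simp
  have le: "AE t in \<nu> x. t \<le> b" for x
  proof -
    have "emeasure (\<nu> x) {b<..} = 0" using \<open>E {b<..} = 0\<close> by (simp add: nu)
    then show ?thesis by (intro AE_I[where N="{b<..}"]) auto
  qed
  \<comment> \<open>The integral of b - t is b |x|^2 - <B x, x>. Its integrand is nonnegative almost
    everywhere, so it vanishes exactly when the measure of x sits at b; by positivity of b - B it
    vanishes exactly when x is an eigenvector.\<close>
  have eig: "E {b} x = x \<longleftrightarrow> B x = b *\<^sub>R x" for x
  proof
    assume Ex: "E {b} x = x"
    then have "AE t in \<nu> x. t \<in> {b}" by (intro null) (simp_all add: power2_norm_eq_inner)
    then have "AE t in \<nu> x. b - t = 0" by eventually_elim simp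
    then have "integral\<^sup>L (\<nu> x) (\<lambda>t. b - t) = integral\<^sup>L (\<nu> x) (\<lambda>t. 0)" by (intro integral_cong_AE) auto
    then have "inner (B x) x = b * (norm x)\<^sup>2" by (simp add: int_diff)
    moreover have "pos (b *\<^sub>R id_blinfun - B)"
      by (rule posI) (simp_all add: pos_hadj[OF B] blinfun.bilinear_simps inner_diff_left Bb flip: power2_norm_eq_inner)
    ultimately have "(b *\<^sub>R id_blinfun - B) x = 0"
      by (intro pos_inner_0) (simp_all add: blinfun.bilinear_simps inner_diff_left power2_norm_eq_inner)
    then show "B x = b *\<^sub>R x" by (simp add: blinfun.bilinear_simps)
  next
    assume Bx: "B x = b *\<^sub>R x"
    have "integral\<^sup>L (\<nu> x) (\<lambda>t. b - t) = 0" by (simp add: int_diff Bx power2_norm_eq_inner)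
    moreover have "AE t in \<nu> x. 0 \<le> b - t" using le[of x] by eventually_elim simp
    ultimately have "AE t in \<nu> x. b - t = 0"
      using integral_nonneg_eq_0_iff_AE[OF int_diff(1)] by simp
    then have "AE t in \<nu> x. t \<in> {b}" by eventually_elim simp
    then have "inner (E {b} x) x = (norm x)\<^sup>2" by (intro full) auto
    then show "E {b} x = x" by (simp add: proj_fixes_iff[OF proj])
  qed
  have V: "subspace {x. B x = b *\<^sub>R x}" "closed {x. B x = b *\<^sub>R x}"
    by (auto simp: subspace_def blinfun.bilinear_simps scaleR_add_right intro!: closed_Collect_eq continuous_intros)
  have "hproj {x. B x = b *\<^sub>R x} y = E {b} y" for y
  proof (rule hproj_unique[OF V])
    show "E {b} y \<in> {x. B x = b *\<^sub>R x}" by (simp add: eig[symmetric] proj_idem[OF proj])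
    fix z assume "z \<in> {x. B x = b *\<^sub>R x}"
    then have "E {b} z = z" by (simp add: eig)
    then have "inner (y - E {b} y) z = inner (y - E {b} y) (E {b} z)" by simp
    also have "\<dots> = 0" by (simp add: proj_inner[OF proj, symmetric] blinfun.diff_right proj_idem[OF proj])
    finally show "inner (y - E {b} y) z = 0" .
  qed
  then have "hproj {x. B x = b *\<^sub>R x} = E {b}" by (intro blinfun_eqI)
  then show ?thesis by (simp add: b_def)
qed

lemma spectral_proj_top:
  fixes B :: "'a::complex_hilbert_space bop"
  assumes "pos_op B"
  shows "spectral_proj B {norm B} = hproj {x. B x = norm B *\<^sub>R x}"
  unfolding spectral_proj_def
  using spectral_measure_exists[OF assms] spectral_measure_top[OF assms] by (intro the_equality) metis+

subsection \<open>Von Neumann algebras\<close>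

context
  fixes M :: "'a::complex_hilbert_space bop set"
  assumes vna: "von_neumann_algebra M"
begin

lemma vna_bounded: "M \<subseteq> bounded_ops"
  using vna unfolding von_neumann_algebra_def commutant_def by blast

lemma vna_adj: "X \<in> M \<Longrightarrow> adj X = X\<^sup>\<star>"
  using vna_bounded by (intro adj_eq_hadj) blast

lemma scalar_op_commutant: "scalar_op c \<in> commutant M"
  unfolding commutant_def
proof (intro CollectI conjI ballI)
  show "scalar_op c \<in> bounded_ops" by (simp add: bounded_ops_iff scaleC_scaleC mult.commute)
  show "scalar_op c o\<^sub>L X = X o\<^sub>L scalar_op c" if "X \<in> M" for X
    using that vna_bounded by (auto simp: scalar_op_commute_iff bounded_ops_iff)
qed

lemma vn_commutant: "vn (commutant M) M"
proof
  fix C assume C: "C \<in> commutant M"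
  have "C\<^sup>\<star> o\<^sub>L X = X o\<^sub>L C\<^sup>\<star>" if X: "X \<in> M" for X
  proof -
    have "X\<^sup>\<star> \<in> M" using X vna vna_adj[OF X] by (auto simp: von_neumann_algebra_def)
    then have "(C o\<^sub>L X\<^sup>\<star>)\<^sup>\<star> = (X\<^sup>\<star> o\<^sub>L C)\<^sup>\<star>" using C by (simp add: commutant_def)
    then show ?thesis by simp
  qed
  then show "C\<^sup>\<star> \<in> commutant M" using C by (simp add: commutant_def hadj_bounded_ops)
next
  have "T \<in> bounded_ops" if "\<forall>C\<in>commutant M. C o\<^sub>L T = T o\<^sub>L C" for T
    unfolding bounded_ops_iff scalar_op_commute_iff[symmetric] using that scalar_op_commutant by blast
  then have "commutant (commutant M) = {T. \<forall>C\<in>commutant M. C o\<^sub>L T = T o\<^sub>L C}"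
    unfolding commutant_def[of "commutant M"] by (auto simp: eq_commute)
  then show "M = {T. \<forall>C\<in>commutant M. C o\<^sub>L T = T o\<^sub>L C}"
    using vna by (simp add: von_neumann_algebra_def)
qed

interpretation vn "commutant M" M by (rule vn_commutant)

lemma projections_iff: "P \<in> projections M \<longleftrightarrow> P \<in> M \<and> proj P"
  using vna_bounded by (auto simp: projections_def is_projection_iff)

lemma positive_part_iff: "P \<in> positive_part M \<longleftrightarrow> P \<in> M \<and> pos P"
  using vna_bounded by (auto simp: positive_part_def pos_op_iff)

lemma mv_equiv_iff: "mv_equiv M B C \<longleftrightarrow> (\<exists>X\<in>M. B = X o\<^sub>L X\<^sup>\<star> \<and> C = X\<^sup>\<star> o\<^sub>L X)"
  by (auto simp: mv_equiv_def vna_adj)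

text \<open>The form in which infinite projections enter the construction. If Q =
  \<open>w o\<^sub>L w\<^sup>\<star>\<close> lies below P, the adjoint of w kills the complement of
  P, which is P w = w.\<close>

lemma infinite_proj_iff:
  assumes P: "P \<in> M" "proj P"
  shows "infinite_proj M P \<longleftrightarrow> (\<exists>w\<in>M. w\<^sup>\<star> o\<^sub>L w = P \<and> P o\<^sub>L w = w \<and> w o\<^sub>L w\<^sup>\<star> \<noteq> P)"
proof
  assume "infinite_proj M P"
  then obtain Q where Q: "Q \<in> M" "proj Q" "op_le Q P" "mv_equiv M Q P" "Q \<noteq> P"
    using P by (auto simp: infinite_proj_def finite_proj_def projections_iff)
  from Q(4) obtain w where w: "w \<in> M" "Q = w o\<^sub>L w\<^sup>\<star>" "P = w\<^sup>\<star> o\<^sub>L w" by (auto simp: mv_equiv_iff)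
  have "pos (P - Q)" using Q(3) by (simp add: op_le_def pos_op_iff)
  have "w\<^sup>\<star> (y - P y) = 0" for y
  proof -
    have Py: "P (y - P y) = 0" by (simp add: blinfun.diff_right proj_idem[OF P(2)])
    have "0 \<le> inner ((P - Q) (y - P y)) (y - P y)" by (rule pos_ge0) fact
    then have "inner (Q (y - P y)) (y - P y) \<le> 0"
      by (simp add: blinfun.diff_left Py)
    then have "(norm (w\<^sup>\<star> (y - P y)))\<^sup>2 \<le> 0" unfolding norm_sq_hadj w(2) by simp
    then show ?thesis by simp
  qed
  then have "w\<^sup>\<star> o\<^sub>L P = w\<^sup>\<star>" by (intro blinfun_eqI) (simp add: blinfun.diff_right)
  then have "(w\<^sup>\<star> o\<^sub>L P)\<^sup>\<star> = w" by simp
  then have "P o\<^sub>L w = w" using P(2) by (simp add: proj_def)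
  then show "\<exists>w\<in>M. w\<^sup>\<star> o\<^sub>L w = P \<and> P o\<^sub>L w = w \<and> w o\<^sub>L w\<^sup>\<star> \<noteq> P" using w Q(5) by metis
next
  assume "\<exists>w\<in>M. w\<^sup>\<star> o\<^sub>L w = P \<and> P o\<^sub>L w = w \<and> w o\<^sub>L w\<^sup>\<star> \<noteq> P"
  then obtain w where w: "w \<in> M" "w\<^sup>\<star> o\<^sub>L w = P" "P o\<^sub>L w = w" "w o\<^sub>L w\<^sup>\<star> \<noteq> P" by blast
  have wP: "w\<^sup>\<star> (w x) = P x" "P (w x) = w x" for x using w by (metis blinfun_apply_blinfun_compose)+
  have "(P o\<^sub>L w)\<^sup>\<star> = w\<^sup>\<star>" using w(3) by simp
  then have w'P: "w\<^sup>\<star> (P x) = w\<^sup>\<star> x" for x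
    using P(2) by (metis blinfun_apply_blinfun_compose hadj_compose proj_def)
  have "norm (w (x - P x)) = 0" for x
  proof -
    have "(norm (w (x - P x)))\<^sup>2 = 0" unfolding norm_sq_hadj w(2) by (simp add: blinfun.diff_right proj_idem[OF P(2)])
    then show ?thesis by simp
  qed
  then have wP': "w (P x) = w x" for x by (simp add: blinfun.diff_right)
  have Q: "proj (w o\<^sub>L w\<^sup>\<star>)" unfolding proj_def by (auto intro!: blinfun_eqI simp: wP wP')
  have "pos (P - (w o\<^sub>L w\<^sup>\<star>))"
  proof (rule posI)
    show "(P - (w o\<^sub>L w\<^sup>\<star>))\<^sup>\<star> = P - (w o\<^sub>L w\<^sup>\<star>)" using P(2) by (simp add: proj_def)
    fix x
    have "(w o\<^sub>L w\<^sup>\<star>) (P x) = (w o\<^sub>L w\<^sup>\<star>) x" by (simp add: w'P)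
    then have "norm ((w o\<^sub>L w\<^sup>\<star>) x) \<le> norm (P x)" using proj_norm_le[OF Q, of "P x"] by metis
    then have "inner ((w o\<^sub>L w\<^sup>\<star>) x) x \<le> inner (P x) x"
      unfolding proj_norm_sq[OF P(2), symmetric] proj_norm_sq[OF Q, symmetric] by (rule power_mono) simp
    then show "0 \<le> inner ((P - (w o\<^sub>L w\<^sup>\<star>)) x) x" by (simp add: blinfun.diff_left inner_diff_left)
  qed
  moreover have "P - (w o\<^sub>L w\<^sup>\<star>) \<in> bounded_ops" by (rule subsetD[OF vna_bounded]) (intro M_diff M_compose M_hadj P w)
  ultimately have "op_le (w o\<^sub>L w\<^sup>\<star>) P" by (simp add: op_le_def pos_op_iff)
  moreover have "mv_equiv M (w o\<^sub>L w\<^sup>\<star>) P" using w by (auto simp: mv_equiv_iff)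
  moreover have "w o\<^sub>L w\<^sup>\<star> \<in> M" using w by blast
  ultimately show "infinite_proj M P"
    using P Q w(4) by (auto simp: infinite_proj_def finite_proj_def projections_iff)
qed

lemma closed_vna: "closed M"
proof -
  have "closed {T :: 'a bop. C o\<^sub>L T = T o\<^sub>L C}" for C
    by (intro closed_Collect_eq bounded_bilinear.continuous_on[OF bounded_bilinear_blinfun_compose] continuous_intros)
  moreover have "M = (\<Inter>C\<in>commutant M. {T. C o\<^sub>L T = T o\<^sub>L C})" by (subst M_eq) auto
  ultimately show ?thesis by (metis (no_types, lifting) closed_INT)
qed

lemma finite_ideal_iff:
  "T \<in> finite_ideal M \<longleftrightarrow> (\<forall>I. closed_ideal M I \<and> {P. finite_proj M P} \<subseteq> I \<longrightarrow> T \<in> I)"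
  by (auto simp: finite_ideal_def hull_def)

lemma finite_ideal_subset: "finite_ideal M \<subseteq> M"
proof -
  have "closed_ideal M M" using closed_vna by (auto simp: closed_ideal_def)
  moreover have "{P. finite_proj M P} \<subseteq> M" by (auto simp: finite_proj_def projections_iff)
  ultimately show ?thesis by (auto simp: finite_ideal_iff)
qed

lemma finite_ideal_add: "S \<in> finite_ideal M \<Longrightarrow> T \<in> finite_ideal M \<Longrightarrow> S + T \<in> finite_ideal M"
  and finite_ideal_left: "X \<in> M \<Longrightarrow> T \<in> finite_ideal M \<Longrightarrow> X o\<^sub>L T \<in> finite_ideal M"
  and finite_ideal_right: "X \<in> M \<Longrightarrow> T \<in> finite_ideal M \<Longrightarrow> T o\<^sub>L X \<in> finite_ideal M"
  by (auto simp: finite_ideal_iff closed_ideal_def)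

lemma not_finite_ideal_infinite:
  assumes "P \<in> M" "proj P" "P \<notin> finite_ideal M" shows "infinite_proj M P"
  using assms by (auto simp: infinite_proj_def projections_iff finite_ideal_iff)

text \<open>If the spectral projection just below the norm were in the ideal, then so would be the part of \<open>A\<close> above
  it, and subtracting that part would lower the norm.\<close>

lemma ess_norm_imp_not_finite_ideal:
  assumes A: "A \<in> M" "pos A" "ess_norm M A = norm A" "0 < norm A" and "0 < \<epsilon>"
  shows "id_blinfun - specp A (norm A - \<epsilon>) \<notin> finite_ideal M"
proof
  define l where "l = norm A - \<epsilon>"
  define P where "P = specp A l"
  note sA = pos_hadj[OF A(2)]
  note P = specp_proj[OF sA, of l, folded P_def]
  note AP = specp_commute_self[OF sA, of l, folded P_def]
  assume "id_blinfun - specp A (norm A - \<epsilon>) \<in> finite_ideal M"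
  then have "(- 1 *\<^sub>R A) o\<^sub>L (id_blinfun - P) \<in> finite_ideal M"
    unfolding l_def[symmetric] P_def[symmetric] by (intro finite_ideal_left M_scaleR A)
  moreover have "A + ((- 1 *\<^sub>R A) o\<^sub>L (id_blinfun - P)) = A o\<^sub>L P"
    by (rule blinfun_eqI) (simp add: blinfun.bilinear_simps)
  ultimately have "A o\<^sub>L P \<in> quot_map (finite_ideal M) A" unfolding quot_map_def by force
  then have "norm A \<le> norm (A o\<^sub>L P)"
    unfolding A(3)[symmetric] ess_norm_def quot_norm_def by (intro cINF_lower bdd_belowI2[where m=0]) auto
  also have "norm (A o\<^sub>L P) \<le> max l 0"
  proof (rule pos_norm_le)
    have APx: "inner (A (P x)) x = inner (A (P x)) (P x)" for x
    proof -
      have "inner (A (P x)) x = inner (P (A (P x))) x" by (simp add: AP[symmetric] proj_idem[OF P])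
      then show ?thesis by (simp add: proj_inner[OF P])
    qed
    show "pos (A o\<^sub>L P)"
    proof (rule posI)
      show "(A o\<^sub>L P)\<^sup>\<star> = A o\<^sub>L P"
        using P by (intro blinfun_eqI) (simp add: sA proj_def AP)
      show "0 \<le> inner ((A o\<^sub>L P) x) x" for x by (simp add: APx pos_ge0[OF A(2)])
    qed
    fix x
    have "inner (A (P x)) (P x) \<le> l * (norm (P x))\<^sup>2"
      using specp_upper[OF sA, of l "P x"] proj_idem[OF P] by (simp add: P_def)
    also have "\<dots> \<le> max l 0 * (norm (P x))\<^sup>2" by (rule mult_right_mono) auto
    also have "\<dots> \<le> max l 0 * (norm x)\<^sup>2" by (intro mult_left_mono power_mono proj_norm_le[OF P]) auto
    finally show "inner ((A o\<^sub>L P) x) x \<le> max l 0 * (norm x)\<^sup>2" by (simp add: APx)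
  qed simp
  finally show False using A(4) \<open>0 < \<epsilon>\<close> by (auto simp: l_def max_def split: if_splits)
qed

lemma null_proj_eq:
  assumes "C \<in> M" shows "null_proj C = hproj {x. C x = 0}"
  unfolding null_proj_def orth_proj_def
proof (rule the_equality)
  note V = subspace_ker[of C] closed_ker[of C]
  show "is_projection (hproj {x. C x = 0}) \<and> range (hproj {x. C x = 0}) = {x. C x = 0}"
    using M_hproj_ker[OF assms] vna_bounded proj_hproj[OF V] range_hproj[OF V] by (auto simp: is_projection_iff)
  fix P :: "'a bop" assume P: "is_projection P \<and> range P = {x. C x = 0}"
  then have "proj P" by (simp add: is_projection_iff)
  have "hproj {x. C x = 0} y = P y" for y
  proof (rule hproj_unique[OF V])
    show "P y \<in> {x. C x = 0}" using P by blast
    fix z assume "z \<in> {x. C x = 0}"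
    then have "z \<in> range P" using P by simp
    then obtain u where "z = P u" by blast
    then show "inner (y - P y) z = 0"
      by (simp add: proj_inner[OF \<open>proj P\<close>, symmetric] blinfun.diff_right proj_idem[OF \<open>proj P\<close>])
  qed
  then show "P = hproj {x. C x = 0}" by (intro blinfun_eqI) simp
qed

end

text \<open>For transitivity: if r M e = 0, the space V of all z with r X z = 0 for every X in M is
  invariant under M and under its commutant. Its projection is therefore central, hence scalar; it
  fixes the nonzero range of e, so it is the identity, and taking X to be the identity gives r =
  0.\<close>

lemma sf_factor_finite_ideal:
  assumes fac: "factor M" and "semifinite_vna M" "infinite_vna M" "sigma_finite_vna M"
  shows "sf_factor (commutant M) M (finite_ideal M)"
proof -
  have vna: "von_neumann_algebra M" using fac by (simp add: factor_def)
  interpret vn "commutant M" M by (rule vn_commutant[OF vna])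
  have inf: "\<exists>w\<in>M. w\<^sup>\<star> o\<^sub>L w = id_blinfun \<and> id_blinfun o\<^sub>L w = w \<and> w o\<^sub>L w\<^sup>\<star> \<noteq> id_blinfun"
    using \<open>infinite_vna M\<close> unfolding infinite_vna_def infinite_proj_iff[OF vna M_id proj_id] .
  show ?thesis
  proof
    fix e r assume e: "e \<in> M" "proj e" "e \<noteq> 0" and r: "r \<in> M" "proj r" "r \<noteq> 0"
    show "\<exists>X\<in>M. r o\<^sub>L X o\<^sub>L e \<noteq> 0"
    proof (rule ccontr)
      assume "\<not> (\<exists>X\<in>M. r o\<^sub>L X o\<^sub>L e \<noteq> 0)"
      then have 0: "r (X (e x)) = 0" if "X \<in> M" for X x
        using that by (metis blinfun_apply_blinfun_compose zero_blinfun.rep_eq)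
      define V where "V = {z. \<forall>X\<in>M. r (blinfun_apply X z) = 0}"
      have "V = (\<Inter>X\<in>M. {z. blinfun_apply (r o\<^sub>L X) z = 0})" by (auto simp: V_def)
      then have V: "subspace V" "closed V"
        by (auto simp: subspace_def blinfun.bilinear_simps simp del: blinfun_apply_blinfun_compose intro!: closed_INT closed_ker)
      have "hproj V \<in> M"
      proof (rule M_hproj[OF V])
        fix C x assume C: "C \<in> commutant M" and "x \<in> V"
        then show "C x \<in> V" by (auto simp: V_def M_apply[OF _ C, symmetric] r(1))
      qed
      moreover have inv: "T z \<in> V" if "T \<in> M" "z \<in> V" for T z
      proof -
        have "r ((X o\<^sub>L T) z) = 0" if "X \<in> M" for X
          using \<open>z \<in> V\<close> M_compose[OF that \<open>T \<in> M\<close>] unfolding V_def by blast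
        then show ?thesis by (simp add: V_def)
      qed
      moreover have "hproj V o\<^sub>L T = T o\<^sub>L hproj V" if "T \<in> M" for T
        by (rule hproj_commute[OF V, symmetric]) (intro inv M_hadj that; assumption)+
      moreover have "hproj V \<in> bounded_ops" using vna_bounded[OF vna] calculation(1) by blast
      ultimately have "hproj V \<in> M \<inter> commutant M" by (simp add: commutant_def)
      then obtain c where c: "hproj V x = c *\<^sub>C x" for x using fac by (auto simp: factor_def)
      obtain x where x: "e x \<noteq> 0" using e(3) by (metis blinfun_eqI zero_blinfun.rep_eq)
      have "e x \<in> V" by (simp add: V_def 0)
      then have "c *\<^sub>C e x = e x" using hproj_eq_self[OF V] c by simp
      then have "(c + complex_of_real (-1)) *\<^sub>C e x = 0" by (simp only: scaleC_add_left scaleC_of_real) simp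
      then have "cmod (c + complex_of_real (-1)) * norm (e x) = 0" by (metis norm_scaleC norm_zero)
      then have "c = complex_of_real 1" using x by simp
      then have "hproj V z = z" for z using c[of z] scaleC_of_real[of 1 z] by simp
      then have "z \<in> V" for z using hproj_mem[OF V, of z] by simp
      then have "r (id_blinfun z) = 0" for z unfolding V_def by blast
      then have "r = 0" by (intro blinfun_eqI) simp
      with r(3) show False by blast
    qed
  next
    fix F assume "F \<subseteq> {P \<in> M. proj P \<and> P \<noteq> 0}" "\<And>P Q. P \<in> F \<Longrightarrow> Q \<in> F \<Longrightarrow> P \<noteq> Q \<Longrightarrow> P o\<^sub>L Q = 0"
    then have "F \<subseteq> projections M - {0}" "pairwise (\<lambda>P Q. P o\<^sub>L Q = 0) F"
      by (auto simp: projections_iff[OF vna] pairwise_def)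
    then show "countable F" using \<open>sigma_finite_vna M\<close> by (simp add: sigma_finite_vna_def)
  next
    show "\<exists>w\<in>M. iso w \<and> w o\<^sub>L w\<^sup>\<star> \<noteq> id_blinfun" using inf by (auto simp: iso_def)
  next
    have "id_blinfun \<in> projections (M \<inter> commutant M)"
      using vna_bounded[OF vna] by (auto simp: projections_def commutant_def is_projection_iff proj_id intro: blinfun_eqI)
    moreover have "id_blinfun \<noteq> (0 :: 'a bop)"
    proof
      assume "id_blinfun = (0 :: 'a bop)"
      then have "x = 0" for x :: 'a by (metis id_blinfun.rep_eq zero_blinfun.rep_eq id_apply)
      then have "w o\<^sub>L w\<^sup>\<star> = id_blinfun" for w :: "'a bop" by (intro blinfun_eqI) metis
      then show False using inf by blast
    qed
    ultimately obtain P where P: "finite_proj M P" "P \<noteq> 0"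
      using \<open>semifinite_vna M\<close> unfolding semifinite_vna_def by blast
    then have "P \<in> finite_ideal M" by (auto simp: finite_ideal_iff[OF vna])
    moreover have "proj P" using P by (simp add: finite_proj_def projections_iff[OF vna])
    ultimately show "\<exists>e\<in>finite_ideal M. proj e \<and> e \<noteq> 0" using P by blast
  next
    fix P assume "P \<in> M" "proj P" "P \<notin> finite_ideal M"
    then show "\<exists>w\<in>M. w\<^sup>\<star> o\<^sub>L w = P \<and> P o\<^sub>L w = w \<and> w o\<^sub>L w\<^sup>\<star> \<noteq> P"
      using not_finite_ideal_infinite[OF vna] infinite_proj_iff[OF vna] by blast
  qed (intro finite_ideal_subset[OF vna] finite_ideal_add[OF vna] finite_ideal_left[OF vna] finite_ideal_right[OF vna]; assumption)+
qed

theorem corollary5p3: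
  fixes M :: "'a::complex_hilbert_space bop set"
    and A B :: "'a bop"
  assumes "factor M" and "semifinite_vna M" and "infinite_vna M" and "sigma_finite_vna M"
    and "A \<in> positive_part M" and "B \<in> positive_part M" and "B \<noteq> 0"
    and "ess_norm M A = norm A"
  shows "let chiA = spectral_proj A {norm A};
             chiB = spectral_proj B {norm B};
             c1 = (norm A > norm B);
             c2 = (norm A = norm B \<and> chiB = 0);
             c3 = (norm A = norm B \<and> chiB \<noteq> 0 \<and> B \<noteq> norm B *\<^sub>R chiB \<and> infinite_proj M chiA);
             c4 = (norm A = norm B \<and> B = norm B *\<^sub>R chiB \<and> A = norm A *\<^sub>R chiA \<and> infinite_proj M chiA)
         in ((\<exists>C. (\<forall>j. C j \<in> positive_part M \<and> mv_equiv M (C j) B) \<and> sot_sums C A)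
               \<longleftrightarrow> c1 \<or> c2 \<or> c3 \<or> c4)
          \<and> (\<not> (c1 \<and> c2) \<and> \<not> (c1 \<and> c3) \<and> \<not> (c1 \<and> c4) \<and> \<not> (c2 \<and> c3) \<and> \<not> (c2 \<and> c4) \<and> \<not> (c3 \<and> c4))
          \<and> (c1 \<or> c2 \<or> c3 \<or> c4 \<longrightarrow>
               (\<exists>C. (\<forall>j. C j \<in> positive_part M \<and> mv_equiv M (C j) B \<and> infinite_proj M (null_proj (C j)))
                    \<and> sot_sums C A))"
proof -
  have vna: "von_neumann_algebra M" using assms(1) by (simp add: factor_def)
  interpret sf_factor "commutant M" M "finite_ideal M" by (rule sf_factor_finite_ideal) fact+
  have A: "A \<in> M" "pos A" and B: "B \<in> M" "pos B"
    using assms by (simp_all add: positive_part_iff[OF vna])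
  define a where "a = norm A"
  define E where "E = spectral_proj A {norm A}"
  define p where "p = spectral_proj B {norm B}"
  have norm_pos: "0 < norm B" using \<open>B \<noteq> 0\<close> by simp
  have Aa: "inner (A x) x \<le> a * (norm x)\<^sup>2" for x unfolding a_def by (rule inner_le_norm)
  have Bb: "inner (B x) x \<le> norm B * (norm x)\<^sup>2" for x by (rule inner_le_norm)
  have top: "spectral_proj T {norm T} \<in> M" "proj (spectral_proj T {norm T})"
    "\<And>x. spectral_proj T {norm T} x = x \<longleftrightarrow> T x = norm T *\<^sub>R x" if T: "T \<in> M" "pos T" for T
  proof -
    have ker: "{x. T x = norm T *\<^sub>R x} = {x. (T - norm T *\<^sub>R id_blinfun) x = 0}"
      by (auto simp: blinfun.bilinear_simps)
    have "pos_op T" using T vna_bounded[OF vna] by (auto simp: pos_op_iff)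
    then have eq: "spectral_proj T {norm T} = hproj {x. (T - norm T *\<^sub>R id_blinfun) x = 0}"
      by (simp only: spectral_proj_top ker)
    show "spectral_proj T {norm T} \<in> M" unfolding eq by (intro M_hproj_ker M_diff M_scaleR M_id T)
    show "proj (spectral_proj T {norm T})" unfolding eq by (intro proj_hproj subspace_ker closed_ker)
    show "spectral_proj T {norm T} x = x \<longleftrightarrow> T x = norm T *\<^sub>R x" for x
      unfolding eq hproj_eq_self_iff[OF subspace_ker closed_ker] by (simp add: blinfun.bilinear_simps)
  qed
  note E = top[OF A, folded E_def a_def] and p = top[OF B, folded p_def]
  define c1 where "c1 \<longleftrightarrow> norm A > norm B"
  define c2 where "c2 \<longleftrightarrow> norm A = norm B \<and> p = 0"
  define c3 where "c3 \<longleftrightarrow> norm A = norm B \<and> p \<noteq> 0 \<and> B \<noteq> norm B *\<^sub>R p \<and> infinite_proj M E"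
  define c4 where "c4 \<longleftrightarrow> norm A = norm B \<and> B = norm B *\<^sub>R p \<and> A = norm A *\<^sub>R E \<and> infinite_proj M E"
  \<comment> \<open>The conditions \<open>c2\<close> and \<open>c4\<close> exclude each other
    because \<open>p = 0\<close> in \<open>c4\<close> would give B = 0.\<close>
  have excl: "\<not> (c1 \<and> c2) \<and> \<not> (c1 \<and> c3) \<and> \<not> (c1 \<and> c4) \<and> \<not> (c2 \<and> c3) \<and> \<not> (c2 \<and> c4) \<and> \<not> (c3 \<and> c4)"
    using \<open>B \<noteq> 0\<close> by (auto simp: c1_def c2_def c3_def c4_def)
  have dec: "decomposes A B" if c: "c1 \<or> c2 \<or> c3 \<or> c4"
  proof -
    have a: "0 < a" using c norm_pos by (auto simp: a_def c1_def c2_def c3_def c4_def)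
    have room: "room A a"
      by (rule room_from_not_J[OF A Aa a])
        (use ess_norm_imp_not_finite_ideal[OF vna A] assms(8) a in \<open>simp add: a_def\<close>)
    have isometries: "\<exists>v. (\<forall>i :: nat. v i \<in> M \<and> iso (v i) \<and> (\<forall>x. E (blinfun_apply (v i) x) = v i x)) \<and>
        (\<forall>i j x y. i \<noteq> j \<longrightarrow> inner (v i x) (v j y) = 0)" if inf: "infinite_proj M E"
    proof -
      obtain w where w: "w \<in> M" "w\<^sup>\<star> o\<^sub>L w = E" "E o\<^sub>L w = w" "w o\<^sub>L w\<^sup>\<star> \<noteq> E"
        using inf infinite_proj_iff[OF vna E(1,2)] by blast
      obtain v :: "nat \<Rightarrow> 'a bop" where "\<And>k. v k \<in> M" "\<And>k. iso (v k)" "\<And>k x. E (v k x) = v k x"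
        "\<And>k l x y. k \<noteq> l \<Longrightarrow> inner (v k x) (v l y) = 0"
        by (rule infinite_proj_isometries[OF E(1,2) w]) (rule that; assumption)
      then show ?thesis by blast
    qed
    \<comment> \<open>Under \<open>c1\<close> and \<open>c2\<close> the form of B is strictly below
      a |x|^2: by the gap between the norms, or because equality would produce an eigenvector for
      a.\<close>
    consider c1 | c2 | c3 | c4 using c by blast
    then show ?thesis
    proof cases
      case 1
      have "inner (B x) x < a * (norm x)\<^sup>2" if "x \<noteq> 0" for x
      proof -
        have "norm B * (norm x)\<^sup>2 < a * (norm x)\<^sup>2" using 1 that by (simp add: c1_def a_def)
        then show ?thesis using Bb[of x] by linarith
      qed
      then show ?thesis by (intro decomposes_strict[of A a] A Aa room B \<open>B \<noteq> 0\<close>)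
    next
      case 2
      have ab: "norm B = a" and "p = 0" using 2 by (simp_all add: c2_def a_def)
      have "inner (B x) x < a * (norm x)\<^sup>2" if "x \<noteq> 0" for x
      proof (rule ccontr)
        assume "\<not> inner (B x) x < a * (norm x)\<^sup>2"
        then have eq: "inner (B x) x = a * (norm x)\<^sup>2" using Bb[of x] ab by simp
        have "pos (a *\<^sub>R id_blinfun - B)"
          using Bb ab by (intro posI) (simp_all add: pos_hadj[OF B(2)] blinfun.bilinear_simps inner_diff_left flip: power2_norm_eq_inner)
        then have "(a *\<^sub>R id_blinfun - B) x = 0"
          by (rule pos_inner_0) (simp add: blinfun.bilinear_simps inner_diff_left eq power2_norm_eq_inner)
        then have "p x = x" using p(3) ab by (simp add: blinfun.bilinear_simps)
        then show False using \<open>p = 0\<close> that by simp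
      qed
      then show ?thesis by (intro decomposes_strict[of A a] A Aa room B \<open>B \<noteq> 0\<close>)
    next
      case 3
      then have ab: "norm B = a" and ne: "B \<noteq> a *\<^sub>R p" and inf: "infinite_proj M E" by (simp_all add: c3_def a_def)
      from isometries[OF inf] obtain v :: "nat \<Rightarrow> 'a bop" where v: "\<And>i. v i \<in> M" "\<And>i. iso (v i)"
        "\<And>i x. E (v i x) = v i x" "\<And>i j x y. i \<noteq> j \<Longrightarrow> inner (v i x) (v j y) = 0" by blast
      show ?thesis
        by (rule decomposes_mixed[OF A Aa a v(1,2,4) _ B _ p(1,2) _ ne])
          (use v(3) E(3) Bb p(3) ab in auto)
    next
      case 4
      then have AE: "A = a *\<^sub>R E" and inf: "infinite_proj M E" unfolding c4_def a_def by blast+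
      have Bp: "B = a *\<^sub>R p" using 4 unfolding c4_def a_def by metis
      from isometries[OF inf] obtain v :: "nat \<Rightarrow> 'a bop" where v: "\<And>i. v i \<in> M" "\<And>i. iso (v i)"
        "\<And>i x. E (v i x) = v i x" by blast
      have "p \<noteq> 0" using Bp \<open>B \<noteq> 0\<close> by auto
      have "decomposes (a *\<^sub>R E) (a *\<^sub>R p)"
        by (rule decomposes_projection[OF E(1,2) v[of 0] p(1,2) \<open>p \<noteq> 0\<close> a])
      then show ?thesis using AE Bp by simp
    qed
  qed
  have suff: "\<exists>C. (\<forall>j. C j \<in> positive_part M \<and> mv_equiv M (C j) B \<and> infinite_proj M (null_proj (C j))) \<and> sot_sums C A"
    if c: "c1 \<or> c2 \<or> c3 \<or> c4"
  proof -
    obtain X :: "nat \<Rightarrow> 'a bop" where X: "\<And>n. X n \<in> M" "\<And>n. (X n)\<^sup>\<star> o\<^sub>L X n = B"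
      "\<And>x. (\<lambda>N. (\<Sum>n<N. X n o\<^sub>L (X n)\<^sup>\<star>) x) \<longlonglongrightarrow> A x"
      "\<And>n. \<exists>w\<in>M. w\<^sup>\<star> o\<^sub>L w = hproj {x. (X n o\<^sub>L (X n)\<^sup>\<star>) x = 0} \<and>
        hproj {x. (X n o\<^sub>L (X n)\<^sup>\<star>) x = 0} o\<^sub>L w = w \<and> w o\<^sub>L w\<^sup>\<star> \<noteq> hproj {x. (X n o\<^sub>L (X n)\<^sup>\<star>) x = 0}"
      by (rule decomposes_imp_series[OF A B \<open>B \<noteq> 0\<close> dec[OF c]]) (rule that; assumption)
    have CM: "X n o\<^sub>L (X n)\<^sup>\<star> \<in> M" for n using X(1) by blast
    have "X n o\<^sub>L (X n)\<^sup>\<star> \<in> positive_part M" for n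
      using CM by (simp add: positive_part_iff[OF vna] pos_compose_hadj)
    moreover have "mv_equiv M (X n o\<^sub>L (X n)\<^sup>\<star>) B" for n
      unfolding mv_equiv_iff[OF vna] by (intro bexI[of _ "X n"] conjI refl X(1) X(2)[symmetric])
    moreover have "infinite_proj M (null_proj (X n o\<^sub>L (X n)\<^sup>\<star>))" for n
      unfolding null_proj_eq[OF vna CM]
        infinite_proj_iff[OF vna M_hproj_ker[OF CM] proj_hproj[OF subspace_ker closed_ker]] by (rule X(4))
    moreover have "sot_sums (\<lambda>n. X n o\<^sub>L (X n)\<^sup>\<star>) A" unfolding sot_sums_iff using X(3) by blast
    ultimately show ?thesis by (intro exI[of _ "\<lambda>n. X n o\<^sub>L (X n)\<^sup>\<star>"]) simp
  qed
  have nec: "c1 \<or> c2 \<or> c3 \<or> c4" if "\<forall>j. mv_equiv M (C j) B" "sot_sums C A" for C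
  proof -
    have "\<forall>j. \<exists>X. X \<in> M \<and> C j = X o\<^sub>L X\<^sup>\<star> \<and> B = X\<^sup>\<star> o\<^sub>L X"
      using that(1) by (auto simp: mv_equiv_iff[OF vna])
    then obtain X where X: "\<And>j. X j \<in> M" "\<And>j. C j = X j o\<^sub>L (X j)\<^sup>\<star>" "\<And>j. (X j)\<^sup>\<star> o\<^sub>L X j = B" by metis
    have lim: "(\<lambda>N. (\<Sum>n<N. X n o\<^sub>L (X n)\<^sup>\<star>) x) \<longlonglongrightarrow> A x" for x
      using that(2) by (simp add: sot_sums_iff X(2))
    have "norm (X 0 o\<^sub>L (X 0)\<^sup>\<star>) \<le> norm A"
    proof (rule pos_norm_le[OF pos_compose_hadj])
      fix x
      have "(\<lambda>N. inner ((\<Sum>n<N. X n o\<^sub>L (X n)\<^sup>\<star>) x) x) \<longlonglongrightarrow> inner (A x) x" by (intro tendsto_intros lim)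
      then have "(\<lambda>n. inner ((X n o\<^sub>L (X n)\<^sup>\<star>) x) x) sums inner (A x) x"
        by (simp add: sums_def blinfun.sum_left inner_sum_left)
      \<comment> \<open>The first term of a series of nonnegative terms is at most its sum; applied
        to forms, one copy lies below A.\<close>
      then have "inner ((X 0 o\<^sub>L (X 0)\<^sup>\<star>) x) x \<le> inner (A x) x"
        using sums_finite_nonneg_le[of _ _ 1] pos_ge0[OF pos_compose_hadj] by fastforce
      then show "inner ((X 0 o\<^sub>L (X 0)\<^sup>\<star>) x) x \<le> norm A * (norm x)\<^sup>2" using Aa[of x] by (simp add: a_def)
    qed simp
    then have le: "norm B \<le> norm A"
      using norm_hadj_compose_self[of "X 0"] norm_hadj_compose_self[of "(X 0)\<^sup>\<star>"] X(3)[of 0] by simp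
    show ?thesis
    proof (cases "norm A = norm B \<and> p \<noteq> 0")
      case False
      then show ?thesis using le by (auto simp: c1_def c2_def)
    next
      case True
      have a: "0 < a" and ab: "norm B = a" using True norm_pos by (simp_all add: a_def)
      note nec = necessity[OF A Aa a X(1,3) lim p(1,2) conjunct2[OF True] p(3)[unfolded ab] E]
      have "infinite_proj M E" using nec(1) infinite_proj_iff[OF vna E(1,2)] by blast
      then show ?thesis using True nec(2) ab by (auto simp: c3_def c4_def a_def)
    qed
  qed
  have "((\<exists>C. (\<forall>j. C j \<in> positive_part M \<and> mv_equiv M (C j) B) \<and> sot_sums C A) \<longleftrightarrow> c1 \<or> c2 \<or> c3 \<or> c4)"
    using suff nec by blast
  then show ?thesis
    using excl suff unfolding Let_def c1_def c2_def c3_def c4_def E_def p_def by blast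
qed

end
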